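(* Let $n\ge 2$, let $\beta\in\mathbf{C}$ be nonzero, let $L$ be a generic planar diagram of an oriented link in $S^3$ with $l$ components, and let $\overline{H}(L)$ be the cohomology of the filtered chain complex $\overline{C}(L)$ defined in the context. Then $\dim_{\mathbf{C}}\overline{H}(L)=n^l$. Moreover, let $\Sigma_n$ be the set of the $n$ complex roots of $x^n-1=0$. To each mapping $$\psi:\{\text{components of }L\}\to\Sigma_n$$ one can assign an element $\mathbf{a}_\psi\in\overline{H}(L)$ which lies in the cohomological degree $$\sum_{(\varepsilon_1,\varepsilon_2)\in\Sigma_n\times\Sigma_n,\ \varepsilon_1\ne\varepsilon_2}\mathrm{lk}\big(\psi^{-1}(\varepsilon_1),\psi^{-1}(\varepsilon_2)\big),$$ and all the elements $\mathbf{a}_\psi$ together generate $\overline{H}(L)$ as a $\mathbf{C}$-vector space. Here $\mathrm{lk}(L',L'')$ for disjoint sublinks is the sum of linking numbers of components of $L'$ with components of $L''$ (half the signed number of crossings between $L'$ and $L''$; zero if one is empty), and the sum is over ordered pairs.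
   Context: Fix $n\ge 2$ and $\beta\in\mathbf{C}\setminus\{0\}$. **Resolutions.** $L$ is an oriented link diagram. Each crossing can be resolved in two ways: the $0$-resolution is the oriented smoothing (two disjoint oriented arcs); the $1$-resolution replaces the crossing by a "thick edge" into which the two incoming ends merge and out of which the two outgoing ends emanate. A resolution $\Gamma$ of $L$ is obtained by choosing one of these at every crossing; it is a planar graph consisting of thick edges and oriented thin edges (each thin edge is either a closed circle or runs from a thick edge to a thick edge). Near a crossing, call the incoming ends $x_1,x_2$ and the outgoing ends $x_3,x_4$, so that the $0$-resolution consists of arcs from $x_1$ to $x_3$ (on the left, facing in the direction of the orientation) and from $x_2$ to $x_4$ (on the right). **The 2-complex $\overline{M}(\Gamma)$.** Place marks on the edges of the diagram, at least one on every edge (and on every crossingless component), let $I$ be the set of marks and $R=\mathbf{C}[x_i\mid i\in I]$, graded with $\deg x_i=2$. The ends at a crossing are labelled by the nearest marks. $R\{s\}$ denotes $R$ with grading shifted up by $s$. Put $\pi_{xy}=(x^{n+1}-y^{n+1})/(x-y)$ (with $\pi_{xx}=(n+1)x^n$) and $\pi_{ij}=\pi_{x_ix_j}$. Let $g$ be the unique two-variable polynomial with $g(x+y,xy)=x^{n+1}+y^{n+1}$ and $$u_1=\frac{g(x_1+x_2,x_1x_2)-g(x_3+x_4,x_1x_2)}{x_1+x_2-x_3-x_4},\qquad u_2=\frac{g(x_3+x_4,x_1x_2)-g(x_3+x_4,x_3x_4)}{x_1x_2-x_3x_4}.$$ To each arc of $\Gamma$ oriented from a mark $x$ to the neighbouring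 mark $y$ assign the factorization $R\xrightarrow{\pi_{xy}-(n+1)\beta^n}R\{1-n\}\xrightarrow{x-y}R$. To each thick edge assign the tensor product of $R\{-1\}\xrightarrow{u_1-(n+1)\beta^n}R\{-n\}\xrightarrow{x_1+x_2-x_3-x_4}R\{-1\}$ and $R\xrightarrow{u_2}R\{3-n\}\xrightarrow{x_1x_2-x_3x_4}R$. $\overline{M}(\Gamma)$ is the tensor product over $R$ of all these factorizations; it is a 2-periodic complex $\overline{M}^0(\Gamma)\to\overline{M}^1(\Gamma)\to\overline{M}^0(\Gamma)$ with a grading on the underlying space. **$\overline{H}(\Gamma)$.** Let $p(\Gamma)$ be the number mod $2$ of circles obtained from $\Gamma$ by replacing all thick edges by $0$-resolutions. Set $\overline{H}(\Gamma)=H^{p(\Gamma)}(\overline{M}(\Gamma))$, filtered by letting $F^k\overline{H}(\Gamma)$ be the set of classes represented by cocycles in $\bigoplus_{i\le k}\overline{M}_i(\Gamma)$, where $\overline{M}_i$ is the degree $i$ part. **Maps $\overline{\chi}_0,\overline{\chi}_1$.** Let $\Gamma_0,\Gamma_1$ be resolutions that differ at exactly one crossing, $\Gamma_0$ having the $0$-resolution and $\Gamma_1$ the thick edge there. The local factor of $\overline{M}(\Gamma_0)$ is $$M_1:\ \begin{bmatrix} R \\ R\{2-2n\}\end{bmatrix}\xrightarrow{P_0}\begin{bmatrix} R\{1-n\} \\ R\{1-n\}\end{bmatrix}\xrightarrow{P_1}\begin{bmatrix} R \\ R\{2-2n\}\end{bmatrix},$$ $$P_0=\begin{bmatrix}\pi_{13}-(n+1)\beta^n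 & x_2-x_4 \\ \pi_{24}-(n+1)\beta^n & x_3-x_1\end{bmatrix},\quad P_1=\begin{bmatrix} x_1-x_3 & x_2-x_4 \\ \pi_{24}-(n+1)\beta^n & -\pi_{13}+(n+1)\beta^n\end{bmatrix},$$ and that of $\overline{M}(\Gamma_1)$ is $$M_2:\ \begin{bmatrix} R\{-1\} \\ R\{3-2n\}\end{bmatrix}\xrightarrow{Q_0}\begin{bmatrix} R\{-n\} \\ R\{2-n\}\end{bmatrix}\xrightarrow{Q_1}\begin{bmatrix} R\{-1\} \\ R\{3-2n\}\end{bmatrix},$$ $$Q_0=\begin{bmatrix} u_1-(n+1)\beta^n & x_1x_2-x_3x_4 \\ {u_2} & x_3+x_4-x_1-x_2\end{bmatrix},\quad Q_1=\begin{bmatrix} x_1+x_2-x_3-x_4 & x_1x_2-x_3x_4 \\ {u_2} & -u_1+(n+1)\beta^n\end{bmatrix}.$$ With $a_1=-u_2+(u_1+x_1u_2-\pi_{24})/(x_1-x_3)$ (a polynomial), $\overline{\chi}_0:\overline{H}(\Gamma_0)\to\overline{H}(\Gamma_1)$ is induced by $M_1\to M_2$ given by $U_0=\begin{bmatrix} x_3-x_2 & 0 \\ {a_1} & 1\end{bmatrix}$ in degree $0$ and $U_1=\begin{bmatrix} x_3 & -x_2 \\ -1 & 1\end{bmatrix}$ in degree $1$, and $\overline{\chi}_1:\overline{H}(\Gamma_1)\to\overline{H}(\Gamma_0)$ by $M_2\to M_1$ given by $V_0=\begin{bmatrix} 1 & 0 \\ -a_1 & x_3-x_2\end{bmatrix}$,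 $V_1=\begin{bmatrix} 1 & x_2 \\ 1 & x_3\end{bmatrix}$ (tensored with the identity on the remaining factors). Both are filtered of degree $1$. **The complex $\overline{C}(L)$.** For a filtered space $V$, $F^k(V\{s\})=F^{k-s}V$. To a positive crossing associate the two-term complex $\overline{H}(\Gamma_0)\{1-n\}\xrightarrow{\overline{\chi}_0}\overline{H}(\Gamma_1)\{-n\}$ with the $0$-resolution in cohomological degree $0$ and the $1$-resolution in degree $1$; to a negative crossing associate $\overline{H}(\Gamma_1)\{n\}\xrightarrow{\overline{\chi}_1}\overline{H}(\Gamma_0)\{n-1\}$ with the $1$-resolution in degree $-1$ and the $0$-resolution in degree $0$. $\overline{C}(L)$ is the total complex of the resulting cube over all crossings: $\overline{C}(L)=\bigoplus_\Gamma\overline{H}(\Gamma)\{s(\Gamma)\}$, where cohomological degrees and shifts add over crossings, and the differential is the sum of the maps $\overline{\chi}_0$ (at positive crossings), $\overline{\chi}_1$ (at negative crossings) with the usual cube signs making squares anticommute. The signs of crossings used here are the same as those used to compute linking numbers. *)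

theory Defs
  imports
    "Jordan_Normal_Form.VS_Connect"
    "HOL-Algebra.AbelCoset"
    "HOL-Library.Poly_Mapping"
begin

section \<open>Polynomials in several variables\<close>

type_synonym 'v mpoly = "('v \<Rightarrow>\<^sub>0 nat) \<Rightarrow>\<^sub>0 complex"

definition Const :: "complex \<Rightarrow> 'v mpoly" where
  "Const a = Poly_Mapping.single 0 a"

definition Var :: "'v \<Rightarrow> 'v mpoly" where
  "Var v = Poly_Mapping.single (Poly_Mapping.single v 1) 1"

definition subst :: "('v \<Rightarrow> 'w mpoly) \<Rightarrow> 'v mpoly \<Rightarrow> 'w mpoly" where
  "subst f p = (\<Sum>m\<in>Poly_Mapping.keys p. Const (Poly_Mapping.lookup p m) *
     (\<Prod>v\<in>Poly_Mapping.keys m. f v ^ Poly_Mapping.lookup m v))"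

definition exact_quotient :: "'v mpoly \<Rightarrow> 'v mpoly \<Rightarrow> 'v mpoly" where
  "exact_quotient p q = (THE r. r * q = p)"

text \<open>
  The quotients below are formed with independent variables \<open>gvar i\<close> and only then evaluated at
  marks. This matters when one mark labels two ends of a crossing (a kink with a single mark on
  its loop): the denominator \<open>x\<^sub>1 - x\<^sub>3\<close>, say, may then vanish.
\<close>

abbreviation gvar :: "nat \<Rightarrow> nat mpoly" where
  "gvar \<equiv> Var"

definition pi_poly :: "nat \<Rightarrow> nat mpoly" where
  "pi_poly n = exact_quotient (gvar 1 ^ (n + 1) - gvar 2 ^ (n + 1)) (gvar 1 - gvar 2)"

definition pi_at :: "nat \<Rightarrow> 'v mpoly \<Rightarrow> 'v mpoly \<Rightarrow> 'v mpoly" where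
  "pi_at n p q = subst (\<lambda>i. if i = 1 then p else q) (pi_poly n)"

text \<open>The two variables of \<open>g\<close> are \<open>False\<close> (the first) and \<open>True\<close> (the second).\<close>

definition g_poly :: "nat \<Rightarrow> bool mpoly" where
  "g_poly n = (THE g. subst (\<lambda>b. if b then gvar 1 * gvar 2 else gvar 1 + gvar 2) g =
     gvar 1 ^ (n + 1) + gvar 2 ^ (n + 1))"

definition g_at :: "nat \<Rightarrow> 'v mpoly \<Rightarrow> 'v mpoly \<Rightarrow> 'v mpoly" where
  "g_at n s p = subst (\<lambda>b. if b then p else s) (g_poly n)"

definition u1_poly :: "nat \<Rightarrow> nat mpoly" where
  "u1_poly n = exact_quotient
     (g_at n (gvar 1 + gvar 2) (gvar 1 * gvar 2) - g_at n (gvar 3 + gvar 4) (gvar 1 * gvar 2))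
     (gvar 1 + gvar 2 - gvar 3 - gvar 4)"

definition u2_poly :: "nat \<Rightarrow> nat mpoly" where
  "u2_poly n = exact_quotient
     (g_at n (gvar 3 + gvar 4) (gvar 1 * gvar 2) - g_at n (gvar 3 + gvar 4) (gvar 3 * gvar 4))
     (gvar 1 * gvar 2 - gvar 3 * gvar 4)"

definition a1_poly :: "nat \<Rightarrow> nat mpoly" where
  "a1_poly n = - u2_poly n +
     exact_quotient (u1_poly n + gvar 1 * u2_poly n - pi_at n (gvar 2) (gvar 4)) (gvar 1 - gvar 3)"


section \<open>Oriented link diagrams with marks\<close>

text \<open>
  The set of marks is the whole (finite) type \<open>'m\<close>. The ends \<open>1, 2, 3, 4\<close> of a
  crossing, seen along the orientation, are the incoming left, incoming right, outgoing left and
  outgoing right end; \<open>ends L c i\<close> is the mark nearest to end \<open>i\<close>. Thus the two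
  strands of the link at a crossing lead from \<open>1\<close> to \<open>4\<close> and from \<open>2\<close> to
  \<open>3\<close>; the former passes over the latter iff the crossing is positive. The pairs in
  \<open>arcs L\<close> are the arcs from a mark to the next mark on the same edge or crossingless
  component.
\<close>

record ('c, 'm) diagram =
  crossings :: "'c set"
  positive :: "'c \<Rightarrow> bool"
  ends :: "'c \<Rightarrow> nat \<Rightarrow> 'm"
  arcs :: "('m \<times> 'm) set"

definition crossing_sign :: "('c, 'm) diagram \<Rightarrow> 'c \<Rightarrow> int" where
  "crossing_sign L c = (if positive L c then 1 else -1)"

definition equiv_classes :: "('a \<Rightarrow> 'a \<Rightarrow> bool) \<Rightarrow> 'a set set" where
  "equiv_classes r = UNIV // {(x, y). equivclp r x y}"

definition link_components :: "('c, 'm) diagram \<Rightarrow> 'm set set" where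
  "link_components L = equiv_classes (\<lambda>x y. (x, y) \<in> arcs L \<or>
     (\<exists>c\<in>crossings L. (x, y) \<in> {(ends L c 1, ends L c 4), (ends L c 2, ends L c 3)}))"

text \<open>The circles obtained by the \<open>0\<close>-resolution of all crossings.\<close>

definition resolution_circles :: "('c, 'm) diagram \<Rightarrow> 'm set set" where
  "resolution_circles L = equiv_classes (\<lambda>x y. (x, y) \<in> arcs L \<or>
     (\<exists>c\<in>crossings L. (x, y) \<in> {(ends L c 1, ends L c 3), (ends L c 2, ends L c 4)}))"

definition graph_components :: "('c, 'm) diagram \<Rightarrow> 'm set set" where
  "graph_components L = equiv_classes (\<lambda>x y. (x, y) \<in> arcs L \<or>
     (\<exists>c\<in>crossings L. x \<in> ends L c ` {1..4} \<and> y \<in> ends L c ` {1..4}))"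

text \<open>
  A face is given by the sides of marks along its boundary, where \<open>(x, True)\<close> is the left
  and \<open>(x, False)\<close> the right side of \<open>x\<close>. Each of the four regions at a crossing
  lies between two neighbouring ends.
\<close>

definition diagram_faces :: "('c, 'm) diagram \<Rightarrow> ('m \<times> bool) set set" where
  "diagram_faces L = equiv_classes (\<lambda>s t.
     (\<exists>(x, y)\<in>arcs L. \<exists>b. s = (x, b) \<and> t = (y, b)) \<or>
     (\<exists>c\<in>crossings L. (s, t) \<in>
       {((ends L c 1, True), (ends L c 3, True)),
        ((ends L c 2, False), (ends L c 4, False)),
        ((ends L c 1, False), (ends L c 2, True)),
        ((ends L c 3, False), (ends L c 4, True))}))"

text \<open>
  Planarity says that the surface obtained by gluing discs into the faces is a union of spheres,
  one for each connected component of the graph: its Euler characteristic is twice the number of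
  components. Vertices are the marks and crossings, edges the arcs and the four ends of each
  crossing. (Faces are counted separately for each connected component of the graph.)
\<close>

definition planar :: "('c, 'm::finite) diagram \<Rightarrow> bool" where
  "planar L \<longleftrightarrow>
     (int (card (UNIV :: 'm set)) + int (card (crossings L))) -
     (int (card (arcs L)) + 4 * int (card (crossings L))) +
     int (card (diagram_faces L)) = 2 * int (card (graph_components L))"

text \<open>Every mark has exactly one continuation forwards and one backwards: an arc or a crossing.\<close>

definition link_diagram :: "('c, 'm::finite) diagram \<Rightarrow> bool" where
  "link_diagram L \<longleftrightarrow>
     finite (crossings L) \<and>
     bij_betw (case_sum fst (\<lambda>(c, i). ends L c i))
       (Sum_Type.Plus (arcs L) (crossings L \<times> {1, 2})) UNIV \<and>
     bij_betw (case_sum snd (\<lambda>(c, i). ends L c i))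
       (Sum_Type.Plus (arcs L) (crossings L \<times> {3, 4})) UNIV \<and>
     planar L"

definition linking_number :: "('c, 'm) diagram \<Rightarrow> 'm set \<Rightarrow> 'm set \<Rightarrow> rat" where
  "linking_number L K K' = of_int (\<Sum>c\<in>{c \<in> crossings L.
       ends L c 1 \<in> K \<and> ends L c 2 \<in> K' \<or> ends L c 1 \<in> K' \<and> ends L c 2 \<in> K}.
     crossing_sign L c) / 2"

definition lk :: "('c, 'm) diagram \<Rightarrow> 'm set set \<Rightarrow> 'm set set \<Rightarrow> rat" where
  "lk L A B = (\<Sum>K\<in>A. \<Sum>K'\<in>B. linking_number L K K')"


section \<open>The factorizations assigned to arcs and crossings\<close>

text \<open>
  Each local factorization has at most two generators in either degree. The generator
  \<open>(d, r)\<close> has degree \<open>1\<close> iff \<open>d\<close>, and is the second of its degree iff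
  \<open>r\<close>. Matrices act on columns.
\<close>

type_synonym local_gen = "bool \<times> bool"

type_synonym 'r mat22 = "('r \<times> 'r) \<times> ('r \<times> 'r)"

definition entry :: "'r mat22 \<Rightarrow> bool \<Rightarrow> bool \<Rightarrow> 'r" where
  "entry A i j = (let row = (if i then snd A else fst A) in if j then snd row else fst row)"

definition odd_map :: "'r mat22 \<Rightarrow> 'r mat22 \<Rightarrow> local_gen \<Rightarrow> local_gen \<Rightarrow> 'r::zero" where
  "odd_map P0 P1 t s =
     (if fst t = fst s then 0 else entry (if fst s then P1 else P0) (snd t) (snd s))"

definition even_map :: "'r mat22 \<Rightarrow> 'r mat22 \<Rightarrow> local_gen \<Rightarrow> local_gen \<Rightarrow> 'r::zero" where
  "even_map U0 U1 t s =
     (if fst t \<noteq> fst s then 0 else entry (if fst s then U1 else U0) (snd t) (snd s))"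

definition beta_const :: "nat \<Rightarrow> complex \<Rightarrow> 'm mpoly" where
  "beta_const n \<beta> = Const (of_nat (n + 1) * \<beta> ^ n)"

definition arc_diff ::
  "nat \<Rightarrow> complex \<Rightarrow> 'm mpoly \<Rightarrow> 'm mpoly \<Rightarrow> local_gen \<Rightarrow> local_gen \<Rightarrow> 'm mpoly" where
  "arc_diff n \<beta> x y = odd_map
     ((pi_at n x y - beta_const n \<beta>, 0),
      (0, 0))
     ((x - y, 0),
      (0, 0))"

text \<open>
  \<open>M1\<close> is the tensor product of the factorizations of the arcs from \<open>x\<^sub>1\<close> to
  \<open>x\<^sub>3\<close> and from \<open>x\<^sub>2\<close> to \<open>x\<^sub>4\<close>; \<open>M2\<close> is that of
  a thick edge. In the following, \<open>x i\<close> is the variable of the mark at end \<open>i\<close> of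
  the crossing.
\<close>

definition M1_diff ::
  "nat \<Rightarrow> complex \<Rightarrow> (nat \<Rightarrow> 'm mpoly) \<Rightarrow> local_gen \<Rightarrow> local_gen \<Rightarrow> 'm mpoly" where
  "M1_diff n \<beta> x =
     (let b = beta_const n \<beta>; \<pi>13 = pi_at n (x 1) (x 3); \<pi>24 = pi_at n (x 2) (x 4) in
      odd_map
       ((\<pi>13 - b, x 2 - x 4),
        (\<pi>24 - b, x 3 - x 1))
       ((x 1 - x 3, x 2 - x 4),
        (\<pi>24 - b, - \<pi>13 + b)))"

definition M2_diff ::
  "nat \<Rightarrow> complex \<Rightarrow> (nat \<Rightarrow> 'm mpoly) \<Rightarrow> local_gen \<Rightarrow> local_gen \<Rightarrow> 'm mpoly" where
  "M2_diff n \<beta> x =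
     (let b = beta_const n \<beta>; u1 = subst x (u1_poly n); u2 = subst x (u2_poly n) in
      odd_map
       ((u1 - b, x 1 * x 2 - x 3 * x 4),
        (u2, x 3 + x 4 - x 1 - x 2))
       ((x 1 + x 2 - x 3 - x 4, x 1 * x 2 - x 3 * x 4),
        (u2, - u1 + b)))"

definition chi0_local ::
  "nat \<Rightarrow> (nat \<Rightarrow> 'm mpoly) \<Rightarrow> local_gen \<Rightarrow> local_gen \<Rightarrow> 'm mpoly" where
  "chi0_local n x = even_map
     ((x 3 - x 2, 0),
      (subst x (a1_poly n), 1))
     ((x 3, - x 2),
      (- 1, 1))"

definition chi1_local ::
  "nat \<Rightarrow> (nat \<Rightarrow> 'm mpoly) \<Rightarrow> local_gen \<Rightarrow> local_gen \<Rightarrow> 'm mpoly" where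
  "chi1_local n x = even_map
     ((1, 0),
      (- subst x (a1_poly n), x 3 - x 2))
     ((1, x 2),
      (1, x 3))"


section \<open>The 2-complex of a resolution\<close>

text \<open>
  A resolution is given by the set \<open>\<Gamma>\<close> of the crossings that are replaced by a thick
  edge. Its factorization is the tensor product of one factor for each crossing and one for each
  arc. It is a free module whose generators are the families of local generators of the factors;
  elements are coefficient functions on generators. The order of the factors only serves to fix
  the signs \<open>d (a \<otimes> b) = d a \<otimes> b \<plusminus> a \<otimes> d b\<close>.
\<close>

type_synonym ('c, 'm) factor = "'c + 'm \<times> 'm"

type_synonym ('c, 'm) gen = "('c, 'm) factor \<Rightarrow> local_gen"

type_synonym ('c, 'm) chain = "('c, 'm) gen \<Rightarrow> 'm mpoly"

definition factors :: "('c, 'm) diagram \<Rightarrow> ('c, 'm) factor set" where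
  "factors L = Sum_Type.Plus (crossings L) (arcs L)"

fun before :: "('c::linorder, 'm::linorder) factor \<Rightarrow> ('c, 'm) factor \<Rightarrow> bool" where
  "before (Inl c) (Inl c') \<longleftrightarrow> c < c'"
| "before (Inl c) (Inr a) \<longleftrightarrow> True"
| "before (Inr a) (Inl c) \<longleftrightarrow> False"
| "before (Inr a) (Inr a') \<longleftrightarrow> fst a < fst a'"

fun local_gens :: "('c, 'm) factor \<Rightarrow> local_gen set" where
  "local_gens (Inl c) = UNIV"
| "local_gens (Inr a) = {(False, False), (True, False)}"

definition generators :: "('c, 'm) diagram \<Rightarrow> ('c, 'm) gen set" where
  "generators L = (\<Pi>\<^sub>E k\<in>factors L. local_gens k)"

definition odd_gen :: "('c, 'm) diagram \<Rightarrow> ('c, 'm) gen \<Rightarrow> bool" where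
  "odd_gen L G \<longleftrightarrow> odd (card {k \<in> factors L. fst (G k)})"

definition chains :: "('c, 'm) diagram \<Rightarrow> bool \<Rightarrow> (complex, ('c, 'm) chain) module" where
  "chains L p =
     \<lparr>carrier = {v. \<forall>G. v G \<noteq> 0 \<longrightarrow> G \<in> generators L \<and> odd_gen L G = p},
      mult = undefined, one = undefined,
      zero = (\<lambda>G. 0), add = (\<lambda>v w G. v G + w G),
      smult = (\<lambda>a v G. Const a * v G)\<rparr>"

definition end_var :: "('c, 'm) diagram \<Rightarrow> 'c \<Rightarrow> nat \<Rightarrow> 'm mpoly" where
  "end_var L c i = Var (ends L c i)"

fun factor_diff :: "nat \<Rightarrow> complex \<Rightarrow> ('c, 'm) diagram \<Rightarrow> 'c set \<Rightarrow> ('c, 'm) factor \<Rightarrow>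
    local_gen \<Rightarrow> local_gen \<Rightarrow> 'm mpoly" where
  "factor_diff n \<beta> L \<Gamma> (Inl c) =
     (if c \<in> \<Gamma> then M2_diff n \<beta> (end_var L c) else M1_diff n \<beta> (end_var L c))"
| "factor_diff n \<beta> L \<Gamma> (Inr (x, y)) = arc_diff n \<beta> (Var x) (Var y)"

definition res_diff :: "nat \<Rightarrow> complex \<Rightarrow> ('c::linorder, 'm::linorder) diagram \<Rightarrow> 'c set \<Rightarrow>
    ('c, 'm) chain \<Rightarrow> ('c, 'm) chain" where
  "res_diff n \<beta> L \<Gamma> v = (\<lambda>G. if G \<in> generators L then
     (\<Sum>k\<in>factors L. \<Sum>e\<in>local_gens k.
        (- 1) ^ card {j \<in> factors L. before j k \<and> fst (G j)} *
        factor_diff n \<beta> L \<Gamma> k (G k) e * v (G(k := e))) else 0)"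

text \<open>
  The degree of a generator of \<open>R{s}\<close> is \<open>s\<close>, and every variable has degree
  \<open>2\<close>. \<open>chains_upto L \<Gamma> k\<close> is the sum of the graded parts of degree at most
  \<open>k\<close>.
\<close>

fun factor_degree :: "nat \<Rightarrow> 'c set \<Rightarrow> ('c, 'm) factor \<Rightarrow> local_gen \<Rightarrow> int" where
  "factor_degree n \<Gamma> (Inl c) e =
     (if c \<in> \<Gamma>
      then (if fst e then (if snd e then 2 - int n else - int n)
            else (if snd e then 3 - 2 * int n else - 1))
      else (if fst e then 1 - int n
            else (if snd e then 2 - 2 * int n else 0)))"
| "factor_degree n \<Gamma> (Inr a) e = (if fst e then 1 - int n else 0)"

definition chains_upto ::
  "nat \<Rightarrow> ('c, 'm) diagram \<Rightarrow> 'c set \<Rightarrow> int \<Rightarrow> ('c, 'm) chain set" where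
  "chains_upto n L \<Gamma> k = {v. \<forall>G. \<forall>m\<in>Poly_Mapping.keys (v G).
     2 * (\<Sum>i\<in>Poly_Mapping.keys m. int (Poly_Mapping.lookup m i)) +
     (\<Sum>j\<in>factors L. factor_degree n \<Gamma> j (G j)) \<le> k}"


section \<open>Cohomology of a resolution\<close>

definition quotient_space :: "('k, 'v) module \<Rightarrow> 'v set \<Rightarrow> ('k, 'v set) module" where
  "quotient_space V N =
     \<lparr>carrier = a_rcosets\<^bsub>V\<^esub> N,
      mult = undefined, one = undefined,
      zero = N, add = (\<lambda>A B. A <+>\<^bsub>V\<^esub> B),
      smult = (\<lambda>a A. \<Union>v\<in>A. N +>\<^bsub>V\<^esub> (a \<odot>\<^bsub>V\<^esub> v))\<rparr>"

text \<open>The parity \<open>p(\<Gamma>)\<close>, which is the same for all resolutions.\<close>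

definition circle_parity :: "('c, 'm) diagram \<Rightarrow> bool" where
  "circle_parity L \<longleftrightarrow> odd (card (resolution_circles L))"

definition res_cocycles :: "nat \<Rightarrow> complex \<Rightarrow> ('c::linorder, 'm::linorder) diagram \<Rightarrow> 'c set \<Rightarrow>
    ('c, 'm) chain set" where
  "res_cocycles n \<beta> L \<Gamma> =
     {z \<in> carrier (chains L (circle_parity L)). res_diff n \<beta> L \<Gamma> z = (\<lambda>G. 0)}"

definition res_coboundaries :: "nat \<Rightarrow> complex \<Rightarrow> ('c::linorder, 'm::linorder) diagram \<Rightarrow>
    'c set \<Rightarrow> ('c, 'm) chain set" where
  "res_coboundaries n \<beta> L \<Gamma> = res_diff n \<beta> L \<Gamma> ` carrier (chains L (\<not> circle_parity L))"

definition res_cohomology :: "nat \<Rightarrow> complex \<Rightarrow> ('c::linorder, 'm::linorder) diagram \<Rightarrow> 'c set \<Rightarrow>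
    (complex, ('c, 'm) chain set) module" where
  "res_cohomology n \<beta> L \<Gamma> = quotient_space
     (chains L (circle_parity L) \<lparr>carrier := res_cocycles n \<beta> L \<Gamma>\<rparr>)
     (res_coboundaries n \<beta> L \<Gamma>)"

definition res_class :: "nat \<Rightarrow> complex \<Rightarrow> ('c::linorder, 'm::linorder) diagram \<Rightarrow> 'c set \<Rightarrow>
    ('c, 'm) chain \<Rightarrow> ('c, 'm) chain set" where
  "res_class n \<beta> L \<Gamma> z = res_coboundaries n \<beta> L \<Gamma> +>\<^bsub>chains L (circle_parity L)\<^esub> z"

definition res_filtration :: "nat \<Rightarrow> complex \<Rightarrow> ('c::linorder, 'm::linorder) diagram \<Rightarrow> 'c set \<Rightarrow>
    int \<Rightarrow> ('c, 'm) chain set set" where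
  "res_filtration n \<beta> L \<Gamma> k =
     res_class n \<beta> L \<Gamma> ` (res_cocycles n \<beta> L \<Gamma> \<inter> chains_upto n L \<Gamma> k)"


section \<open>The maps between resolutions differing at one crossing\<close>

text \<open>
  At the crossing \<open>c\<close>, the map leaves the resolution \<open>\<Gamma>\<close>: it is
  \<open>\<chi>\<^sub>0\<close> if \<open>c\<close> is \<open>0\<close>-resolved in \<open>\<Gamma>\<close>, and
  \<open>\<chi>\<^sub>1\<close> if it is a thick edge.
\<close>

definition chi_chain :: "nat \<Rightarrow> ('c, 'm) diagram \<Rightarrow> 'c set \<Rightarrow> 'c \<Rightarrow>
    ('c, 'm) chain \<Rightarrow> ('c, 'm) chain" where
  "chi_chain n L \<Gamma> c v = (\<lambda>G. if G \<in> generators L then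
     (\<Sum>e\<in>UNIV. (if c \<in> \<Gamma> then chi1_local else chi0_local) n (end_var L c) (G (Inl c)) e *
        v (G(Inl c := e))) else 0)"

definition switch :: "'c \<Rightarrow> 'c set \<Rightarrow> 'c set" where
  "switch c \<Gamma> = (if c \<in> \<Gamma> then \<Gamma> - {c} else insert c \<Gamma>)"

definition chi :: "nat \<Rightarrow> complex \<Rightarrow> ('c::linorder, 'm::linorder) diagram \<Rightarrow> 'c set \<Rightarrow> 'c \<Rightarrow>
    ('c, 'm) chain set \<Rightarrow> ('c, 'm) chain set" where
  "chi n \<beta> L \<Gamma> c A = (\<Union>z\<in>A. res_class n \<beta> L (switch c \<Gamma>) (chi_chain n L \<Gamma> c z))"


section \<open>The filtered complex of a link diagram\<close>

text \<open>
  A complex is given by its total space and total differential; \<open>degree_part C j\<close> is the part of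
  cohomological degree \<open>j\<close>, and \<open>filtration C k\<close> the filtration level
  \<open>F\<^sup>k\<close>.
\<close>

record 'v filtered_complex =
  total_space :: "(complex, 'v) module"
  total_diff :: "'v \<Rightarrow> 'v"
  degree_part :: "int \<Rightarrow> 'v set"
  filtration :: "int \<Rightarrow> 'v set"

definition direct_sum :: "'i set \<Rightarrow> ('i \<Rightarrow> ('k, 'v) module) \<Rightarrow> ('k, 'i \<Rightarrow> 'v) module" where
  "direct_sum I V =
     \<lparr>carrier = {f \<in> (\<Pi>\<^sub>E i\<in>I. carrier (V i)). finite {i \<in> I. f i \<noteq> \<zero>\<^bsub>V i\<^esub>}},
      mult = undefined, one = undefined,
      zero = (\<lambda>i\<in>I. \<zero>\<^bsub>V i\<^esub>), add = (\<lambda>f g. \<lambda>i\<in>I. f i \<oplus>\<^bsub>V i\<^esub> g i),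
      smult = (\<lambda>a f. \<lambda>i\<in>I. a \<odot>\<^bsub>V i\<^esub> f i)\<rparr>"

text \<open>
  A thick edge has cohomological degree \<open>1\<close> at a positive crossing and \<open>-1\<close> at a
  negative one; a \<open>0\<close>-resolved crossing has degree \<open>0\<close>.
\<close>

definition res_degree :: "('c, 'm) diagram \<Rightarrow> 'c set \<Rightarrow> int" where
  "res_degree L \<Gamma> = (\<Sum>c\<in>\<Gamma>. crossing_sign L c)"

definition res_shift :: "nat \<Rightarrow> ('c, 'm) diagram \<Rightarrow> 'c set \<Rightarrow> int" where
  "res_shift n L \<Gamma> = (\<Sum>c\<in>crossings L.
     if positive L c then (if c \<in> \<Gamma> then - int n else 1 - int n)
     else (if c \<in> \<Gamma> then int n else int n - 1))"

text \<open>
  The component at \<open>\<Gamma>\<close> of the differential collects the maps into \<open>\<Gamma>\<close>.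
  These switch a positive crossing to a thick edge or a negative crossing from a thick edge, so
  they come from \<open>switch c \<Gamma>\<close> for those \<open>c\<close> that are thick in \<open>\<Gamma>\<close>
  iff they are positive. The sign counts the preceding crossings of odd cohomological degree.
\<close>

definition link_complex :: "nat \<Rightarrow> complex \<Rightarrow> ('c::linorder, 'm::linorder) diagram \<Rightarrow>
    ('c set \<Rightarrow> ('c, 'm) chain set) filtered_complex" where
  "link_complex n \<beta> L = (let H = res_cohomology n \<beta> L; C = direct_sum (Pow (crossings L)) H in
     \<lparr>total_space = C,
      total_diff = (\<lambda>f. \<lambda>\<Gamma>\<in>Pow (crossings L).
        \<Oplus>\<^bsub>H \<Gamma>\<^esub> c\<in>{c \<in> crossings L. c \<in> \<Gamma> \<longleftrightarrow> positive L c}.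
          (- 1) ^ card {c' \<in> \<Gamma>. c' < c} \<odot>\<^bsub>H \<Gamma>\<^esub>
            chi n \<beta> L (switch c \<Gamma>) c (f (switch c \<Gamma>))),
      degree_part = (\<lambda>j. {f \<in> carrier C. \<forall>\<Gamma>\<in>Pow (crossings L).
        res_degree L \<Gamma> \<noteq> j \<longrightarrow> f \<Gamma> = \<zero>\<^bsub>H \<Gamma>\<^esub>}),
      filtration = (\<lambda>k. {f \<in> carrier C. \<forall>\<Gamma>\<in>Pow (crossings L).
        f \<Gamma> \<in> res_filtration n \<beta> L \<Gamma> (k - res_shift n L \<Gamma>)})\<rparr>)"

definition cocycles :: "'v filtered_complex \<Rightarrow> 'v set" where
  "cocycles C = {z \<in> carrier (total_space C). total_diff C z = \<zero>\<^bsub>total_space C\<^esub>}"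

definition coboundaries :: "'v filtered_complex \<Rightarrow> 'v set" where
  "coboundaries C = total_diff C ` carrier (total_space C)"

definition cohomology :: "'v filtered_complex \<Rightarrow> (complex, 'v set) module" where
  "cohomology C = quotient_space (total_space C \<lparr>carrier := cocycles C\<rparr>) (coboundaries C)"

text \<open>The classes of cohomological degree \<open>j\<close> in the total cohomology.\<close>

definition cohomology_part :: "'v filtered_complex \<Rightarrow> int \<Rightarrow> 'v set set" where
  "cohomology_part C j =
     (\<lambda>z. coboundaries C +>\<^bsub>total_space C\<^esub> z) ` (cocycles C \<inter> degree_part C j)"

definition roots_of_unity :: "nat \<Rightarrow> complex set" where
  "roots_of_unity n = {\<epsilon>. \<epsilon> ^ n - 1 = 0}"

end

theory Submission
  imports Defs "HOL-Computational_Algebra.Polynomial" "HOL-Library.Function_Algebras"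
    "HOL-Combinatorics.Permutations" "HOL-Library.Z2"
begin

text \<open>
  Each factor of a resolution acts on the chains as a Clifford element, and all Clifford elements
  together square to zero. Hence \<open>\<langle>\<partial>\<^sub>x \<xi>, \<partial>\<^sub>x \<xi>\<rangle>\<close>, a multiple of
  \<open>x\<^sup>n - \<beta>\<^sup>n\<close>, acts null-homotopically for every mark \<open>x\<close>, and the cohomology
  splits into eigenspaces indexed by the states, which assign to each mark an \<open>n\<close>-th root of
  \<open>\<beta>\<^sup>n\<close>. The eigenspace of a state vanishes unless the whole differential vanishes at the
  state, in which case it has dimension one over both parities together; the parity in which it lives
  is found by multiplying all Clifford generators out in two ways, which leads to the sign of the
  permutation of the marks that follows the smoothed diagram.

  In the cube, the two maps at a crossing compose to \<open>x\<^sub>3 - x\<^sub>2\<close>, so the states whose values differ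
  at these two ends contribute nothing. The others are constant along the components of the
  link, and each survives in exactly one resolution: the one whose thick edges are the crossings of
  strands with different values. This resolution lies in the asserted degree, and planarity, in the
  form that two closed curves cross evenly often, shows that the parity there is the right one.
\<close>

text \<open>Let \<open>d\<close> be the differential of a resolution, given by a vector \<xi> at
  each factor. For a vector \<eta> at one factor, \<open>d cl(\<eta>) + cl(\<eta>) d\<close> is
  multiplication by the pairing of \<xi> and \<eta>. With \<eta> a derivative of \<xi> this is the
  derivative of the local potential, a signed sum of terms
  \<open>x ^ (n + 1) - (n + 1) * \<beta> ^ n * x\<close>. The two arcs and the thick edge at a
  crossing have the same potential; this one identity replaces explicit forms of \<open>u1\<close>
  and \<open>u2\<close>. At a surviving state \<xi> vanishes, and second derivatives show that its
  derivatives are orthogonal, with squares proportional to \<open>\<phi> ^ (n - 1)\<close>, nonzero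
  because \<beta> is. These are the Clifford generators that get multiplied out. A mark may label
  two ends of one crossing, so local identities are proved in four independent variables and marks
  are substituted afterwards. Chains are infinite-dimensional over the complex numbers, so
  generators can be counted only once all variables are set. The parity obtained involves the number
  of thick edges; planarity enters to make this number even.\<close>

lemma Const_0 [simp]: "Const 0 = 0" by (simp add: Const_def)
lemma Const_1 [simp]: "Const 1 = 1" by (simp add: Const_def)
lemma Const_add: "Const (a + b) = Const a + Const b" by (simp add: Const_def single_add)
lemma Const_minus: "Const (- a) = - Const a" by (simp add: Const_def single_uminus)
lemma Const_mult: "Const (a * b) = Const a * Const b" by (simp add: Const_def mult_single)
lemma Const_power: "Const (a ^ k) = Const a ^ k" by (induction k) (simp_all add: Const_mult)
lemma Const_of_nat: "Const (of_nat k) = of_nat k" by (induction k) (simp_all add: Const_add)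
lemma Const_sum: "Const (sum f A) = (\<Sum>a\<in>A. Const (f a))"
  by (induction A rule: infinite_finite_induct) (simp_all add: Const_add)
lemma Const_inject [simp]: "Const a = Const b \<longleftrightarrow> a = b"
  by (metis Const_def lookup_single_eq)
lemma Const_eq_0 [simp]: "Const a = 0 \<longleftrightarrow> a = 0" by (metis Const_0 Const_inject)

section \<open>Evaluation homomorphisms of polynomial rings\<close>

definition monomial_at :: "('v \<Rightarrow> 'r::comm_ring_1) \<Rightarrow> ('v \<Rightarrow>\<^sub>0 nat) \<Rightarrow> 'r" where
  "monomial_at f m = (\<Prod>v\<in>Poly_Mapping.keys m. f v ^ Poly_Mapping.lookup m v)"

lemma monomial_at_superset:
  assumes "finite K" "Poly_Mapping.keys m \<subseteq> K"
  shows "monomial_at f m = (\<Prod>v\<in>K. f v ^ Poly_Mapping.lookup m v)"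
  unfolding monomial_at_def
  by (rule prod.mono_neutral_left) (use assms in \<open>auto simp: in_keys_iff\<close>)

lemma monomial_at_0 [simp]: "monomial_at f 0 = 1" by (simp add: monomial_at_def)

lemma monomial_at_add: "monomial_at f (m + m') = monomial_at f m * monomial_at f m'"
proof -
  let ?K = "Poly_Mapping.keys m \<union> Poly_Mapping.keys m'"
  have "monomial_at f (m + m') = (\<Prod>v\<in>?K. f v ^ Poly_Mapping.lookup (m + m') v)"
    by (rule monomial_at_superset) (auto dest: set_mp[OF keys_add])
  also have "\<dots> = (\<Prod>v\<in>?K. f v ^ Poly_Mapping.lookup m v) * (\<Prod>v\<in>?K. f v ^ Poly_Mapping.lookup m' v)"
    by (simp add: lookup_add power_add prod.distrib)
  also have "\<dots> = monomial_at f m * monomial_at f m'"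
    by (subst (1 2) monomial_at_superset[of ?K]) auto
  finally show ?thesis .
qed

lemma monomial_at_single [simp]: "monomial_at f (Poly_Mapping.single v k) = f v ^ k"
  by (simp add: monomial_at_def)

definition coeff_hom :: "(complex \<Rightarrow> 'r::comm_ring_1) \<Rightarrow> bool" where
  "coeff_hom h \<longleftrightarrow> h 0 = 0 \<and> h 1 = 1 \<and> (\<forall>a b. h (a + b) = h a + h b) \<and> (\<forall>a b. h (a * b) = h a * h b)"

text \<open>Substitution, numerical evaluation and first-order Taylor expansion are the instances
  with \<open>h\<close> equal to \<open>Const\<close>, the identity and the constants of a
  univariate polynomial ring; the homomorphism laws are proved once for all three.\<close>

definition ins :: "(complex \<Rightarrow> 'r::comm_ring_1) \<Rightarrow> ('v \<Rightarrow> 'r) \<Rightarrow> 'v mpoly \<Rightarrow> 'r" where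
  "ins h f p = (\<Sum>m\<in>Poly_Mapping.keys p. h (Poly_Mapping.lookup p m) * monomial_at f m)"

lemma subst_ins: "subst f = ins Const f"
  by (simp add: fun_eq_iff subst_def ins_def monomial_at_def)

lemma coeff_hom_Const: "coeff_hom Const" by (simp add: coeff_hom_def Const_add Const_mult)
lemma coeff_hom_id: "coeff_hom (\<lambda>a. a)" by (simp add: coeff_hom_def)

lemma poly_mapping_sum_single:
  "(\<Sum>m\<in>Poly_Mapping.keys p. Poly_Mapping.single m (Poly_Mapping.lookup p m)) = p"
  by (rule poly_mapping_eqI)
     (simp add: lookup_sum lookup_single when_def in_keys_iff)

lemma mpoly_induct_single [case_names single add]:
  assumes single: "\<And>m a. P (Poly_Mapping.single m a)"
    and add: "\<And>p q. P p \<Longrightarrow> P q \<Longrightarrow> P (p + q :: 'v mpoly)"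
  shows "P p"
proof -
  have "P (\<Sum>m\<in>A. Poly_Mapping.single m (Poly_Mapping.lookup p m))" if "finite A" for A
    using that
  proof (induction A)
    case empty
    then show ?case using single[of 0 0] by simp
  qed (simp add: single add)
  from this[of "Poly_Mapping.keys p"] show ?thesis by (simp add: poly_mapping_sum_single)
qed

context
  fixes h :: "complex \<Rightarrow> 'r::comm_ring_1"
  assumes h: "coeff_hom h"
begin

private lemma h0: "h 0 = 0" and h1: "h 1 = 1" and hadd: "h (a + b) = h a + h b"
  and hmult: "h (a * b) = h a * h b"
  using h by (simp_all add: coeff_hom_def)

private lemma ins_superset:
  assumes "finite K" "Poly_Mapping.keys p \<subseteq> K"
  shows "ins h f p = (\<Sum>m\<in>K. h (Poly_Mapping.lookup p m) * monomial_at f m)"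
  unfolding ins_def
  by (rule sum.mono_neutral_left) (use assms in \<open>auto simp: in_keys_iff h0\<close>)

lemma ins_single: "ins h f (Poly_Mapping.single m a) = h a * monomial_at f m"
  by (subst ins_superset[of "{m}"]) auto

lemma ins_0 [simp]: "ins h f 0 = 0" by (simp add: ins_def)

lemma ins_add: "ins h f (p + q) = ins h f p + ins h f q"
proof -
  let ?K = "Poly_Mapping.keys p \<union> Poly_Mapping.keys q"
  have "ins h f (p + q) = (\<Sum>m\<in>?K. h (Poly_Mapping.lookup (p + q) m) * monomial_at f m)"
    by (rule ins_superset) (auto dest: set_mp[OF keys_add])
  also have "\<dots> = (\<Sum>m\<in>?K. h (Poly_Mapping.lookup p m) * monomial_at f m)
      + (\<Sum>m\<in>?K. h (Poly_Mapping.lookup q m) * monomial_at f m)"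
    by (simp add: lookup_add hadd distrib_right sum.distrib)
  also have "\<dots> = ins h f p + ins h f q"
    by (subst (1 2) ins_superset[of ?K]) auto
  finally show ?thesis .
qed

lemma ins_mult: "ins h f (p * q) = ins h f p * ins h f q"
proof (induction p rule: mpoly_induct_single)
  case (single m a)
  show ?case
  proof (induction q rule: mpoly_induct_single)
    case (single m' b)
    show ?case by (simp add: mult_single ins_single monomial_at_add hmult mult_ac)
  qed (simp add: distrib_left ins_add)
qed (simp add: distrib_right ins_add)

lemma ins_Const [simp]: "ins h f (Const a) = h a"
  by (simp add: Const_def ins_single)

lemma ins_Var [simp]: "ins h f (Var v) = f v"
  by (simp add: Var_def ins_single h1)

lemma ins_1 [simp]: "ins h f 1 = 1"
  using ins_Const[of f 1] by (simp add: h1)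

lemma ins_uminus: "ins h f (- p) = - ins h f p"
  using ins_add[of f p "- p"] by (simp add: add_eq_0_iff2 add_eq_0_iff)

lemma ins_diff: "ins h f (p - q) = ins h f p - ins h f q"
  using ins_add[of f p "- q"] by (simp add: ins_uminus)

lemma ins_power: "ins h f (p ^ k) = ins h f p ^ k"
  by (induction k) (simp_all add: ins_mult)

lemma ins_sum: "ins h f (sum g A) = (\<Sum>a\<in>A. ins h f (g a))"
  by (induction A rule: infinite_finite_induct) (simp_all add: ins_add)

lemma ins_prod: "ins h f (prod g A) = (\<Prod>a\<in>A. ins h f (g a))"
  by (induction A rule: infinite_finite_induct) (simp_all add: ins_mult)

lemma ins_of_nat: "ins h f (of_nat k) = of_nat k"
  by (induction k) (simp_all add: ins_add)

lemmas ins_simps = ins_add ins_mult ins_uminus ins_diff ins_power ins_sum ins_prod ins_of_nat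

end

lemma Const_mult_monomial:
  fixes m :: "'v \<Rightarrow>\<^sub>0 nat"
  shows "Poly_Mapping.single m a = Const a * (monomial_at Var m :: 'v mpoly)"
proof -
  have pow: "Var v ^ k = (Poly_Mapping.single (Poly_Mapping.single v k) 1 :: 'v mpoly)" for v k
    by (induction k) (simp_all add: Var_def mult_single flip: single_add)
  have "(\<Prod>v\<in>A. Var v ^ Poly_Mapping.lookup m v) =
      (Poly_Mapping.single (\<Sum>v\<in>A. Poly_Mapping.single v (Poly_Mapping.lookup m v)) 1 :: 'v mpoly)" for A
    by (induction A rule: infinite_finite_induct) (simp_all add: pow mult_single)
  moreover have "(\<Sum>v\<in>Poly_Mapping.keys m. Poly_Mapping.single v (Poly_Mapping.lookup m v)) = m"
    by (rule poly_mapping_eqI) (simp add: lookup_sum lookup_single when_def in_keys_iff)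
  ultimately show ?thesis
    by (simp add: monomial_at_def Const_def mult_single)
qed

lemma mpoly_induct [case_names Const Var add mult]:
  assumes "\<And>a. P (Const a)" "\<And>v. P (Var v)"
    "\<And>p q. P p \<Longrightarrow> P q \<Longrightarrow> P (p + q)" "\<And>p q. P p \<Longrightarrow> P q \<Longrightarrow> P (p * q)"
  shows "P (p :: 'v mpoly)"
proof (induction p rule: mpoly_induct_single)
  case (single m a)
  have 1: "P 1" using assms(1)[of 1] by simp
  have "P (Var v ^ k)" for v k by (induction k) (auto intro: assms 1)
  then have "P (\<Prod>v\<in>A. Var v ^ Poly_Mapping.lookup m v)" for A
    by (induction A rule: infinite_finite_induct) (auto intro: assms 1)
  then show ?case by (simp add: Const_mult_monomial monomial_at_def assms)
qed (rule assms)

lemmas subst_simps = ins_simps[OF coeff_hom_Const, folded subst_ins]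
lemma subst_Const [simp]: "subst f (Const a) = Const a" by (simp add: subst_ins coeff_hom_Const)
lemma subst_Var [simp]: "subst f (Var v) = f v" by (simp add: subst_ins coeff_hom_Const)
lemma subst_0 [simp]: "subst f 0 = 0" by (simp add: subst_ins coeff_hom_Const)
lemma subst_1 [simp]: "subst f 1 = 1" by (simp add: subst_ins coeff_hom_Const)

lemma ins_subst: "coeff_hom h \<Longrightarrow> ins h f (subst g p) = ins h (\<lambda>v. ins h f (g v)) p"
  by (induction p rule: mpoly_induct) (simp_all add: subst_simps ins_simps)

lemma subst_subst: "subst f (subst g p) = subst (\<lambda>v. subst f (g v)) p"
  unfolding subst_ins using ins_subst[OF coeff_hom_Const] by (simp add: subst_ins)

lemma subst_Var_id [simp]: "subst Var p = p"
  by (induction p rule: mpoly_induct) (simp_all add: subst_simps)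

definition ev :: "('v \<Rightarrow> complex) \<Rightarrow> 'v mpoly \<Rightarrow> complex" where
  "ev = ins (\<lambda>a. a)"

lemmas ev_simps = ins_simps[OF coeff_hom_id, folded ev_def]
lemma ev_Const [simp]: "ev f (Const a) = a" by (simp add: ev_def coeff_hom_id)
lemma ev_Var [simp]: "ev f (Var v) = f v" by (simp add: ev_def coeff_hom_id)
lemma ev_0 [simp]: "ev f 0 = 0" by (simp add: ev_def coeff_hom_id)
lemma ev_1 [simp]: "ev f 1 = 1" by (simp add: ev_def coeff_hom_id)
lemma ev_subst: "ev f (subst g p) = ev (\<lambda>v. ev f (g v)) p"
  unfolding ev_def by (rule ins_subst[OF coeff_hom_id])

lemma subst_eq_Const_ev: "subst (\<lambda>v. Const (f v)) p = Const (ev f p)"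
  by (induction p rule: mpoly_induct) (simp_all add: subst_simps ev_simps Const_add Const_mult)

text \<open>Modulo \<open>q\<close> the two substitutions are the same ring homomorphism. The
  divisibilities behind \<open>u1\<close>, \<open>u2\<close>, \<open>a1\<close> and the
  specialization of variables come from here.\<close>

lemma dvd_subst_diff:
  assumes "\<And>v. q dvd f v - g v"
  shows "q dvd subst f p - subst g p"
proof (induction p rule: mpoly_induct)
  case (add p p')
  then show ?case
    by (simp add: subst_simps) (metis add_diff_add dvd_add)
next
  case (mult p p')
  have "subst f p * subst f p' - subst g p * subst g p'
     = (subst f p - subst g p) * subst f p' + subst g p * (subst f p' - subst g p')"
    by (simp add: algebra_simps)
  with mult show ?case by (simp add: subst_simps)
qed (simp_all add: assms)

subsection \<open>Partial derivatives\<close>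

text \<open>The coefficient of \<open>t\<close> after replacing the variable \<open>i\<close> by
  itself plus \<open>t\<close>; the Leibniz rule is then the product rule for linear
  coefficients.\<close>

definition pd :: "'v \<Rightarrow> 'v mpoly \<Rightarrow> 'v mpoly" where
  "pd i p = coeff (ins (\<lambda>a. [:Const a:]) (\<lambda>v. if v = i then [:Var v, 1:] else [:Var v:]) p) 1"

lemma coeff_hom_pd: "coeff_hom (\<lambda>a. [:Const a:])"
  by (simp add: coeff_hom_def Const_add Const_mult one_pCons)

lemma coeff_1_mult: "coeff (p * q) (Suc 0) = coeff p 0 * coeff q (Suc 0) + coeff p (Suc 0) * coeff q 0"
  for p q :: "'a::comm_ring_1 poly"
  by (simp add: coeff_mult)

lemma pd_Const [simp]: "pd i (Const a) = 0" by (simp add: pd_def coeff_hom_pd)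
lemma pd_Var: "pd i (Var v) = (if v = i then 1 else 0)" by (simp add: pd_def coeff_hom_pd)
lemma pd_add: "pd i (p + q) = pd i p + pd i q" by (simp add: pd_def coeff_hom_pd ins_simps)
lemma pd_uminus: "pd i (- p) = - pd i p" by (simp add: pd_def coeff_hom_pd ins_simps)
lemma pd_diff: "pd i (p - q) = pd i p - pd i q" by (simp add: pd_def coeff_hom_pd ins_simps)

lemma pd_mult: "pd i (p * q) = p * pd i q + pd i p * q"
proof -
  have "coeff (ins (\<lambda>a. [:Const a:]) (\<lambda>v. if v = i then [:Var v, 1:] else [:Var v:]) p) 0 = p" for p
    by (induction p rule: mpoly_induct) (simp_all add: coeff_hom_pd ins_simps coeff_mult)
  then show ?thesis
    by (simp add: pd_def coeff_hom_pd ins_simps coeff_1_mult)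
qed

lemma pd_0 [simp]: "pd i 0 = 0" using pd_Const[of i 0] by simp
lemma pd_1 [simp]: "pd i 1 = 0" using pd_Const[of i 1] by simp
lemma pd_power: "pd i (p ^ k) = of_nat k * p ^ (k - 1) * pd i p"
proof (induction k)
  case (Suc k)
  show ?case
    by (cases k) (use Suc in \<open>simp_all add: pd_mult algebra_simps\<close>)
qed simp
lemma pd_sum: "pd i (sum f A) = (\<Sum>a\<in>A. pd i (f a))"
  by (induction A rule: infinite_finite_induct) (simp_all add: pd_add)

text \<open>The chain rule. Variables outside the finite set \<open>E\<close> are sent to zero to
  keep the sum finite over an infinite variable type. The map \<open>g\<close> may identify
  variables: this is how a mark at two ends contributes twice.\<close>

lemma pd_subst_cut:
  fixes g :: "'w \<Rightarrow> 'v"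
  assumes "finite E"
  defines "f \<equiv> \<lambda>v. if v \<in> E then Var (g v) else 0"
  shows "pd i (subst f p) = (\<Sum>v\<in>E. if g v = i then subst f (pd v p) else 0)"
proof (induction p rule: mpoly_induct)
  case (Const a)
  then show ?case by (simp cong: if_cong)
next
  case (Var v)
  have "pd i (subst f (Var v)) = (if v \<in> E then if g v = i then 1 else 0 else 0)"
    by (simp only: subst_Var f_def pd_Var pd_0 if_distrib[of "pd i"] split: if_split)
  also have "\<dots> = (\<Sum>u\<in>E. if v = u then (if g v = i then 1 else 0) else 0)"
    by (rule sum.delta'[OF assms(1), symmetric])
  also have "\<dots> = (\<Sum>u\<in>E. if g u = i then subst f (pd u (Var v)) else 0)"
    by (rule sum.cong[OF refl]) (simp only: pd_Var subst_0 subst_1 split: if_split, blast)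
  finally show ?case .
next
  case (add p q)
  have "pd i (subst f (p + q)) = (\<Sum>v\<in>E. (if g v = i then subst f (pd v p) else 0)
      + (if g v = i then subst f (pd v q) else 0))"
    unfolding sum.distrib by (simp only: subst_simps pd_add add)
  also have "\<dots> = (\<Sum>v\<in>E. if g v = i then subst f (pd v (p + q)) else 0)"
    by (rule sum.cong[OF refl]) (simp add: pd_add subst_simps)
  finally show ?case .
next
  case (mult p q)
  have "pd i (subst f (p * q)) = (\<Sum>v\<in>E. subst f p * (if g v = i then subst f (pd v q) else 0)
      + (if g v = i then subst f (pd v p) else 0) * subst f q)"
    unfolding sum.distrib sum_distrib_left[symmetric] sum_distrib_right[symmetric]
    by (simp only: subst_simps pd_mult mult)
  also have "\<dots> = (\<Sum>v\<in>E. if g v = i then subst f (pd v (p * q)) else 0)"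
    by (rule sum.cong[OF refl]) (simp add: pd_mult subst_simps)
  finally show ?case .
qed

section \<open>Polynomials in the four ends of a crossing\<close>

definition slot_poly :: "nat mpoly \<Rightarrow> bool" where
  "slot_poly p \<longleftrightarrow> subst (\<lambda>v. if v \<in> {1..4} then Var v else 0) p = p"

lemma subst_slot_cong:
  fixes f g :: "nat \<Rightarrow> 'v mpoly"
  assumes "slot_poly p" "\<And>v. v \<in> {1..4} \<Longrightarrow> f v = g v"
  shows "subst f p = subst g p"
proof -
  have star: "subst h p = subst (\<lambda>v. if v \<in> {1..4} then h v else 0) p" for h :: "nat \<Rightarrow> 'v mpoly"
  proof -
    have "subst h p = subst h (subst (\<lambda>v. if v \<in> {1..4} then Var v else 0) p)"
      using assms(1) by (simp only: slot_poly_def)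
    also have "\<dots> = subst (\<lambda>v. if v \<in> {1..4} then h v else 0) p"
      unfolding subst_subst by (rule arg_cong[where f = "\<lambda>f. subst f p"]) (simp add: fun_eq_iff)
    finally show ?thesis .
  qed
  have eq: "(\<lambda>v. if v \<in> {1..4} then f v else 0) = (\<lambda>v. if v \<in> {1..4} then g v else 0)"
    using assms(2) by auto
  show ?thesis
    by (rule trans[OF star[of f] trans[OF _ star[of g, symmetric]]]) (simp only: eq)
qed

lemma slot_poly_pd:
  assumes "slot_poly p" "v \<in> {1..4}"
  shows "slot_poly (pd v p)"
proof -
  have "pd v p = pd v (subst (\<lambda>v. if v \<in> {1..4} then Var v else 0) p)"
    using assms(1) by (simp add: slot_poly_def)
  also have "\<dots> = (\<Sum>u\<in>{1..4}. if u = v then subst (\<lambda>v. if v \<in> {1..4} then Var v else 0) (pd u p) else 0)"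
    by (rule pd_subst_cut[where g = "\<lambda>v. v"]) simp
  also have "\<dots> = subst (\<lambda>v. if v \<in> {1..4} then Var v else 0) (pd v p)"
    using assms(2) by (simp add: sum.delta)
  finally show ?thesis by (simp add: slot_poly_def)
qed

lemma pd_subst_slot:
  assumes "slot_poly p"
  shows "pd i (subst (\<lambda>v. Var (g v)) p) =
    (\<Sum>v\<in>{1..4}. if g v = i then subst (\<lambda>v. Var (g v)) (pd v p) else 0)"
proof -
  let ?f = "\<lambda>v. if v \<in> {1..4} then Var (g v) else 0"
  have "pd i (subst (\<lambda>v. Var (g v)) p) = pd i (subst ?f p)"
    by (rule arg_cong[where f = "pd i"], rule subst_slot_cong[OF assms]) auto
  also have "\<dots> = (\<Sum>v\<in>{1..4}. if g v = i then subst ?f (pd v p) else 0)"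
    by (rule pd_subst_cut) simp
  also have "\<dots> = (\<Sum>v\<in>{1..4}. if g v = i then subst (\<lambda>v. Var (g v)) (pd v p) else 0)"
    by (rule sum.cong) (auto intro!: subst_slot_cong slot_poly_pd assms)
  finally show ?thesis .
qed

lemma slot_poly_intros [intro, simp]:
  "slot_poly (Const a)" "slot_poly 0" "slot_poly 1"
  "slot_poly p \<Longrightarrow> slot_poly q \<Longrightarrow> slot_poly (p + q)"
  "slot_poly p \<Longrightarrow> slot_poly q \<Longrightarrow> slot_poly (p * q)"
  "slot_poly p \<Longrightarrow> slot_poly q \<Longrightarrow> slot_poly (p - q)"
  "slot_poly p \<Longrightarrow> slot_poly (- p)"
  "slot_poly p \<Longrightarrow> slot_poly (p ^ k)"
  "v \<in> {1..4} \<Longrightarrow> slot_poly (Var v)"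
  by (simp_all add: slot_poly_def subst_simps)

text \<open>Apply the homomorphism that kills the other variables to the product and cancel
  \<open>q\<close>. This covers the exact quotients, whose monomials are not at hand.\<close>

lemma slot_poly_quotient:
  assumes "r * q = p" "slot_poly p" "slot_poly q" "q \<noteq> 0"
  shows "slot_poly r"
proof -
  let ?k = "\<lambda>v. if v \<in> {1..4} then Var v else 0 :: nat mpoly"
  have "subst ?k r * q = r * q"
  proof -
    have "subst ?k r * q = subst ?k (r * q)" using assms(3) by (simp only: subst_simps slot_poly_def)
    also have "\<dots> = r * q" using assms(1,2) by (simp only: slot_poly_def)
    finally show ?thesis .
  qed
  with assms(4) show ?thesis by (simp add: slot_poly_def)
qed

section \<open>The polynomials of the local factorizations\<close>

lemma mpoly_neq_0_ev: "ev f p \<noteq> 0 \<Longrightarrow> p \<noteq> 0" by auto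

text \<open>Kronecker substitution: sending the two variables to \<open>t\<close> and
  \<open>t ^ B\<close> keeps distinct monomials apart, and a univariate polynomial with all values
  zero is zero.\<close>

lemma ev_bool_zero:
  fixes h :: "bool mpoly"
  assumes "\<And>f. ev f h = 0"
  shows "h = 0"
proof (rule poly_mapping_eqI)
  fix m0 :: "bool \<Rightarrow>\<^sub>0 nat"
  define K where "K = Poly_Mapping.keys h"
  \<comment> \<open>\<open>B\<close> exceeds the first exponent of every monomial in play, including
    \<open>m0\<close>, which may not occur in \<open>h\<close>. So \<open>e m\<close> has the two
    exponents of \<open>m\<close> as remainder and quotient by \<open>B\<close>.\<close>
  define B where "B = Suc (\<Sum>m\<in>insert m0 K. Poly_Mapping.lookup m False)"
  define e where "e m = Poly_Mapping.lookup m False + B * Poly_Mapping.lookup m True" for m :: "bool \<Rightarrow>\<^sub>0 nat"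
  have fin: "finite K" by (simp add: K_def)
  have less: "Poly_Mapping.lookup m False < B" if "m \<in> insert m0 K" for m
    unfolding B_def less_Suc_eq_le by (rule member_le_sum) (use that fin in auto)
  have inj: "m = m'" if "m \<in> insert m0 K" "m' \<in> insert m0 K" "e m = e m'" for m m'
  proof -
    have "e m mod B = e m' mod B" "e m div B = e m' div B" using that by auto
    with less[OF that(1)] less[OF that(2)]
    have "Poly_Mapping.lookup m False = Poly_Mapping.lookup m' False"
      "Poly_Mapping.lookup m True = Poly_Mapping.lookup m' True" by (simp_all add: e_def)
    then show ?thesis by (metis (full_types) poly_mapping_eqI)
  qed
  have mon: "monomial_at f m = f False ^ Poly_Mapping.lookup m False * f True ^ Poly_Mapping.lookup m True"
    for f :: "bool \<Rightarrow> complex" and m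
    by (subst monomial_at_superset[of UNIV]) (auto simp: UNIV_bool)
  define P where "P = (\<Sum>m\<in>K. monom (Poly_Mapping.lookup h m) (e m))"
  have "poly P t = ev (\<lambda>b. if b then t ^ B else t) h" for t
    by (simp add: P_def ev_def ins_def K_def poly_sum poly_monom mon e_def power_add power_mult)
  then have "P = 0" by (simp add: assms flip: poly_all_0_iff_0)
  then have "0 = coeff P (e m0)" by simp
  also have "\<dots> = (\<Sum>m\<in>K. if m = m0 then Poly_Mapping.lookup h m else 0)"
    unfolding P_def coeff_sum using inj[OF insertI2 insertI1] by (intro sum.cong) auto
  also have "\<dots> = Poly_Mapping.lookup h m0"
    using fin by (auto simp: K_def in_keys_iff)
  finally show "Poly_Mapping.lookup h m0 = Poly_Mapping.lookup 0 m0" by simp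
qed

text \<open>Every pair of complex numbers consists of the sum and the product of two complex numbers.\<close>

lemma elementary_symmetric_independent:
  fixes h :: "bool mpoly"
  assumes "subst (\<lambda>b. if b then gvar 1 * gvar 2 else gvar 1 + gvar 2) h = 0"
  shows "h = 0"
proof (rule ev_bool_zero)
  fix f :: "bool \<Rightarrow> complex"
  define s t where "s = f False" and "t = f True"
  define x where "x = (s + csqrt (s\<^sup>2 - 4 * t)) / 2"
  have "x * (s - x) = t"
  proof -
    have "4 * (x * (s - x)) = (s + csqrt (s\<^sup>2 - 4 * t)) * (s - csqrt (s\<^sup>2 - 4 * t))"
      by (simp add: x_def field_simps)
    also have "\<dots> = s\<^sup>2 - (csqrt (s\<^sup>2 - 4 * t))\<^sup>2" by (simp add: power2_eq_square algebra_simps)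
    finally show ?thesis by simp
  qed
  then have f: "f = (\<lambda>b. if b then x * (s - x) else x + (s - x))"
    by (auto simp: fun_eq_iff s_def t_def)
  have "0 = ev (\<lambda>i. if i = 1 then x else s - x)
      (subst (\<lambda>b. if b then gvar 1 * gvar 2 else gvar 1 + gvar 2) h)"
    by (simp add: assms)
  also have "\<dots> = ev f h"
    unfolding ev_subst by (subst f) (rule arg_cong[where f = "\<lambda>f. ev f h"], auto simp: ev_simps)
  finally show "ev f h = 0" by simp
qed

text \<open>Newton's recursion for \<open>x ^ k + y ^ k\<close> in terms of \<open>x + y\<close> and
  \<open>x * y\<close>. It exhibits \<open>g\<close>; its uniqueness is the algebraic independence
  of the elementary symmetric polynomials.\<close>

fun power_sum :: "nat \<Rightarrow> bool mpoly" where
  "power_sum 0 = 2"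
| "power_sum (Suc 0) = Var False"
| "power_sum (Suc (Suc k)) = Var False * power_sum (Suc k) - Var True * power_sum k"

lemma subst_power_sum:
  "subst (\<lambda>b. if b then p * q else p + q) (power_sum k) = p ^ k + q ^ k"
proof (induction k rule: power_sum.induct)
  case 1
  have "subst (\<lambda>b. if b then p * q else p + q) (of_nat 2) = (of_nat 2)" by (simp only: subst_simps)
  then show ?case by simp
next
  case (3 k)
  then show ?case by (simp add: subst_simps algebra_simps)
qed simp

lemma g_poly_eq: "g_poly n = power_sum (n + 1)"
  unfolding g_poly_def
proof (rule the_equality)
  show "subst (\<lambda>b. if b then gvar 1 * gvar 2 else gvar 1 + gvar 2) (power_sum (n + 1)) =
     gvar 1 ^ (n + 1) + gvar 2 ^ (n + 1)"
    by (rule subst_power_sum)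
next
  fix g assume "subst (\<lambda>b. if b then gvar 1 * gvar 2 else gvar 1 + gvar 2) g =
     gvar 1 ^ (n + 1) + gvar 2 ^ (n + 1)"
  then have "subst (\<lambda>b. if b then gvar 1 * gvar 2 else gvar 1 + gvar 2) (g - power_sum (n + 1)) = 0"
    unfolding subst_simps subst_power_sum by simp
  then show "g = power_sum (n + 1)"
    by (metis elementary_symmetric_independent eq_iff_diff_eq_0)
qed

lemma g_at_sum_prod: "g_at n (p + q) (p * q) = p ^ (n + 1) + q ^ (n + 1)"
  unfolding g_at_def g_poly_eq by (rule subst_power_sum)

lemma subst_g_at: "subst f (g_at n s p) = g_at n (subst f s) (subst f p)"
  unfolding g_at_def subst_subst by (simp add: if_distrib)

lemma exact_quotient_eqI:
  fixes p q r :: "'v::linorder mpoly"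
  assumes "r * q = p" "q \<noteq> 0"
  shows "exact_quotient p q = r"
  unfolding exact_quotient_def by (rule the_equality) (use assms in auto)

lemma exact_quotient_mult:
  fixes p q :: "'v::linorder mpoly"
  assumes "q dvd p" "q \<noteq> 0"
  shows "exact_quotient p q * q = p"
  using assms by (metis dvdE exact_quotient_eqI mult.commute)

lemma pi_at_eq: "pi_at n p q = (\<Sum>i<Suc n. p ^ i * q ^ (n - i))"
proof -
  have "gvar 1 - gvar 2 \<noteq> 0"
    by (rule mpoly_neq_0_ev[of "\<lambda>i. of_nat i"]) (simp add: ev_simps)
  then have "pi_poly n = (\<Sum>i<Suc n. gvar 1 ^ i * gvar 2 ^ (n - i))"
    unfolding pi_poly_def
    by (intro exact_quotient_eqI) (simp_all only: diff_power_eq_sum Suc_eq_plus1[symmetric] mult.commute, simp)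
  then show ?thesis by (simp only: pi_at_def subst_simps) simp
qed

lemma pi_at_mult: "pi_at n p q * (p - q) = p ^ (n + 1) - q ^ (n + 1)"
  unfolding pi_at_eq Suc_eq_plus1[symmetric] diff_power_eq_sum by (simp only: mult.commute)

lemma subst_pi_at: "subst f (pi_at n p q) = pi_at n (subst f p) (subst f q)"
  by (simp only: pi_at_eq subst_simps)

definition sum_diff :: "nat mpoly" where
  "sum_diff = gvar 1 + gvar 2 - gvar 3 - gvar 4"

definition prod_diff :: "nat mpoly" where
  "prod_diff = gvar 1 * gvar 2 - gvar 3 * gvar 4"

lemma sum_diff_neq_0: "sum_diff \<noteq> 0" and prod_diff_neq_0: "prod_diff \<noteq> 0"
  by (rule mpoly_neq_0_ev[of "\<lambda>i. of_nat i"], simp add: ev_simps sum_diff_def prod_diff_def)+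

text \<open>The two values of \<open>g\<close> differ only in the first argument, and there by
  exactly \<open>sum_diff\<close>, so the quotient is exact. The same holds for \<open>u2\<close>
  with the second argument.\<close>

lemma u1_poly_mult:
  "u1_poly n * sum_diff =
     g_at n (gvar 1 + gvar 2) (gvar 1 * gvar 2) - g_at n (gvar 3 + gvar 4) (gvar 1 * gvar 2)"
  unfolding u1_poly_def sum_diff_def[symmetric]
proof (rule exact_quotient_mult[OF _ sum_diff_neq_0])
  show "sum_diff dvd g_at n (gvar 1 + gvar 2) (gvar 1 * gvar 2) - g_at n (gvar 3 + gvar 4) (gvar 1 * gvar 2)"
    unfolding g_at_def by (rule dvd_subst_diff) (simp add: sum_diff_def algebra_simps)
qed

lemma u2_poly_mult:
  "u2_poly n * prod_diff =
     g_at n (gvar 3 + gvar 4) (gvar 1 * gvar 2) - g_at n (gvar 3 + gvar 4) (gvar 3 * gvar 4)"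
  unfolding u2_poly_def prod_diff_def[symmetric]
proof (rule exact_quotient_mult[OF _ prod_diff_neq_0])
  show "prod_diff dvd g_at n (gvar 3 + gvar 4) (gvar 1 * gvar 2) - g_at n (gvar 3 + gvar 4) (gvar 3 * gvar 4)"
    unfolding g_at_def by (rule dvd_subst_diff) (simp add: prod_diff_def)
qed

text \<open>The two numerators telescope through the value of \<open>g\<close> at
  \<open>x3 + x4\<close> and \<open>x1 * x2\<close>. Derivatives of this identity supply what is
  known about \<open>u1\<close> and \<open>u2\<close> at a state.\<close>

lemma u_poly_potential:
  "u1_poly n * sum_diff + u2_poly n * prod_diff =
     gvar 1 ^ (n + 1) + gvar 2 ^ (n + 1) - gvar 3 ^ (n + 1) - gvar 4 ^ (n + 1)"
  unfolding u1_poly_mult u2_poly_mult g_at_sum_prod by simp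

text \<open>On the hyperplane \<open>x3 = x1\<close> one has \<open>sum_diff = x2 - x4\<close> and
  \<open>prod_diff = x1 * (x2 - x4)\<close>; cancelling \<open>x2 - x4\<close> in the potential
  identity shows that the numerator of \<open>a1\<close> vanishes there. The summand
  \<open>- u2\<close> of \<open>a1\<close> turns the factor \<open>x1\<close> of \<open>u2\<close>
  into \<open>x3\<close>.\<close>

lemma a1_poly_mult:
  "a1_poly n * (gvar 1 - gvar 3) =
     u1_poly n + gvar 3 * u2_poly n - pi_at n (gvar 2) (gvar 4)"
proof -
  define p where "p = u1_poly n + gvar 1 * u2_poly n - pi_at n (gvar 2) (gvar 4)"
  define k where "k = (\<lambda>i::nat. if i = 3 then gvar 1 else gvar i)"
  have nz: "gvar 1 - gvar 3 \<noteq> 0" "gvar 2 - gvar 4 \<noteq> 0"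
    by (rule mpoly_neq_0_ev[of "\<lambda>i. of_nat i"], simp add: ev_simps)+
  have k: "subst k sum_diff = gvar 2 - gvar 4" "subst k prod_diff = gvar 1 * (gvar 2 - gvar 4)"
    by (simp_all add: subst_simps sum_diff_def prod_diff_def k_def algebra_simps)
  have "subst k (u1_poly n) * (gvar 2 - gvar 4) + subst k (u2_poly n) * (gvar 1 * (gvar 2 - gvar 4)) =
     gvar 2 ^ (n + 1) - gvar 4 ^ (n + 1)"
    using arg_cong[OF u_poly_potential[of n], of "subst k"]
    unfolding subst_simps k by (simp add: k_def)
  then have "(subst k (u1_poly n) + gvar 1 * subst k (u2_poly n) - pi_at n (gvar 2) (gvar 4)) * (gvar 2 - gvar 4) = 0"
    unfolding left_diff_distrib pi_at_mult by (simp add: algebra_simps)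
  then have "subst k p = 0"
    using nz(2) by (simp add: p_def subst_simps subst_pi_at) (simp add: k_def)
  moreover have "gvar 1 - gvar 3 dvd subst gvar p - subst k p"
    by (rule dvd_subst_diff) (auto simp: k_def intro: dvdI[of _ _ "- 1"])
  ultimately have "gvar 1 - gvar 3 dvd p" by simp
  from exact_quotient_mult[OF this nz(1)]
  have "exact_quotient p (gvar 1 - gvar 3) * (gvar 1 - gvar 3) = p" .
  then show ?thesis
    unfolding a1_poly_def p_def[symmetric] by (simp add: p_def algebra_simps)
qed

lemma slot_poly_sum [intro]: "(\<And>i. i \<in> A \<Longrightarrow> slot_poly (f i)) \<Longrightarrow> slot_poly (sum f A)"
  by (induction A rule: infinite_finite_induct) auto

lemma slot_poly_pi_at: "slot_poly p \<Longrightarrow> slot_poly q \<Longrightarrow> slot_poly (pi_at n p q)"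
  unfolding pi_at_eq by auto

lemma slot_poly_g_at: "slot_poly p \<Longrightarrow> slot_poly q \<Longrightarrow> slot_poly (g_at n p q)"
  unfolding slot_poly_def subst_g_at by simp

lemma slot_poly_diffs: "slot_poly sum_diff" "slot_poly prod_diff"
  by (simp_all add: sum_diff_def prod_diff_def)

lemma slot_poly_u: "slot_poly (u1_poly n)" "slot_poly (u2_poly n)"
  by (rule slot_poly_quotient[OF u1_poly_mult _ _ sum_diff_neq_0]
        slot_poly_quotient[OF u2_poly_mult _ _ prod_diff_neq_0];
      auto intro!: slot_poly_g_at slot_poly_diffs)+

section \<open>Clifford operators on chains\<close>

lemma sum_fun_apply: "(\<Sum>a\<in>A. f a) x = (\<Sum>a\<in>A. f a x)"
  by (induction A rule: infinite_finite_induct) simp_all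

locale diagram =
  fixes L :: "('c::linorder, 'm::{finite,linorder}) diagram"
  assumes diagram: "link_diagram L"
begin

lemma finite_crossings: "finite (crossings L)"
  using diagram by (simp add: link_diagram_def)

lemma finite_factors [simp]: "finite (factors L)"
  by (simp add: factors_def finite_crossings)

lemma in_bij: "bij_betw (case_sum fst (\<lambda>(c, i). ends L c i))
    (Sum_Type.Plus (arcs L) (crossings L \<times> {1, 2})) UNIV"
  and out_bij: "bij_betw (case_sum snd (\<lambda>(c, i). ends L c i))
    (Sum_Type.Plus (arcs L) (crossings L \<times> {3, 4})) UNIV"
  using diagram by (simp_all add: link_diagram_def)

lemma arcs_fst_inj: "a \<in> arcs L \<Longrightarrow> a' \<in> arcs L \<Longrightarrow> fst a = fst a' \<Longrightarrow> a = a'"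
  using inj_onD[OF bij_betw_imp_inj_on[OF in_bij], of "Inl a" "Inl a'"] by auto

lemma before_irrefl [simp]: "\<not> before k k"
  by (cases k) auto

text \<open>Arcs are compared by their first marks only; these differ for different arcs because
  every mark has a single continuation.\<close>

lemma before_total:
  assumes "j \<in> factors L" "k \<in> factors L" "j \<noteq> k"
  shows "before j k \<longleftrightarrow> \<not> before k j"
proof (cases j)
  case (Inr a)
  show ?thesis
  proof (cases k)
    case Inr': (Inr a')
    with Inr assms have "fst a \<noteq> fst a'" using arcs_fst_inj[of a a'] by (auto simp: factors_def)
    then show ?thesis using Inr Inr' by auto
  qed (use Inr in auto)
qed (use assms in \<open>cases k; auto\<close>)

lemma finite_generators [simp]: "finite (generators L)"
  unfolding generators_def by (rule finite_PiE) auto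

lemma generators_upd:
  "G \<in> generators L \<Longrightarrow> k \<in> factors L \<Longrightarrow> e \<in> local_gens k \<Longrightarrow> G(k := e) \<in> generators L"
  by (auto simp: generators_def PiE_def extensional_def)

lemma generators_apply: "G \<in> generators L \<Longrightarrow> k \<in> factors L \<Longrightarrow> G k \<in> local_gens k"
  by (auto simp: generators_def)

section \<open>Operators on one tensor factor, with the Koszul sign rule\<close>

definition sgn_at :: "('c, 'm) factor \<Rightarrow> ('c, 'm) gen \<Rightarrow> 'r::comm_ring_1" where
  "sgn_at k G = (- 1) ^ card {j \<in> factors L. before j k \<and> fst (G j)}"

lemma sgn_at_square [simp]: "sgn_at k G * sgn_at k G = 1" "sgn_at k G * (sgn_at k G * x) = x"
  by (simp_all add: sgn_at_def flip: power_add mult.assoc mult_2)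

lemma sgn_at_upd:
  fixes k :: "('c, 'm) factor"
  assumes "j \<in> factors L"
  shows "sgn_at k (G(j := e)) =
    (if before j k \<and> fst e \<noteq> fst (G j) then - sgn_at k G else (sgn_at k G :: 'r::comm_ring_1))"
proof -
  let ?A = "\<lambda>G. {i \<in> factors L. before i k \<and> fst (G i)}"
  consider "\<not> (before j k \<and> fst e \<noteq> fst (G j))" | "before j k" "fst e" "\<not> fst (G j)"
    | "before j k" "\<not> fst e" "fst (G j)" by auto
  then show ?thesis
  proof cases
    case 1
    then have "?A (G(j := e)) = ?A G" by auto
    then show ?thesis unfolding sgn_at_def using 1 by (simp only: if_False)
  next
    case 2
    then have "?A (G(j := e)) = insert j (?A G)" "j \<notin> ?A G" using assms by auto
    then have "card (?A (G(j := e))) = Suc (card (?A G))" by simp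
    then show ?thesis unfolding sgn_at_def using 2 by (simp del: fun_upd_apply)
  next
    case 3
    then have "?A G = insert j (?A (G(j := e)))" "j \<notin> ?A (G(j := e))" using assms by auto
    then have "card (?A G) = Suc (card (?A (G(j := e))))" by simp
    then show ?thesis unfolding sgn_at_def using 3 by (simp del: fun_upd_apply)
  qed
qed

definition odd_op :: "('c, 'm) factor \<Rightarrow> (local_gen \<Rightarrow> local_gen \<Rightarrow> 'r) \<Rightarrow>
    (('c, 'm) gen \<Rightarrow> 'r::comm_ring_1) \<Rightarrow> ('c, 'm) gen \<Rightarrow> 'r" where
  "odd_op k T v = (\<lambda>G. if G \<in> generators L then
     (\<Sum>e\<in>local_gens k. sgn_at k G * T (G k) e * v (G(k := e))) else 0)"

definition even_op :: "('c, 'm) factor \<Rightarrow> (local_gen \<Rightarrow> local_gen \<Rightarrow> 'r) \<Rightarrow>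
    (('c, 'm) gen \<Rightarrow> 'r::comm_ring_1) \<Rightarrow> ('c, 'm) gen \<Rightarrow> 'r" where
  "even_op k T v = (\<lambda>G. if G \<in> generators L then
     (\<Sum>e\<in>local_gens k. T (G k) e * v (G(k := e))) else 0)"

definition supported :: "(('c, 'm) gen \<Rightarrow> 'r::zero) set" where
  "supported = {v. \<forall>G. G \<notin> generators L \<longrightarrow> v G = 0}"

definition smul :: "'r::comm_ring_1 \<Rightarrow> (('c, 'm) gen \<Rightarrow> 'r) \<Rightarrow> ('c, 'm) gen \<Rightarrow> 'r" where
  "smul p v = (\<lambda>G. p * v G)"

lemma smul_simps: "smul p (v + w) = smul p v + smul p w" "smul (p + q) v = smul p v + smul q v"
  "smul p (smul q v) = smul (p * q) v" "smul 1 v = v" "smul 0 v = 0" "smul p 0 = 0"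
  "smul (- p) v = - smul p v" "smul p (- v) = - smul p v" "smul p (v - w) = smul p v - smul p w"
  "smul (p - q) v = smul p v - smul q v"
  by (simp_all add: smul_def fun_eq_iff algebra_simps)

lemma smul_sum: "smul p (sum f A) = (\<Sum>a\<in>A. smul p (f a))"
  by (simp add: fun_eq_iff smul_def sum_fun_apply sum_distrib_left)

lemma smul_sum_left: "smul (sum f A) v = (\<Sum>a\<in>A. smul (f a) v)"
  by (simp add: fun_eq_iff smul_def sum_fun_apply sum_distrib_right)

lemma supported_intros [intro, simp]:
  "0 \<in> supported" "v \<in> supported \<Longrightarrow> w \<in> supported \<Longrightarrow> v + w \<in> supported"
  "v \<in> supported \<Longrightarrow> w \<in> supported \<Longrightarrow> v - w \<in> supported"
  "v \<in> supported \<Longrightarrow> - v \<in> supported"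
  "v \<in> supported \<Longrightarrow> smul p v \<in> supported" "odd_op k T u \<in> supported" "even_op k T u \<in> supported"
  by (auto simp: supported_def smul_def odd_op_def even_op_def)

lemma supported_sum [intro]:
  fixes f :: "'a \<Rightarrow> ('c, 'm) gen \<Rightarrow> 'r::comm_ring_1"
  shows "(\<And>a. a \<in> A \<Longrightarrow> f a \<in> supported) \<Longrightarrow> sum f A \<in> supported"
  by (induction A rule: infinite_finite_induct) auto

text \<open>Linearity is asked for on all coefficient functions, so that it composes without side
  conditions; membership in the free module is part of the condition on the values.\<close>

definition rlin :: "((('c, 'm) gen \<Rightarrow> 'r) \<Rightarrow> (('c, 'm) gen \<Rightarrow> 'r::comm_ring_1)) \<Rightarrow> bool" where
  "rlin s \<longleftrightarrow> (\<forall>v w. s (v + w) = s v + s w) \<and> (\<forall>p v. s (smul p v) = smul p (s v)) \<and> (\<forall>v. s v \<in> supported)"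

lemma rlinD: assumes "rlin s"
  shows "s (v + w) = s v + s w" "s (smul p v) = smul p (s v)" "s v \<in> supported"
    "s 0 = 0" "s (- v) = - s v" "s (v - w) = s v - s w"
proof -
  show *: "s (v + w) = s v + s w" "s (smul p v) = smul p (s v)" "s v \<in> supported" for v w p
    using assms by (auto simp: rlin_def)
  show "s 0 = 0" using *(2)[of 0 0] by (simp add: smul_simps)
  show m: "s (- v) = - s v" for v using *(2)[of "- 1" v] by (simp add: smul_simps)
  show "s (v - w) = s v - s w" using *(1)[of v "- w"] m by simp
qed

lemma rlin_sum: assumes "rlin s" shows "s (sum f A) = (\<Sum>a\<in>A. s (f a))"
  by (rule sum_comp_morphism[symmetric, unfolded o_def, where h = s and g = f]) (simp_all only: rlinD[OF assms])

lemma rlin_odd_op [intro, simp]: "rlin (odd_op k T)"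
  by (auto simp: rlin_def odd_op_def smul_def fun_eq_iff algebra_simps sum.distrib sum_distrib_left intro!: sum.cong)
     (auto simp: supported_def)

lemma rlin_even_op [intro, simp]: "rlin (even_op k T)"
  by (auto simp: rlin_def even_op_def smul_def fun_eq_iff algebra_simps sum.distrib sum_distrib_left intro!: sum.cong)
     (auto simp: supported_def)

lemma rlin_add: "rlin s \<Longrightarrow> rlin t \<Longrightarrow> rlin (\<lambda>v. s v + t v)"
  by (simp add: rlin_def smul_simps algebra_simps)

lemma rlin_smul: "rlin s \<Longrightarrow> rlin (\<lambda>v. smul p (s v))"
  by (simp add: rlin_def smul_simps algebra_simps)

lemma rlin_0: "rlin (\<lambda>v. 0)"
  by (simp add: rlin_def smul_simps)

lemma rlin_sum_op: "(\<And>a. a \<in> A \<Longrightarrow> rlin (s a)) \<Longrightarrow> rlin (\<lambda>v. \<Sum>a\<in>A. s a v)"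
  by (induction A rule: infinite_finite_induct) (simp_all add: rlin_0 rlin_add)

definition mat_prod :: "('c, 'm) factor \<Rightarrow> (local_gen \<Rightarrow> local_gen \<Rightarrow> 'r) \<Rightarrow>
    (local_gen \<Rightarrow> local_gen \<Rightarrow> 'r) \<Rightarrow> local_gen \<Rightarrow> local_gen \<Rightarrow> 'r::comm_ring_1" where
  "mat_prod k A B g e' = (\<Sum>e\<in>local_gens k. A g e * B e e')"

lemma sgn_at_upd_same [simp]: "k \<in> factors L \<Longrightarrow> sgn_at k (G(k := e)) = sgn_at k G"
  by (simp add: sgn_at_upd)

lemma op_comp_aux:
  "(\<Sum>e\<in>local_gens k. A e * (\<Sum>e'\<in>local_gens k. B e e' * v e')) =
   (\<Sum>e'\<in>local_gens k. (\<Sum>e\<in>local_gens k. A e * B e e') * (v e' :: 'r::comm_ring_1))"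
  by (simp add: sum_distrib_left sum_distrib_right mult.assoc) (rule sum.swap)

lemma op_comp_same:
  assumes k: "k \<in> factors L"
  shows odd_odd_same: "odd_op k A (odd_op k B v) = even_op k (mat_prod k A B) v"
    and odd_even_same: "odd_op k A (even_op k B v) = odd_op k (mat_prod k A B) v"
    and even_odd_same: "even_op k A (odd_op k B v) = odd_op k (mat_prod k A B) v"
    and even_even_same: "even_op k A (even_op k B v) = even_op k (mat_prod k A B) v"
proof -
  have *: "(\<Sum>e\<in>local_gens k. A (G k) e * (\<Sum>e'\<in>local_gens k. B e e' * v (G(k := e')))) =
     (\<Sum>e'\<in>local_gens k. (\<Sum>e\<in>local_gens k. A (G k) e * B e e') * v (G(k := e')))" for G
    by (rule op_comp_aux)
  have **: "(\<Sum>e\<in>local_gens k. A (G k) e * (c * (\<Sum>e'\<in>local_gens k. B e e' * v (G(k := e'))))) =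
     c * (\<Sum>e'\<in>local_gens k. (\<Sum>e\<in>local_gens k. A (G k) e * B e e') * v (G(k := e')))" for G c
    unfolding *[symmetric] sum_distrib_left by (simp add: mult_ac)
  show "odd_op k A (odd_op k B v) = even_op k (mat_prod k A B) v"
    "odd_op k A (even_op k B v) = odd_op k (mat_prod k A B) v"
    "even_op k A (odd_op k B v) = odd_op k (mat_prod k A B) v"
    "even_op k A (even_op k B v) = even_op k (mat_prod k A B) v"
    by (auto simp: odd_op_def even_op_def mat_prod_def k generators_upd fun_eq_iff * **
        mult.assoc sum_distrib_left[symmetric] cong: sum.cong)
qed

definition is_odd :: "(local_gen \<Rightarrow> local_gen \<Rightarrow> 'r::zero) \<Rightarrow> bool" where
  "is_odd T \<longleftrightarrow> (\<forall>g e. fst g = fst e \<longrightarrow> T g e = 0)"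

definition is_even :: "(local_gen \<Rightarrow> local_gen \<Rightarrow> 'r::zero) \<Rightarrow> bool" where
  "is_even T \<longleftrightarrow> (\<forall>g e. fst g \<noteq> fst e \<longrightarrow> T g e = 0)"

lemma is_oddD: "is_odd T \<Longrightarrow> fst g = fst e \<Longrightarrow> T g e = 0"
  by (cases g; cases e) (simp add: is_odd_def)

lemma is_evenD: "is_even T \<Longrightarrow> fst g \<noteq> fst e \<Longrightarrow> T g e = 0"
  by (cases g; cases e) (simp add: is_even_def)

lemma is_odd_odd_map [intro, simp]: "is_odd (odd_map P Q)"
  by (simp add: is_odd_def odd_map_def)

lemma is_even_even_map [intro, simp]: "is_even (even_map P Q)"
  by (simp add: is_even_def even_map_def)

context
  fixes j k assumes jk: "j \<in> factors L" "k \<in> factors L" "j \<noteq> k"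
begin

private lemma upd_comm: "G(k := e', j := e) = G(j := e, k := e')"
  using jk(3) by (simp add: fun_upd_twist)

text \<open>Exactly one of the two factors precedes the other, so exactly one of the two composites
  sees its Koszul sign flipped by the operator applied at the other factor.\<close>

lemma odd_odd_other:
  assumes "is_odd A" "is_odd B"
  shows "odd_op j A (odd_op k B v) = - odd_op k B (odd_op j A v)"
proof
  fix G
  show "odd_op j A (odd_op k B v) G = (- odd_op k B (odd_op j A v)) G"
  proof (cases "G \<in> generators L")
    case True
    have 1: "A (G j) e * sgn_at k (G(j := e)) = (if before j k then - 1 else 1) * (A (G j) e * sgn_at k G)" for e
      using is_oddD[OF assms(1), of "G j" e] jk by (auto simp: sgn_at_upd)
    have 2: "B (G k) e * sgn_at j (G(k := e)) = (if before k j then - 1 else 1) * (B (G k) e * sgn_at j G)" for e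
      using is_oddD[OF assms(2), of "G k" e] jk by (auto simp: sgn_at_upd)
    have "odd_op j A (odd_op k B v) G = (\<Sum>e\<in>local_gens j. \<Sum>e'\<in>local_gens k.
        sgn_at j G * B (G k) e' * v (G(j := e, k := e')) * (A (G j) e * sgn_at k (G(j := e))))"
      using True jk by (simp add: odd_op_def generators_upd sum_distrib_left mult_ac)
    also have "\<dots> = (\<Sum>e\<in>local_gens j. \<Sum>e'\<in>local_gens k.
        (if before j k then - 1 else 1) * (sgn_at k G * sgn_at j G * A (G j) e * B (G k) e' * v (G(j := e, k := e'))))"
      unfolding 1 by (simp add: mult_ac)
    also have "\<dots> = - (\<Sum>e\<in>local_gens j. \<Sum>e'\<in>local_gens k.
        (if before k j then - 1 else 1) * (sgn_at k G * sgn_at j G * A (G j) e * B (G k) e' * v (G(j := e, k := e'))))"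
      using before_total[OF jk] by (simp add: sum_negf)
    also have "\<dots> = - (\<Sum>e'\<in>local_gens k. \<Sum>e\<in>local_gens j.
        sgn_at k G * A (G j) e * v (G(j := e, k := e')) * (B (G k) e' * sgn_at j (G(k := e'))))"
      unfolding 2 by (subst sum.swap) (simp add: mult_ac)
    also have "\<dots> = - odd_op k B (odd_op j A v) G"
      using True jk by (simp add: odd_op_def generators_upd sum_distrib_left mult_ac upd_comm)
    finally show ?thesis by simp
  qed (simp add: odd_op_def)
qed

lemma even_odd_other:
  assumes "is_even A"
  shows "even_op j A (odd_op k B v) = odd_op k B (even_op j A v)"
proof
  fix G
  show "even_op j A (odd_op k B v) G = odd_op k B (even_op j A v) G"
  proof (cases "G \<in> generators L")
    case True
    have 1: "A (G j) e * sgn_at k (G(j := e)) = A (G j) e * sgn_at k G" for e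
      using is_evenD[OF assms(1), of "G j" e] jk by (auto simp: sgn_at_upd)
    have "even_op j A (odd_op k B v) G = (\<Sum>e\<in>local_gens j. \<Sum>e'\<in>local_gens k.
        B (G k) e' * v (G(j := e, k := e')) * (A (G j) e * sgn_at k (G(j := e))))"
      using True jk by (simp add: odd_op_def even_op_def generators_upd sum_distrib_left mult_ac)
    also have "\<dots> = odd_op k B (even_op j A v) G"
      unfolding 1 using True jk
      by (subst sum.swap) (simp add: odd_op_def even_op_def generators_upd sum_distrib_left mult_ac upd_comm)
    finally show ?thesis .
  qed (simp add: odd_op_def even_op_def)
qed

lemma even_even_other: "even_op j A (even_op k B v) = even_op k B (even_op j A v)"
proof
  fix G
  show "even_op j A (even_op k B v) G = even_op k B (even_op j A v) G"
  proof (cases "G \<in> generators L")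
    case True
    have "even_op j A (even_op k B v) G = (\<Sum>e\<in>local_gens j. \<Sum>e'\<in>local_gens k.
        B (G k) e' * v (G(j := e, k := e')) * A (G j) e)"
      using True jk by (simp add: even_op_def generators_upd sum_distrib_left mult_ac)
    also have "\<dots> = even_op k B (even_op j A v) G"
      using True jk
      by (subst sum.swap) (simp add: even_op_def generators_upd sum_distrib_left mult_ac upd_comm)
    finally show ?thesis .
  qed (simp add: even_op_def)
qed

end

lemma even_op_mat_add: "even_op k (\<lambda>g e. A g e + B g e) v = even_op k A v + even_op k B v"
  by (auto simp: even_op_def fun_eq_iff sum.distrib distrib_right)

lemma even_op_scalar:
  assumes k: "k \<in> factors L" and v: "v \<in> supported"
    and A: "\<And>g e. g \<in> local_gens k \<Longrightarrow> e \<in> local_gens k \<Longrightarrow> A g e = (if e = g then p else 0)"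
  shows "even_op k A v = smul p v"
proof
  fix G
  show "even_op k A v G = smul p v G"
  proof (cases "G \<in> generators L")
    case True
    have "even_op k A v G = (\<Sum>e\<in>local_gens k. A (G k) e * v (G(k := e)))"
      using True by (simp add: even_op_def)
    also have "\<dots> = (\<Sum>e\<in>local_gens k. if e = G k then p * v G else 0)"
      by (rule sum.cong) (auto simp: A[OF generators_apply[OF True k]])
    also have "\<dots> = p * v G" using generators_apply[OF True k] by simp
    finally show ?thesis by (simp add: smul_def)
  qed (use v in \<open>auto simp: even_op_def smul_def supported_def\<close>)
qed

text \<open>The vector \<open>(a\<^sub>1, b\<^sub>1, a\<^sub>2, b\<^sub>2)\<close> acts as the Koszul factorization of \<open>a\<^sub>1 b\<^sub>1 + a\<^sub>2 b\<^sub>2\<close>.\<close>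

definition koszul :: "(nat \<Rightarrow> 'r::comm_ring_1) \<Rightarrow> local_gen \<Rightarrow> local_gen \<Rightarrow> 'r" where
  "koszul \<xi> = odd_map ((\<xi> 0, \<xi> 3), (\<xi> 2, - \<xi> 1)) ((\<xi> 1, \<xi> 3), (\<xi> 2, - \<xi> 0))"

text \<open>The bilinear form of the Clifford relations, i.e. twice the polarization of \<open>a\<^sub>1 b\<^sub>1 + a\<^sub>2 b\<^sub>2\<close>.\<close>

definition polar :: "(nat \<Rightarrow> 'r) \<Rightarrow> (nat \<Rightarrow> 'r) \<Rightarrow> 'r::comm_ring_1" where
  "polar \<xi> \<eta> = \<xi> 0 * \<eta> 1 + \<xi> 1 * \<eta> 0 + \<xi> 2 * \<eta> 3 + \<xi> 3 * \<eta> 2"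

text \<open>An arc has one generator in either degree; a second Koszul pair would enter
  \<open>polar\<close> there without acting on the module.\<close>

definition fits :: "('c, 'm) factor \<Rightarrow> (nat \<Rightarrow> 'r::comm_ring_1) \<Rightarrow> bool" where
  "fits k \<xi> \<longleftrightarrow> k \<in> factors L \<and> (\<forall>a. k = Inr a \<longrightarrow> \<xi> 2 = 0 \<and> \<xi> 3 = 0)"

definition cl :: "('c, 'm) factor \<Rightarrow> (nat \<Rightarrow> 'r) \<Rightarrow> (('c, 'm) gen \<Rightarrow> 'r::comm_ring_1) \<Rightarrow> ('c, 'm) gen \<Rightarrow> 'r" where
  "cl k \<xi> = odd_op k (koszul \<xi>)"

lemma sum_local_gens_Inl:
  "(\<Sum>e\<in>local_gens (Inl c). f e) = f (False, False) + f (False, True) + f (True, False) + (f (True, True) :: 'r::comm_monoid_add)"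
proof -
  have eq: "local_gens (Inl c) = {(False, False), (False, True), (True, False), (True, True)}" by auto
  show ?thesis unfolding eq by (simp add: add.assoc)
qed

lemma sum_local_gens_Inr:
  "(\<Sum>e\<in>local_gens (Inr a). f e) = f (False, False) + (f (True, False) :: 'r::comm_monoid_add)"
  by simp

lemmas sum_local_gens = sum_local_gens_Inl sum_local_gens_Inr

lemma is_odd_koszul [intro, simp]: "is_odd (koszul \<xi>)" by (simp add: koszul_def)

text \<open>The Clifford relation. Linearity of \<open>koszul\<close> in its vector makes it the
  polarization of the fact that a Koszul factorization squares to its potential.\<close>

lemma koszul_anticommutator:
  assumes "fits k \<xi>" "fits k \<eta>" "g \<in> local_gens k" "e \<in> local_gens k"
  shows "mat_prod k (koszul \<xi>) (koszul \<eta>) g e + mat_prod k (koszul \<eta>) (koszul \<xi>) g e = (if e = g then polar \<xi> \<eta> else 0)"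
  using assms
  by (cases k; cases g; cases e)
     (auto simp: mat_prod_def sum_local_gens koszul_def odd_map_def entry_def fits_def polar_def algebra_simps
           simp del: local_gens.simps(1))

lemma cl_anticommutator_same:
  assumes "fits k \<xi>" "fits k \<eta>" "v \<in> supported"
  shows "cl k \<xi> (cl k \<eta> v) + cl k \<eta> (cl k \<xi> v) = smul (polar \<xi> \<eta>) v"
proof -
  have k: "k \<in> factors L" using assms(1) by (simp add: fits_def)
  have "even_op k (\<lambda>g e. mat_prod k (koszul \<xi>) (koszul \<eta>) g e + mat_prod k (koszul \<eta>) (koszul \<xi>) g e) v = smul (polar \<xi> \<eta>) v"
    using assms by (intro even_op_scalar k koszul_anticommutator)
  then show ?thesis
    unfolding cl_def odd_odd_same[OF k] by (simp only: even_op_mat_add)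
qed

lemma cl_anticommutator_other:
  assumes "j \<in> factors L" "k \<in> factors L" "j \<noteq> k"
  shows "cl j \<xi> (cl k \<eta> v) + cl k \<eta> (cl j \<xi> v) = 0"
  using odd_odd_other[OF assms is_odd_koszul is_odd_koszul, of \<xi> \<eta> v] by (simp add: cl_def)

lemma rlin_cl [intro, simp]: "rlin (cl k \<xi>)" by (simp add: cl_def)

lemma cl_vec_add: "cl k (\<lambda>i. \<xi> i + \<eta> i) v = cl k \<xi> v + cl k \<eta> v"
proof -
  have "koszul (\<lambda>i. \<xi> i + \<eta> i) g e = koszul \<xi> g e + koszul \<eta> g e" for g e
    by (auto simp: koszul_def odd_map_def entry_def Let_def)
  then show ?thesis by (simp add: cl_def odd_op_def fun_eq_iff algebra_simps sum.distrib)
qed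

lemma cl_vec_0: "cl k (\<lambda>i. 0) v = (0 :: ('c, 'm) gen \<Rightarrow> 'r::comm_ring_1)"
proof -
  have "koszul (\<lambda>i. 0) g e = (0 :: 'r)" for g e by (auto simp: koszul_def odd_map_def entry_def Let_def)
  then show ?thesis by (simp add: cl_def odd_op_def fun_eq_iff)
qed

lemma cl_vec_sum: "cl k (\<lambda>i. \<Sum>a\<in>A. \<xi> a i) v = (\<Sum>a\<in>A. cl k (\<xi> a) v)"
  by (induction A rule: infinite_finite_induct) (simp_all add: cl_vec_0 cl_vec_add)

section \<open>The grading of chains by parity\<close>

definition homogeneous :: "bool \<Rightarrow> (('c, 'm) gen \<Rightarrow> 'r::zero) set" where
  "homogeneous p = {v. \<forall>G. v G \<noteq> 0 \<longrightarrow> G \<in> generators L \<and> odd_gen L G = p}"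

lemma odd_gen_upd:
  assumes "k \<in> factors L"
  shows "odd_gen L (G(k := e)) \<longleftrightarrow> (odd_gen L G \<longleftrightarrow> (fst e \<longleftrightarrow> fst (G k)))"
proof -
  let ?A = "\<lambda>G. {i \<in> factors L. fst (G i)}"
  consider "fst e \<longleftrightarrow> fst (G k)" | "fst e" "\<not> fst (G k)" | "\<not> fst e" "fst (G k)" by auto
  then show ?thesis
  proof cases
    case 1
    then have "?A (G(k := e)) = ?A G" by auto
    with 1 show ?thesis by (simp add: odd_gen_def del: fun_upd_apply)
  next
    case 2
    then have "?A (G(k := e)) = insert k (?A G)" "k \<notin> ?A G" using assms by auto
    with 2 show ?thesis by (simp add: odd_gen_def del: fun_upd_apply)
  next
    case 3
    then have "?A G = insert k (?A (G(k := e)))" "k \<notin> ?A (G(k := e))" using assms by auto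
    with 3 show ?thesis by (simp add: odd_gen_def del: fun_upd_apply)
  qed
qed

lemma homogeneous_odd_op:
  assumes "k \<in> factors L" "is_odd T" "v \<in> homogeneous p"
  shows "odd_op k T v \<in> homogeneous (\<not> p)"
  unfolding homogeneous_def
proof safe
  fix G assume *: "odd_op k T v G \<noteq> 0"
  then show G: "G \<in> generators L" by (auto simp: odd_op_def split: if_splits)
  from * G obtain e where "T (G k) e \<noteq> 0" "v (G(k := e)) \<noteq> 0"
    by (auto simp: odd_op_def elim!: sum.not_neutral_contains_not_neutral)
       (metis mult_zero_left mult_zero_right)
  with assms have "odd_gen L (G(k := e)) = p" "fst (G k) \<noteq> fst e"
    using is_oddD[OF assms(2), of "G k" e] by (auto simp: homogeneous_def)
  then show "odd_gen L G \<Longrightarrow> p \<Longrightarrow> False" "\<not> p \<Longrightarrow> odd_gen L G"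
    using odd_gen_upd[OF assms(1), of G e] by auto
qed

lemma homogeneous_even_op:
  assumes "k \<in> factors L" "is_even T" "v \<in> homogeneous p"
  shows "even_op k T v \<in> homogeneous p"
  unfolding homogeneous_def
proof safe
  fix G assume *: "even_op k T v G \<noteq> 0"
  then show G: "G \<in> generators L" by (auto simp: even_op_def split: if_splits)
  from * G obtain e where "T (G k) e \<noteq> 0" "v (G(k := e)) \<noteq> 0"
    by (auto simp: even_op_def elim!: sum.not_neutral_contains_not_neutral)
       (metis mult_zero_left mult_zero_right)
  with assms have "odd_gen L (G(k := e)) = p" "fst (G k) = fst e"
    using is_evenD[OF assms(2), of "G k" e] by (auto simp: homogeneous_def)
  then show "odd_gen L G \<Longrightarrow> p" "p \<Longrightarrow> odd_gen L G"
    using odd_gen_upd[OF assms(1), of G e] by auto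
qed

lemma homogeneous_iff: "v \<in> homogeneous p \<longleftrightarrow> (\<forall>G. \<not> (G \<in> generators L \<and> odd_gen L G = p) \<longrightarrow> v G = 0)"
  unfolding homogeneous_def by blast

lemma homogeneous_intros [intro, simp]:
  fixes v w :: "('c, 'm) gen \<Rightarrow> 'r::comm_ring_1"
  shows "0 \<in> homogeneous p" "v \<in> homogeneous p \<Longrightarrow> w \<in> homogeneous p \<Longrightarrow> v + w \<in> homogeneous p"
  "v \<in> homogeneous p \<Longrightarrow> w \<in> homogeneous p \<Longrightarrow> v - w \<in> homogeneous p"
  "v \<in> homogeneous p \<Longrightarrow> - v \<in> homogeneous p"
  "v \<in> homogeneous p \<Longrightarrow> smul q v \<in> homogeneous p"
  unfolding homogeneous_iff smul_def by simp_all

lemma homogeneous_sum [intro]: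
  fixes f :: "'a \<Rightarrow> ('c, 'm) gen \<Rightarrow> 'r::comm_ring_1"
  shows "(\<And>a. a \<in> A \<Longrightarrow> f a \<in> homogeneous p) \<Longrightarrow> sum f A \<in> homogeneous p"
  by (induction A rule: infinite_finite_induct) auto

lemma homogeneous_supported: "v \<in> homogeneous p \<Longrightarrow> v \<in> supported"
  by (auto simp: homogeneous_def supported_def)

end

section \<open>The cohomology of a resolution at a common eigenvalue\<close>

text \<open>Gaussian elimination on the coordinates in \<open>B\<close>: a vector \<open>p\<close>
  with nonzero coordinate \<open>b\<close> clears this coordinate from the others, and its own
  coefficient collects the multiples that were subtracted.\<close>

lemma linear_dependence:
  fixes f :: "'j \<Rightarrow> 'g \<Rightarrow> 'a::field"
  assumes "finite B" "finite J" "card B < card J"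
  shows "\<exists>a. (\<exists>j\<in>J. a j \<noteq> 0) \<and> (\<forall>x\<in>B. (\<Sum>j\<in>J. a j * f j x) = 0)"
  using assms
proof (induction B arbitrary: J f rule: finite_induct)
  case empty
  then have "J \<noteq> {}" by auto
  then show ?case by (intro exI[of _ "\<lambda>_. 1"]) auto
next
  case (insert b B)
  show ?case
  proof (cases "\<forall>j\<in>J. f j b = 0")
    case True
    have "card B < card J" using insert by simp
    from insert.IH[OF insert.prems(1) this, of f] True show ?thesis by auto
  next
    case False
    then obtain p where p: "p \<in> J" "f p b \<noteq> 0" by auto
    have "card B < card (J - {p})" "finite (J - {p})" using insert p by auto
    from insert.IH[OF this(2,1), of "\<lambda>j x. f j x - f j b / f p b * f p x"]
    obtain a j where a: "j \<in> J - {p}" "a j \<noteq> 0"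
      "\<And>x. x \<in> B \<Longrightarrow> (\<Sum>j\<in>J - {p}. a j * (f j x - f j b / f p b * f p x)) = 0" by blast
    define a' where "a' = (\<lambda>j. if j = p then - (\<Sum>j\<in>J - {p}. a j * f j b / f p b) else a j)"
    have sum: "(\<Sum>j\<in>J. a' j * f j x) = (\<Sum>j\<in>J - {p}. a j * (f j x - f j b / f p b * f p x))" for x
    proof -
      have "(\<Sum>j\<in>J. a' j * f j x) = a' p * f p x + (\<Sum>j\<in>J - {p}. a' j * f j x)"
        using insert.prems p by (subst sum.remove[of J p]) auto
      also have "(\<Sum>j\<in>J - {p}. a' j * f j x) = (\<Sum>j\<in>J - {p}. a j * f j x)"
        by (rule sum.cong) (auto simp: a'_def)
      finally show ?thesis
        by (simp add: a'_def right_diff_distrib sum_subtractf sum_distrib_right mult.assoc)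
    qed
    show ?thesis
    proof (intro exI[of _ a'] conjI bexI[of _ j] ballI)
      fix x assume "x \<in> insert b B"
      then show "(\<Sum>j\<in>J. a' j * f j x) = 0" unfolding sum using a(3) p(2) by auto
    qed (use a in \<open>auto simp: a'_def\<close>)
  qed
qed

definition quad :: "'r \<Rightarrow> 'r \<Rightarrow> 'r \<Rightarrow> 'r \<Rightarrow> nat \<Rightarrow> 'r::zero" where
  "quad a b c d i = (if i = 0 then a else if i = 1 then b else if i = 2 then c else if i = 3 then d else 0)"

lemma quad_simps [simp]: "quad a b c d 0 = a" "quad a b c d 1 = b" "quad a b c d (Suc 0) = b"
  "quad a b c d 2 = c" "quad a b c d 3 = d"
  by (simp_all add: quad_def)

locale gornik = diagram L for L :: "('c::linorder, 'm::{finite,linorder}) diagram" +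
  fixes n :: nat and \<beta> :: complex
  assumes n: "n \<ge> 2" and \<beta>: "\<beta> \<noteq> 0"
begin

definition const :: complex where "const = of_nat (n + 1) * \<beta> ^ n"

text \<open>The arc from a mark to the next is treated as having an end \<open>1\<close> and an end \<open>3\<close>.\<close>

fun mark :: "('c, 'm) factor \<Rightarrow> nat \<Rightarrow> 'm" where
  "mark (Inl c) e = ends L c e"
| "mark (Inr a) e = (if e = 1 then fst a else snd a)"

text \<open>Both kinds of slots are in bijection with the marks, so a mark is an edge running from
  the factor of its out-slot to the factor of its in-slot.\<close>

definition in_slots :: "(('c, 'm) factor \<times> nat) set" where
  "in_slots = Inl ` crossings L \<times> {1, 2} \<union> Inr ` arcs L \<times> {1}"

definition out_slots :: "(('c, 'm) factor \<times> nat) set" where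
  "out_slots = Inl ` crossings L \<times> {3, 4} \<union> Inr ` arcs L \<times> {3}"

lemma in_slots_bij: "bij_betw (\<lambda>(k, e). mark k e) in_slots UNIV"
  and out_slots_bij: "bij_betw (\<lambda>(k, e). mark k e) out_slots UNIV"
proof -
  have *: "bij_betw (\<lambda>(k, e). mark k e) (Inl ` crossings L \<times> {i, j} \<union> Inr ` arcs L \<times> {l}) UNIV"
    if b: "bij_betw (case_sum f (\<lambda>(c, i). ends L c i)) (Sum_Type.Plus (arcs L) (crossings L \<times> {i, j})) UNIV"
      and f: "\<And>a. mark (Inr a) l = f a" for i j l f
  proof -
    let ?h = "\<lambda>(k, e). case k of Inl c \<Rightarrow> Inr (c, e) | Inr a \<Rightarrow> Inl a"
    have "bij_betw ?h (Inl ` crossings L \<times> {i, j} \<union> Inr ` arcs L \<times> {l})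
        (Sum_Type.Plus (arcs L) (crossings L \<times> {i, j}))"
      by (rule bij_betw_byWitness[where f' = "\<lambda>s. case s of Inl a \<Rightarrow> (Inr a, l) | Inr (c, e) \<Rightarrow> (Inl c, e)"]) auto
    from bij_betw_trans[OF this b]
    show ?thesis by (rule bij_betw_cong[THEN iffD1, rotated]) (auto simp: f[symmetric] simp del: mark.simps(2))
  qed
  show "bij_betw (\<lambda>(k, e). mark k e) in_slots UNIV"
    unfolding in_slots_def by (rule *[OF in_bij]) simp
  show "bij_betw (\<lambda>(k, e). mark k e) out_slots UNIV"
    unfolding out_slots_def by (rule *[OF out_bij]) simp
qed

lemma finite_slots [simp]: "finite in_slots" "finite out_slots"
  by (auto simp: in_slots_def out_slots_def finite_crossings)

lemma slots_factors: "(k, e) \<in> in_slots \<Longrightarrow> k \<in> factors L" "(k, e) \<in> out_slots \<Longrightarrow> k \<in> factors L"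
  by (auto simp: in_slots_def out_slots_def factors_def)

text \<open>Stated in the variables of the ends, so that the derivative at a single end still makes
  sense when two ends carry the same mark.\<close>

fun vec :: "'c set \<Rightarrow> ('c, 'm) factor \<Rightarrow> nat \<Rightarrow> nat mpoly" where
  "vec \<Gamma> (Inl c) = (if c \<in> \<Gamma>
     then quad (u1_poly n - Const const) sum_diff (u2_poly n) prod_diff
     else quad (pi_at n (gvar 1) (gvar 3) - Const const) (gvar 1 - gvar 3)
            (pi_at n (gvar 2) (gvar 4) - Const const) (gvar 2 - gvar 4))"
| "vec \<Gamma> (Inr a) = quad (pi_at n (gvar 1) (gvar 3) - Const const) (gvar 1 - gvar 3) 0 0"

lemma slot_poly_vec: "slot_poly (vec \<Gamma> k i)"
  by (cases k) (auto simp: quad_def intro!: slot_poly_u slot_poly_diffs slot_poly_pi_at)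

text \<open>The one-variable potential; its critical points are the solutions of
  \<open>x ^ n = \<beta> ^ n\<close>.\<close>

definition wt :: "'v \<Rightarrow> 'v mpoly" where
  "wt v = Var v ^ (n + 1) - Const const * Var v"

fun potential :: "('c, 'm) factor \<Rightarrow> nat mpoly" where
  "potential (Inl c) = wt 1 + wt 2 - wt 3 - wt 4"
| "potential (Inr a) = wt 1 - wt 3"

text \<open>For a thick edge the constant in the first entry meets \<open>sum_diff\<close>, which
  produces exactly the linear terms of the four potentials.\<close>

lemma vec_potential: "vec \<Gamma> k 0 * vec \<Gamma> k 1 + vec \<Gamma> k 2 * vec \<Gamma> k 3 = potential k"
proof -
  have 13: "(pi_at n (gvar i) (gvar j) - Const const) * (gvar i - gvar j) = wt i - wt j" for i j
    unfolding wt_def left_diff_distrib pi_at_mult by (simp add: algebra_simps)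
  show ?thesis
  proof (cases k)
    case (Inl c)
    show ?thesis
    proof (cases "c \<in> \<Gamma>")
      case True
      have "(u1_poly n - Const const) * sum_diff + u2_poly n * prod_diff =
          (u1_poly n * sum_diff + u2_poly n * prod_diff) - Const const * sum_diff"
        by (simp add: algebra_simps)
      also have "\<dots> = potential k"
        unfolding u_poly_potential using Inl by (simp add: wt_def sum_diff_def algebra_simps)
      finally show ?thesis using Inl True by simp
    qed (use Inl 13 in simp)
  qed (use 13 in simp)
qed

lemma polar_vec: "polar (vec \<Gamma> k) (vec \<Gamma> k) = 2 * potential k"
  unfolding vec_potential[of \<Gamma>, symmetric] polar_def by (simp add: algebra_simps)

definition loc :: "('c, 'm) factor \<Rightarrow> nat mpoly \<Rightarrow> 'm mpoly" where
  "loc k = subst (\<lambda>e. Var (mark k e))"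

lemmas loc_simps = subst_simps[where f = "\<lambda>e. Var (mark k e)" for k, folded loc_def]

lemma loc_basic [simp]: "loc k (Const a) = Const a" "loc k (Var e) = Var (mark k e)" "loc k 0 = 0" "loc k 1 = 1"
  by (simp_all add: loc_def)

lemma loc_2 [simp]: "loc k 2 = 2"
  using loc_simps(8)[of k 2] by simp

definition lvec :: "'c set \<Rightarrow> ('c, 'm) factor \<Rightarrow> nat \<Rightarrow> 'm mpoly" where
  "lvec \<Gamma> k = (\<lambda>i. loc k (vec \<Gamma> k i))"

definition dd :: "'c set \<Rightarrow> ('c, 'm) chain \<Rightarrow> ('c, 'm) chain" where
  "dd \<Gamma> v = (\<Sum>k\<in>factors L. cl k (lvec \<Gamma> k) v)"

lemma factor_diff_koszul:
  assumes "k \<in> factors L" "g \<in> local_gens k" "e \<in> local_gens k"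
  shows "factor_diff n \<beta> L \<Gamma> k g e = koszul (lvec \<Gamma> k) g e"
proof (cases k)
  case (Inl c)
  have s: "subst (end_var L c) p = loc (Inl c) p" for p
    unfolding loc_def by (rule arg_cong[where f = "\<lambda>f. subst f p"]) (auto simp: end_var_def)
  show ?thesis
    unfolding Inl
    by (auto simp: M1_diff_def M2_diff_def Let_def koszul_def lvec_def s beta_const_def const_def
        loc_simps subst_pi_at[where f = "\<lambda>e. Var (mark k e)" for k, folded loc_def] end_var_def
        sum_diff_def prod_diff_def algebra_simps intro!: arg_cong[where f = "\<lambda>A. odd_map A B g e" for B]
        arg_cong2[where f = "\<lambda>A B. odd_map A B g e"])
next
  case (Inr a)
  obtain x y where a: "a = (x, y)" by (cases a)
  show ?thesis
    using assms unfolding Inr a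
    by (auto simp: arc_diff_def koszul_def lvec_def beta_const_def const_def odd_map_def entry_def
        loc_simps subst_pi_at[where f = "\<lambda>e. Var (mark k e)" for k, folded loc_def])
qed

lemma res_diff_eq: "res_diff n \<beta> L \<Gamma> = dd \<Gamma>"
proof (intro ext)
  fix v G
  show "res_diff n \<beta> L \<Gamma> v G = dd \<Gamma> v G"
    by (auto simp: res_diff_def dd_def sum_fun_apply cl_def odd_op_def sgn_at_def factor_diff_koszul
        generators_apply intro!: sum.cong)
qed

lemma rlin_dd [intro, simp]: "rlin (dd \<Gamma>)"
  unfolding dd_def by (rule rlin_sum_op) simp

lemmas dd_simps = rlinD[OF rlin_dd] rlin_sum[OF rlin_dd]

lemma fits_lvec: "k \<in> factors L \<Longrightarrow> fits k (lvec \<Gamma> k)"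
  by (auto simp: fits_def lvec_def)

text \<open>Only the summand of \<open>dd\<close> at \<open>k\<close> fails to anticommute with
  \<open>cl k \<eta>\<close>, so the homotopy relation is local.\<close>

lemma dd_cl:
  assumes "fits k \<eta>" "v \<in> supported"
  shows "dd \<Gamma> (cl k \<eta> v) + cl k \<eta> (dd \<Gamma> v) = smul (polar (lvec \<Gamma> k) \<eta>) v"
proof -
  have k: "k \<in> factors L" using assms by (simp add: fits_def)
  have "dd \<Gamma> (cl k \<eta> v) + cl k \<eta> (dd \<Gamma> v) =
      (\<Sum>j\<in>factors L. cl j (lvec \<Gamma> j) (cl k \<eta> v) + cl k \<eta> (cl j (lvec \<Gamma> j) v))"
    unfolding dd_def rlin_sum[OF rlin_cl] by (rule sum.distrib[symmetric])
  also have "\<dots> = (\<Sum>j\<in>factors L. if j = k then smul (polar (lvec \<Gamma> k) \<eta>) v else 0)"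
  proof (rule sum.cong[OF refl])
    fix j assume "j \<in> factors L"
    then show "cl j (lvec \<Gamma> j) (cl k \<eta> v) + cl k \<eta> (cl j (lvec \<Gamma> j) v) =
        (if j = k then smul (polar (lvec \<Gamma> k) \<eta>) v else 0)"
      using cl_anticommutator_same[OF fits_lvec assms] cl_anticommutator_other[of j k] k by auto
  qed
  also have "\<dots> = smul (polar (lvec \<Gamma> k) \<eta>) v" using k by simp
  finally show ?thesis .
qed

lemma sum_in_slots: "(\<Sum>(k, e)\<in>in_slots. f (mark k e)) = (\<Sum>m\<in>UNIV. f m)"
  and sum_out_slots: "(\<Sum>(k, e)\<in>out_slots. f (mark k e)) = (\<Sum>m\<in>UNIV. f m)"
  using sum.reindex_bij_betw[OF in_slots_bij, of f] sum.reindex_bij_betw[OF out_slots_bij, of f]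
  by (simp_all add: case_prod_unfold)

lemma sum_factors: "(\<Sum>k\<in>factors L. f k) = (\<Sum>c\<in>crossings L. f (Inl c)) + (\<Sum>a\<in>arcs L. f (Inr a))"
  for f :: "('c, 'm) factor \<Rightarrow> 'r::comm_monoid_add"
  unfolding factors_def by (subst sum.Plus) (simp_all add: finite_crossings)

lemma sum_slots_expand:
  fixes f :: "('c, 'm) factor \<Rightarrow> nat \<Rightarrow> 'r::comm_monoid_add"
  shows "(\<Sum>(k, e)\<in>in_slots. f k e) = (\<Sum>c\<in>crossings L. f (Inl c) 1 + f (Inl c) 2) + (\<Sum>a\<in>arcs L. f (Inr a) 1)"
    "(\<Sum>(k, e)\<in>out_slots. f k e) = (\<Sum>c\<in>crossings L. f (Inl c) 3 + f (Inl c) 4) + (\<Sum>a\<in>arcs L. f (Inr a) 3)"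
  unfolding in_slots_def out_slots_def
  by (subst sum.union_disjoint; auto simp: finite_crossings sum.reindex simp flip: sum.cartesian_product)+

text \<open>Every mark is the incoming end of one factor and the outgoing end of one factor, with
  opposite signs in the potentials.\<close>

lemma total_potential: "(\<Sum>k\<in>factors L. loc k (potential k)) = 0"
proof -
  have "(\<Sum>k\<in>factors L. loc k (potential k)) =
      (\<Sum>(k, e)\<in>in_slots. wt (mark k e)) - (\<Sum>(k, e)\<in>out_slots. wt (mark k e))"
    unfolding sum_factors sum_slots_expand
    by (simp add: loc_simps wt_def sum_subtractf sum.distrib algebra_simps)
  then show ?thesis unfolding sum_in_slots sum_out_slots by simp
qed

text \<open>Twice the square is the sum of the anticommutators of the summands with
  \<open>dd\<close>, that is, twice the total potential; 2 can be cancelled.\<close>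

lemma dd_dd:
  assumes "v \<in> supported"
  shows "dd \<Gamma> (dd \<Gamma> v) = 0"
proof -
  have "dd \<Gamma> (dd \<Gamma> v) + dd \<Gamma> (dd \<Gamma> v) =
      (\<Sum>k\<in>factors L. dd \<Gamma> (cl k (lvec \<Gamma> k) v)) + (\<Sum>k\<in>factors L. cl k (lvec \<Gamma> k) (dd \<Gamma> v))"
    by (subst (2) dd_def) (simp add: dd_simps, simp add: dd_def)
  also have "\<dots> = (\<Sum>k\<in>factors L. dd \<Gamma> (cl k (lvec \<Gamma> k) v) + cl k (lvec \<Gamma> k) (dd \<Gamma> v))"
    by (simp add: sum.distrib)
  also have "\<dots> = (\<Sum>k\<in>factors L. smul (polar (lvec \<Gamma> k) (lvec \<Gamma> k)) v)"
    by (rule sum.cong) (auto intro!: dd_cl fits_lvec assms)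
  also have "\<dots> = smul (\<Sum>k\<in>factors L. loc k (potential k) + loc k (potential k)) v"
  proof -
    have "polar (lvec \<Gamma> k) (lvec \<Gamma> k) = loc k (polar (vec \<Gamma> k) (vec \<Gamma> k))" for k
      by (simp add: polar_def lvec_def loc_simps)
    then show ?thesis unfolding smul_sum_left polar_vec mult_2 loc_simps by simp
  qed
  also have "\<dots> = 0" unfolding sum.distrib total_potential by (simp add: smul_simps)
  finally have "dd \<Gamma> (dd \<Gamma> v) G + dd \<Gamma> (dd \<Gamma> v) G = 0" for G
    by (metis plus_fun_apply zero_fun_apply)
  then have "2 * dd \<Gamma> (dd \<Gamma> v) G = 0" for G by (simp only: mult_2)
  then show ?thesis by (simp add: fun_eq_iff)
qed

subsection \<open>Null-homotopic polynomials\<close>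

text \<open>Multiplication by \<open>p\<close> is homotopic to zero. These \<open>p\<close> form an
  ideal that kills the cohomology, so one may compute modulo it.\<close>

definition null :: "'c set \<Rightarrow> 'm mpoly \<Rightarrow> bool" where
  "null \<Gamma> p \<longleftrightarrow> (\<exists>s. rlin s \<and> (\<forall>v\<in>supported. dd \<Gamma> (s v) + s (dd \<Gamma> v) = smul p v))"

lemma null_add: assumes "null \<Gamma> p" "null \<Gamma> q" shows "null \<Gamma> (p + q)"
proof -
  from assms obtain s t where "rlin s" "rlin t" "\<And>v. v \<in> supported \<Longrightarrow> dd \<Gamma> (s v) + s (dd \<Gamma> v) = smul p v"
    "\<And>v. v \<in> supported \<Longrightarrow> dd \<Gamma> (t v) + t (dd \<Gamma> v) = smul q v" unfolding null_def by blast
  note st = this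
  have "dd \<Gamma> (s v + t v) + (s (dd \<Gamma> v) + t (dd \<Gamma> v)) = smul (p + q) v" if "v \<in> supported" for v
  proof -
    have "dd \<Gamma> (s v + t v) + (s (dd \<Gamma> v) + t (dd \<Gamma> v)) =
        (dd \<Gamma> (s v) + s (dd \<Gamma> v)) + (dd \<Gamma> (t v) + t (dd \<Gamma> v))"
      by (simp add: dd_simps add_ac)
    then show ?thesis by (simp only: st that smul_simps)
  qed
  with rlin_add[OF st(1,2)] show ?thesis unfolding null_def by blast
qed

lemma null_mult: assumes "null \<Gamma> p" shows "null \<Gamma> (q * p)"
proof -
  from assms obtain s where s: "rlin s" "\<And>v. v \<in> supported \<Longrightarrow> dd \<Gamma> (s v) + s (dd \<Gamma> v) = smul p v"
    unfolding null_def by blast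
  have "dd \<Gamma> (smul q (s v)) + smul q (s (dd \<Gamma> v)) = smul (q * p) v" if "v \<in> supported" for v
    using arg_cong[OF s(2)[OF that], of "smul q"] by (simp add: dd_simps smul_simps)
  with rlin_smul[OF s(1)] show ?thesis
    unfolding null_def by blast
qed

lemma null_mult_right: "null \<Gamma> p \<Longrightarrow> null \<Gamma> (p * q)"
  using null_mult[of \<Gamma> p q] by (simp add: mult.commute)

lemma null_0 [simp]: "null \<Gamma> 0"
  unfolding null_def by (rule exI[of _ "\<lambda>v. 0"]) (simp add: rlin_0 dd_simps smul_simps)

lemma null_uminus: "null \<Gamma> p \<Longrightarrow> null \<Gamma> (- p)"
  using null_mult[of \<Gamma> p "- 1"] by simp

lemma null_diff: "null \<Gamma> p \<Longrightarrow> null \<Gamma> q \<Longrightarrow> null \<Gamma> (p - q)"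
  using null_add[OF _ null_uminus, of \<Gamma> p q] by simp

lemma null_polar: "fits k \<eta> \<Longrightarrow> null \<Gamma> (polar (lvec \<Gamma> k) \<eta>)"
  unfolding null_def using dd_cl by (intro exI[of _ "cl k \<eta>"]) auto

text \<open>Pairing with a unit vector picks out the dual entry of the same Koszul pair.\<close>

lemma null_vec:
  assumes "k \<in> factors L" "i < 4"
  shows "null \<Gamma> (lvec \<Gamma> k i)"
proof (cases k)
  case (Inl c)
  have "fits k (quad a b c d)" for a b c d :: "'m mpoly"
    using assms Inl by (auto simp: fits_def)
  from null_polar[OF this, of \<Gamma>]
  have *: "null \<Gamma> (polar (lvec \<Gamma> k) (quad a b c d))" for a b c d .
  have "i = 0 \<or> i = 1 \<or> i = 2 \<or> i = 3" using assms by auto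
  then show ?thesis
    using *[of 1 0 0 0] *[of 0 1 0 0] *[of 0 0 1 0] *[of 0 0 0 1] by (auto simp: polar_def)
next
  case (Inr a)
  have "fits k (quad a b 0 0)" for a b :: "'m mpoly"
    using assms Inr by (auto simp: fits_def)
  from null_polar[OF this, of \<Gamma>]
  have *: "null \<Gamma> (polar (lvec \<Gamma> k) (quad a b 0 0))" for a b .
  have "i = 0 \<or> i = 1 \<or> i = 2 \<or> i = 3" using assms by auto
  then show ?thesis
    using *[of 1 0] *[of 0 1] Inr by (auto simp: polar_def lvec_def)
qed

text \<open>The derivative of a quadratic form along a family of vectors is its polar form with the
  derivative of the family.\<close>

lemma pd_polar_vec:
  "polar (vec \<Gamma> k) (\<lambda>i. pd e (vec \<Gamma> k i)) = pd e (potential k)"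
  unfolding vec_potential[of \<Gamma>, symmetric] pd_add pd_mult polar_def by (simp add: algebra_simps)

lemma fits_pd_vec: "k \<in> factors L \<Longrightarrow> fits k (\<lambda>i. loc k (pd e (vec \<Gamma> k i)))"
  by (auto simp: fits_def)

lemma null_pd_potential:
  assumes "k \<in> factors L"
  shows "null \<Gamma> (loc k (pd e (potential k)))"
proof -
  have "polar (lvec \<Gamma> k) (\<lambda>i. loc k (pd e (vec \<Gamma> k i))) = loc k (pd e (potential k))"
    unfolding pd_polar_vec[of \<Gamma>, symmetric] by (simp add: polar_def lvec_def loc_simps)
  with null_polar[OF fits_pd_vec[OF assms, of e \<Gamma>], of \<Gamma>] show ?thesis by simp
qed

lemma pd_wt: "pd e (wt v) = (if v = e then of_nat (n + 1) * Var v ^ n - Const const else 0)"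
  unfolding wt_def pd_diff pd_mult pd_power pd_Var by simp

lemma pd_potential_in:
  assumes "(k, e) \<in> in_slots"
  shows "pd e (potential k) = of_nat (n + 1) * gvar e ^ n - Const const"
  using assms by (auto simp: in_slots_def pd_wt pd_add pd_diff)

text \<open>Differentiate the potential of the factor that the mark enters, at that end: up to the
  scalar \<open>n + 1\<close> this is the claimed polynomial.\<close>

lemma null_power: "null \<Gamma> (Var m ^ n - Const (\<beta> ^ n))"
proof -
  have "m \<in> (\<lambda>(k, e). mark k e) ` in_slots" using in_slots_bij by (simp add: bij_betw_def)
  then obtain k e where ke: "(k, e) \<in> in_slots" "mark k e = m" by auto
  have k: "k \<in> factors L" using ke slots_factors by auto
  have "null \<Gamma> (of_nat (n + 1) * Var m ^ n - Const const)"
    using null_pd_potential[OF k, of \<Gamma> e] ke(2)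
    unfolding pd_potential_in[OF ke(1)] by (simp add: loc_simps)
  from null_mult[OF this, of "Const (1 / of_nat (n + 1))"]
  have "null \<Gamma> (Const (1 / of_nat (n + 1)) * (Const (of_nat (n + 1)) * Var m ^ n - Const const))"
    unfolding Const_of_nat .
  also have "Const (1 / of_nat (n + 1)) * (Const (of_nat (n + 1)) * Var m ^ n - Const const) = Var m ^ n - Const (\<beta> ^ n)"
    unfolding right_diff_distrib mult.assoc[symmetric] Const_mult[symmetric] const_def
    by (simp del: of_nat_Suc of_nat_add)
  finally show ?thesis .
qed

subsection \<open>Idempotents\<close>

definition rts :: "complex set" where "rts = {\<epsilon>. \<epsilon> ^ n = \<beta> ^ n}"

lemma rts_nonzero: "\<epsilon> \<in> rts \<Longrightarrow> \<epsilon> \<noteq> 0"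
  using \<beta> n by (auto simp: rts_def power_0_left)

lemma finite_rts [simp]: "finite rts" and card_rts: "card rts = n"
proof -
  show "card rts = n" unfolding rts_def using \<beta> n by (intro card_nth_roots) auto
  then show "finite rts" using n by (metis card.infinite not_numeral_le_zero)
qed

text \<open>Lagrange interpolation on \<open>rts\<close>: the value is \<open>1\<close> at \<open>\<epsilon>\<close> and \<open>0\<close> at the other roots.\<close>

definition lag :: "complex \<Rightarrow> 'v mpoly \<Rightarrow> 'v mpoly" where
  "lag \<epsilon> x = Const (1 / of_nat n) * (\<Sum>i<n. Const ((1 / \<epsilon>) ^ i) * x ^ i)"

lemma lag_mult:
  assumes "\<epsilon> \<in> rts"
  shows "(x - Const \<epsilon>) * lag \<epsilon> x = Const (1 / of_nat n / \<epsilon> ^ (n - 1)) * (x ^ n - Const (\<beta> ^ n))"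
proof -
  obtain k where k: "n = Suc k" using n by (cases n) auto
  have nz: "\<epsilon> \<noteq> 0" using rts_nonzero assms by auto
  have "(\<Sum>i<n. Const ((1 / \<epsilon>) ^ i) * x ^ i) = Const (1 / \<epsilon> ^ k) * (\<Sum>i<Suc k. x ^ i * Const \<epsilon> ^ (k - i))"
    unfolding sum_distrib_left k
  proof (rule sum.cong[OF refl])
    fix i assume "i \<in> {..<Suc k}"
    then have "(1 / \<epsilon>) ^ i = 1 / \<epsilon> ^ k * \<epsilon> ^ (k - i)"
      using nz by (simp add: power_one_over power_diff field_simps)
    then show "Const ((1 / \<epsilon>) ^ i) * x ^ i = Const (1 / \<epsilon> ^ k) * (x ^ i * Const \<epsilon> ^ (k - i))"
      by (simp only: Const_mult Const_power mult_ac)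
  qed
  then have "(x - Const \<epsilon>) * lag \<epsilon> x = Const (1 / of_nat n) * (Const (1 / \<epsilon> ^ k) * ((x - Const \<epsilon>) * (\<Sum>i<Suc k. x ^ i * Const \<epsilon> ^ (k - i))))"
    by (simp only: lag_def mult_ac)
  also have "\<dots> = Const (1 / of_nat n) * (Const (1 / \<epsilon> ^ k) * (x ^ Suc k - Const \<epsilon> ^ Suc k))"
    by (simp only: diff_power_eq_sum)
  also have "Const \<epsilon> ^ Suc k = Const (\<beta> ^ n)"
    using assms unfolding Const_power[symmetric] k[symmetric] by (simp add: rts_def)
  also have "Const (1 / of_nat n) * (Const (1 / \<epsilon> ^ k) * (x ^ Suc k - Const (\<beta> ^ n))) =
      Const (1 / of_nat n * (1 / \<epsilon> ^ k)) * (x ^ Suc k - Const (\<beta> ^ n))"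
    by (simp only: Const_mult mult.assoc)
  finally show ?thesis by (simp add: k)
qed

lemma ev_lag:
  assumes "\<epsilon> \<in> rts" "\<delta> \<in> rts"
  shows "ev \<phi> (lag \<epsilon> (Const \<delta>)) = (if \<delta> = \<epsilon> then 1 else 0)"
proof (cases "\<delta> = \<epsilon>")
  case True
  then show ?thesis
    using rts_nonzero[OF assms(1)] n by (simp add: lag_def ev_simps power_one_over)
next
  case False
  have "ev \<phi> ((Const \<delta> - Const \<epsilon>) * lag \<epsilon> (Const \<delta>)) = 0"
    unfolding lag_mult[OF assms(1)] using assms(2) by (simp add: ev_simps rts_def)
  with False show ?thesis by (simp add: ev_simps)
qed

text \<open>For \<open>0 < i < n\<close> the sum of the powers \<open>(1 / \<epsilon>) ^ i\<close>
  vanishes, since multiplying the roots by a primitive root of unity permutes them but rescales the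
  sum by a factor other than 1.\<close>

lemma sum_lag: "(\<Sum>\<epsilon>\<in>rts. lag \<epsilon> x) = 1"
proof -
  have pw: "(\<Sum>\<epsilon>\<in>rts. (1 / \<epsilon>) ^ i) = (if i = 0 then of_nat n else 0)" if "i < n" for i
  proof (cases "i = 0")
    case False
    define \<omega> where "\<omega> = cis (2 * pi / real n)"
    have wn: "\<omega> ^ n = 1" using n by (simp add: \<omega>_def DeMoivre)
    have wi: "\<omega> ^ i \<noteq> 1"
    proof
      assume "\<omega> ^ i = 1"
      then have "cis (2 * pi * real i / real n) = 1" by (simp add: \<omega>_def DeMoivre mult_ac)
      then have "cos (2 * pi * real i / real n) = 1" by (simp add: complex_eq_iff)
      then obtain k :: int where "2 * pi * real i / real n = 2 * pi * of_int k"
        by (auto simp: cos_one_2pi_int)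
      then have "real i = of_int (int n * k)" using n by (simp add: field_simps)
      then have *: "int i = int n * k" by linarith
      have "0 < k" using * False n by (metis mult_eq_0_iff of_nat_0_less_iff not_gr0 zero_less_mult_pos zero_less_imp_eq_int of_nat_eq_0_iff gr0I less_le_trans zero_less_numeral)
      then have "int n \<le> int n * k" by (simp add: mult_le_cancel_left1)
      then show False using * that by linarith
    qed
    have nz: "\<omega> \<noteq> 0" by (simp add: \<omega>_def)
    have "bij_betw (\<lambda>\<epsilon>. \<epsilon> / \<omega>) rts rts"
      by (rule bij_betw_byWitness[where f' = "\<lambda>\<epsilon>. \<epsilon> * \<omega>"])
         (auto simp: rts_def power_divide power_mult_distrib wn nz)
    from sum.reindex_bij_betw[OF this, of "\<lambda>\<epsilon>. (1 / \<epsilon>) ^ i"]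
    have "\<omega> ^ i * (\<Sum>\<epsilon>\<in>rts. (1 / \<epsilon>) ^ i) = (\<Sum>\<epsilon>\<in>rts. (1 / \<epsilon>) ^ i)"
      by (simp add: sum_distrib_left power_divide)
    with wi have "(\<Sum>\<epsilon>\<in>rts. (1 / \<epsilon>) ^ i) = 0" by simp
    with False show ?thesis by simp
  qed (simp add: card_rts)
  have "(\<Sum>\<epsilon>\<in>rts. lag \<epsilon> x) = Const (1 / of_nat n) * (\<Sum>i<n. Const (\<Sum>\<epsilon>\<in>rts. (1 / \<epsilon>) ^ i) * x ^ i)"
    unfolding lag_def sum_distrib_left[symmetric] Const_sum sum_distrib_right by (subst sum.swap) simp
  also have "\<dots> = Const (1 / of_nat n) * (\<Sum>i<n. if i = 0 then Const (of_nat n) else 0)"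
    by (rule arg_cong2[where f = "(*)"], simp, rule sum.cong) (auto simp: pw)
  also have "\<dots> = 1" using n by (simp flip: Const_mult)
  finally show ?thesis .
qed

text \<open>The interpolation polynomial of the indicator of one state among all states. It is
  idempotent only modulo null-homotopic polynomials.\<close>

definition idem :: "('m \<Rightarrow> complex) \<Rightarrow> 'm mpoly" where
  "idem \<phi> = (\<Prod>m\<in>UNIV. lag (\<phi> m) (Var m))"

definition states :: "('m \<Rightarrow> complex) set" where
  "states = (UNIV \<rightarrow>\<^sub>E rts)"

lemma states_iff: "\<phi> \<in> states \<longleftrightarrow> (\<forall>m. \<phi> m \<in> rts)"
  by (auto simp: states_def)

lemma finite_states [simp]: "finite states"
  unfolding states_def by (rule finite_PiE) auto

lemma sum_idem: "(\<Sum>\<phi>\<in>states. idem \<phi>) = 1"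
proof -
  have "(\<Sum>\<phi>\<in>states. idem \<phi>) = (\<Prod>m\<in>UNIV. \<Sum>\<epsilon>\<in>rts. lag \<epsilon> (Var m))"
    unfolding states_def idem_def by (rule prod_sum_PiE[symmetric]) auto
  then show ?thesis by (simp add: sum_lag)
qed

lemma ev_idem:
  assumes "\<phi> \<in> states" "\<psi> \<in> states"
  shows "ev \<psi> (idem \<phi>) = (if \<psi> = \<phi> then 1 else 0)"
proof -
  have "ev \<psi> (lag \<epsilon> (Var m)) = ev \<psi> (lag \<epsilon> (Const (\<psi> m)))" for \<epsilon> m
    by (simp add: lag_def ev_simps)
  then have "ev \<psi> (idem \<phi>) = (\<Prod>m\<in>UNIV. if \<psi> m = \<phi> m then 1 else 0)"
    using assms by (simp add: idem_def ev_simps ev_lag states_iff)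
  also have "\<dots> = (if \<psi> = \<phi> then 1 else 0)"
  proof (cases "\<psi> = \<phi>")
    case False
    then obtain m where "\<psi> m \<noteq> \<phi> m" by auto
    then have "(\<Prod>m\<in>UNIV. if \<psi> m = \<phi> m then 1 else 0) = (0 :: complex)"
      by (intro prod_zero) auto
    with False show ?thesis by simp
  qed simp
  finally show ?thesis .
qed

text \<open>On the summand cut out by \<open>idem \<phi>\<close> every polynomial acts as its value.
  For a variable this is \<open>lag_mult\<close>, and it passes to sums and products because null
  polynomials form an ideal.\<close>

lemma null_idem:
  assumes "\<phi> \<in> states"
  shows "null \<Gamma> ((p - Const (ev \<phi> p)) * idem \<phi>)"
proof (induction p rule: mpoly_induct)
  case (Var m)
  have "idem \<phi> = lag (\<phi> m) (Var m) * (\<Prod>m\<in>UNIV - {m}. lag (\<phi> m) (Var m))"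
    unfolding idem_def by (subst prod.remove[of _ m]) auto
  then have "(Var m - Const (\<phi> m)) * idem \<phi> =
      (Const (1 / of_nat n / \<phi> m ^ (n - 1)) * (Var m ^ n - Const (\<beta> ^ n))) * (\<Prod>m\<in>UNIV - {m}. lag (\<phi> m) (Var m))"
    using lag_mult[of "\<phi> m" "Var m"] assms by (simp add: states_iff mult.assoc[symmetric])
  then show ?case by (simp only: ev_Var) (intro null_mult_right null_mult null_power)
next
  case (add p q)
  from null_add[OF add] show ?case by (simp add: ev_simps Const_add algebra_simps)
next
  case (mult p q)
  have "(p * q - Const (ev \<phi> (p * q))) * idem \<phi> =
      q * ((p - Const (ev \<phi> p)) * idem \<phi>) + Const (ev \<phi> p) * ((q - Const (ev \<phi> q)) * idem \<phi>)"
    by (simp add: ev_simps Const_mult algebra_simps)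
  then show ?case by (simp only:) (intro null_add null_mult mult)
qed simp

text \<open>On this summand \<open>p\<close> acts both as zero and as the nonzero scalar
  \<open>ev \<phi> p\<close>.\<close>

lemma null_idem_nonadmissible:
  assumes "\<phi> \<in> states" "null \<Gamma> p" "ev \<phi> p \<noteq> 0"
  shows "null \<Gamma> (idem \<phi>)"
proof -
  have "null \<Gamma> (Const (1 / ev \<phi> p) * (idem \<phi> * p - (p - Const (ev \<phi> p)) * idem \<phi>))"
    by (intro null_mult null_diff null_mult[OF assms(2)] null_idem assms)
  also have "Const (1 / ev \<phi> p) * (idem \<phi> * p - (p - Const (ev \<phi> p)) * idem \<phi>) =
      Const (1 / ev \<phi> p * ev \<phi> p) * idem \<phi>"
    by (simp only: Const_mult) (simp add: algebra_simps)
  finally show ?thesis using assms(3) by simp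
qed

end

context gornik
begin

subsection \<open>Specializing variables one at a time\<close>

text \<open>The quotient by the ideal of all \<open>Var m - \<phi> m\<close> with \<open>m\<close>
  in \<open>S\<close>, realized as the image of a substitution so that all specializations share one
  type of chains.\<close>

definition rho :: "('m \<Rightarrow> complex) \<Rightarrow> 'm set \<Rightarrow> 'm mpoly \<Rightarrow> 'm mpoly" where
  "rho \<phi> S = subst (\<lambda>m. if m \<in> S then Const (\<phi> m) else Var m)"

lemma rho_simps:
  "rho \<phi> S (p + q) = rho \<phi> S p + rho \<phi> S q" "rho \<phi> S (p * q) = rho \<phi> S p * rho \<phi> S q"
  "rho \<phi> S (- p) = - rho \<phi> S p" "rho \<phi> S (p - q) = rho \<phi> S p - rho \<phi> S q"
  "rho \<phi> S (sum f A) = (\<Sum>a\<in>A. rho \<phi> S (f a))"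
  unfolding rho_def by (rule subst_simps)+

lemma rho_basic [simp]: "rho \<phi> S (Const a) = Const a" "rho \<phi> S 0 = 0" "rho \<phi> S 1 = 1"
  "rho \<phi> S (Var m) = (if m \<in> S then Const (\<phi> m) else Var m)" "rho \<phi> {} p = p"
  by (simp_all add: rho_def)

lemma rho_UNIV: "rho \<phi> UNIV p = Const (ev \<phi> p)"
  by (simp add: rho_def subst_eq_Const_ev)

lemma rho_rho: "rho \<phi> S (rho \<phi> T p) = rho \<phi> (S \<union> T) p"
  unfolding rho_def subst_subst by (rule arg_cong[where f = "\<lambda>f. subst f p"]) auto

definition rv :: "('m \<Rightarrow> complex) \<Rightarrow> 'm set \<Rightarrow> ('c, 'm) chain \<Rightarrow> ('c, 'm) chain" where
  "rv \<phi> S v = (\<lambda>G. rho \<phi> S (v G))"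

lemma rv_simps: "rv \<phi> S (v + w) = rv \<phi> S v + rv \<phi> S w" "rv \<phi> S (v - w) = rv \<phi> S v - rv \<phi> S w"
  "rv \<phi> S (- v) = - rv \<phi> S v" "rv \<phi> S (smul p v) = smul (rho \<phi> S p) (rv \<phi> S v)" "rv \<phi> S 0 = 0" "rv \<phi> {} v = v"
  by (simp_all add: rv_def smul_def fun_eq_iff rho_simps)

lemma rv_rv: "rv \<phi> S (rv \<phi> T v) = rv \<phi> (S \<union> T) v"
  by (simp add: rv_def rho_rho)

lemma rv_0_mono: "rv \<phi> T v = 0 \<Longrightarrow> rv \<phi> (S \<union> T) v = 0"
  by (simp add: rv_rv[symmetric] rv_simps)

lemma rv_eq_mono: "rv \<phi> T v = rv \<phi> T w \<Longrightarrow> rv \<phi> (S \<union> T) v = rv \<phi> (S \<union> T) w"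
  by (simp add: rv_rv[symmetric])

definition delta :: "('c, 'm) gen \<Rightarrow> ('c, 'm) chain" where
  "delta G = (\<lambda>G'. if G' = G then 1 else 0)"

lemma supported_expand:
  assumes "v \<in> supported"
  shows "v = (\<Sum>G\<in>generators L. smul (v G) (delta G))"
proof
  fix G'
  have "(\<Sum>G\<in>generators L. smul (v G) (delta G)) G' = (\<Sum>G\<in>generators L. if G' = G then v G else 0)"
    unfolding sum_fun_apply by (rule sum.cong) (auto simp: smul_def delta_def)
  also have "\<dots> = v G'"
    using assms by (auto simp: supported_def)
  finally show "v G' = (\<Sum>G\<in>generators L. smul (v G) (delta G)) G'" by simp
qed

lemma rv_rlin:
  assumes "rlin s" "v \<in> supported" "rv \<phi> S v = 0"
  shows "rv \<phi> S (s v) = 0"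
proof
  fix G'
  have v: "rho \<phi> S (v G) = 0" for G using assms(3) by (simp add: rv_def fun_eq_iff)
  have "s v = (\<Sum>G\<in>generators L. smul (v G) (s (delta G)))"
    by (subst supported_expand[OF assms(2)]) (simp add: rlin_sum[OF assms(1)] rlinD[OF assms(1)])
  then have "s v G' = (\<Sum>G\<in>generators L. v G * s (delta G) G')"
    by (simp add: sum_fun_apply smul_def)
  then show "rv \<phi> S (s v) G' = 0 G'" by (simp add: rv_def rho_simps v)
qed

lemma rv_rlin_cong:
  assumes "rlin s" "v \<in> supported" "w \<in> supported" "rv \<phi> S v = rv \<phi> S w"
  shows "rv \<phi> S (s v) = rv \<phi> S (s w)"
proof -
  have "rv \<phi> S (s (v - w)) = 0"
    by (rule rv_rlin[OF assms(1)]) (use assms in \<open>auto simp: rv_simps\<close>)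
  then show ?thesis by (simp add: rlinD[OF assms(1)] rv_simps)
qed

text \<open>The remainder theorem, applied to every coefficient after the variables in
  \<open>S\<close> have been set.\<close>

lemma rv_factor:
  assumes "v \<in> supported" "rv \<phi> (insert m S) v = 0" "m \<notin> S"
  shows "\<exists>w\<in>supported. rv \<phi> S v = rv \<phi> S (smul (Var m - Const (\<phi> m)) w)"
proof -
  have "\<exists>q. rho \<phi> S (v G) = (Var m - Const (\<phi> m)) * q" for G
  proof -
    have 0: "rho \<phi> {m} (rho \<phi> S (v G)) = 0"
      using fun_cong[OF assms(2), of G] by (simp add: rv_def rho_rho)
    have "Var m - Const (\<phi> m) dvd subst Var (rho \<phi> S (v G)) - rho \<phi> {m} (rho \<phi> S (v G))"
      unfolding rho_def[of _ "{m}"] by (rule dvd_subst_diff) auto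
    then show ?thesis unfolding 0 by (auto elim: dvdE)
  qed
  then obtain q where q: "\<And>G. rho \<phi> S (v G) = (Var m - Const (\<phi> m)) * q G" by metis
  define w where "w G = (if G \<in> generators L then q G else 0)" for G
  have "rho \<phi> S (v G) = rho \<phi> S ((Var m - Const (\<phi> m)) * w G)" for G
  proof (cases "G \<in> generators L")
    case True
    have "rho \<phi> S (v G) = rho \<phi> S (rho \<phi> S (v G))" by (simp add: rho_rho)
    then show ?thesis using True by (simp add: q w_def)
  next
    case False
    then have "v G = 0" using assms(1) by (auto simp: supported_def)
    with False show ?thesis by (simp add: w_def)
  qed
  then show ?thesis
    by (intro bexI[of _ w]) (auto simp: rv_def smul_def supported_def w_def)
qed

text \<open>\<open>Var m - \<phi> m\<close> is not a zero divisor after setting variables other than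
  \<open>m\<close>: the factors form a regular sequence.\<close>

lemma rv_regular:
  assumes "rv \<phi> S (smul (Var m - Const (\<phi> m)) w) = 0" "m \<notin> S"
  shows "rv \<phi> S w = 0"
proof -
  have "Var m - Const (\<phi> m) \<noteq> (0 :: 'm mpoly)"
    by (rule mpoly_neq_0_ev[of "\<lambda>_. \<phi> m + 1"]) (simp add: ev_simps)
  then show ?thesis
    using assms by (auto simp: rv_def smul_def fun_eq_iff rho_simps)
qed

lemma card_marks: "card (UNIV :: 'm set) = card (arcs L) + 2 * card (crossings L)"
  using bij_betw_same_card[OF in_bij] by (simp add: card_Plus finite_crossings card_cartesian_product)

lemma card_generators: "card (generators L) = 2 ^ card (UNIV :: 'm set)"
proof -
  have "card (generators L) = (\<Prod>k\<in>factors L. card (local_gens k))"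
    unfolding generators_def by (rule card_PiE) simp
  also have "\<dots> = (\<Prod>c\<in>crossings L. 4) * (\<Prod>a\<in>arcs L. 2)"
  proof -
    have "card (local_gens (Inl c :: ('c, 'm) factor)) = 4" for c by (simp add: card_cartesian_product flip: UNIV_Times_UNIV)
    moreover have "card (local_gens (Inr a :: ('c, 'm) factor)) = 2" for a by simp
    ultimately show ?thesis
      unfolding factors_def by (subst prod.Plus) (simp_all add: finite_crossings del: local_gens.simps)
  qed
  also have "\<dots> = 2 ^ card (UNIV :: 'm set)"
    by (simp add: card_marks power_add power_mult)
  finally show ?thesis .
qed

context
  fixes \<Gamma> :: "'c set" and \<phi> :: "'m \<Rightarrow> complex"
  assumes \<phi>: "\<phi> \<in> states"
begin

text \<open>
  Setting \<open>x\<^sub>m = \<phi> m\<close> for one more mark \<open>m\<close> is passing to the cone of a null-homotopic map, so it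
  doubles the dimension. Once all variables are set, the differential vanishes and the dimension is the
  number of generators, which is \<open>2\<close> to the number of marks; so it was \<open>1\<close> at the start.
\<close>

definition cyc :: "'m set \<Rightarrow> ('c, 'm) chain set" where
  "cyc S = {v \<in> supported. rv \<phi> S (dd \<Gamma> v) = 0}"

definition bnd :: "'m set \<Rightarrow> ('c, 'm) chain set" where
  "bnd S = {v \<in> supported. \<exists>y\<in>supported. rv \<phi> S v = rv \<phi> S (dd \<Gamma> y)}"

abbreviation "eproj \<equiv> idem \<phi>"
abbreviation "tvar m \<equiv> Var m - Const (\<phi> m)"

lemma cyc_intros:
  "v \<in> cyc S \<Longrightarrow> w \<in> cyc S \<Longrightarrow> v + w \<in> cyc S" "v \<in> cyc S \<Longrightarrow> smul p v \<in> cyc S" "0 \<in> cyc S"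
  by (auto simp: cyc_def dd_simps rv_simps smul_simps)

lemma cyc_sum: "(\<And>a. a \<in> A \<Longrightarrow> f a \<in> cyc S) \<Longrightarrow> sum f A \<in> cyc S"
  by (induction A rule: infinite_finite_induct) (auto intro: cyc_intros)

lemma bnd_intros:
  "v \<in> bnd S \<Longrightarrow> w \<in> bnd S \<Longrightarrow> v + w \<in> bnd S" "v \<in> bnd S \<Longrightarrow> smul p v \<in> bnd S" "0 \<in> bnd S"
proof -
  assume "v \<in> bnd S" "w \<in> bnd S"
  then obtain y z where "v \<in> supported" "w \<in> supported" "y \<in> supported" "z \<in> supported"
    "rv \<phi> S v = rv \<phi> S (dd \<Gamma> y)" "rv \<phi> S w = rv \<phi> S (dd \<Gamma> z)" by (auto simp: bnd_def)
  then show "v + w \<in> bnd S"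
    by (auto simp: bnd_def dd_simps rv_simps intro!: bexI[of _ "y + z"])
next
  assume "v \<in> bnd S"
  then obtain y where "v \<in> supported" "y \<in> supported"
    "rv \<phi> S v = rv \<phi> S (dd \<Gamma> y)" by (auto simp: bnd_def)
  then show "smul p v \<in> bnd S"
    by (auto simp: bnd_def dd_simps rv_simps intro!: bexI[of _ "smul p y"])
next
  show "0 \<in> bnd S" by (auto simp: bnd_def dd_simps rv_simps intro!: bexI[of _ 0])
qed

lemma bnd_diff: "v \<in> bnd S \<Longrightarrow> w \<in> bnd S \<Longrightarrow> v - w \<in> bnd S"
  using bnd_intros(1)[OF _ bnd_intros(2)[of w S "- 1"], of v] by (simp add: smul_simps)

lemma bnd_cong: "v \<in> bnd S \<Longrightarrow> w \<in> supported \<Longrightarrow> rv \<phi> S v = rv \<phi> S w \<Longrightarrow> w \<in> bnd S"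
  by (auto simp: bnd_def)

lemma null_cyc:
  assumes "null \<Gamma> p" "v \<in> cyc S"
  shows "smul p v \<in> bnd S"
proof -
  from assms(1) obtain s where s: "rlin s" "\<And>v. v \<in> supported \<Longrightarrow> dd \<Gamma> (s v) + s (dd \<Gamma> v) = smul p v"
    unfolding null_def by auto
  have v: "v \<in> supported" "rv \<phi> S (dd \<Gamma> v) = 0" using assms(2) by (auto simp: cyc_def)
  have "rv \<phi> S (s (dd \<Gamma> v)) = 0" by (rule rv_rlin[OF s(1) _ v(2)]) (simp add: dd_simps)
  then have "rv \<phi> S (smul p v) = rv \<phi> S (dd \<Gamma> (s v))"
    unfolding s(2)[OF v(1), symmetric] by (simp add: rv_simps)
  then show ?thesis using v rlinD(3)[OF s(1)] by (auto simp: bnd_def)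
qed

lemma null_t: "null \<Gamma> (tvar m * eproj)"
  using null_idem[OF \<phi>, of \<Gamma> "Var m"] by simp

lemma idem_idem:
  assumes "v \<in> cyc S" "smul eproj (smul eproj v) \<in> bnd S"
  shows "smul eproj v \<in> bnd S"
proof -
  have "null \<Gamma> ((eproj - 1) * eproj)" using null_idem[OF \<phi>, of \<Gamma> eproj] \<phi> by (simp add: ev_idem)
  from bnd_diff[OF assms(2) null_cyc[OF this assms(1)]]
  show ?thesis by (simp add: smul_simps algebra_simps)
qed

lemma cyc_insert: "cyc S \<subseteq> cyc (insert m S)"
  using rv_0_mono[of \<phi> S _ "{m}"] by (auto simp: cyc_def)

lemma bnd_insert: "bnd S \<subseteq> bnd (insert m S)"
proof
  fix v assume "v \<in> bnd S"
  then obtain y where y: "v \<in> supported" "y \<in> supported" "rv \<phi> S v = rv \<phi> S (dd \<Gamma> y)"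
    by (auto simp: bnd_def)
  have "rv \<phi> ({m} \<union> S) v = rv \<phi> ({m} \<union> S) (dd \<Gamma> y)" by (rule rv_eq_mono[OF y(3)])
  with y show "v \<in> bnd (insert m S)" by (auto simp: bnd_def)
qed

text \<open>The square of the differential is zero, so \<open>tvar m\<close> times the differential
  of \<open>u\<close> vanishes over \<open>S\<close>, and \<open>tvar m\<close> can be
  cancelled.\<close>

lemma dd_t:
  assumes "v \<in> supported" "u \<in> supported" "rv \<phi> S (dd \<Gamma> v) = rv \<phi> S (smul (tvar m) u)" "m \<notin> S"
  shows "u \<in> cyc S"
proof -
  have "rv \<phi> S (dd \<Gamma> (smul (tvar m) u)) = rv \<phi> S (dd \<Gamma> (dd \<Gamma> v))"
    by (rule rv_rlin_cong) (use assms in \<open>auto simp: dd_simps\<close>)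
  then have "rv \<phi> S (smul (tvar m) (dd \<Gamma> u)) = 0"
    using assms by (simp add: dd_dd dd_simps rv_simps)
  then show ?thesis using rv_regular assms by (auto simp: cyc_def)
qed

lemma bnd_insertE:
  assumes "v \<in> bnd (insert m S)" "m \<notin> S"
  obtains y u where "y \<in> supported" "u \<in> supported" "rv \<phi> S v = rv \<phi> S (dd \<Gamma> y + smul (tvar m) u)"
proof -
  from assms obtain y where y: "v \<in> supported" "y \<in> supported" "rv \<phi> (insert m S) v = rv \<phi> (insert m S) (dd \<Gamma> y)"
    by (auto simp: bnd_def)
  then have "rv \<phi> (insert m S) (v - dd \<Gamma> y) = 0" by (simp add: rv_simps)
  from rv_factor[OF _ this assms(2)] y obtain u where "u \<in> supported"
    "rv \<phi> S (v - dd \<Gamma> y) = rv \<phi> S (smul (tvar m) u)" by (auto simp: dd_simps)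
  with y show thesis by (intro that[of y u]) (auto simp: rv_simps algebra_simps)
qed

text \<open>A boundary over \<open>insert m S\<close> is over \<open>S\<close> a boundary plus
  \<open>tvar m\<close> times some \<open>u\<close>. Here \<open>u\<close> is a cycle because
  \<open>tvar m\<close> is regular, and \<open>tvar m * eproj\<close> is null-homotopic.\<close>

lemma bnd_insert_injective:
  assumes "m \<notin> S" "v \<in> cyc S" "v \<in> bnd (insert m S)"
  shows "smul eproj v \<in> bnd S"
proof -
  from assms(3,1) obtain y u where y: "y \<in> supported" "u \<in> supported"
    "rv \<phi> S v = rv \<phi> S (dd \<Gamma> y + smul (tvar m) u)" by (rule bnd_insertE)
  have "rv \<phi> S (dd \<Gamma> v) = rv \<phi> S (dd \<Gamma> (dd \<Gamma> y + smul (tvar m) u))"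
    by (rule rv_rlin_cong[OF rlin_dd _ _ y(3)]) (use assms y in \<open>auto simp: cyc_def dd_simps\<close>)
  then have "rv \<phi> S (dd \<Gamma> 0) = rv \<phi> S (smul (tvar m) (dd \<Gamma> u))"
    using assms(2) y by (simp add: cyc_def dd_simps dd_dd rv_simps)
  then have "rv \<phi> S (dd \<Gamma> u) = 0" using rv_regular assms(1) by (simp add: dd_simps rv_simps)
  then have "u \<in> cyc S" using y by (simp add: cyc_def)
  from null_cyc[OF null_t this, of m] have "smul eproj (smul (tvar m) u) \<in> bnd S"
    by (simp only: smul_simps(3) mult.commute)
  moreover have "dd \<Gamma> y + 0 \<in> bnd S" using y by (auto simp: bnd_def dd_simps)
  then have "smul eproj (dd \<Gamma> y) \<in> bnd S" by (auto intro: bnd_intros)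
  ultimately have "smul eproj (dd \<Gamma> y) + smul eproj (smul (tvar m) u) \<in> bnd S" by (rule bnd_intros(1)[rotated])
  then show ?thesis
    by (rule bnd_cong) (use assms y in \<open>auto simp: cyc_def rv_simps rho_simps smul_simps\<close>)
qed

lemma bnd_injective:
  assumes "v \<in> cyc {}" "v \<in> bnd UNIV"
  shows "smul eproj v \<in> bnd {}"
proof -
  have "v \<in> bnd S \<Longrightarrow> v \<in> cyc {} \<Longrightarrow> smul eproj v \<in> bnd {}" if "finite S" for S v
    using that
  proof (induction S arbitrary: v rule: finite_induct)
    case empty
    then show ?case by (auto intro: bnd_intros)
  next
    case (insert m S)
    have "cyc {} \<subseteq> cyc S" using rv_0_mono[of \<phi> "{}" _ S] by (auto simp: cyc_def)
    then have "smul eproj v \<in> bnd S"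
      using insert by (intro bnd_insert_injective[of m]) auto
    then have "smul eproj (smul eproj v) \<in> bnd {}"
      using insert by (intro insert.IH cyc_intros) auto
    then show ?case by (rule idem_idem[OF insert.prems(2)])
  qed
  from this[of UNIV v] assms show ?thesis by simp
qed

text \<open>If the summand is acyclic over \<open>S\<close>, it is so over
  \<open>insert m S\<close>. The differential of \<open>v\<close> is \<open>tvar m\<close> times a
  cycle \<open>u\<close> over \<open>S\<close>; writing \<open>eproj\<close> times \<open>u\<close>
  as the boundary of \<open>y\<close> makes \<open>eproj\<close> times \<open>v\<close>, minus
  \<open>tvar m\<close> times \<open>y\<close>, a cycle over \<open>S\<close>, and the correction
  dies when the variable \<open>m\<close> is set.\<close>

lemma nonvanishing_insert:
  assumes "m \<notin> S" "\<And>v. v \<in> cyc S \<Longrightarrow> smul eproj v \<in> bnd S" "v \<in> cyc (insert m S)"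
  shows "smul eproj v \<in> bnd (insert m S)"
proof -
  have v: "v \<in> supported" "rv \<phi> (insert m S) (dd \<Gamma> v) = 0" using assms by (auto simp: cyc_def)
  from rv_factor[OF _ v(2) assms(1)] obtain u where u: "u \<in> supported"
    "rv \<phi> S (dd \<Gamma> v) = rv \<phi> S (smul (tvar m) u)" by (auto simp: dd_simps)
  have "smul eproj u \<in> bnd S" using assms(2) dd_t[OF v(1) u assms(1)] by simp
  then obtain y where y: "y \<in> supported" "rv \<phi> S (smul eproj u) = rv \<phi> S (dd \<Gamma> y)" by (auto simp: bnd_def)
  define w where "w = smul eproj v - smul (tvar m) y"
  define T where "T = rho \<phi> S (tvar m)"
  have "rv \<phi> S (dd \<Gamma> w) = smul (rho \<phi> S eproj) (smul T (rv \<phi> S u)) - smul T (rv \<phi> S (dd \<Gamma> y))"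
    by (simp only: w_def dd_simps rv_simps u(2) T_def)
  also have "\<dots> = smul T (smul (rho \<phi> S eproj) (rv \<phi> S u) - rv \<phi> S (dd \<Gamma> y))"
    by (simp only: smul_simps mult.commute)
  also have "\<dots> = 0" using y(2) by (simp only: rv_simps smul_simps diff_self)
  finally have "w \<in> cyc S" using v y by (simp add: cyc_def w_def)
  then have "smul eproj w \<in> bnd S" by (rule assms(2))
  then have "smul eproj w \<in> bnd (insert m S)"
    using bnd_insert by blast
  then have "smul eproj (smul eproj v) \<in> bnd (insert m S)"
    by (rule bnd_cong) (use v in \<open>auto simp: w_def rv_simps rho_simps smul_simps\<close>)
  then show ?thesis by (rule idem_idem[OF assms(3)])
qed

definition indep :: "'m set \<Rightarrow> nat \<Rightarrow> (nat \<Rightarrow> ('c, 'm) chain) \<Rightarrow> bool" where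
  "indep S d f \<longleftrightarrow> (\<forall>j<d. f j \<in> cyc S) \<and>
     (\<forall>a. smul eproj (\<Sum>j<d. smul (Const (a j)) (f j)) \<in> bnd S \<longrightarrow> (\<forall>j<d. a j = 0))"

text \<open>The exact sequence of multiplication by \<open>tvar m\<close>, which is null on this
  summand. The old classes stay independent, and for a null-homotopy \<open>s\<close> of
  \<open>tvar m * eproj\<close> the chains \<open>s (f j)\<close> become cycles that the connecting
  map sends to the classes of the \<open>f j\<close>.\<close>

lemma indep_insert:
  assumes m: "m \<notin> S" and f: "indep S d f"
  shows "\<exists>f'. indep (insert m S) (2 * d) f'"
proof -
  have fc: "f j \<in> cyc S" if "j < d" for j using f that by (simp add: indep_def)
  have fi: "a j = 0" if "smul eproj (\<Sum>j<d. smul (Const (a j)) (f j)) \<in> bnd S" "j < d" for a j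
    using f that by (auto simp: indep_def)
  from null_t[of m] obtain s where s: "rlin s"
    "\<And>v. v \<in> supported \<Longrightarrow> dd \<Gamma> (s v) + s (dd \<Gamma> v) = smul (tvar m * eproj) v"
    unfolding null_def by auto
  have ds: "rv \<phi> S (dd \<Gamma> (s v)) = rv \<phi> S (smul (tvar m * eproj) v)" if "v \<in> cyc S" for v
  proof -
    have v: "v \<in> supported" "rv \<phi> S (dd \<Gamma> v) = 0" using that by (auto simp: cyc_def)
    have "rv \<phi> S (s (dd \<Gamma> v)) = 0" by (rule rv_rlin[OF s(1) _ v(2)]) (simp add: dd_simps)
    then show ?thesis unfolding s(2)[OF v(1), symmetric] by (simp add: rv_simps)
  qed
  define f' where "f' j = (if j < d then f j else s (f (j - d)))" for j
  have "f' j \<in> cyc (insert m S)" if "j < 2 * d" for j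
  proof (cases "j < d")
    case True
    then show ?thesis using fc cyc_insert by (auto simp: f'_def)
  next
    case False
    have "rv \<phi> (insert m S) (dd \<Gamma> (s (f (j - d)))) = rv \<phi> (insert m S) (smul (tvar m * eproj) (f (j - d)))"
      using rv_eq_mono[OF ds[OF fc], of "j - d" "{m}"] that False by simp
    also have "\<dots> = 0" by (simp add: rv_simps rho_simps smul_simps)
    finally show ?thesis using False rlinD(3)[OF s(1)] by (simp add: cyc_def f'_def)
  qed
  moreover have "\<forall>j<2 * d. a j = 0"
    if a: "smul eproj (\<Sum>j<2 * d. smul (Const (a j)) (f' j)) \<in> bnd (insert m S)" for a
  proof -
    define x where "x = (\<Sum>j<d. smul (Const (a j)) (f j))"
    define z where "z = (\<Sum>j<d. smul (Const (a (d + j))) (f j))"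
    have xz: "x \<in> cyc S" "z \<in> cyc S" unfolding x_def z_def by (auto intro!: cyc_sum cyc_intros fc)
    have sz: "s z = (\<Sum>j<d. smul (Const (a (d + j))) (s (f j)))"
      unfolding z_def rlin_sum[OF s(1)] rlinD[OF s(1)] ..
    have split: "{..<2 * d} = {..<d} \<union> {d..<2 * d}" by auto
    have "(\<Sum>j<2 * d. smul (Const (a j)) (f' j)) =
        (\<Sum>j<d. smul (Const (a j)) (f' j)) + (\<Sum>j\<in>{d..<2 * d}. smul (Const (a j)) (f' j))"
      unfolding split by (rule sum.union_disjoint) auto
    also have "(\<Sum>j<d. smul (Const (a j)) (f' j)) = x" by (simp add: f'_def x_def)
    also have "(\<Sum>j\<in>{d..<2 * d}. smul (Const (a j)) (f' j)) = s z"
      unfolding sz by (rule sum.reindex_bij_witness[where i = "\<lambda>j. d + j" and j = "\<lambda>j. j - d"]) (auto simp: f'_def)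
    finally have eq: "(\<Sum>j<2 * d. smul (Const (a j)) (f' j)) = x + s z" .
    have w: "smul eproj (x + s z) \<in> bnd (insert m S)" using a unfolding eq .
    have szs: "s z \<in> supported" "x \<in> supported" "z \<in> supported"
      using rlinD(3)[OF s(1)] xz by (auto simp: cyc_def)
    from w m obtain y u where yu: "y \<in> supported" "u \<in> supported"
      "rv \<phi> S (smul eproj (x + s z)) = rv \<phi> S (dd \<Gamma> y + smul (tvar m) u)" by (rule bnd_insertE)
    \<comment> \<open>Applying the differential and cancelling \<open>tvar m\<close> computes the
      connecting map; it isolates \<open>z\<close>, the combination of the old classes behind the
      new half of the family.\<close>
    have "rv \<phi> S (dd \<Gamma> (smul eproj (x + s z))) = rv \<phi> S (dd \<Gamma> (dd \<Gamma> y + smul (tvar m) u))"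
      by (rule rv_rlin_cong[OF rlin_dd _ _ yu(3)]) (use szs yu in \<open>auto simp: dd_simps\<close>)
    then have "rv \<phi> S (smul eproj (dd \<Gamma> (s z))) = rv \<phi> S (smul (tvar m) (dd \<Gamma> u))"
      using xz(1) yu by (simp add: dd_simps dd_dd rv_simps cyc_def smul_simps)
    then have "smul (rho \<phi> S (tvar m)) (rv \<phi> S (smul eproj (smul eproj z))) = smul (rho \<phi> S (tvar m)) (rv \<phi> S (dd \<Gamma> u))"
      unfolding rv_simps(4) ds[OF xz(2)] rho_simps(2) smul_simps(3) by (simp only: mult_ac)
    then have "rv \<phi> S (smul (tvar m) (smul eproj (smul eproj z) - dd \<Gamma> u)) = 0"
      by (simp only: rv_simps(2,4) smul_simps(9) diff_self)
    from rv_regular[OF this m] have "smul eproj (smul eproj z) \<in> bnd S"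
      using szs yu(2) by (auto simp: bnd_def rv_simps intro!: bexI[of _ u])
    from idem_idem[OF xz(2) this] have "smul eproj z \<in> bnd S" .
    then have a2: "a (d + j) = 0" if "j < d" for j using fi[of "\<lambda>j. a (d + j)" j] that by (simp add: z_def)
    then have "z = 0" unfolding z_def by (intro sum.neutral) (simp add: smul_simps)
    then have "smul eproj x \<in> bnd (insert m S)" using w by (simp add: rlinD[OF s(1)])
    then have "smul eproj (smul eproj x) \<in> bnd S"
      by (intro bnd_insert_injective[OF m] cyc_intros xz)
    from idem_idem[OF xz(1) this] have "smul eproj x \<in> bnd S" .
    then have a1: "a j = 0" if "j < d" for j using fi[of a j] that by (simp add: x_def)
    show ?thesis
    proof (intro allI impI)
      fix j assume "j < 2 * d"
      then show "a j = 0" using a1[of j] a2[of "j - d"] by (cases "j < d") auto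
    qed
  qed
  ultimately show ?thesis unfolding indep_def by blast
qed

lemma indep_finite:
  assumes "indep {} d f" "finite S"
  shows "\<exists>f'. indep S (2 ^ card S * d) f'"
  using assms(2)
proof (induction S rule: finite_induct)
  case empty
  then show ?case using assms(1) by auto
next
  case (insert m S)
  then obtain f' where "indep S (2 ^ card S * d) f'" by blast
  from indep_insert[OF insert.hyps(2) this] show ?case using insert.hyps by (simp add: mult.assoc)
qed

context
  assumes adm: "\<And>k i. k \<in> factors L \<Longrightarrow> ev \<phi> (lvec \<Gamma> k i) = 0"
begin

lemma rv_UNIV_cl:
  assumes "k \<in> factors L" "\<And>i. ev \<phi> (\<xi> i) = 0"
  shows "rv \<phi> UNIV (cl k \<xi> v) = 0"
proof -
  have "ev \<phi> (koszul \<xi> g h) = 0" for g h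
    using assms(2) by (auto simp: koszul_def odd_map_def entry_def Let_def ev_simps)
  then show ?thesis
    by (simp add: rv_def rho_UNIV cl_def odd_op_def fun_eq_iff ev_simps)
qed

lemma rv_UNIV_dd: "rv \<phi> UNIV (dd \<Gamma> v) = 0"
proof -
  have "rv \<phi> UNIV (sum f A) = (\<Sum>a\<in>A. rv \<phi> UNIV (f a))" for f :: "('c, 'm) factor \<Rightarrow> ('c, 'm) chain" and A
    by (simp add: rv_def fun_eq_iff sum_fun_apply rho_simps)
  then show ?thesis unfolding dd_def by (simp add: rv_UNIV_cl adm)
qed

lemma bnd_UNIV: "v \<in> bnd UNIV \<longleftrightarrow> v \<in> supported \<and> (\<forall>G. ev \<phi> (v G) = 0)"
proof -
  have "rv \<phi> UNIV v = 0 \<longleftrightarrow> (\<forall>G. ev \<phi> (v G) = 0)" by (simp add: rv_def rho_UNIV fun_eq_iff)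
  then show ?thesis unfolding bnd_def rv_UNIV_dd by auto
qed

text \<open>Vanishing would persist under setting variables one by one. With all of them set the
  differential is zero and the idempotent has value 1, so a single generator gives a
  contradiction.\<close>

lemma ex_nonvanishing: "\<exists>v\<in>cyc {}. smul eproj v \<notin> bnd {}"
proof (rule ccontr)
  assume *: "\<not> ?thesis"
  have "\<forall>v\<in>cyc S. smul eproj v \<in> bnd S" if "finite S" for S
    using that
  proof (induction S rule: finite_induct)
    case (insert m S)
    then show ?case using nonvanishing_insert[of m S] by blast
  qed (use * in auto)
  from this[of UNIV] have **: "\<And>v. v \<in> cyc UNIV \<Longrightarrow> smul eproj v \<in> bnd UNIV" by simp
  have "generators L \<noteq> {}" using card_generators by (metis card.empty power_not_zero zero_neq_numeral)
  then obtain G where G: "G \<in> generators L" by auto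
  have "delta G \<in> cyc UNIV"
    using G unfolding cyc_def rv_UNIV_dd by (auto simp: supported_def delta_def)
  from **[OF this] have "ev \<phi> (smul eproj (delta G) G) = 0" by (simp add: bnd_UNIV)
  then show False using \<phi> by (simp add: smul_def delta_def ev_idem)
qed

text \<open>A cycle whose coefficients all vanish at the state is a boundary once all variables are
  set, hence already before, up to the idempotent.\<close>

lemma cyc_ev_nonzero:
  assumes "v \<in> cyc {}" "smul eproj v \<notin> bnd {}"
  shows "\<exists>G. ev \<phi> (v G) \<noteq> 0"
  using assms bnd_injective[OF assms(1)] by (auto simp: bnd_UNIV cyc_def)

text \<open>Two independent classes would double with every variable that is set, to twice as many
  independent values at the state as there are generators.\<close>

lemma cyc_dependent:
  assumes "v \<in> cyc {}" "w \<in> cyc {}"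
  shows "\<exists>a b. (a \<noteq> 0 \<or> b \<noteq> 0) \<and> smul eproj (smul (Const a) v + smul (Const b) w) \<in> bnd {}"
proof (rule ccontr)
  assume neg: "\<not> ?thesis"
  define f where "f j = (if j = 0 then v else w)" for j :: nat
  have "indep {} 2 f"
    unfolding indep_def
  proof (intro conjI allI impI)
    fix a :: "nat \<Rightarrow> complex" and j :: nat
    assume "smul eproj (\<Sum>j<2. smul (Const (a j)) (f j)) \<in> bnd {}" "j < 2"
    then show "a j = 0" using neg[simplified, rule_format, of "a 0" "a 1"]
      by (auto simp: f_def numeral_2_eq_2 less_Suc_eq)
  qed (use assms in \<open>auto simp: f_def\<close>)
  \<comment> \<open>The family now has \<open>2 ^ (N + 1)\<close> members for \<open>N\<close>
    marks, against \<open>2 ^ N\<close> generators, so its values at the state are linearly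
    dependent.\<close>
  from indep_finite[OF this, of UNIV] obtain f' where f': "indep UNIV (2 ^ card (UNIV :: 'm set) * 2) f'" by auto
  let ?d = "2 ^ card (UNIV :: 'm set) * 2 :: nat"
  have "card (generators L) < card {..<?d}" by (simp add: card_generators)
  from linear_dependence[OF finite_generators finite_lessThan this, of "\<lambda>j G. ev \<phi> (f' j G)"]
  obtain a j where a: "j < ?d" "a j \<noteq> 0" "\<And>G. G \<in> generators L \<Longrightarrow> (\<Sum>j<?d. a j * ev \<phi> (f' j G)) = 0"
    by auto
  have sup: "f' j \<in> supported" if "j < ?d" for j using f' that by (auto simp: indep_def cyc_def)
  have "smul eproj (\<Sum>j<?d. smul (Const (a j)) (f' j)) \<in> bnd UNIV"
    unfolding bnd_UNIV
  proof (intro conjI allI)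
    show "smul eproj (\<Sum>j<?d. smul (Const (a j)) (f' j)) \<in> supported" using sup by auto
    fix G
    show "ev \<phi> (smul eproj (\<Sum>j<?d. smul (Const (a j)) (f' j)) G) = 0"
    proof (cases "G \<in> generators L")
      case True
      then show ?thesis using a(3)[OF True] by (simp add: smul_def sum_fun_apply ev_simps)
    next
      case False
      then have "f' j G = 0" if "j < ?d" for j using sup[OF that] by (auto simp: supported_def)
      then show ?thesis by (simp add: smul_def sum_fun_apply ev_simps)
    qed
  qed
  with f' a(1,2) show False unfolding indep_def by blast
qed

end

end

end

subsection \<open>The states that survive\<close>

context gornik
begin

definition val :: "('m \<Rightarrow> complex) \<Rightarrow> ('c, 'm) factor \<Rightarrow> nat mpoly \<Rightarrow> complex" where
  "val \<phi> k p = ev (\<lambda>e. \<phi> (mark k e)) p"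

lemma ev_loc: "ev \<phi> (loc k p) = val \<phi> k p"
  by (simp add: loc_def ev_subst val_def)

lemma val_simps:
  "val \<phi> k (p + q) = val \<phi> k p + val \<phi> k q" "val \<phi> k (p * q) = val \<phi> k p * val \<phi> k q"
  "val \<phi> k (- p) = - val \<phi> k p" "val \<phi> k (p - q) = val \<phi> k p - val \<phi> k q"
  "val \<phi> k (p ^ i) = val \<phi> k p ^ i" "val \<phi> k (of_nat i) = of_nat i"
  "val \<phi> k 0 = 0" "val \<phi> k 1 = 1" "val \<phi> k (Const a) = a" "val \<phi> k (Var e) = \<phi> (mark k e)"
  "val \<phi> k (sum f A) = (\<Sum>a\<in>A. val \<phi> k (f a))"
  by (simp_all add: val_def ev_simps)

lemma pd_of_nat [simp]: "pd i (of_nat k) = 0"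
  unfolding Const_of_nat[symmetric] by simp

lemma val_numeral [simp]: "val \<phi> k (numeral i) = numeral i"
  using val_simps(6)[of \<phi> k "numeral i"] by simp

lemma factors_iff [simp]: "Inl c \<in> factors L \<longleftrightarrow> c \<in> crossings L" "Inr a \<in> factors L \<longleftrightarrow> a \<in> arcs L"
  by (auto simp: factors_def)

lemma polar_pd_pd:
  "polar (\<lambda>i. pd e' (vec \<Gamma> k i)) (\<lambda>i. pd e (vec \<Gamma> k i)) + polar (vec \<Gamma> k) (\<lambda>i. pd e' (pd e (vec \<Gamma> k i)))
     = pd e' (pd e (potential k))"
  unfolding pd_polar_vec[of \<Gamma>, symmetric] polar_def pd_add pd_mult by (simp add: algebra_simps)

lemma pd_pi_at:
  "e \<noteq> i \<Longrightarrow> e \<noteq> j \<Longrightarrow> pd e (pi_at n (gvar i) (gvar j)) = 0"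
  by (simp add: pi_at_eq pd_sum pd_mult pd_power pd_Var del: sum.lessThan_Suc)

lemma val_pi_at:
  assumes "\<phi> \<in> states" "\<phi> (mark k i) = \<phi> (mark k j)"
  shows "val \<phi> k (pi_at n (gvar i) (gvar j) - Const const) = 0"
proof -
  define x where "x = \<phi> (mark k i)"
  have x: "x ^ n = \<beta> ^ n" using assms(1) by (simp add: x_def states_iff rts_def)
  have "(\<Sum>l<Suc n. x ^ l * x ^ (n - l)) = of_nat (n + 1) * x ^ n"
    by (simp add: less_Suc_eq_le flip: power_add)
  then show ?thesis
    using assms(2) x unfolding pi_at_eq val_simps by (simp add: const_def flip: x_def)
qed

lemma pd_diffs:
  "pd e sum_diff = (if e = 1 \<or> e = 2 then 1 else if e = 3 \<or> e = 4 then - 1 else 0)"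
  "pd 1 prod_diff = gvar 2" "pd (Suc 0) prod_diff = gvar 2" "pd 2 prod_diff = gvar 1" "pd 3 prod_diff = - gvar 4" "pd 4 prod_diff = - gvar 3"
  by (auto simp: sum_diff_def prod_diff_def pd_diff pd_add pd_mult pd_Var)

text \<open>First derivatives of the potential identity at the two incoming ends. Derivatives of
  \<open>u1\<close> and \<open>u2\<close> come multiplied by \<open>sum_diff\<close> or
  \<open>prod_diff\<close>, which vanish here.\<close>

lemma deriv_thick:
  fixes \<phi>
  assumes c: "c \<in> \<Gamma>" and eq: "val \<phi> (Inl c) sum_diff = 0" "val \<phi> (Inl c) prod_diff = 0"
  defines "x \<equiv> \<lambda>e. \<phi> (ends L c e)" and "u \<equiv> val \<phi> (Inl c) (u1_poly n) - const" and "w \<equiv> val \<phi> (Inl c) (u2_poly n)"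
  shows "u + x 2 * w = of_nat (n + 1) * x 1 ^ n - const" "u + x 1 * w = of_nat (n + 1) * x 2 ^ n - const"
  using arg_cong[OF pd_polar_vec[of \<Gamma> "Inl c" 1], of "val \<phi> (Inl c)"]
    arg_cong[OF pd_polar_vec[of \<Gamma> "Inl c" 2], of "val \<phi> (Inl c)"] eq c
  by (simp_all add: polar_def val_simps pd_diffs pd_wt pd_add pd_diff x_def u_def w_def mult.commute)

text \<open>Second derivatives where the two incoming values coincide. The mixed second derivative
  of the potential is zero, while that of \<open>prod_diff\<close> is 1 and brings in
  \<open>u2\<close>; the pure second derivatives eliminate the unknown first derivatives of
  \<open>u1\<close> and \<open>u2\<close>.\<close>

lemma deriv2_thick:
  assumes c: "c \<in> \<Gamma>" and eq: "\<And>i. i \<noteq> 2 \<Longrightarrow> val \<phi> (Inl c) (vec \<Gamma> (Inl c) i) = 0"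
    and x: "\<phi> (ends L c 1) = x" "\<phi> (ends L c 2) = x"
  shows "val \<phi> (Inl c) (u2_poly n) = - (of_nat (n + 1) * of_nat n * x ^ (n - 1))"
proof -
  define A1 A2 C1 C2 where "A1 = val \<phi> (Inl c) (pd 1 (u1_poly n))" and "A2 = val \<phi> (Inl c) (pd 2 (u1_poly n))"
    and "C1 = val \<phi> (Inl c) (pd 1 (u2_poly n))" and "C2 = val \<phi> (Inl c) (pd 2 (u2_poly n))"
  define R where "R = of_nat (n + 1) * of_nat n * x ^ (n - 1)"
  have v: "val \<phi> (Inl c) (u1_poly n) = const" "val \<phi> (Inl c) sum_diff = 0" "val \<phi> (Inl c) prod_diff = 0"
    using eq[of 0] eq[of 1] eq[of 3] c by (simp_all add: val_simps)
  note S = polar_def val_simps pd_diffs pd_wt pd_add pd_diff pd_mult pd_Var pd_power pd_uminus v x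
    A1_def[symmetric] A2_def[symmetric] C1_def[symmetric] C2_def[symmetric]
  have 11: "2 * (A1 + x * C1) = R"
    using arg_cong[OF polar_pd_pd[of 1 \<Gamma> "Inl c" 1], of "val \<phi> (Inl c)"] c
    by (simp add: S R_def algebra_simps del: One_nat_def)
  have 22: "2 * (A2 + x * C2) = R"
    using arg_cong[OF polar_pd_pd[of 2 \<Gamma> "Inl c" 2], of "val \<phi> (Inl c)"] c
    by (simp add: S R_def algebra_simps del: One_nat_def)
  have 12: "A1 + A2 + x * C1 + x * C2 + val \<phi> (Inl c) (u2_poly n) = 0"
    using arg_cong[OF polar_pd_pd[of 1 \<Gamma> "Inl c" 2], of "val \<phi> (Inl c)"] c
    by (simp add: S algebra_simps del: One_nat_def)
  have "2 * (val \<phi> (Inl c) (u2_poly n) + R) = 2 * (A1 + A2 + x * C1 + x * C2 + val \<phi> (Inl c) (u2_poly n))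
      + (R - 2 * (A1 + x * C1)) + (R - 2 * (A2 + x * C2))"
    by (simp add: algebra_simps)
  also have "\<dots> = 0" unfolding 11 22 12 by simp
  finally have "2 * (val \<phi> (Inl c) (u2_poly n) + R) = 0" .
  then have "val \<phi> (Inl c) (u2_poly n) + R = 0" unfolding mult_eq_0_iff by simp
  then show ?thesis unfolding R_def by (simp add: eq_neg_iff_add_eq_0)
qed

lemma null_val:
  assumes "k \<in> factors L" "i < 4" "\<phi> \<in> states" "val \<phi> k (vec \<Gamma> k i) \<noteq> 0"
  shows "null \<Gamma> (idem \<phi>)"
  using null_idem_nonadmissible[OF assms(3) null_vec[OF assms(1,2)]] assms(4)
  by (simp add: lvec_def ev_loc)

lemma not_null_arc:
  assumes "\<phi> \<in> states" "\<not> null \<Gamma> (idem \<phi>)" "a \<in> arcs L"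
  shows "\<phi> (fst a) = \<phi> (snd a)"
  using null_val[of "Inr a" 1 \<phi> \<Gamma>] assms by (force simp: val_simps)

lemma not_null_thin:
  assumes "\<phi> \<in> states" "\<not> null \<Gamma> (idem \<phi>)" "c \<in> crossings L" "c \<notin> \<Gamma>"
  shows "\<phi> (ends L c 1) = \<phi> (ends L c 3)" "\<phi> (ends L c 2) = \<phi> (ends L c 4)"
  using null_val[of "Inl c" 1 \<phi> \<Gamma>] null_val[of "Inl c" 3 \<phi> \<Gamma>] assms by (force simp: val_simps)+

lemma sum_prod_eq:
  fixes a b c d :: complex
  assumes "a + b = c + d" "a * b = c * d"
  shows "c = a \<and> d = b \<or> c = b \<and> d = a"
proof -
  have "(c - a) * (c - b) = c * c - (a + b) * c + a * b" by (simp add: algebra_simps)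
  also have "\<dots> = 0" unfolding assms by (simp add: algebra_simps)
  finally have "c = a \<or> c = b" by simp
  then show ?thesis using assms(1) by auto
qed

text \<open>Equal sums and products force the outgoing values to be the incoming ones in some order.
  Were the incoming values equal, \<open>deriv2_thick\<close> would give a nonzero value of
  \<open>u2\<close>, although every entry of the factorization vanishes at a surviving
  state.\<close>

lemma not_null_thick:
  assumes "\<phi> \<in> states" "\<not> null \<Gamma> (idem \<phi>)" "c \<in> crossings L" "c \<in> \<Gamma>"
  shows "\<phi> (ends L c 1) \<noteq> \<phi> (ends L c 2)"
    and "\<phi> (ends L c 3) = \<phi> (ends L c 1) \<and> \<phi> (ends L c 4) = \<phi> (ends L c 2) \<or>
      \<phi> (ends L c 3) = \<phi> (ends L c 2) \<and> \<phi> (ends L c 4) = \<phi> (ends L c 1)"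
proof -
  have k: "Inl c \<in> factors L" using assms(3) by simp
  have v: "val \<phi> (Inl c) (vec \<Gamma> (Inl c) i) = 0" for i
  proof (cases "i < 4")
    case True
    then show ?thesis using null_val[OF k, of i \<phi> \<Gamma>] assms by blast
  next
    case False
    then show ?thesis by (simp add: val_simps quad_def)
  qed
  from v[of 1] v[of 3] show "\<phi> (ends L c 3) = \<phi> (ends L c 1) \<and> \<phi> (ends L c 4) = \<phi> (ends L c 2) \<or>
      \<phi> (ends L c 3) = \<phi> (ends L c 2) \<and> \<phi> (ends L c 4) = \<phi> (ends L c 1)"
    using assms(4) by (intro sum_prod_eq) (auto simp: sum_diff_def prod_diff_def val_simps algebra_simps)
  show "\<phi> (ends L c 1) \<noteq> \<phi> (ends L c 2)"
  proof
    assume eq: "\<phi> (ends L c 1) = \<phi> (ends L c 2)"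
    have "0 = - (of_nat (n + 1) * of_nat n * \<phi> (ends L c 1) ^ (n - 1))"
      using deriv2_thick[OF assms(4) v refl eq[symmetric]] v[of 2] assms(4) by simp
    moreover have "\<phi> (ends L c 1) \<noteq> 0" using assms(1) rts_nonzero by (simp add: states_iff)
    moreover have "(of_nat (n + 1) :: complex) \<noteq> 0" "(of_nat n :: complex) \<noteq> 0"
      using n by (simp_all del: of_nat_Suc of_nat_add)
    ultimately show False by simp
  qed
qed

text \<open>
  For the states that are constant along the components of the link, a crossing of two strands of
  different value is resolved by a thick edge.
\<close>

definition resolved :: "'c set \<Rightarrow> ('m \<Rightarrow> complex) \<Rightarrow> bool" where
  "resolved \<Gamma> \<phi> \<longleftrightarrow> \<phi> \<in> states \<and> (\<forall>a\<in>arcs L. \<phi> (fst a) = \<phi> (snd a)) \<and>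
     (\<forall>c\<in>crossings L. \<phi> (ends L c 1) = \<phi> (ends L c 4) \<and> \<phi> (ends L c 2) = \<phi> (ends L c 3) \<and>
       (c \<in> \<Gamma> \<longleftrightarrow> \<phi> (ends L c 1) \<noteq> \<phi> (ends L c 2)))"

definition islot :: "'m \<Rightarrow> ('c, 'm) factor \<times> nat" where
  "islot m = (THE s. s \<in> in_slots \<and> (case s of (k, e) \<Rightarrow> mark k e) = m)"

definition oslot :: "'m \<Rightarrow> ('c, 'm) factor \<times> nat" where
  "oslot m = (THE s. s \<in> out_slots \<and> (case s of (k, e) \<Rightarrow> mark k e) = m)"

lemma slot_unique:
  assumes "bij_betw f S UNIV"
  shows "(THE s. s \<in> S \<and> f s = m) \<in> S" "f (THE s. s \<in> S \<and> f s = m) = m"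
proof -
  have "\<exists>!s. s \<in> S \<and> f s = m"
    using assms unfolding bij_betw_def inj_on_def by (metis UNIV_I imageE)
  from theI'[OF this] show "(THE s. s \<in> S \<and> f s = m) \<in> S" "f (THE s. s \<in> S \<and> f s = m) = m" by auto
qed

lemma islot: "islot m \<in> in_slots" "(case islot m of (k, e) \<Rightarrow> mark k e) = m"
  and oslot: "oslot m \<in> out_slots" "(case oslot m of (k, e) \<Rightarrow> mark k e) = m"
  unfolding islot_def oslot_def by (rule slot_unique in_slots_bij out_slots_bij)+

lemma islot_mark: "(k, e) \<in> in_slots \<Longrightarrow> islot (mark k e) = (k, e)"
  using islot[of "mark k e"] bij_betw_imp_inj_on[OF in_slots_bij]
  by (auto simp: inj_on_def split: prod.splits)

lemma oslot_mark: "(k, e) \<in> out_slots \<Longrightarrow> oslot (mark k e) = (k, e)"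
  using oslot[of "mark k e"] bij_betw_imp_inj_on[OF out_slots_bij]
  by (auto simp: inj_on_def split: prod.splits)

lemma islot_inj: "islot m = islot m' \<Longrightarrow> m = m'" and oslot_inj: "oslot m = oslot m' \<Longrightarrow> m = m'"
  by (metis islot(2)) (metis oslot(2))

lemma slots_disjoint: "in_slots \<inter> out_slots = {}"
  by (auto simp: in_slots_def out_slots_def)

lemma islot_oslot: "islot m \<noteq> oslot m'" "oslot m' \<noteq> islot m"
  using islot(1) oslot(1) slots_disjoint by (metis disjoint_iff)+

context
  fixes \<Gamma> \<phi> assumes res: "resolved \<Gamma> \<phi>"
begin

lemma resolved_states: "\<phi> \<in> states" using res by (simp add: resolved_def)

text \<open>At a thick edge the relations of \<open>deriv_thick\<close> are a homogeneous linear
  system for the values of \<open>u1 - const\<close> and \<open>u2\<close>, with determinant the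
  nonzero difference of the two incoming values.\<close>

lemma resolved_admissible:
  assumes "k \<in> factors L"
  shows "val \<phi> k (vec \<Gamma> k i) = 0"
proof (cases k)
  case (Inr a)
  then show ?thesis
    using res assms val_pi_at[OF resolved_states, of k 1 3]
    by (auto simp: quad_def val_simps resolved_def factors_def)
next
  case (Inl c)
  have c: "\<phi> (ends L c 1) = \<phi> (ends L c 4)" "\<phi> (ends L c 2) = \<phi> (ends L c 3)"
    "c \<in> \<Gamma> \<longleftrightarrow> \<phi> (ends L c 1) \<noteq> \<phi> (ends L c 2)"
    using res assms Inl by (auto simp: resolved_def factors_def)
  show ?thesis
  proof (cases "c \<in> \<Gamma>")
    case False
    then show ?thesis
      using c Inl val_pi_at[OF resolved_states, of k 1 3] val_pi_at[OF resolved_states, of k 2 4]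
      by (simp add: quad_def val_simps)
  next
    case True
    have b: "val \<phi> (Inl c) sum_diff = 0" "val \<phi> (Inl c) prod_diff = 0"
      using c by (simp_all add: sum_diff_def prod_diff_def val_simps)
    have x: "of_nat (n + 1) * \<phi> m ^ n - const = 0" for m
      using resolved_states by (simp add: states_iff rts_def const_def)
    let ?u = "val \<phi> (Inl c) (u1_poly n) - const" and ?w = "val \<phi> (Inl c) (u2_poly n)"
    note d = deriv_thick[OF True b, unfolded x]
    have "(\<phi> (ends L c 2) - \<phi> (ends L c 1)) * ?w =
        (?u + \<phi> (ends L c 2) * ?w) - (?u + \<phi> (ends L c 1) * ?w)" by (simp add: algebra_simps)
    also have "\<dots> = 0" by (simp only: d diff_self)
    finally have "(\<phi> (ends L c 2) - \<phi> (ends L c 1)) * ?w = 0" .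
    then have w: "?w = 0" using True c(3) by auto
    then have "?u = 0" using d(1) by simp
    with w b True Inl show ?thesis by (simp add: quad_def val_simps)
  qed
qed

lemma resolved_adm: "k \<in> factors L \<Longrightarrow> ev \<phi> (lvec \<Gamma> k i) = 0"
  by (simp add: lvec_def ev_loc resolved_admissible)

subsection \<open>Clifford relations at a surviving state\<close>

text \<open>Half of the second derivative of \<open>wt\<close> at the value of the mark.\<close>

definition slope :: "'m \<Rightarrow> complex" where
  "slope m = of_nat n * of_nat (n + 1) / 2 * \<phi> m ^ (n - 1)"

lemma slope_nonzero: "slope m \<noteq> 0"
proof -
  have "(of_nat (n + 1) :: complex) \<noteq> 0" "(of_nat n :: complex) \<noteq> 0"
    using n by (simp_all del: of_nat_Suc of_nat_add)
  then show ?thesis using resolved_states rts_nonzero by (auto simp: slope_def states_iff)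
qed

definition dvec :: "('c, 'm) factor \<Rightarrow> nat \<Rightarrow> nat \<Rightarrow> complex" where
  "dvec k e = (\<lambda>i. val \<phi> k (pd e (vec \<Gamma> k i)))"

lemma fits_dvec: "k \<in> factors L \<Longrightarrow> fits k (dvec k e)"
  by (auto simp: fits_def dvec_def val_simps)

text \<open>In the second derivative of the potential identity, the term with second derivatives of
  \<open>vec\<close> is paired with \<open>vec\<close> itself, which vanishes at the state.\<close>

lemma polar_dvec:
  assumes "k \<in> factors L"
  shows "polar (dvec k e) (dvec k e') = val \<phi> k (pd e (pd e' (potential k)))"
proof -
  have "polar (dvec k e) (dvec k e') =
      val \<phi> k (polar (\<lambda>i. pd e (vec \<Gamma> k i)) (\<lambda>i. pd e' (vec \<Gamma> k i)) + polar (vec \<Gamma> k) (\<lambda>i. pd e (pd e' (vec \<Gamma> k i))))"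
    by (simp add: polar_def dvec_def val_simps resolved_admissible[OF assms])
  then show ?thesis by (simp only: polar_pd_pd)
qed

lemma pd_pd_wt: "val \<phi> k (pd e (pd e' (wt i))) = (if i = e \<and> i = e' then 2 * slope (mark k i) else 0)"
proof -
  have "pd e (pd e' (wt i)) = (if i = e \<and> i = e' then of_nat (n + 1) * (of_nat n * gvar i ^ (n - 1)) else 0)"
    unfolding pd_wt by (auto simp: pd_diff pd_mult pd_power pd_Var Const_of_nat[symmetric] simp del: of_nat_add of_nat_Suc)
  then show ?thesis by (simp add: val_simps slope_def mult_ac)
qed

text \<open>The potential is a sum of functions of one end each, so its Hessian is diagonal;
  outgoing ends carry the minus sign of the potential.\<close>

lemma polar_dvec_eq:
  assumes "(k, e) \<in> in_slots \<union> out_slots" "(k, e') \<in> in_slots \<union> out_slots"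
  shows "polar (dvec k e) (dvec k e') =
    (if e = e' then (if (k, e) \<in> in_slots then 2 else - 2) * slope (mark k e) else 0)"
proof -
  have k: "k \<in> factors L" using assms(1) slots_factors by blast
  show ?thesis
  proof (cases k)
    case (Inl c)
    have e: "e \<in> {1, 2, 3, 4}" "e' \<in> {1, 2, 3, 4}" "(k, e) \<in> in_slots \<longleftrightarrow> e \<in> {1, 2}"
      using assms k Inl by (auto simp: in_slots_def out_slots_def)
    have "val \<phi> k (pd e (pd e' (potential k))) =
      (if e = e' then (if e \<in> {1, 2} then 2 else - 2) * slope (mark k e) else 0)"
      using e(1,2) unfolding Inl potential.simps pd_add pd_diff val_simps pd_pd_wt
      by (elim insertE emptyE) simp_all
    then show ?thesis unfolding polar_dvec[OF k] e(3) .
  next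
    case (Inr a)
    have e: "e \<in> {1, 3}" "e' \<in> {1, 3}" "(k, e) \<in> in_slots \<longleftrightarrow> e = 1"
      using assms k Inr by (auto simp: in_slots_def out_slots_def)
    have "val \<phi> k (pd e (pd e' (potential k))) =
      (if e = e' then (if e = 1 then 2 else - 2) * slope (mark k e) else 0)"
      using e(1,2) unfolding Inr potential.simps pd_add pd_diff val_simps pd_pd_wt
      by (elim insertE emptyE) simp_all
    then show ?thesis unfolding polar_dvec[OF k] e(3) .
  qed
qed

definition gam :: "('c, 'm) factor \<times> nat \<Rightarrow> (('c, 'm) gen \<Rightarrow> complex) \<Rightarrow> ('c, 'm) gen \<Rightarrow> complex" where
  "gam s = cl (fst s) (dvec (fst s) (snd s))"

lemma rlin_gam [simp]: "rlin (gam s)" by (simp add: gam_def)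

lemma cl_restrict: "cl k \<xi> v = cl k \<xi> (\<lambda>G. if G \<in> generators L then v G else 0)"
  if "k \<in> factors L" for v :: "('c, 'm) gen \<Rightarrow> 'r::comm_ring_1"
  by (auto simp: cl_def odd_op_def fun_eq_iff generators_upd that intro!: sum.cong)

lemma gam_anticommute:
  assumes "s \<in> in_slots \<union> out_slots" "s' \<in> in_slots \<union> out_slots" "s \<noteq> s'"
  shows "gam s (gam s' v) = - gam s' (gam s v)"
proof -
  obtain k e k' e' where s: "s = (k, e)" "s' = (k', e')" by (cases s; cases s')
  have k: "k \<in> factors L" "k' \<in> factors L" using assms s slots_factors by auto
  show ?thesis
  proof (cases "k = k'")
    case False
    then show ?thesis using cl_anticommutator_other[OF k] by (simp add: s gam_def eq_neg_iff_add_eq_0)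
  next
    case True
    let ?v = "\<lambda>G. if G \<in> generators L then v G else 0"
    have v: "?v \<in> supported" by (auto simp: supported_def)
    have "gam s (gam s' ?v) + gam s' (gam s ?v) = smul (polar (dvec k e) (dvec k e')) ?v"
      unfolding gam_def s True fst_conv snd_conv
      by (rule cl_anticommutator_same) (use k v fits_dvec in \<open>auto simp: True\<close>)
    also have "polar (dvec k e) (dvec k e') = 0"
      using assms s True by (subst polar_dvec_eq) auto
    finally have "gam s (gam s' ?v) + gam s' (gam s ?v) = 0" by (simp only: smul_simps)
    moreover have "gam s' ?v = gam s' v" "gam s ?v = gam s v"
      using k by (simp_all add: gam_def s cl_restrict[symmetric])
    ultimately show ?thesis by (simp add: eq_neg_iff_add_eq_0)
  qed
qed

lemma gam_square:
  assumes "(k, e) \<in> in_slots" "v \<in> supported"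
  shows "gam (k, e) (gam (k, e) v) = smul (slope (mark k e)) v"
proof -
  have k: "k \<in> factors L" using assms slots_factors by auto
  have "gam (k, e) (gam (k, e) v) + gam (k, e) (gam (k, e) v) = smul (polar (dvec k e) (dvec k e)) v"
    unfolding gam_def fst_conv snd_conv by (rule cl_anticommutator_same) (use k fits_dvec assms in auto)
  also have "polar (dvec k e) (dvec k e) = 2 * slope (mark k e)"
    using assms by (subst polar_dvec_eq) auto
  finally have "2 * gam (k, e) (gam (k, e) v) G = 2 * (slope (mark k e) * v G)" for G
    by (simp add: smul_def fun_eq_iff mult.assoc)
  then have "gam (k, e) (gam (k, e) v) G = slope (mark k e) * v G" for G
    by (simp only: mult_cancel_left) simp
  then show ?thesis by (simp add: smul_def fun_eq_iff)
qed

definition gin where "gin m = gam (islot m)"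
definition gout where "gout m = gam (oslot m)"

lemma rlin_gin [simp]: "rlin (gin m)" "rlin (gout m)" by (simp_all add: gin_def gout_def)

lemma gin_gin: "m \<noteq> m' \<Longrightarrow> gin m (gin m' v) = - gin m' (gin m v)"
  and gout_gout: "m \<noteq> m' \<Longrightarrow> gout m (gout m' v) = - gout m' (gout m v)"
  and gin_gout: "gin m (gout m' v) = - gout m' (gin m v)"
  and gout_gin: "gout m' (gin m v) = - gin m (gout m' v)"
  unfolding gin_def gout_def
  by (rule gam_anticommute; use islot oslot islot_inj oslot_inj islot_oslot in blast)+

lemma gin_square: "v \<in> supported \<Longrightarrow> gin m (gin m v) = smul (slope m) v"
  using gam_square[of "fst (islot m)" "snd (islot m)" v] islot[of m]
  by (simp add: gin_def case_prod_unfold)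

lemma sum_pair: "a \<noteq> b \<Longrightarrow> sum f {a, b} = f a + (f b :: 'r::comm_monoid_add)" by simp

text \<open>The derivatives of a cocycle equation, evaluated at a state where the differential vanishes.\<close>

lemma gin_gout_cocycle:
  assumes z: "z \<in> supported" "dd \<Gamma> z = 0"
  defines "z0 \<equiv> \<lambda>G. ev \<phi> (z G)"
  shows "gin m z0 = - gout m z0"
proof -
  \<comment> \<open>By the Leibniz rule, a coefficient vanishing at the state contributes only its
    derivative times the value of the chain.\<close>
  have 1: "ev \<phi> (pd m (cl k \<xi> z G)) = cl k (\<lambda>i. ev \<phi> (pd m (\<xi> i))) z0 G"
    if "\<And>i. ev \<phi> (\<xi> i) = 0" for k \<xi> G
  proof -
    have K: "ev \<phi> (koszul \<xi> g e) = 0" "ev \<phi> (pd m (koszul \<xi> g e)) = koszul (\<lambda>i. ev \<phi> (pd m (\<xi> i))) g e" for g e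
      using that by (auto simp: koszul_def odd_map_def entry_def Let_def ev_simps pd_uminus)
    have S: "sgn_at k G = (Const (sgn_at k G) :: 'm mpoly)"
      by (simp add: sgn_at_def Const_power Const_minus)
    have S': "ev \<phi> (pd m (sgn_at k G * p)) = sgn_at k G * ev \<phi> (pd m p)" for p
      by (subst S) (simp add: pd_mult ev_simps)
    show ?thesis
      by (simp add: cl_def odd_op_def pd_sum ev_simps mult.assoc S' z0_def) (simp add: pd_mult ev_simps K)
  qed
  \<comment> \<open>The chain rule: the derivative at a mark sums over the ends of the factor that
    carry it. For an arc the ends 2 and 4 do not occur in \<open>vec\<close> and contribute
    zero.\<close>
  have 2: "(\<lambda>i. ev \<phi> (pd m (lvec \<Gamma> k i))) = (\<lambda>i. \<Sum>e\<in>{e. (k, e) \<in> in_slots \<union> out_slots \<and> mark k e = m}. dvec k e i)"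
    if k: "k \<in> factors L" for k
  proof
    fix i
    have "ev \<phi> (pd m (lvec \<Gamma> k i)) = (\<Sum>e\<in>{1..4}. if mark k e = m then dvec k e i else 0)"
      unfolding lvec_def loc_def pd_subst_slot[OF slot_poly_vec]
      unfolding ev_simps by (rule sum.cong) (auto simp: dvec_def ev_loc[unfolded loc_def])
    also have "\<dots> = (\<Sum>e\<in>{e\<in>{1..4}. (k, e) \<in> in_slots \<union> out_slots \<and> mark k e = m}. dvec k e i)"
    proof (subst sum.inter_filter[symmetric], simp, rule sum.mono_neutral_cong_right)
      have "dvec k e i = 0" if "e \<in> {1..4}" "(k, e) \<notin> in_slots \<union> out_slots" for e
      proof (cases k)
        case (Inl c)
        have "e = 1 \<or> e = 2 \<or> e = 3 \<or> e = 4" using that(1) by auto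
        then show ?thesis using that k Inl by (auto simp: in_slots_def out_slots_def factors_def)
      next
        case (Inr a)
        then have "e \<noteq> 1" "e \<noteq> 3" using that k by (auto simp: in_slots_def out_slots_def factors_def)
        then show ?thesis
          using Inr by (simp add: dvec_def quad_def pd_diff pd_pi_at pd_Var val_simps)
      qed
      then show "\<forall>e\<in>{e \<in> {1..4}. mark k e = m} - {e \<in> {1..4}. (k, e) \<in> in_slots \<union> out_slots \<and> mark k e = m}. dvec k e i = 0"
        by blast
    qed auto
    also have "{e\<in>{1..4}. (k, e) \<in> in_slots \<union> out_slots \<and> mark k e = m} = {e. (k, e) \<in> in_slots \<union> out_slots \<and> mark k e = m}"
      by (auto simp: in_slots_def out_slots_def)
    finally show "ev \<phi> (pd m (lvec \<Gamma> k i)) = (\<Sum>e\<in>{e. (k, e) \<in> in_slots \<union> out_slots \<and> mark k e = m}. dvec k e i)" .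
  qed
  have "0 = (\<lambda>G. ev \<phi> (pd m (dd \<Gamma> z G)))" by (simp add: z fun_eq_iff)
  also have "\<dots> = (\<lambda>G. \<Sum>k\<in>factors L. cl k (\<lambda>i. ev \<phi> (pd m (lvec \<Gamma> k i))) z0 G)"
    unfolding dd_def sum_fun_apply pd_sum ev_simps by (simp add: 1 resolved_adm)
  also have "\<dots> = (\<Sum>k\<in>factors L. \<Sum>e\<in>{e. (k, e) \<in> in_slots \<union> out_slots \<and> mark k e = m}. gam (k, e) z0)"
    by (simp add: fun_eq_iff sum_fun_apply 2 cl_vec_sum gam_def)
  also have "\<dots> = (\<Sum>s\<in>(SIGMA k:factors L. {e. (k, e) \<in> in_slots \<union> out_slots \<and> mark k e = m}). gam s z0)"
  proof (subst sum.Sigma)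
    have "finite {e. (k, e) \<in> in_slots \<union> out_slots \<and> mark k e = m}" for k
      by (rule finite_subset[of _ "snd ` (in_slots \<union> out_slots)"]) (force, simp)
    then show "\<forall>k\<in>factors L. finite {e. (k, e) \<in> in_slots \<union> out_slots \<and> mark k e = m}"
      by blast
  qed simp_all
  also have "(SIGMA k:factors L. {e. (k, e) \<in> in_slots \<union> out_slots \<and> mark k e = m}) = {islot m, oslot m}"
  proof -
    obtain k e k' e' where io: "islot m = (k, e)" "oslot m = (k', e')" by (cases "islot m"; cases "oslot m")
    have 1: "(k, e) \<in> in_slots" "mark k e = m" "(k', e') \<in> out_slots" "mark k' e' = m"
      using islot[of m] oslot[of m] io by auto
    have 2: "(l, i) = (k, e)" if "(l, i) \<in> in_slots" "mark l i = m" for l i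
      using islot_mark[OF that(1)] that(2) io by simp
    have 3: "(l, i) = (k', e')" if "(l, i) \<in> out_slots" "mark l i = m" for l i
      using oslot_mark[OF that(1)] that(2) io by simp
    show ?thesis
    proof (intro equalityI subsetI)
      fix s assume "s \<in> (SIGMA k:factors L. {e. (k, e) \<in> in_slots \<union> out_slots \<and> mark k e = m})"
      then show "s \<in> {islot m, oslot m}" using 2 3 unfolding io by (cases s) blast
    next
      fix s assume "s \<in> {islot m, oslot m}"
      then show "s \<in> (SIGMA k:factors L. {e. (k, e) \<in> in_slots \<union> out_slots \<and> mark k e = m})"
        using 1 slots_factors unfolding io by blast
    qed
  qed
  also have "(\<Sum>s\<in>{islot m, oslot m}. gam s z0) = gin m z0 + gout m z0"
    unfolding gin_def gout_def by (rule sum_pair[OF islot_oslot(1)])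
  finally have "gin m z0 + gout m z0 = 0" by (rule sym)
  then show ?thesis by (rule eq_neg_iff_add_eq_0[THEN iffD2])
qed

end

end

subsection \<open>The parity of a surviving state\<close>

context gornik
begin

fun target :: "'c set \<Rightarrow> ('c, 'm) factor \<Rightarrow> nat \<Rightarrow> nat" where
  "target \<Gamma> (Inl c) e = (if (c \<in> \<Gamma>) = (e = 1) then 4 else 3)"
| "target \<Gamma> (Inr a) e = 3"

text \<open>The curves pass straight through the crossings in \<open>\<Gamma>\<close>, and the other crossings are smoothed.\<close>

definition sigma :: "'c set \<Rightarrow> 'm \<Rightarrow> 'm" where
  "sigma \<Gamma> m = (case islot m of (k, e) \<Rightarrow> mark k (target \<Gamma> k e))"

lemma islot_bij: "bij_betw islot UNIV in_slots"
  by (rule bij_betw_byWitness[where f' = "\<lambda>(k, e). mark k e"])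
     (auto simp: islot_mark islot)

lemma target_bij: "bij_betw (\<lambda>(k, e). (k, target \<Gamma> k e)) in_slots out_slots"
  by (rule bij_betw_byWitness[where f' = "\<lambda>(k, e). (k, case k of Inl c \<Rightarrow> if (c \<in> \<Gamma>) = (e = 4) then 1 else 2 | Inr a \<Rightarrow> 1)"])
     (auto simp: in_slots_def out_slots_def split: if_splits)

lemma sigma_bij: "bij (sigma \<Gamma>)"
proof -
  have "sigma \<Gamma> = (\<lambda>(k, e). mark k e) \<circ> ((\<lambda>(k, e). (k, target \<Gamma> k e)) \<circ> islot)"
    by (auto simp: sigma_def fun_eq_iff split: prod.splits)
  then show ?thesis
    using bij_betw_trans[OF bij_betw_trans[OF islot_bij target_bij] out_slots_bij] by simp
qed

lemma sigma_permutes: "sigma \<Gamma> permutes UNIV"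
  by (rule bij_imp_permutes) (use sigma_bij in auto)

lemma sigma_crossing:
  assumes "c \<in> crossings L"
  shows "sigma \<Gamma> (ends L c 1) = (if c \<in> \<Gamma> then ends L c 4 else ends L c 3)"
    "sigma \<Gamma> (ends L c 2) = (if c \<in> \<Gamma> then ends L c 3 else ends L c 4)"
  using islot_mark[of "Inl c" 1] islot_mark[of "Inl c" 2] assms
  by (auto simp: sigma_def in_slots_def)

lemma sigma_arc: "a \<in> arcs L \<Longrightarrow> sigma \<Gamma> (fst a) = snd a"
  using islot_mark[of "Inr a" 1] by (auto simp: sigma_def in_slots_def)

lemma ends_distinct:
  assumes "c \<in> crossings L"
  shows "ends L c 1 \<noteq> ends L c 2" "ends L c 3 \<noteq> ends L c 4"
  using islot_mark[of "Inl c" 1] islot_mark[of "Inl c" 2] oslot_mark[of "Inl c" 3] oslot_mark[of "Inl c" 4] assms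
  by (auto simp: in_slots_def out_slots_def)

lemma mark_cases:
  obtains (arc) a where "a \<in> arcs L" "m = fst a"
  | (first) c where "c \<in> crossings L" "m = ends L c 1"
  | (second) c where "c \<in> crossings L" "m = ends L c 2"
  using islot[of m] by (auto simp: in_slots_def)

lemma sigma_insert:
  assumes "c \<in> crossings L" "c \<notin> \<Gamma>"
  shows "sigma (insert c \<Gamma>) = sigma \<Gamma> \<circ> transpose (ends L c 1) (ends L c 2)"
proof
  fix m
  have ne: "mark k e \<noteq> ends L c i" if "(k, e) \<in> in_slots" "(Inl c, i) \<in> in_slots" "(k, e) \<noteq> (Inl c, i)" for k e i
    using islot_mark[OF that(1)] islot_mark[OF that(2)] that(3) by auto
  have in12: "(Inl c, 1) \<in> in_slots" "(Inl c, 2) \<in> in_slots" using assms by (auto simp: in_slots_def)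
  show "sigma (insert c \<Gamma>) m = (sigma \<Gamma> \<circ> transpose (ends L c 1) (ends L c 2)) m"
  proof (cases "m = ends L c 1 \<or> m = ends L c 2")
    case True
    then show ?thesis using assms by (auto simp: sigma_crossing simp del: One_nat_def)
  next
    case False
    then have "transpose (ends L c 1) (ends L c 2) m = m" by (simp add: transpose_apply_other)
    moreover have "sigma (insert c \<Gamma>) m = sigma \<Gamma> m"
      using False by (cases m rule: mark_cases) (auto simp: sigma_arc sigma_crossing simp del: One_nat_def)
    ultimately show ?thesis by simp
  qed
qed

text \<open>Passing straight through one more crossing composes the permutation with the
  transposition of the two incoming marks.\<close>

lemma sign_sigma:
  assumes "finite \<Gamma>" "\<Gamma> \<subseteq> crossings L"
  shows "sign (sigma \<Gamma>) = (- 1) ^ card \<Gamma> * sign (sigma {})"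
  using assms
proof (induction \<Gamma> rule: finite_induct)
  case (insert c \<Gamma>)
  have "permutation (sigma \<Gamma>)" using sigma_permutes by (auto simp: permutation_permutes)
  then have "sign (sigma (insert c \<Gamma>)) = - sign (sigma \<Gamma>)"
    using insert ends_distinct[of c]
    by (subst sigma_insert) (auto simp: sign_compose permutation_swap_id sign_swap_id)
  then show ?case using insert by simp
qed simp

section \<open>The grading operator as a product of Clifford generators\<close>

lemma mat_prod_koszul_Inl:
  "mat_prod (Inl c) (koszul \<xi>) (koszul \<eta>) (False, r) (False, s) =
    (if r then (if s then \<xi> 2 * \<eta> 3 + \<xi> 0 * \<eta> 1 else \<xi> 2 * \<eta> 0 - \<xi> 0 * \<eta> 2)
     else (if s then \<xi> 1 * \<eta> 3 - \<xi> 3 * \<eta> 1 else \<xi> 1 * \<eta> 0 + \<xi> 3 * \<eta> 2))"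
  "mat_prod (Inl c) (koszul \<xi>) (koszul \<eta>) (True, r) (True, s) =
    (if r then (if s then \<xi> 2 * \<eta> 3 + \<xi> 1 * \<eta> 0 else \<xi> 2 * \<eta> 1 - \<xi> 1 * \<eta> 2)
     else (if s then \<xi> 0 * \<eta> 3 - \<xi> 3 * \<eta> 0 else \<xi> 0 * \<eta> 1 + \<xi> 3 * \<eta> 2))"
  "mat_prod (Inl c) (koszul \<xi>) (koszul \<eta>) (False, r) (True, s) = 0"
  "mat_prod (Inl c) (koszul \<xi>) (koszul \<eta>) (True, r) (False, s) = 0"
  by (auto simp: mat_prod_def sum_local_gens koszul_def odd_map_def entry_def simp del: local_gens.simps(1))

lemma mat_prod_koszul_Inr:
  "mat_prod (Inr a) (koszul \<xi>) (koszul \<eta>) (False, False) (False, False) = \<xi> 1 * \<eta> 0"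
  "mat_prod (Inr a) (koszul \<xi>) (koszul \<eta>) (True, False) (True, False) = \<xi> 0 * \<eta> 1"
  "mat_prod (Inr a) (koszul \<xi>) (koszul \<eta>) (False, False) (True, False) = 0"
  "mat_prod (Inr a) (koszul \<xi>) (koszul \<eta>) (True, False) (False, False) = 0"
  by (auto simp: mat_prod_def koszul_def odd_map_def entry_def)

definition par :: "('c, 'm) factor set \<Rightarrow> (('c, 'm) gen \<Rightarrow> complex) \<Rightarrow> ('c, 'm) gen \<Rightarrow> complex" where
  "par T v = (\<lambda>G. (- 1) ^ card {k \<in> T. fst (G k)} * v G)"

lemma par_insert:
  assumes "finite T" "k \<notin> T"
  shows "par (insert k T) v = par {k} (par T v)"
proof
  fix G :: "('c, 'm) gen"
  have "{j \<in> insert k T. fst (G j)} = (if fst (G k) then insert k {j \<in> T. fst (G j)} else {j \<in> T. fst (G j)})"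
    "{j \<in> {k}. fst (G j)} = (if fst (G k) then {k} else {})" by auto
  then show "par (insert k T) v G = par {k} (par T v) G"
    using assms by (simp add: par_def)
qed

lemma par_single: "par {k} v G = (if fst (G k) then - v G else v G)"
proof -
  have "{j \<in> {k}. fst (G j)} = (if fst (G k) then {k} else {})" by auto
  then show ?thesis unfolding par_def by simp
qed

lemma par_supported [intro, simp]: "v \<in> supported \<Longrightarrow> par T v \<in> supported"
  by (auto simp: supported_def par_def)

lemma even_op_par:
  assumes k: "k \<in> factors L" and v: "v \<in> supported"
    and A: "\<And>g e. g \<in> local_gens k \<Longrightarrow> e \<in> local_gens k \<Longrightarrow> A g e = (if e = g then if fst g then - p else p else 0)"
  shows "even_op k A v = smul p (par {k} v)"
proof
  fix G :: "('c, 'm) gen"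
  show "even_op k A v G = smul p (par {k} v) G"
  proof (cases "G \<in> generators L")
    case True
    have "even_op k A v G = (\<Sum>e\<in>local_gens k. A (G k) e * v (G(k := e)))"
      using True by (simp add: even_op_def)
    also have "\<dots> = (\<Sum>e\<in>local_gens k. if e = G k then (if fst (G k) then - p else p) * v G else 0)"
      by (rule sum.cong) (auto simp: A[OF generators_apply[OF True k]])
    also have "\<dots> = (if fst (G k) then - p else p) * v G" using generators_apply[OF True k] by simp
    finally show ?thesis by (simp add: smul_def par_single)
  qed (use v in \<open>auto simp: even_op_def smul_def par_single supported_def\<close>)
qed

context
  fixes \<Gamma> \<phi> assumes res: "resolved \<Gamma> \<phi>"
begin

abbreviation "slp \<equiv> slope \<phi>"
abbreviation "gi \<equiv> gin \<Gamma> \<phi>"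
abbreviation "go \<equiv> gout \<Gamma> \<phi>"
abbreviation "dv \<equiv> dvec \<Gamma> \<phi>"

text \<open>A product of two odd generators is even, so these operators commute for an injective
  \<open>\<tau>\<close> and can be folded over a set of marks without choosing an order.\<close>

definition pair_op :: "('m \<Rightarrow> 'm) \<Rightarrow> 'm \<Rightarrow> (('c, 'm) gen \<Rightarrow> complex) \<Rightarrow> ('c, 'm) gen \<Rightarrow> complex" where
  "pair_op \<tau> m v = gi m (go (\<tau> m) v)"

lemma g_uminus: "gi m (- v) = - gi m v" "go m (- v) = - go m v"
  and g_smul: "gi m (smul p v) = smul p (gi m v)" "go m (smul p v) = smul p (go m v)"
  by (rule rlinD rlin_gin[OF res])+

lemma pair_op_commute:
  assumes "m \<noteq> m'" "\<tau> m \<noteq> \<tau> m'"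
  shows "pair_op \<tau> m (pair_op \<tau> m' v) = pair_op \<tau> m' (pair_op \<tau> m v)"
proof -
  have "gi m (go (\<tau> m) (gi m' (go (\<tau> m') v))) = - gi m (gi m' (go (\<tau> m) (go (\<tau> m') v)))"
    by (simp only: gout_gin[OF res, of "\<tau> m" m'] g_uminus)
  also have "\<dots> = gi m' (gi m (go (\<tau> m) (go (\<tau> m') v)))"
    by (simp only: gin_gin[OF res assms(1)] minus_minus)
  also have "\<dots> = - gi m' (gi m (go (\<tau> m') (go (\<tau> m) v)))"
    by (simp only: gout_gout[OF res assms(2)] g_uminus)
  also have "\<dots> = gi m' (go (\<tau> m') (gi m (go (\<tau> m) v)))"
    by (simp only: gout_gin[OF res, of "\<tau> m'" m] g_uminus)
  finally show ?thesis by (simp only: pair_op_def)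
qed

lemma pair_op_comm_fun:
  assumes "inj \<tau>" shows "comp_fun_commute (pair_op \<tau>)"
proof
  fix x y :: 'm
  show "pair_op \<tau> y \<circ> pair_op \<tau> x = pair_op \<tau> x \<circ> pair_op \<tau> y"
    using pair_op_commute[of y x \<tau>] assms by (cases "x = y") (auto simp: fun_eq_iff[of "_ \<circ> _"] inj_def)
qed

text \<open>The cocycle relation replaces the outgoing generator by minus the incoming one, whose
  square is the slope.\<close>

lemma fold_pair_id:
  assumes z: "z \<in> supported" "\<And>m. gi m z = - go m z" and "finite S"
  shows "Finite_Set.fold (pair_op id) z S = smul (\<Prod>m\<in>S. - slp m) z"
proof -
  interpret comp_fun_commute "pair_op id" by (rule pair_op_comm_fun) simp
  have "pair_op id m z = smul (- slp m) z" for m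
  proof -
    have "go m z = - gi m z" using z(2)[of m] by simp
    then have "pair_op id m z = - gi m (gi m z)" by (simp only: pair_op_def id_apply g_uminus)
    then show ?thesis by (simp only: gin_square[OF res z(1)] smul_simps)
  qed
  moreover have "pair_op id m (smul p z) = smul p (pair_op id m z)" for m p
    by (simp only: pair_op_def g_smul)
  ultimately have *: "pair_op id m (smul p z) = smul (- slp m * p) z" for m p
    by (simp only: smul_simps(3) mult.commute)
  show ?thesis
    using assms(3)
  proof (induction S rule: finite_induct)
    case empty
    then show ?case by (simp add: smul_simps)
  next
    case (insert m S)
    show ?case unfolding fold_insert[OF insert.hyps] insert.IH * prod.insert[OF insert.hyps] ..
  qed
qed

text \<open>The transposition exchanges two outgoing generators, which anticommute; moving the
  intermediate incoming generator out of the way and back costs two signs that cancel.\<close>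

lemma fold_pair_transpose:
  assumes \<tau>: "\<tau> permutes UNIV" and ab: "a \<noteq> b"
  shows "Finite_Set.fold (pair_op (transpose a b \<circ> \<tau>)) v UNIV = - Finite_Set.fold (pair_op \<tau>) v UNIV"
proof -
  let ?\<tau>' = "transpose a b \<circ> \<tau>"
  have inj: "inj \<tau>" "inj ?\<tau>'"
    using \<tau> permutes_inj[OF \<tau>] by (auto intro: inj_compose)
  interpret f: comp_fun_commute "pair_op \<tau>" by (rule pair_op_comm_fun[OF inj(1)])
  interpret f': comp_fun_commute "pair_op ?\<tau>'" by (rule pair_op_comm_fun[OF inj(2)])
  obtain a' b' where a'b': "\<tau> a' = a" "\<tau> b' = b" using permutes_surj[OF \<tau>] by (metis surjD)
  then have ne: "a' \<noteq> b'" using ab by auto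
  let ?S = "UNIV - {a', b'}"
  have U: "UNIV = insert a' (insert b' ?S)" by auto
  have fS: "Finite_Set.fold (pair_op ?\<tau>') v ?S = Finite_Set.fold (pair_op \<tau>) v ?S"
  proof (rule Finite_Set.fold_cong[where S = UNIV])
    show "Finite_Set.comp_fun_commute_on UNIV (pair_op ?\<tau>')" "Finite_Set.comp_fun_commute_on UNIV (pair_op \<tau>)"
      using f'.comp_fun_commute_axioms f.comp_fun_commute_axioms by (simp_all add: comp_fun_commute_def')
    fix m assume "m \<in> ?S"
    then have "\<tau> m \<noteq> a" "\<tau> m \<noteq> b" using a'b' inj(1) by (auto simp: inj_def)
    then show "pair_op ?\<tau>' m = pair_op \<tau> m"
      unfolding pair_op_def by (simp add: transpose_apply_other)
  qed auto
  let ?w = "Finite_Set.fold (pair_op \<tau>) v ?S"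
  have "Finite_Set.fold (pair_op ?\<tau>') v UNIV = pair_op ?\<tau>' a' (pair_op ?\<tau>' b' ?w)"
    using ne by (subst U) (simp add: f'.fold_insert fS)
  also have "\<dots> = gi a' (go b (gi b' (go a ?w)))"
    by (simp add: pair_op_def a'b')
  also have "\<dots> = - gi a' (gi b' (go b (go a ?w)))"
    by (simp only: gout_gin[OF res, of b b'] g_uminus)
  also have "\<dots> = gi a' (gi b' (go a (go b ?w)))"
    by (simp only: gout_gout[OF res ab] g_uminus minus_minus)
  also have "\<dots> = - gi a' (go a (gi b' (go b ?w)))"
    by (simp only: gout_gin[OF res, of a b'] g_uminus minus_minus)
  also have "\<dots> = - Finite_Set.fold (pair_op \<tau>) v UNIV"
    using ne by (subst U) (simp add: f.fold_insert pair_op_def a'b')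
  finally show ?thesis .
qed

lemma fold_pair_sign:
  assumes z: "z \<in> supported" "\<And>m. gi m z = - go m z" and "\<tau> permutes UNIV"
  shows "Finite_Set.fold (pair_op \<tau>) z UNIV = smul (of_int (sign \<tau>) * (\<Prod>m\<in>UNIV. - slp m)) z"
  using assms(3) finite
proof (induction \<tau> rule: permutes_induct)
  case id
  show ?case by (simp only: sign_id of_int_1 mult_1 fold_pair_id[OF z finite])
next
  case (swap a b p)
  have p: "p permutes UNIV" "permutation p" using swap by (auto simp: permutation_permutes)
  have "sign (transpose a b \<circ> p) = - sign p"
    using swap p by (simp add: sign_compose permutation_swap_id sign_swap_id)
  then show ?case
    unfolding fold_pair_transpose[OF p(1) swap.hyps(3)] swap.IH
    by (simp only: of_int_minus mult_minus_left smul_simps)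
qed

text \<open>The entry with index 1 is a derivative of \<open>x1 - x3\<close>; the known square then
  forces the entry with index 0, with no computation of the derivative of the arc
  polynomial.\<close>

lemma dvec_arc:
  assumes "a \<in> arcs L"
  shows "dv (Inr a) 1 = quad (slp (fst a)) 1 0 0" "dv (Inr a) 3 = quad (slp (snd a)) (- 1) 0 0"
proof -
  have 1: "polar (dv (Inr a) 1) (dv (Inr a) 1) = 2 * slp (fst a)"
    "polar (dv (Inr a) 3) (dv (Inr a) 3) = - 2 * slp (snd a)"
    using assms by (subst polar_dvec_eq[OF res]; auto simp: in_slots_def out_slots_def)+
  have 2: "dv (Inr a) e i = 0" if "i \<noteq> 0" "i \<noteq> 1" for e i
    using that by (simp add: dvec_def[OF res] quad_def val_simps)
  have 3: "dv (Inr a) 1 1 = 1" "dv (Inr a) 3 1 = - 1"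
    by (simp_all add: dvec_def[OF res] val_simps pd_diff pd_Var)
  have 4: "dv (Inr a) 1 0 = slp (fst a)" "dv (Inr a) 3 0 = slp (snd a)"
    using 1 2 3 by (simp_all add: polar_def del: One_nat_def)
  show "dv (Inr a) 1 = quad (slp (fst a)) 1 0 0" "dv (Inr a) 3 = quad (slp (snd a)) (- 1) 0 0"
    using 2 3 4 by (auto simp: fun_eq_iff quad_def)
qed

lemma pair_arc:
  assumes a: "a \<in> arcs L" and v: "v \<in> supported"
  shows "pair_op (sigma \<Gamma>) (fst a) v = smul (slp (fst a)) (par {Inr a} v)"
proof -
  have i: "islot (fst a) = (Inr a, 1)" and o: "oslot (snd a) = (Inr a, 3)"
    using islot_mark[of "Inr a" 1] oslot_mark[of "Inr a" 3] a by (auto simp: in_slots_def out_slots_def)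
  have k: "Inr a \<in> factors L" using a by simp
  have eq: "slp (snd a) = slp (fst a)" using res a by (auto simp: resolved_def slope_def[OF res])
  have "pair_op (sigma \<Gamma>) (fst a) v = cl (Inr a) (dv (Inr a) 1) (cl (Inr a) (dv (Inr a) 3) v)"
    unfolding pair_op_def sigma_arc[OF a] gin_def[OF res] gout_def[OF res] gam_def[OF res] i o by simp
  also have "\<dots> = smul (slp (fst a)) (par {Inr a} v)"
    unfolding cl_def odd_odd_same[OF k] dvec_arc[OF a] eq
    by (rule even_op_par[OF k v]) (auto simp: mat_prod_koszul_Inr)
  finally show ?thesis .
qed

lemma dvec_vanish: "i > 3 \<Longrightarrow> dv k e i = 0"
  by (cases k) (auto simp: dvec_def[OF res] quad_def val_simps)

lemma dvec_eqI:
  assumes "dv k e 0 = a" "dv k e 1 = b" "dv k e 2 = c" "dv k e 3 = d"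
  shows "dv k e = quad a b c d"
proof
  fix i :: nat
  have "i = 0 \<or> i = 1 \<or> i = 2 \<or> i = 3 \<or> i > 3" by auto
  then show "dv k e i = quad a b c d i"
    using assms dvec_vanish[of i k e] by (elim disjE) (auto simp: quad_def)
qed

lemma polar_crossing:
  assumes "c \<in> crossings L" "e \<in> {1, 2, 3, 4}" "e' \<in> {1, 2, 3, 4}"
  shows "polar (dv (Inl c) e) (dv (Inl c) e') =
    (if e = e' then (if e \<in> {1, 2} then 2 else - 2) * slp (ends L c e) else 0)"
  using assms by (subst polar_dvec_eq[OF res]) (auto simp: in_slots_def out_slots_def)

lemma dvec_thin:
  assumes c: "c \<in> crossings L" "c \<notin> \<Gamma>"
  shows "dv (Inl c) 1 = quad (slp (ends L c 1)) 1 0 0" "dv (Inl c) 3 = quad (slp (ends L c 3)) (- 1) 0 0"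
    "dv (Inl c) 2 = quad 0 0 (slp (ends L c 2)) 1" "dv (Inl c) 4 = quad 0 0 (slp (ends L c 4)) (- 1)"
proof -
  note p = polar_crossing[OF c(1), unfolded polar_def]
  have z: "dv (Inl c) 1 1 = 1" "dv (Inl c) 1 2 = 0" "dv (Inl c) 1 3 = 0"
    "dv (Inl c) 3 1 = - 1" "dv (Inl c) 3 2 = 0" "dv (Inl c) 3 3 = 0"
    "dv (Inl c) 2 0 = 0" "dv (Inl c) 2 1 = 0" "dv (Inl c) 2 3 = 1"
    "dv (Inl c) 4 0 = 0" "dv (Inl c) 4 1 = 0" "dv (Inl c) 4 3 = - 1"
    using c(2) by (simp_all add: dvec_def[OF res] val_simps pd_diff pd_Var pd_pi_at)
  have "dv (Inl c) 1 0 = slp (ends L c 1)" using p[of 1 1] by (simp add: z del: One_nat_def)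
  moreover have "dv (Inl c) 3 0 = slp (ends L c 3)" using p[of 3 3] by (simp add: z del: One_nat_def)
  moreover have "dv (Inl c) 2 2 = slp (ends L c 2)" using p[of 2 2] by (simp add: z del: One_nat_def)
  moreover have "dv (Inl c) 4 2 = slp (ends L c 4)" using p[of 4 4] by (simp add: z del: One_nat_def)
  ultimately show "dv (Inl c) 1 = quad (slp (ends L c 1)) 1 0 0" "dv (Inl c) 3 = quad (slp (ends L c 3)) (- 1) 0 0"
    "dv (Inl c) 2 = quad 0 0 (slp (ends L c 2)) 1" "dv (Inl c) 4 = quad 0 0 (slp (ends L c 4)) (- 1)"
    using z by (auto intro!: dvec_eqI)
qed

text \<open>Entries with index 1 and 3 are derivatives of \<open>sum_diff\<close> and
  \<open>prod_diff\<close>, hence explicit. The four squares determine the entries with index 0, and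
  three orthogonality relations express the entries with index 2 through \<open>g\<close>, the one
  at end 1. This \<open>g\<close> is a derivative of \<open>u2\<close>; it stays a parameter and
  cancels in \<open>pair_crossing\<close>.\<close>

lemma dvec_thick:
  assumes c: "c \<in> crossings L" "c \<in> \<Gamma>"
  obtains D p q b g where "slp (ends L c 1) = D * p" "slp (ends L c 2) = D * q"
    "dv (Inl c) 1 = quad (D * p - b * g) 1 g b"
    "dv (Inl c) 4 = quad (D * p + b * (g + 2 * p)) (- 1) (- g - 2 * p) (- b)"
    "dv (Inl c) 2 = quad (D * q - (b + D) * (g + p + q)) 1 (g + p + q) (b + D)"
    "dv (Inl c) 3 = quad (D * q - (b + D) * (q - p - g)) (- 1) (q - p - g) (- (b + D))"
proof -
  define a b where "a = \<phi> (ends L c 1)" and "b = \<phi> (ends L c 2)"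
  have ab: "\<phi> (ends L c 4) = a" "\<phi> (ends L c 3) = b" "a \<noteq> b"
    using res c by (auto simp: resolved_def a_def b_def)
  define la lb where "la = slp (ends L c 1)" and "lb = slp (ends L c 2)"
  have l: "slp (ends L c 4) = la" "slp (ends L c 3) = lb"
    using ab by (simp_all add: slope_def[OF res] la_def lb_def a_def b_def)
  define D where "D = a - b"
  \<comment> \<open>A thick edge joins strands of different values, so slopes can be divided by
    \<open>D\<close>; \<open>p\<close> and \<open>q\<close> then make all entries polynomial in the
    parameters.\<close>
  have D: "D \<noteq> 0" "a = b + D" using ab by (auto simp: D_def)
  define p q g where "p = la / D" and "q = lb / D" and "g = dv (Inl c) 1 2"
  have pq: "la = D * p" "lb = D * q" using D by (simp_all add: p_def q_def)
  have z: "dv (Inl c) 1 1 = 1" "dv (Inl c) 1 3 = b" "dv (Inl c) 2 1 = 1" "dv (Inl c) 2 3 = a"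
    "dv (Inl c) 3 1 = - 1" "dv (Inl c) 3 3 = - a" "dv (Inl c) 4 1 = - 1" "dv (Inl c) 4 3 = - b"
    using c(2) ab by (simp_all add: dvec_def[OF res] val_simps pd_diffs a_def b_def)
  note P = polar_crossing[OF c(1), unfolded polar_def]
  have diag: "dv (Inl c) 1 0 = D * p - b * g"
    "dv (Inl c) 2 0 = D * q - a * dv (Inl c) 2 2"
    "dv (Inl c) 3 0 = D * q - a * dv (Inl c) 3 2"
    "dv (Inl c) 4 0 = D * p - b * dv (Inl c) 4 2"
  proof -
    have "2 * (dv (Inl c) 1 0 + b * g) = 2 * la" using P[of 1 1] by (simp add: z g_def la_def algebra_simps del: One_nat_def)
    then show "dv (Inl c) 1 0 = D * p - b * g" by (simp only: mult_cancel_left pq) (auto simp: algebra_simps)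
    have "2 * (dv (Inl c) 2 0 + a * dv (Inl c) 2 2) = 2 * lb" using P[of 2 2] by (simp add: z lb_def algebra_simps del: One_nat_def)
    then show "dv (Inl c) 2 0 = D * q - a * dv (Inl c) 2 2" by (simp only: mult_cancel_left pq) (auto simp: algebra_simps)
    have "2 * (dv (Inl c) 3 0 + a * dv (Inl c) 3 2) = 2 * lb" using P[of 3 3] by (simp add: z l algebra_simps del: One_nat_def)
    then show "dv (Inl c) 3 0 = D * q - a * dv (Inl c) 3 2" by (simp only: mult_cancel_left pq) (auto simp: algebra_simps)
    have "2 * (dv (Inl c) 4 0 + b * dv (Inl c) 4 2) = 2 * la" using P[of 4 4] by (simp add: z l algebra_simps del: One_nat_def)
    then show "dv (Inl c) 4 0 = D * p - b * dv (Inl c) 4 2" by (simp only: mult_cancel_left pq) (auto simp: algebra_simps)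
  qed
  have 12: "D * (dv (Inl c) 2 2 - (g + p + q)) = 0"
    using P[of 1 2] by (simp add: z diag g_def[symmetric] D(2) algebra_simps del: One_nat_def)
  have 13: "D * (dv (Inl c) 3 2 - (q - p - g)) = 0"
    using P[of 1 3] by (simp add: z diag g_def[symmetric] D(2) algebra_simps del: One_nat_def)
  have g2: "dv (Inl c) 2 2 = g + p + q" and g3: "dv (Inl c) 3 2 = q - p - g" using 12 13 D(1) by auto
  have 34: "D * (dv (Inl c) 4 2 + g + 2 * p) = 0"
  proof -
    have "dv (Inl c) 3 0 * dv (Inl c) 4 1 + dv (Inl c) 3 1 * dv (Inl c) 4 0 + dv (Inl c) 3 2 * dv (Inl c) 4 3 +
        dv (Inl c) 3 3 * dv (Inl c) 4 2 = 0"
      using P[of 3 4] by (simp del: One_nat_def)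
    then have "- (D * (dv (Inl c) 4 2 + g + 2 * p)) = 0"
      unfolding z diag g3 D(2) by (rule trans[rotated]) (simp only: algebra_simps, simp add: algebra_simps)
    then show ?thesis by simp
  qed
  then have "dv (Inl c) 4 2 + g + 2 * p = 0" using D(1) by simp
  then have g4: "dv (Inl c) 4 2 = - g - 2 * p" by (simp add: eq_neg_iff_add_eq_0 algebra_simps)
  show thesis
  proof (rule that[of D p q b g])
    show "slp (ends L c 1) = D * p" "slp (ends L c 2) = D * q" using pq by (simp_all add: la_def lb_def)
  qed (rule dvec_eqI; simp add: diag z g2 g3 g4 g_def[symmetric] D(2) algebra_simps del: One_nat_def)+
qed

text \<open>Four orthogonal generators on a module with two generators in either degree multiply to
  a multiple of the grading operator. The scalar comes out the same for a thin and a thick crossing,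
  although the outgoing generators are paired differently.\<close>

lemma pair_crossing:
  assumes c: "c \<in> crossings L" and v: "v \<in> supported"
  shows "pair_op (sigma \<Gamma>) (ends L c 1) (pair_op (sigma \<Gamma>) (ends L c 2) v) =
    smul (slp (ends L c 1) * slp (ends L c 2)) (par {Inl c} v)"
proof -
  have k: "Inl c \<in> factors L" using c by simp
  have i: "islot (ends L c e) = (Inl c, e)" if "e \<in> {1, 2}" for e
    using islot_mark[of "Inl c" e] c that by (auto simp: in_slots_def)
  have o: "oslot (ends L c e) = (Inl c, e)" if "e \<in> {3, 4}" for e
    using oslot_mark[of "Inl c" e] c that by (auto simp: out_slots_def)
  let ?K = "\<lambda>e. koszul (dv (Inl c) e)"
  let ?t = "target \<Gamma> (Inl c)"
  have "pair_op (sigma \<Gamma>) (ends L c 1) (pair_op (sigma \<Gamma>) (ends L c 2) v) =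
      cl (Inl c) (dv (Inl c) 1) (cl (Inl c) (dv (Inl c) (?t 1)) (cl (Inl c) (dv (Inl c) 2) (cl (Inl c) (dv (Inl c) (?t 2)) v)))"
    unfolding pair_op_def sigma_crossing[OF c] gin_def[OF res] gout_def[OF res] gam_def[OF res]
    by (simp add: i o)
  also have "\<dots> = even_op (Inl c) (mat_prod (Inl c) (mat_prod (Inl c) (?K 1) (?K (?t 1))) (mat_prod (Inl c) (?K 2) (?K (?t 2)))) v"
    unfolding cl_def odd_odd_same[OF k] even_even_same[OF k] ..
  also have "\<dots> = smul (slp (ends L c 1) * slp (ends L c 2)) (par {Inl c} v)"
  proof (rule even_op_par[OF k v])
    fix g e :: local_gen
    show "mat_prod (Inl c) (mat_prod (Inl c) (?K 1) (?K (?t 1))) (mat_prod (Inl c) (?K 2) (?K (?t 2))) g e =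
      (if e = g then if fst g then - (slp (ends L c 1) * slp (ends L c 2)) else slp (ends L c 1) * slp (ends L c 2) else 0)"
    proof (cases "c \<in> \<Gamma>")
      case False
      have eq: "slp (ends L c 3) = slp (ends L c 1)" "slp (ends L c 4) = slp (ends L c 2)"
        using res c False by (auto simp: resolved_def slope_def[OF res])
      show ?thesis
        using False
        by (cases g; cases e; cases "fst g"; cases "snd g"; cases "fst e"; cases "snd e")
          (simp_all add: dvec_thin[OF c False, unfolded One_nat_def] eq mat_prod_koszul_Inl
             mat_prod_def[of _ "mat_prod _ _ _"] sum_local_gens_Inl del: local_gens.simps)
    next
      case True
      obtain D p q b h where t: "slp (ends L c 1) = D * p" "slp (ends L c 2) = D * q"
        "dv (Inl c) 1 = quad (D * p - b * h) 1 h b"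
        "dv (Inl c) 4 = quad (D * p + b * (h + 2 * p)) (- 1) (- h - 2 * p) (- b)"
        "dv (Inl c) 2 = quad (D * q - (b + D) * (h + p + q)) 1 (h + p + q) (b + D)"
        "dv (Inl c) 3 = quad (D * q - (b + D) * (q - p - h)) (- 1) (q - p - h) (- (b + D))"
        using dvec_thick[OF c True] .
      show ?thesis
        using True
        by (cases g; cases e; cases "fst g"; cases "snd g"; cases "fst e"; cases "snd e")
          (simp_all add: t[unfolded One_nat_def] mat_prod_koszul_Inl
             mat_prod_def[of _ "mat_prod _ _ _"] sum_local_gens_Inl algebra_simps del: local_gens.simps)
    qed
  qed
  finally show ?thesis .
qed

definition in_marks :: "('c, 'm) factor set \<Rightarrow> 'm set" where
  "in_marks T = {m. fst (islot m) \<in> T}"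

text \<open>\<open>sigma \<Gamma>\<close> matches every incoming end with an outgoing end of the
  same factor, so the pairs of one factor can be collected: one pair for an arc, two for a
  crossing.\<close>

lemma fold_pair_sigma:
  assumes v: "v \<in> supported" and "finite T" "T \<subseteq> factors L"
  shows "Finite_Set.fold (pair_op (sigma \<Gamma>)) v (in_marks T) = smul (\<Prod>m\<in>in_marks T. slp m) (par T v)"
  using assms(2,3)
proof (induction T rule: finite_induct)
  case empty
  have "par {} v = v" by (simp add: par_def fun_eq_iff)
  then show ?case by (simp add: in_marks_def smul_simps)
next
  case (insert k T)
  interpret comp_fun_commute "pair_op (sigma \<Gamma>)"
    by (rule pair_op_comm_fun) (use sigma_bij in \<open>simp add: bij_def\<close>)
  have IH: "Finite_Set.fold (pair_op (sigma \<Gamma>)) v (in_marks T) = smul (\<Prod>m\<in>in_marks T. slp m) (par T v)"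
    using insert by simp
  have lin: "pair_op (sigma \<Gamma>) m (smul p w) = smul p (pair_op (sigma \<Gamma>) m w)" for m p w
    by (simp only: pair_op_def g_smul)
  show ?case
  proof (cases k)
    case (Inr a)
    have a: "a \<in> arcs L" using insert Inr by auto
    have i: "islot (fst a) = (Inr a, 1)" using islot_mark[of "Inr a" 1] a by (auto simp: in_slots_def)
    have "m = fst a" if "fst (islot m) = Inr a" for m
      using islot[of m] that by (auto simp: in_slots_def)
    then have M: "in_marks (insert k T) = insert (fst a) (in_marks T)" "fst a \<notin> in_marks T"
      using i insert(2) Inr by (auto simp: in_marks_def)
    show ?thesis
      unfolding M(1) fold_insert[OF finite M(2)] IH lin prod.insert[OF finite M(2)] par_insert[OF insert(1,2)]
      using pair_arc[OF a par_supported[OF v], of T] Inr by (simp add: smul_simps mult.commute)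
  next
    case (Inl c)
    have c: "c \<in> crossings L" using insert Inl by auto
    have i: "islot (ends L c 1) = (Inl c, 1)" "islot (ends L c 2) = (Inl c, 2)"
      using islot_mark[of "Inl c" 1] islot_mark[of "Inl c" 2] c by (auto simp: in_slots_def)
    have "m = ends L c 1 \<or> m = ends L c 2" if "fst (islot m) = Inl c" for m
      using islot[of m] that by (auto simp: in_slots_def)
    then have M: "in_marks (insert k T) = insert (ends L c 1) (insert (ends L c 2) (in_marks T))"
      "ends L c 2 \<notin> in_marks T" "ends L c 1 \<notin> insert (ends L c 2) (in_marks T)"
      using i insert(2) Inl ends_distinct[OF c] by (auto simp: in_marks_def)
    show ?thesis
      unfolding M(1) fold_insert[OF finite M(3)] fold_insert[OF finite M(2)] IH lin
        prod.insert[OF finite M(3)] prod.insert[OF finite M(2)] par_insert[OF insert(1,2)]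
      using pair_crossing[OF c par_supported[OF v], of T] Inl by (simp add: smul_simps mult_ac)
  qed
qed

text \<open>
  Multiplying out the Clifford generators at all slots in two ways -- grouped by factors, and by the
  cocycle condition -- determines the parity of a cocycle from the sign of a permutation of the marks.
\<close>

lemma cocycle_parity:
  assumes z: "z \<in> supported" "dd \<Gamma> z = 0" and G: "ev \<phi> (z G) \<noteq> 0" and \<Gamma>: "\<Gamma> \<subseteq> crossings L"
  shows "(- 1) ^ card {k \<in> factors L. fst (G k)} = (- 1) ^ (card \<Gamma> + card (UNIV :: 'm set)) * sign (sigma {})"
proof -
  define z0 where "z0 = (\<lambda>G. ev \<phi> (z G))"
  have z0: "z0 \<in> supported" using z by (auto simp: supported_def z0_def)
  have "in_marks (factors L) = UNIV"
    using islot slots_factors by (auto simp: in_marks_def) (metis prod.collapse)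
  then have "smul (\<Prod>m\<in>UNIV. slp m) (par (factors L) z0) =
      smul (of_int (sign (sigma \<Gamma>)) * (\<Prod>m\<in>UNIV. - slp m)) z0"
    using fold_pair_sigma[OF z0 finite_factors subset_refl]
      fold_pair_sign[OF z0 gin_gout_cocycle[OF res z, folded z0_def] sigma_permutes, of \<Gamma>] by simp
  from fun_cong[OF this, of G]
  have "(\<Prod>m\<in>UNIV. slp m) * (- 1) ^ card {k \<in> factors L. fst (G k)} * z0 G =
      of_int (sign (sigma \<Gamma>)) * (- 1) ^ card (UNIV :: 'm set) * (\<Prod>m\<in>UNIV. slp m) * z0 G"
    by (simp add: smul_def par_def prod_uminus mult.assoc)
  moreover have "(\<Prod>m\<in>UNIV. slp m) \<noteq> 0" using slope_nonzero[OF res] by simp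
  ultimately have "of_int ((- 1) ^ card {k \<in> factors L. fst (G k)}) =
      (of_int (sign (sigma \<Gamma>) * (- 1) ^ card (UNIV :: 'm set)) :: complex)"
    using G by (simp add: z0_def)
  then have "(- 1) ^ card {k \<in> factors L. fst (G k)} = sign (sigma \<Gamma>) * (- 1) ^ card (UNIV :: 'm set)"
    by (simp only: of_int_eq_iff)
  also have "sign (sigma \<Gamma>) = (- 1) ^ card \<Gamma> * sign (sigma {})"
    using finite_subset[OF \<Gamma> finite_crossings] \<Gamma> by (rule sign_sigma)
  finally show ?thesis by (simp add: power_add mult_ac)
qed

end

end

section \<open>Circles and permutations\<close>

lemma equiv_classes_range: "equiv_classes r = range (\<lambda>x. Collect (equivclp r x))"
  unfolding equiv_classes_def quotient_def by auto

lemma class_eq_iff: "Collect (equivclp r x) = Collect (equivclp r y) \<longleftrightarrow> equivclp r x y"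
  by (auto intro: equivclp_trans equivclp_sym)

lemma equiv_classes_cong:
  assumes "\<And>x y. r x y \<Longrightarrow> equivclp s x y" "\<And>x y. s x y \<Longrightarrow> equivclp r x y"
  shows "equiv_classes r = equiv_classes s"
proof -
  have le: "equivclp s x y" if "equivclp r x y" "\<And>x y. r x y \<Longrightarrow> equivclp s x y"
    for r s :: "'a \<Rightarrow> 'a \<Rightarrow> bool" and x y
    using that(1)
  proof (induction rule: equivclp_induct)
    case (step y z)
    then show ?case using that(2)[of y z] that(2)[of z y] by (meson equivclp_sym equivclp_trans)
  qed simp
  have "equivclp r = equivclp s" using le[OF _ assms(1)] le[OF _ assms(2)] by (auto simp: fun_eq_iff)
  then show ?thesis by (simp add: equiv_classes_def)
qed

text \<open>A path using the extra pair passes from the class of \<open>a\<close> to that of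
  \<open>b\<close> or back, so exactly these two classes are joined.\<close>

lemma card_equiv_classes_merge:
  fixes r :: "'a::finite \<Rightarrow> 'a \<Rightarrow> bool"
  assumes ab: "\<not> equivclp r a b"
  defines "r' \<equiv> \<lambda>x y. r x y \<or> (x = a \<and> y = b)"
  shows "card (equiv_classes r) = Suc (card (equiv_classes r'))"
proof -
  let ?C = "\<lambda>x. Collect (equivclp r x)"
  have 1: "equivclp r x y \<or> (equivclp r x a \<and> equivclp r b y) \<or> (equivclp r x b \<and> equivclp r a y)"
    if "equivclp r' x y" for x y
    using that
  proof (induction rule: equivclp_induct)
    case (step y z)
    from step.hyps(2) have "equivclp r y z \<or> (y = a \<and> z = b) \<or> (y = b \<and> z = a)"
      unfolding r'_def by blast
    then show ?case using step.IH by (metis equivclp_refl equivclp_sym equivclp_trans)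
  qed simp
  have mono: "equivclp r' x y" if "equivclp r x y" for x y
    using that by (induction rule: equivclp_induct) (auto simp: r'_def intro: equivclp_into_equivclp)
  have ab': "equivclp r' a b" unfolding r'_def by blast
  have E': "equivclp r' x y \<longleftrightarrow> equivclp r x y \<or> (equivclp r x a \<and> equivclp r b y) \<or> (equivclp r x b \<and> equivclp r a y)" for x y
    using 1[of x y] mono ab' by (meson equivclp_sym equivclp_trans)
  have cl: "Collect (equivclp r' x) = (if equivclp r a x \<or> equivclp r b x then ?C a \<union> ?C b else ?C x)" for x
  proof -
    have "equivclp r' x y \<longleftrightarrow> (if equivclp r a x \<or> equivclp r b x then equivclp r a y \<or> equivclp r b y else equivclp r x y)" for y
    proof -
      have tr: "equivclp r u v \<longleftrightarrow> equivclp r w v" if "equivclp r u w" for u v w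
        using that by (meson equivclp_sym equivclp_trans)
      have sy: "equivclp r u v \<longleftrightarrow> equivclp r v u" for u v by (meson equivclp_sym)
      consider "equivclp r a x" | "equivclp r b x" | "\<not> equivclp r a x" "\<not> equivclp r b x" by blast
      then show ?thesis
      proof cases
        case 1
        then show ?thesis unfolding E' using tr[OF 1, of y] tr[OF 1, of b] sy[of a x] ab by simp
      next
        case 2
        then show ?thesis
          unfolding E' using tr[OF 2, of y] tr[OF 2, of a] sy[of b x] sy[of b a] ab by auto
      next
        case 3
        then show ?thesis unfolding E' using sy[of a x] sy[of b x] by simp
      qed
    qed
    note cl = this
    show ?thesis unfolding set_eq_iff mem_Collect_eq cl by simp
  qed
  have ne: "?C a \<noteq> ?C b" using ab by (simp add: class_eq_iff)
  have "equiv_classes r' = insert (?C a \<union> ?C b) (equiv_classes r - {?C a, ?C b})"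
  proof (intro equalityI subsetI)
    fix X assume "X \<in> equiv_classes r'"
    then obtain x where "X = Collect (equivclp r' x)" by (auto simp: equiv_classes_range)
    then show "X \<in> insert (?C a \<union> ?C b) (equiv_classes r - {?C a, ?C b})"
      unfolding cl equiv_classes_range by (auto simp: class_eq_iff intro: equivclp_sym split: if_splits)
  next
    fix X assume "X \<in> insert (?C a \<union> ?C b) (equiv_classes r - {?C a, ?C b})"
    then have X: "X = ?C a \<union> ?C b \<or> (X \<in> equiv_classes r \<and> X \<noteq> ?C a \<and> X \<noteq> ?C b)" by blast
    show "X \<in> equiv_classes r'"
    proof (cases "X = ?C a \<union> ?C b")
      case True
      then have "X = Collect (equivclp r' a)" unfolding cl by simp
      then show ?thesis unfolding equiv_classes_range by blast
    next
      case False
      with X obtain x where x: "X = ?C x" "?C x \<noteq> ?C a" "?C x \<noteq> ?C b"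
        unfolding equiv_classes_range by blast
      then have "\<not> equivclp r a x" "\<not> equivclp r b x" unfolding class_eq_iff by (meson equivclp_sym)+
      then have "X = Collect (equivclp r' x)" using x(1) unfolding cl by simp
      then show ?thesis unfolding equiv_classes_range by blast
    qed
  qed
  moreover have "?C a \<union> ?C b \<notin> equiv_classes r - {?C a, ?C b}"
  proof
    assume "?C a \<union> ?C b \<in> equiv_classes r - {?C a, ?C b}"
    then obtain x where x: "?C a \<union> ?C b = ?C x" unfolding equiv_classes_range by blast
    have "a \<in> ?C a \<union> ?C b" "b \<in> ?C a \<union> ?C b" by simp_all
    then have "equivclp r x a" "equivclp r x b" unfolding x by simp_all
    then show False using ab by (meson equivclp_sym equivclp_trans)
  qed
  moreover have "card (equiv_classes r - {?C a, ?C b}) = card (equiv_classes r) - 2"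
    using ne by (subst card_Diff_subset) (auto simp: equiv_classes_range)
  moreover have "card {?C a, ?C b} \<le> card (equiv_classes r)"
    by (rule card_mono) (auto simp: equiv_classes_range)
  ultimately show ?thesis using ne by simp
qed

text \<open>Induction on the number of moved points. Composing with the transposition of
  \<open>a\<close> and \<open>f a\<close> makes \<open>a\<close> a fixed point and shortens its
  cycle; this flips the sign and adds one cycle.\<close>

lemma sign_eq_cycles:
  fixes f :: "'a::finite \<Rightarrow> 'a"
  assumes "bij f"
  shows "sign f = (- 1) ^ (card (UNIV :: 'a set) + card (equiv_classes (\<lambda>x y. y = f x)))"
  using assms
proof (induction "card {x. f x \<noteq> x}" arbitrary: f rule: less_induct)
  case less
  show ?case
  proof (cases "f = id")
    case True
    have "equivclp (\<lambda>x y. y = f x) x y \<longleftrightarrow> y = x" for x y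
    proof
      assume "equivclp (\<lambda>x y. y = f x) x y"
      then show "y = x" by (induction rule: equivclp_induct) (auto simp: True)
    qed simp
    then have "Collect (equivclp (\<lambda>x y. y = f x) x) = {x}" for x by auto
    then have "equiv_classes (\<lambda>x y. y = f x) = range (\<lambda>x. {x})" by (simp add: equiv_classes_range)
    then have "card (equiv_classes (\<lambda>x y. y = f x)) = card (UNIV :: 'a set)" by (simp add: card_image)
    then show ?thesis by (simp add: True flip: mult_2)
  next
    case False
    then obtain a where a: "f a \<noteq> a" by (auto simp: fun_eq_iff)
    define b where "b = f a"
    define f' where "f' = transpose a b \<circ> f"
    have inj: "f x = f y \<longleftrightarrow> x = y" for x y using less.prems by (auto simp: bij_def inj_def)
    have f': "f' x = (if x = a then a else if f x = a then b else f x)" for x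
      using inj[of x a] a by (auto simp: f'_def b_def transpose_def)
    have bij': "bij f'" unfolding f'_def using less.prems by (intro bij_comp bij_transpose)
    have "{x. f' x \<noteq> x} \<subset> {x. f x \<noteq> x}"
    proof
      show "{x. f' x \<noteq> x} \<subseteq> {x. f x \<noteq> x}" using a inj[of b a] by (auto simp: f' b_def split: if_splits)
      show "{x. f' x \<noteq> x} \<noteq> {x. f x \<noteq> x}" using a f'[of a] by auto
    qed
    then have IH: "sign f' = (- 1) ^ (card (UNIV :: 'a set) + card (equiv_classes (\<lambda>x y. y = f' x)))"
      by (intro less.hyps bij' psubset_card_mono) auto
    have na: "\<not> equivclp (\<lambda>x y. y = f' x) a b"
    proof
      assume "equivclp (\<lambda>x y. y = f' x) a b"
      then have "b = a"
      proof (induction rule: equivclp_induct)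
        case (step y z)
        then show ?case using bij' f'[of a] by (auto simp: bij_def inj_def)
      qed simp
      then show False using a by (simp add: b_def)
    qed
    have "equiv_classes (\<lambda>x y. y = f x) = equiv_classes (\<lambda>x y. y = f' x \<or> (x = a \<and> y = b))" (is "_ = equiv_classes ?s")
    proof (rule equiv_classes_cong)
      fix x y assume y: "y = f x"
      show "equivclp ?s x y"
      proof (cases "f x = a")
        case True
        then have "?s x b" "?s a b" using a f'[of x] by auto
        then have "equivclp ?s x b" "equivclp ?s a b" by (blast intro: r_into_equivclp)+
        from equivclp_trans[OF this(1) equivclp_sym[OF this(2)]] show ?thesis using y True by simp
      next
        case False
        then have "?s x y" using y f'[of x] by (auto simp: b_def)
        then show ?thesis by (rule r_into_equivclp)
      qed
    next
      fix x y assume s: "?s x y"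
      have st: "equivclp (\<lambda>x y. y = f x) z (f z)" for z by (rule r_into_equivclp) simp
      show "equivclp (\<lambda>x y. y = f x) x y"
      proof (cases "x = a \<and> y = b")
        case True
        then show ?thesis using st[of a] by (simp add: b_def)
      next
        case False
        then have y: "y = (if x = a then a else if f x = a then b else f x)" using s False unfolding f' by blast
        show ?thesis
        proof (cases "f x = a")
          case True
          then have "equivclp (\<lambda>x y. y = f x) x a" using st[of x] by simp
          from equivclp_trans[OF this st[of a]] show ?thesis using y True a by (auto simp: b_def)
        next
          case False
          then show ?thesis using y st[of x] by auto
        qed
      qed
    qed
    then have "card (equiv_classes (\<lambda>x y. y = f' x)) = Suc (card (equiv_classes (\<lambda>x y. y = f x)))"
      using card_equiv_classes_merge[OF na] by simp
    moreover have "sign f' = - sign f"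
    proof -
      have "permutation f" using less.prems by (simp add: permutation)
      then show ?thesis
        unfolding f'_def using a by (subst sign_compose) (auto simp: permutation_swap_id sign_swap_id b_def)
    qed
    ultimately show ?thesis using IH by simp
  qed
qed

section \<open>Duality over the field with two elements\<close>

declare add_bit_eq_xor [simp del] mult_bit_eq_and [simp del]

lemma UNIV_bit: "UNIV = {0, 1 :: bit}"
  using bit_not_zero_iff by blast

instance bit :: finite
  by standard (simp add: UNIV_bit)

lemma bit_add_self [simp]: "(x :: bit) + x = 0"
  by (cases "x = 0") (auto simp: add_bit_eq_xor)

lemma bit_add_eq_0: "(x :: bit) + y = 0 \<longleftrightarrow> x = y"
  by (cases "x = 0"; cases "y = 0") (auto simp: add_bit_eq_xor)

lemma card_fun_bit: "card (UNIV :: ('a::finite \<Rightarrow> bit) set) = 2 ^ card (UNIV :: 'a set)"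
proof -
  have "card (UNIV :: bit set) = 2" by (simp add: UNIV_bit)
  moreover have "(UNIV :: ('a \<Rightarrow> bit) set) = UNIV \<rightarrow>\<^sub>E UNIV" by auto
  ultimately show ?thesis by (metis card_funcsetE finite)
qed

definition bit_space :: "('a \<Rightarrow> bit) set \<Rightarrow> bool" where
  "bit_space W \<longleftrightarrow> (\<lambda>x. 0) \<in> W \<and> (\<forall>f\<in>W. \<forall>g\<in>W. (\<lambda>x. f x + g x) \<in> W)"

definition bit_linear :: "(('a \<Rightarrow> bit) \<Rightarrow> ('b \<Rightarrow> bit)) \<Rightarrow> bool" where
  "bit_linear T \<longleftrightarrow> (\<forall>f g x. T (\<lambda>x. f x + g x) x = T f x + T g x)"

text \<open>The nonempty fibres of a linear map are translates of its kernel.\<close>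

lemma card_kernel_image:
  fixes W :: "('a::finite \<Rightarrow> bit) set" and T :: "('a \<Rightarrow> bit) \<Rightarrow> 'b \<Rightarrow> bit"
  assumes W: "bit_space W" and T: "bit_linear T"
  shows "card W = card (T ` W) * card {w\<in>W. T w = (\<lambda>x. 0)}"
proof -
  have fin: "finite W" by simp
  have fib: "card {w\<in>W. T w = y} = card {w\<in>W. T w = (\<lambda>x. 0)}" if "y \<in> T ` W" for y
  proof -
    from that obtain w where w: "w \<in> W" "y = T w" by auto
    have "bij_betw (\<lambda>v x. w x + v x) {w\<in>W. T w = y} {w\<in>W. T w = (\<lambda>x. 0)}"
      by (rule bij_betw_byWitness[where f' = "\<lambda>v x. w x + v x"])
         (use w W T in \<open>auto simp: bit_space_def bit_linear_def fun_eq_iff\<close>)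
    then show ?thesis by (rule bij_betw_same_card)
  qed
  have "card W = (\<Sum>y\<in>T ` W. card {w\<in>W. T w = y})"
    using sum_fun_comp[of W "T ` W" T "\<lambda>_. 1 :: nat"] fin by simp
  also have "\<dots> = card (T ` W) * card {w\<in>W. T w = (\<lambda>x. 0)}" using fib by simp
  finally show ?thesis .
qed

section \<open>Orthogonal complements over the field with two elements\<close>

definition dot :: "('a::finite \<Rightarrow> bit) \<Rightarrow> ('a \<Rightarrow> bit) \<Rightarrow> bit" where
  "dot v w = (\<Sum>x\<in>UNIV. v x * w x)"

lemma dot_add: "dot (\<lambda>x. v x + w x) u = dot v u + dot w u" "dot u (\<lambda>x. v x + w x) = dot u v + dot u w"
  by (simp_all add: dot_def sum.distrib distrib_left distrib_right)

lemma dot_commute: "dot v w = dot w v"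
  by (simp add: dot_def mult.commute)

definition dual :: "('a::finite \<Rightarrow> bit) set \<Rightarrow> ('a \<Rightarrow> bit) set" where
  "dual W = {v. \<forall>w\<in>W. dot v w = 0}"

definition char_bit :: "bit \<Rightarrow> int" where "char_bit b = (if b = 0 then 1 else - 1)"

text \<open>Translation by an element with nonzero image under \<open>T\<close> permutes the space
  and flips the sign of every summand.\<close>

lemma char_sum:
  fixes W :: "('a::finite \<Rightarrow> bit) set"
  assumes W: "bit_space W" and T: "\<And>f g. T (\<lambda>x. f x + g x) = T f + T g"
  shows "(\<Sum>w\<in>W. char_bit (T w)) = (if \<forall>w\<in>W. T w = 0 then int (card W) else 0)"
proof (cases "\<forall>w\<in>W. T w = 0")
  case False
  then obtain w where w: "w \<in> W" "T w = 1" by (auto simp: bit_not_zero_iff)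
  have "(\<Sum>v\<in>W. char_bit (T v)) = (\<Sum>v\<in>W. char_bit (T (\<lambda>x. w x + v x)))"
    by (rule sum.reindex_bij_witness[where i = "\<lambda>v x. w x + v x" and j = "\<lambda>v x. w x + v x"])
       (use w W in \<open>auto simp: bit_space_def\<close>)
  also have "\<dots> = (\<Sum>v\<in>W. - char_bit (T v))"
    by (rule sum.cong) (auto simp: T w char_bit_def)
  finally have "(\<Sum>v\<in>W. char_bit (T v)) = 0" by (simp add: sum_negf)
  then show ?thesis using False by auto
qed (simp add: char_bit_def)

text \<open>Sum the signs of \<open>dot v w\<close> over all \<open>v\<close> and over
  \<open>w\<close> in \<open>W\<close>, in both orders; by \<open>char_sum\<close> each order counts
  one side of the equation.\<close>

lemma card_dual:
  fixes W :: "('a::finite \<Rightarrow> bit) set"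
  assumes W: "bit_space W"
  shows "card W * card (dual W) = 2 ^ card (UNIV :: 'a set)"
proof -
  have fin: "finite (A :: ('a \<Rightarrow> bit) set)" for A by simp
  have 0: "w = (\<lambda>x. 0)" if "\<And>v. dot v w = 0" for w :: "'a \<Rightarrow> bit"
  proof
    fix x
    have "dot (\<lambda>y. if y = x then 1 else 0) w = w x"
      by (simp add: dot_def if_distrib[of "\<lambda>z. z * _"] cong: if_cong)
    then show "w x = 0" using that by simp
  qed
  have "(\<Sum>v\<in>UNIV. \<Sum>w\<in>W. char_bit (dot v w)) = (\<Sum>v\<in>UNIV. if v \<in> dual W then int (card W) else 0)"
    by (rule sum.cong) (auto simp: char_sum[OF W, of "dot _"] dot_add dual_def)
  also have "\<dots> = int (card (dual W)) * int (card W)" using fin by (simp add: sum.If_cases)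
  finally have A: "(\<Sum>v\<in>UNIV. \<Sum>w\<in>W. char_bit (dot v w)) = int (card (dual W)) * int (card W)" .
  have U: "bit_space (UNIV :: ('a \<Rightarrow> bit) set)" by (simp add: bit_space_def)
  have "(\<Sum>v\<in>UNIV. \<Sum>w\<in>W. char_bit (dot v w)) = (\<Sum>w\<in>W. \<Sum>v\<in>UNIV. char_bit (dot v w))" by (rule sum.swap)
  also have "\<dots> = (\<Sum>w\<in>W. if w = (\<lambda>x. 0) then int (card (UNIV :: ('a \<Rightarrow> bit) set)) else 0)"
  proof (rule sum.cong[OF refl])
    fix w assume "w \<in> W"
    have "(\<forall>v\<in>UNIV. dot v w = 0) \<longleftrightarrow> w = (\<lambda>x. 0)" using 0[of w] by (auto simp: dot_def)
    then show "(\<Sum>v\<in>UNIV. char_bit (dot v w)) = (if w = (\<lambda>x. 0) then int (card (UNIV :: ('a \<Rightarrow> bit) set)) else 0)"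
      using char_sum[OF U, of "\<lambda>v. dot v w"] by (simp add: dot_add)
  qed
  also have "\<dots> = int (card (UNIV :: ('a \<Rightarrow> bit) set))" using W fin by (simp add: bit_space_def)
  finally have "int (card W * card (dual W)) = int (2 ^ card (UNIV :: 'a set))" using A by (simp add: card_fun_bit mult.commute)
  then show ?thesis by (simp only: of_nat_eq_iff)
qed

lemma bit_space_dual: "bit_space (dual W)"
  by (auto simp: bit_space_def dual_def dot_add) (simp add: dot_def)

lemma dual_dual:
  assumes W: "bit_space W" shows "dual (dual W) = W"
proof -
  have fin: "finite (A :: ('a \<Rightarrow> bit) set)" for A by simp
  have "card W * card (dual W) = card (dual W) * card (dual (dual W))"
    using card_dual[OF W] card_dual[OF bit_space_dual, of W] by simp
  moreover have "card (dual W) \<noteq> 0" using card_dual[OF W] by auto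
  ultimately have "card (dual (dual W)) = card W" by simp
  moreover have "W \<subseteq> dual (dual W)" by (auto simp: dual_def dot_commute)
  ultimately show ?thesis using fin by (metis card_subset_eq)
qed

text \<open>This turns the numbers of faces and of connected components into dimensions of spaces of
  functions.\<close>

lemma card_respecting:
  fixes r :: "'a::finite \<Rightarrow> 'a \<Rightarrow> bool"
  shows "card {f :: 'a \<Rightarrow> bit. \<forall>x y. r x y \<longrightarrow> f x = f y} = 2 ^ card (equiv_classes r)"
proof -
  let ?C = "\<lambda>x. Collect (equivclp r x)"
  have "bij_betw (\<lambda>g x. g (?C x)) (equiv_classes r \<rightarrow>\<^sub>E (UNIV :: bit set)) {f. \<forall>x y. r x y \<longrightarrow> f x = f y}"
  proof (rule bij_betwI')
    fix g h assume g: "g \<in> equiv_classes r \<rightarrow>\<^sub>E (UNIV :: bit set)" "h \<in> equiv_classes r \<rightarrow>\<^sub>E (UNIV :: bit set)"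
    show "((\<lambda>x. g (?C x)) = (\<lambda>x. h (?C x))) = (g = h)"
    proof
      assume "(\<lambda>x. g (?C x)) = (\<lambda>x. h (?C x))"
      then have "g X = h X" if "X \<in> equiv_classes r" for X
        using that unfolding equiv_classes_range by (auto dest: fun_cong)
      then show "g = h" using g by (intro PiE_ext) auto
    qed simp
  next
    fix g assume "g \<in> equiv_classes r \<rightarrow>\<^sub>E (UNIV :: bit set)"
    show "(\<lambda>x. g (?C x)) \<in> {f. \<forall>x y. r x y \<longrightarrow> f x = f y}"
    proof safe
      fix x y assume "r x y"
      then have "?C x = ?C y" unfolding class_eq_iff by blast
      then show "g (?C x) = g (?C y)" by simp
    qed
  next
    fix f :: "'a \<Rightarrow> bit" assume f: "f \<in> {f. \<forall>x y. r x y \<longrightarrow> f x = f y}"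
    have c: "f x = f y" if "equivclp r x y" for x y
      using that
    proof (induction rule: equivclp_induct)
      case (step y z)
      from step.hyps(2) have "f y = f z" using f by auto
      with step.IH show ?case by simp
    qed simp
    define g where "g = (\<lambda>X\<in>equiv_classes r. f (SOME x. x \<in> X))"
    have "f x = g (?C x)" for x
    proof -
      have "(SOME y. y \<in> ?C x) \<in> ?C x" by (rule someI[of _ x]) simp
      then have "f x = f (SOME y. y \<in> ?C x)" by (intro c) simp
      then show ?thesis by (simp add: g_def equiv_classes_range)
    qed
    then show "\<exists>g\<in>equiv_classes r \<rightarrow>\<^sub>E UNIV. f = (\<lambda>x. g (?C x))"
      by (intro bexI[of _ g]) (auto simp: g_def)
  qed
  from bij_betw_same_card[OF this] show ?thesis
    by (simp add: card_funcsetE UNIV_bit numeral_2_eq_2)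
qed

section \<open>Closed curves in a planar diagram cross evenly often\<close>

context gornik
begin

lemma sum_marks:
  fixes f :: "'m \<Rightarrow> 'r::comm_monoid_add"
  shows "(\<Sum>m\<in>UNIV. f m) = (\<Sum>c\<in>crossings L. f (ends L c 1) + f (ends L c 2)) + (\<Sum>a\<in>arcs L. f (fst a))"
  unfolding sum_in_slots[symmetric] sum_slots_expand by simp

section \<open>Faces, vertices and marks as a chain complex\<close>

definition face_rel :: "'m \<times> bool \<Rightarrow> 'm \<times> bool \<Rightarrow> bool" where
  "face_rel s t \<longleftrightarrow> (\<exists>(x, y)\<in>arcs L. \<exists>b. s = (x, b) \<and> t = (y, b)) \<or>
     (\<exists>c\<in>crossings L. (s, t) \<in>
       {((ends L c 1, True), (ends L c 3, True)),
        ((ends L c 2, False), (ends L c 4, False)),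
        ((ends L c 1, False), (ends L c 2, True)),
        ((ends L c 3, False), (ends L c 4, True))})"

definition graph_rel :: "'m \<Rightarrow> 'm \<Rightarrow> bool" where
  "graph_rel x y \<longleftrightarrow> (x, y) \<in> arcs L \<or>
     (\<exists>c\<in>crossings L. x \<in> ends L c ` {1..4} \<and> y \<in> ends L c ` {1..4})"

lemma ends_image: "ends L c ` {1..4} = {ends L c 1, ends L c 2, ends L c 3, ends L c 4}"
proof -
  have "{1..4::nat} = {1, 2, 3, 4}" by auto
  then show ?thesis by simp
qed

definition face_fun :: "('m \<times> bool \<Rightarrow> bit) set" where
  "face_fun = {f. \<forall>s t. face_rel s t \<longrightarrow> f s = f t}"

definition graph_fun :: "('m \<Rightarrow> bit) set" where
  "graph_fun = {f. \<forall>s t. graph_rel s t \<longrightarrow> f s = f t}"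

lemma face_fun_iff: "f \<in> face_fun \<longleftrightarrow> (\<forall>a\<in>arcs L. \<forall>b. f (fst a, b) = f (snd a, b)) \<and>
    (\<forall>c\<in>crossings L. f (ends L c 1, True) = f (ends L c 3, True) \<and> f (ends L c 2, False) = f (ends L c 4, False) \<and>
      f (ends L c 1, False) = f (ends L c 2, True) \<and> f (ends L c 3, False) = f (ends L c 4, True))"
  (is "_ \<longleftrightarrow> ?P")
proof
  assume "f \<in> face_fun"
  then have H: "f s = f t" if "face_rel s t" for s t using that unfolding face_fun_def by blast
  have "f (fst a, b) = f (snd a, b)" if "a \<in> arcs L" for a b
    by (rule H) (use that in \<open>auto simp: face_rel_def intro!: bexI[of _ a]\<close>)
  moreover have "f (ends L c 1, True) = f (ends L c 3, True)" "f (ends L c 2, False) = f (ends L c 4, False)"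
    "f (ends L c 1, False) = f (ends L c 2, True)" "f (ends L c 3, False) = f (ends L c 4, True)" if "c \<in> crossings L" for c
    using that by (intro H; unfold face_rel_def; blast)+
  ultimately show ?P by blast
next
  assume H: ?P
  show "f \<in> face_fun"
    unfolding face_fun_def mem_Collect_eq
  proof (intro allI impI)
    fix s t assume "face_rel s t"
    then consider a b where "a \<in> arcs L" "s = (fst a, b)" "t = (snd a, b)"
      | c where "c \<in> crossings L" "(s, t) \<in>
       {((ends L c 1, True), (ends L c 3, True)),
        ((ends L c 2, False), (ends L c 4, False)),
        ((ends L c 1, False), (ends L c 2, True)),
        ((ends L c 3, False), (ends L c 4, True))}"
      unfolding face_rel_def by fastforce
    then show "f s = f t"
    proof cases
      case 1
      then show ?thesis using H by blast
    next
      case 2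
      then have "f (ends L c 1, True) = f (ends L c 3, True)" "f (ends L c 2, False) = f (ends L c 4, False)"
        "f (ends L c 1, False) = f (ends L c 2, True)" "f (ends L c 3, False) = f (ends L c 4, True)"
        using H by blast+
      with 2(2) show ?thesis by (elim insertE emptyE) simp_all
    qed
  qed
qed

lemma graph_fun_iff: "f \<in> graph_fun \<longleftrightarrow> (\<forall>a\<in>arcs L. f (fst a) = f (snd a)) \<and>
    (\<forall>c\<in>crossings L. f (ends L c 1) = f (ends L c 2) \<and> f (ends L c 1) = f (ends L c 3) \<and> f (ends L c 1) = f (ends L c 4))"
proof (intro iffI conjI ballI)
  assume "f \<in> graph_fun"
  then have H: "f s = f t" if "graph_rel s t" for s t using that unfolding graph_fun_def by blast
  show "f (fst a) = f (snd a)" if "a \<in> arcs L" for a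
    by (rule H) (use that in \<open>simp add: graph_rel_def\<close>)
  fix c assume "c \<in> crossings L"
  then show "f (ends L c 1) = f (ends L c 2)" "f (ends L c 1) = f (ends L c 3)" "f (ends L c 1) = f (ends L c 4)"
    by (intro H; unfold graph_rel_def ends_image; blast)+
next
  assume H: "(\<forall>a\<in>arcs L. f (fst a) = f (snd a)) \<and>
    (\<forall>c\<in>crossings L. f (ends L c 1) = f (ends L c 2) \<and> f (ends L c 1) = f (ends L c 3) \<and> f (ends L c 1) = f (ends L c 4))"
  show "f \<in> graph_fun"
    unfolding graph_fun_def mem_Collect_eq
  proof (intro allI impI)
    fix s t assume "graph_rel s t"
    then consider "(s, t) \<in> arcs L" | c where "c \<in> crossings L" "s \<in> ends L c ` {1..4}" "t \<in> ends L c ` {1..4}"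
      unfolding graph_rel_def by blast
    then show "f s = f t"
    proof cases
      case 1
      then show ?thesis using H by fastforce
    next
      case 2
      then have "f s = f (ends L c 1)" "f t = f (ends L c 1)" using H unfolding ends_image by auto
      then show ?thesis by simp
    qed
  qed
qed

lemma card_face_fun: "card face_fun = 2 ^ card (diagram_faces L)"
  unfolding face_fun_def card_respecting diagram_faces_def face_rel_def ..

lemma card_graph_fun: "card graph_fun = 2 ^ card (graph_components L)"
  unfolding graph_fun_def card_respecting graph_components_def graph_rel_def ..

text \<open>The boundary map from faces to edges: a mark is an edge, lying between the faces on its
  two sides.\<close>

definition jump :: "('m \<times> bool \<Rightarrow> bit) \<Rightarrow> 'm \<Rightarrow> bit" where
  "jump f x = f (x, True) + f (x, False)"

definition pre_mark :: "'m \<Rightarrow> 'm" where "pre_mark = inv_into UNIV (sigma {})"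

lemma pre_mark_sigma [simp]: "pre_mark (sigma {} m) = m"
  using sigma_bij by (simp add: pre_mark_def bij_def)

text \<open>The coboundary from vertices to edges, where the vertices are the factors:
  \<open>h x\<close> is the value at the vertex where the mark \<open>x\<close> ends,
  \<open>h (pre_mark x)\<close> the value where it begins. On \<open>vertex_fun\<close> either
  predecessor at a crossing would give the same value.\<close>

definition cobd :: "('m \<Rightarrow> bit) \<Rightarrow> 'm \<Rightarrow> bit" where
  "cobd h x = h x + h (pre_mark x)"

text \<open>A function on the vertices is regarded as a function of the mark preceding the vertex.\<close>

definition vertex_fun :: "('m \<Rightarrow> bit) set" where
  "vertex_fun = {h. \<forall>c\<in>crossings L. h (ends L c 1) = h (ends L c 2)}"

lemma bit_space_face: "bit_space face_fun" and bit_space_vertex: "bit_space vertex_fun"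
  by (auto simp: bit_space_def face_fun_def vertex_fun_def)

lemma bit_linear_jump: "bit_linear jump" and bit_linear_cobd: "bit_linear cobd"
  by (auto simp: bit_linear_def jump_def cobd_def algebra_simps)

lemma bit_space_image:
  assumes "bit_space W" "bit_linear T" shows "bit_space (T ` W)"
proof -
  have T: "T (\<lambda>x. f x + g x) = (\<lambda>x. T f x + T g x)" for f g using assms(2) by (auto simp: bit_linear_def)
  have "T (\<lambda>x. 0) = (\<lambda>x. 0)" using T[of "\<lambda>x. 0" "\<lambda>x. 0"] by (simp add: fun_eq_iff)
  show ?thesis
    unfolding bit_space_def
  proof (intro conjI ballI)
    show "(\<lambda>x. 0) \<in> T ` W"
      using \<open>T (\<lambda>x. 0) = (\<lambda>x. 0)\<close>[symmetric] assms(1) by (intro image_eqI) (auto simp: bit_space_def)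
    fix f g assume "f \<in> T ` W" "g \<in> T ` W"
    then obtain u v where uv: "u \<in> W" "v \<in> W" "f = T u" "g = T v" by blast
    then have "(\<lambda>x. u x + v x) \<in> W" using assms(1) by (auto simp: bit_space_def)
    then show "(\<lambda>x. f x + g x) \<in> T ` W" unfolding uv(3,4) T[symmetric] by (rule imageI)
  qed
qed

lemma card_vertex_fun: "card vertex_fun = 2 ^ card (factors L)"
proof -
  let ?f = "\<lambda>m. fst (islot m)"
  have k: "?f m \<in> factors L" for m using islot(1)[of m] slots_factors by (metis prod.collapse)
  have c: "?f (ends L c 1) = Inl c" "?f (ends L c 2) = Inl c" if "c \<in> crossings L" for c
    using islot_mark[of "Inl c" 1] islot_mark[of "Inl c" 2] that by (auto simp: in_slots_def)
  have a: "?f (fst a) = Inr a" if "a \<in> arcs L" for a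
    using islot_mark[of "Inr a" 1] that by (auto simp: in_slots_def)
  have surj: "\<exists>m. k = ?f m" if "k \<in> factors L" for k
    using that c a by (cases k) (metis factors_iff)+
  have "bij_betw (\<lambda>g m. g (?f m)) (factors L \<rightarrow>\<^sub>E (UNIV :: bit set)) vertex_fun"
  proof (rule bij_betwI')
    fix g h assume g: "g \<in> factors L \<rightarrow>\<^sub>E (UNIV :: bit set)" "h \<in> factors L \<rightarrow>\<^sub>E (UNIV :: bit set)"
    show "((\<lambda>x. g (?f x)) = (\<lambda>x. h (?f x))) = (g = h)"
    proof
      assume "(\<lambda>x. g (?f x)) = (\<lambda>x. h (?f x))"
      then have "g k = h k" if "k \<in> factors L" for k
        using surj[OF that] by (auto dest: fun_cong)
      then show "g = h" using g by (intro PiE_ext) auto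
    qed simp
  next
    fix g assume "g \<in> factors L \<rightarrow>\<^sub>E (UNIV :: bit set)"
    show "(\<lambda>m. g (?f m)) \<in> vertex_fun" unfolding vertex_fun_def using c by (simp del: One_nat_def)
  next
    fix h assume h: "h \<in> vertex_fun"
    define g where "g = (\<lambda>k\<in>factors L. case k of Inl c \<Rightarrow> h (ends L c 1) | Inr a \<Rightarrow> h (fst a))"
    have "h m = g (?f m)" for m
    proof (cases m rule: mark_cases)
      case (arc b)
      then show ?thesis using a[of b] by (simp add: g_def)
    next
      case (first d)
      then show ?thesis using c[of d] by (simp add: g_def del: One_nat_def)
    next
      case (second d)
      then show ?thesis using c[of d] h by (simp add: g_def vertex_fun_def del: One_nat_def)
    qed
    then show "\<exists>g\<in>factors L \<rightarrow>\<^sub>E UNIV. h = (\<lambda>m. g (?f m))"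
      by (intro bexI[of _ g]) (auto simp: g_def)
  qed
  from bij_betw_same_card[OF this] show ?thesis
    by (simp add: card_funcsetE UNIV_bit numeral_2_eq_2)
qed

lemma sigma0: "c \<in> crossings L \<Longrightarrow> sigma {} (ends L c 1) = ends L c 3" "c \<in> crossings L \<Longrightarrow> sigma {} (ends L c 2) = ends L c 4"
  using sigma_crossing[of c "{}"] by auto

text \<open>Equal colours on the two sides of every mark spread over a connected component of the
  graph. This is the top homology, one fundamental class for each component.\<close>

lemma card_ker_jump: "card {f\<in>face_fun. jump f = (\<lambda>x. 0)} = card graph_fun"
proof -
  have "bij_betw (\<lambda>h (x, b). h x) graph_fun {f\<in>face_fun. jump f = (\<lambda>x. 0)}"
  proof (rule bij_betw_byWitness[where f' = "\<lambda>f x. f (x, True)"])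
    show "\<forall>f\<in>{f \<in> face_fun. jump f = (\<lambda>x. 0)}. (\<lambda>(x, b). f (x, True)) = f"
    proof
      fix f assume "f \<in> {f \<in> face_fun. jump f = (\<lambda>x. 0)}"
      then have "f (x, True) = f (x, False)" for x
        by (auto simp: jump_def fun_eq_iff bit_add_eq_0)
      then show "(\<lambda>(x, b). f (x, True)) = f" by (auto simp: fun_eq_iff) (metis (full_types))
    qed
    show "(\<lambda>h (x, b). h x) ` graph_fun \<subseteq> {f \<in> face_fun. jump f = (\<lambda>x. 0)}"
    proof safe
      fix h assume h: "h \<in> graph_fun"
      then show "(\<lambda>(x, b). h x) \<in> face_fun" unfolding face_fun_iff graph_fun_iff by (simp, metis)
      show "jump (\<lambda>(x, b). h x) = (\<lambda>x. 0)" by (simp add: jump_def fun_eq_iff)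
    qed
    show "(\<lambda>f x. f (x, True)) ` {f \<in> face_fun. jump f = (\<lambda>x. 0)} \<subseteq> graph_fun"
    proof safe
      fix f assume f: "f \<in> face_fun" "jump f = (\<lambda>x. 0)"
      then have "f (x, False) = f (x, True)" for x
        by (auto simp: jump_def fun_eq_iff bit_add_eq_0)
      then show "(\<lambda>x. f (x, True)) \<in> graph_fun"
        using f(1) unfolding graph_fun_iff face_fun_iff by simp
    qed
  qed auto
  from bij_betw_same_card[OF this] show ?thesis by simp
qed

lemma ker_cobd: "{h\<in>vertex_fun. cobd h = (\<lambda>x. 0)} = graph_fun"
proof (intro equalityI subsetI)
  fix h assume h: "h \<in> {h\<in>vertex_fun. cobd h = (\<lambda>x. 0)}"
  have s: "h (sigma {} m) = h m" for m
  proof -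
    have "cobd h (sigma {} m) = 0" using h by simp
    then show ?thesis by (simp add: cobd_def bit_add_eq_0)
  qed
  show "h \<in> graph_fun"
    unfolding graph_fun_iff
  proof (intro conjI ballI)
    fix a assume "a \<in> arcs L"
    then show "h (fst a) = h (snd a)" using s[of "fst a"] by (simp add: sigma_arc)
  next
    fix c assume c: "c \<in> crossings L"
    show 1: "h (ends L c 1) = h (ends L c 2)" using h c by (simp add: vertex_fun_def)
    show "h (ends L c 1) = h (ends L c 3)" using s[of "ends L c 1"] sigma0(1)[OF c] by simp
    show "h (ends L c 1) = h (ends L c 4)" using s[of "ends L c 2"] sigma0(2)[OF c] 1 by simp
  qed
next
  fix h assume h: "h \<in> graph_fun"
  have s: "h (sigma {} m) = h m" for m
    using h unfolding graph_fun_iff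
    by (cases m rule: mark_cases) (auto simp: sigma_arc sigma0 simp del: One_nat_def)
  have "cobd h x = 0" for x
  proof -
    obtain m where "x = sigma {} m" using sigma_bij by (metis bij_pointE)
    then show ?thesis by (simp add: cobd_def s)
  qed
  then show "h \<in> {h\<in>vertex_fun. cobd h = (\<lambda>x. 0)}"
    using h by (auto simp: graph_fun_iff vertex_fun_def fun_eq_iff)
qed

text \<open>Summation by parts: the sum over edges becomes a sum over vertices, each with the total
  of \<open>w\<close> on the adjacent ends.\<close>

lemma dot_cobd:
  assumes "h \<in> vertex_fun"
  shows "dot (cobd h) w = (\<Sum>c\<in>crossings L. h (ends L c 1) * (w (ends L c 1) + w (ends L c 2) + w (ends L c 3) + w (ends L c 4))) +
    (\<Sum>a\<in>arcs L. h (fst a) * (w (fst a) + w (snd a)))"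
proof -
  have "dot (cobd h) w = (\<Sum>x\<in>UNIV. h x * w x) + (\<Sum>x\<in>UNIV. h (pre_mark x) * w x)"
    by (simp add: dot_def cobd_def distrib_right sum.distrib)
  also have "(\<Sum>x\<in>UNIV. h (pre_mark x) * w x) = (\<Sum>x\<in>UNIV. h x * w (sigma {} x))"
    using sum.reindex_bij_betw[OF sigma_bij, of "\<lambda>x. h (pre_mark x) * w x" "{}"] by simp
  finally have "dot (cobd h) w = (\<Sum>x\<in>UNIV. h x * (w x + w (sigma {} x)))"
    by (simp add: sum.distrib distrib_left)
  also have "\<dots> = (\<Sum>c\<in>crossings L. h (ends L c 1) * (w (ends L c 1) + w (ends L c 3)) + h (ends L c 2) * (w (ends L c 2) + w (ends L c 4)))
      + (\<Sum>a\<in>arcs L. h (fst a) * (w (fst a) + w (snd a)))"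
    unfolding sum_marks by (simp add: sigma0[unfolded One_nat_def] sigma_arc)
  also have "(\<Sum>c\<in>crossings L. h (ends L c 1) * (w (ends L c 1) + w (ends L c 3)) + h (ends L c 2) * (w (ends L c 2) + w (ends L c 4)))
      = (\<Sum>c\<in>crossings L. h (ends L c 1) * (w (ends L c 1) + w (ends L c 2) + w (ends L c 3) + w (ends L c 4)))"
    by (rule sum.cong) (use assms in \<open>auto simp: vertex_fun_def distrib_left add_ac\<close>)
  finally show ?thesis .
qed

text \<open>Planarity says that the first homology with two-element coefficients vanishes.\<close>

lemma jump_image: "jump ` face_fun = dual (cobd ` vertex_fun)"
proof -
  let ?I = "jump ` face_fun" and ?D = "cobd ` vertex_fun"
  have I: "bit_space ?I" and D: "bit_space ?D"
    by (rule bit_space_image bit_space_face bit_space_vertex bit_linear_jump bit_linear_cobd)+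
  have sub: "?D \<subseteq> dual ?I"
  proof -
    have "dot (cobd h) (jump f) = 0" if h: "h \<in> vertex_fun" and f: "f \<in> face_fun" for h f
    proof -
      have 1: "jump f (ends L c 1) + jump f (ends L c 2) + jump f (ends L c 3) + jump f (ends L c 4) = 0"
        if "c \<in> crossings L" for c
      proof -
        \<comment> \<open>Around a crossing each of the four regions borders two neighbouring ends,
          so its colour occurs twice.\<close>
        have *: "a + b + (b + d) + (a + e) + (e + d) = (0 :: bit)" for a b d e
          by (cases "a = 0"; cases "b = 0"; cases "d = 0"; cases "e = 0") auto
        show ?thesis
          unfolding jump_def
          using f that *[of "f (ends L c 3, True)" "f (ends L c 2, True)" "f (ends L c 4, False)" "f (ends L c 4, True)"]
          unfolding face_fun_iff by simp
      qed
      have 2: "jump f (fst a) + jump f (snd a) = 0" if "a \<in> arcs L" for a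
        using f that unfolding face_fun_iff jump_def by simp
      show ?thesis unfolding dot_cobd[OF h] using 1 2 by simp
    qed
    then show ?thesis by (auto simp: dual_def)
  qed
  have *: "card ?D * card graph_fun * (card ?I * card graph_fun) = 2 ^ card (factors L) * 2 ^ card (diagram_faces L)"
    using card_kernel_image[OF bit_space_face bit_linear_jump] card_kernel_image[OF bit_space_vertex bit_linear_cobd]
    unfolding card_ker_jump ker_cobd card_vertex_fun card_face_fun by simp
  then have "(card ?D * card ?I) * 2 ^ (2 * card (graph_components L)) = 2 ^ (card (factors L) + card (diagram_faces L))"
  proof -
    have "(2 :: nat) ^ (2 * card (graph_components L)) = card graph_fun * card graph_fun"
      unfolding card_graph_fun mult_2 power_add ..
    then show ?thesis using * unfolding power_add by (simp only: mult_ac)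
  qed
  \<comment> \<open>Euler's formula for the graph with factors as vertices and marks as edges;
    counting marks by their incoming ends converts \<open>planar\<close> to this form.\<close>
  also have "card (factors L) + card (diagram_faces L) = card (UNIV :: 'm set) + 2 * card (graph_components L)"
  proof -
    have "planar L" using diagram by (simp add: link_diagram_def)
    moreover have "card (factors L) = card (arcs L) + card (crossings L)"
      by (simp add: factors_def card_Plus finite_crossings)
    ultimately show ?thesis using card_marks by (simp add: planar_def)
  qed
  finally have "card ?D * card ?I = 2 ^ card (UNIV :: 'm set)"
    by (simp add: power_add)
  then have "card ?D * card ?I = card (dual ?I) * card ?I" using card_dual[OF I] by (simp add: mult.commute)
  moreover have "card ?I \<noteq> 0" using card_dual[OF I] by auto
  ultimately have "card ?D = card (dual ?I)" by simp
  then have "?D = dual ?I" using sub by (metis card_subset_eq finite)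
  then show ?thesis using dual_dual[OF I] by simp
qed

section \<open>Closed curves and the parity of their crossings\<close>

definition link_closed :: "'m set \<Rightarrow> bool" where
  "link_closed A \<longleftrightarrow> (\<forall>a\<in>arcs L. fst a \<in> A \<longleftrightarrow> snd a \<in> A) \<and>
     (\<forall>c\<in>crossings L. (ends L c 1 \<in> A \<longleftrightarrow> ends L c 4 \<in> A) \<and> (ends L c 2 \<in> A \<longleftrightarrow> ends L c 3 \<in> A))"

lemma of_nat_bit: "(of_nat k :: bit) = 0 \<longleftrightarrow> even k"
  by (induction k) (auto simp: add_bit_eq_xor)

text \<open>The indicator of \<open>A\<close> is a cycle, hence the jump of a colouring
  \<open>f\<close> of the faces. Along the curves of \<open>B\<close>, followed straight through all
  crossings, the colour on the left changes exactly where a strand of \<open>A\<close> is crossed,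
  and on closed curves the changes add up to zero.\<close>

lemma even_crossings:
  assumes A: "link_closed A" and B: "link_closed B" and disj: "A \<inter> B = {}"
  shows "even (card {c\<in>crossings L. ends L c 1 \<in> A \<and> ends L c 2 \<in> B \<or> ends L c 1 \<in> B \<and> ends L c 2 \<in> A})"
proof -
  define g where "g x = (of_bool (x \<in> A) :: bit)" for x
  have "g \<in> dual (cobd ` vertex_fun)"
  proof -
    have "dot (cobd h) g = 0" if h: "h \<in> vertex_fun" for h
    proof -
      have "g (ends L c 1) + g (ends L c 2) + g (ends L c 3) + g (ends L c 4) = 0" if "c \<in> crossings L" for c
      proof -
        have "g (ends L c 3) = g (ends L c 2)" "g (ends L c 4) = g (ends L c 1)"
          using A that by (auto simp: link_closed_def g_def)
        moreover have "a + b + b + a = 0" for a b :: bit by (cases "a = 0"; cases "b = 0") auto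
        ultimately show ?thesis by simp
      qed
      moreover have "g (fst a) + g (snd a) = 0" if "a \<in> arcs L" for a
        using A that by (auto simp: link_closed_def g_def)
      ultimately show ?thesis unfolding dot_cobd[OF h] by simp
    qed
    then show ?thesis by (auto simp: dual_def dot_commute[of g])
  qed
  then obtain f where f: "f \<in> face_fun" "g = jump f" unfolding jump_image[symmetric] by auto
  \<comment> \<open>The colour to the left on marks of \<open>B\<close> and zero elsewhere; its
    total is unchanged by the permutation that runs along the link.\<close>
  define w where "w x = (if x \<in> B then f (x, True) else 0)" for x
  let ?lam = "sigma (crossings L)"
  have lc: "?lam (ends L c 1) = ends L c 4" "?lam (ends L c 2) = ends L c 3" if "c \<in> crossings L" for c
    using sigma_crossing[OF that, of "crossings L"] that by auto
  have "(\<Sum>x\<in>UNIV. w (?lam x)) = (\<Sum>x\<in>UNIV. w x)"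
    by (rule sum.reindex_bij_betw[OF sigma_bij])
  then have "0 = (\<Sum>x\<in>UNIV. w x + w (?lam x))" by (simp add: sum.distrib)
  also have "\<dots> = (\<Sum>c\<in>crossings L. (w (ends L c 1) + w (ends L c 4)) + (w (ends L c 2) + w (ends L c 3))) +
      (\<Sum>a\<in>arcs L. w (fst a) + w (snd a))"
    unfolding sum_marks by (simp add: lc[unfolded One_nat_def] sigma_arc)
  also have "(\<Sum>a\<in>arcs L. w (fst a) + w (snd a)) = 0"
  proof (rule sum.neutral, rule ballI)
    fix a assume a: "a \<in> arcs L"
    then have "w (fst a) = w (snd a)"
      using B f(1) unfolding face_fun_iff link_closed_def w_def by auto
    then show "w (fst a) + w (snd a) = 0" by simp
  qed
  also have "(\<Sum>c\<in>crossings L. (w (ends L c 1) + w (ends L c 4)) + (w (ends L c 2) + w (ends L c 3))) =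
    (\<Sum>c\<in>crossings L. of_bool (ends L c 1 \<in> A \<and> ends L c 2 \<in> B \<or> ends L c 1 \<in> B \<and> ends L c 2 \<in> A))"
  proof (rule sum.cong[OF refl])
    fix c assume c: "c \<in> crossings L"
    have F: "f (ends L c 1, True) = f (ends L c 3, True)" "f (ends L c 1, False) = f (ends L c 2, True)"
      "f (ends L c 3, False) = f (ends L c 4, True)" using f(1) c unfolding face_fun_iff by auto
    have J: "f (ends L c 3, True) + f (ends L c 4, True) = of_bool (ends L c 3 \<in> A)"
      "f (ends L c 3, True) + f (ends L c 2, True) = of_bool (ends L c 1 \<in> A)"
      using fun_cong[OF f(2), of "ends L c 3"] fun_cong[OF f(2), of "ends L c 1"]
      unfolding jump_def g_def F by simp_all
    have e: "ends L c 3 \<in> A \<longleftrightarrow> ends L c 2 \<in> A" "ends L c 4 \<in> B \<longleftrightarrow> ends L c 1 \<in> B" "ends L c 3 \<in> B \<longleftrightarrow> ends L c 2 \<in> B"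
      using A B c by (auto simp: link_closed_def)
    have 1: "w (ends L c 1) + w (ends L c 4) = of_bool (ends L c 1 \<in> B \<and> ends L c 2 \<in> A)"
      using J(1) e unfolding w_def F(1) by auto
    have 2: "w (ends L c 2) + w (ends L c 3) = of_bool (ends L c 2 \<in> B \<and> ends L c 1 \<in> A)"
      using J(2) e unfolding w_def by (auto simp: add.commute)
    show "(w (ends L c 1) + w (ends L c 4)) + (w (ends L c 2) + w (ends L c 3)) =
       of_bool (ends L c 1 \<in> A \<and> ends L c 2 \<in> B \<or> ends L c 1 \<in> B \<and> ends L c 2 \<in> A)"
      unfolding 1 2 using disj by (auto simp: of_bool_def)
  qed
  also have "(\<Sum>c\<in>crossings L. of_bool (ends L c 1 \<in> A \<and> ends L c 2 \<in> B \<or> ends L c 1 \<in> B \<and> ends L c 2 \<in> A) :: bit) =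
     of_nat (card {c\<in>crossings L. ends L c 1 \<in> A \<and> ends L c 2 \<in> B \<or> ends L c 1 \<in> B \<and> ends L c 2 \<in> A})"
    using finite_crossings by (simp add: of_bool_def sum.If_cases Int_def)
  finally show ?thesis by (simp add: of_nat_bit)
qed

text \<open>Order the values of the state and sort the thick edges by the smaller of their two
  values. Those with smaller value \<open>i\<close> are the crossings between the strands of value
  \<open>i\<close> and the strands of larger value, two disjoint unions of closed curves.\<close>

lemma even_card_resolved:
  assumes "resolved \<Gamma> \<phi>" "\<Gamma> \<subseteq> crossings L"
  shows "even (card \<Gamma>)"
proof -
  \<comment> \<open>Numbering the finitely many values supplies an order on them.\<close>
  have "\<exists>\<kappa>::complex \<Rightarrow> nat. inj_on \<kappa> (range \<phi>)" using finite_imp_inj_to_nat_seg[of "range \<phi>"] by auto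
  then obtain \<kappa> :: "complex \<Rightarrow> nat" where \<kappa>: "inj_on \<kappa> (range \<phi>)" by auto
  define k where "k m = \<kappa> (\<phi> m)" for m
  have k: "k m = k m' \<longleftrightarrow> \<phi> m = \<phi> m'" for m m' using \<kappa> by (auto simp: k_def inj_on_def)
  let ?m = "\<lambda>c. min (k (ends L c 1)) (k (ends L c 2))"
  have cl: "link_closed {m. P (k m)}" for P
    using assms(1) by (auto simp: link_closed_def resolved_def k_def)
  have "{c\<in>\<Gamma>. ?m c = i} = {c\<in>crossings L. ends L c 1 \<in> {m. k m = i} \<and> ends L c 2 \<in> {m. k m > i} \<or>
      ends L c 1 \<in> {m. k m > i} \<and> ends L c 2 \<in> {m. k m = i}}" for i
  proof -
    have "c \<in> \<Gamma> \<longleftrightarrow> c \<in> crossings L \<and> k (ends L c 1) \<noteq> k (ends L c 2)" for c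
      using assms by (auto simp: resolved_def k)
    note g = this
    show ?thesis
    proof (rule Collect_cong)
      fix c
      have "(x \<noteq> y \<and> min x y = i) \<longleftrightarrow> (x = i \<and> y > i \<or> x > i \<and> y = i)" for x y :: nat
        by linarith
      then show "(c \<in> \<Gamma> \<and> ?m c = i) \<longleftrightarrow> (c \<in> crossings L \<and> (ends L c 1 \<in> {m. k m = i} \<and> ends L c 2 \<in> {m. k m > i} \<or>
          ends L c 1 \<in> {m. k m > i} \<and> ends L c 2 \<in> {m. k m = i}))"
        unfolding g mem_Collect_eq by blast
    qed
  qed
  then have ev: "even (card {c\<in>\<Gamma>. ?m c = i})" for i
    using even_crossings[OF cl cl, of "\<lambda>x. x = i" "\<lambda>x. x > i"] by auto
  have fin: "finite \<Gamma>" using assms(2) finite_crossings by (rule finite_subset)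
  have "card \<Gamma> = (\<Sum>i\<in>?m ` \<Gamma>. card {c\<in>\<Gamma>. ?m c = i})"
    using sum_fun_comp[of \<Gamma> "?m ` \<Gamma>" ?m "\<lambda>_. 1 :: nat"] fin by simp
  then show ?thesis using ev by (simp add: dvd_sum)
qed

lemma resolution_circles_sigma: "resolution_circles L = equiv_classes (\<lambda>x y. y = sigma {} x)"
  unfolding resolution_circles_def
proof (rule arg_cong[where f = equiv_classes], intro ext iffI)
  fix x y assume "(x, y) \<in> arcs L \<or> (\<exists>c\<in>crossings L. (x, y) \<in> {(ends L c 1, ends L c 3), (ends L c 2, ends L c 4)})"
  then show "y = sigma {} x" using sigma_arc[of "(x, y)" "{}"] sigma0 by auto
next
  fix x y assume y: "y = sigma {} x"
  show "(x, y) \<in> arcs L \<or> (\<exists>c\<in>crossings L. (x, y) \<in> {(ends L c 1, ends L c 3), (ends L c 2, ends L c 4)})"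
  proof (cases x rule: mark_cases)
    case (arc a)
    then show ?thesis using y by (simp add: sigma_arc)
  qed (use y sigma0 in auto)
qed

text \<open>The number of marks enters twice, through the signs of the slopes and through the sign
  of the permutation, and cancels. The number of thick edges is even, which leaves the number of
  circles.\<close>

lemma cocycle_odd_gen:
  assumes "resolved \<Gamma> \<phi>" "\<Gamma> \<subseteq> crossings L" "z \<in> supported" "dd \<Gamma> z = 0" "ev \<phi> (z G) \<noteq> 0"
  shows "odd_gen L G \<longleftrightarrow> circle_parity L"
proof -
  have "(- 1 :: int) ^ card {k \<in> factors L. fst (G k)} =
      (- 1) ^ (card \<Gamma> + card (UNIV :: 'm set)) * (- 1) ^ (card (UNIV :: 'm set) + card (resolution_circles L))"
    using cocycle_parity[OF assms(1,3,4,5,2)] sign_eq_cycles[OF sigma_bij, of "{}"]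
    unfolding resolution_circles_sigma by simp
  also have "\<dots> = (- 1) ^ (card \<Gamma> + 2 * card (UNIV :: 'm set) + card (resolution_circles L))"
    by (simp add: mult_2 add_ac flip: power_add)
  finally show ?thesis
    using even_card_resolved[OF assms(1,2)] unfolding odd_gen_def circle_parity_def
    by (auto simp: minus_one_power_iff split: if_splits)
qed

end

section \<open>The cube of resolutions\<close>

context gornik
begin

subsection \<open>The maps between resolutions\<close>

text \<open>Both arc polynomials expressed through \<open>u1\<close>, \<open>u2\<close> and
  \<open>a1\<close>, so that compatibility with the differentials becomes a polynomial identity
  without quotients. The second relation compares the potentials of the two resolutions after
  multiplication by \<open>x1 - x3\<close>.\<close>

lemma pi_relations:
  "pi_at n (gvar 2) (gvar 4) = u1_poly n + gvar 3 * u2_poly n - a1_poly n * (gvar 1 - gvar 3)"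
  "pi_at n (gvar 1) (gvar 3) = pi_at n (gvar 2) (gvar 4) - u2_poly n * (gvar 3 - gvar 2) + a1_poly n * sum_diff"
proof -
  show 1: "pi_at n (gvar 2) (gvar 4) = u1_poly n + gvar 3 * u2_poly n - a1_poly n * (gvar 1 - gvar 3)"
    unfolding a1_poly_mult by simp
  have nz: "gvar 1 - gvar 3 \<noteq> 0"
    by (rule mpoly_neq_0_ev[of "\<lambda>i. of_nat i"]) (simp add: ev_simps)
  have "pi_at n (gvar 1) (gvar 3) * (gvar 1 - gvar 3) + pi_at n (gvar 2) (gvar 4) * (gvar 2 - gvar 4)
      = u1_poly n * sum_diff + u2_poly n * prod_diff"
    unfolding pi_at_mult u_poly_potential by simp
  then have "(pi_at n (gvar 1) (gvar 3) - (pi_at n (gvar 2) (gvar 4) - u2_poly n * (gvar 3 - gvar 2) + a1_poly n * sum_diff)) * (gvar 1 - gvar 3) =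
     (u1_poly n * sum_diff + u2_poly n * prod_diff) - pi_at n (gvar 2) (gvar 4) * (gvar 2 - gvar 4)
     - (pi_at n (gvar 2) (gvar 4) - u2_poly n * (gvar 3 - gvar 2)) * (gvar 1 - gvar 3) - sum_diff * (a1_poly n * (gvar 1 - gvar 3))"
    by (simp add: algebra_simps)
  also have "\<dots> = 0"
    unfolding a1_poly_mult by (simp add: sum_diff_def prod_diff_def algebra_simps)
  finally show "pi_at n (gvar 1) (gvar 3) = pi_at n (gvar 2) (gvar 4) - u2_poly n * (gvar 3 - gvar 2) + a1_poly n * sum_diff"
    using nz by simp
qed

definition chi_mat :: "'c set \<Rightarrow> 'c \<Rightarrow> local_gen \<Rightarrow> local_gen \<Rightarrow> 'm mpoly" where
  "chi_mat \<Gamma> c = (if c \<in> \<Gamma> then chi1_local else chi0_local) n (end_var L c)"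

lemma chi_chain_eq: "chi_chain n L \<Gamma> c = even_op (Inl c) (chi_mat \<Gamma> c)"
  by (simp add: fun_eq_iff chi_chain_def even_op_def chi_mat_def)

lemma is_even_chi_mat [simp]: "is_even (chi_mat \<Gamma> c)"
  by (simp add: chi_mat_def chi0_local_def chi1_local_def)

lemma lvec_switch_other: "k \<noteq> Inl c \<Longrightarrow> lvec (switch c \<Gamma>) k = lvec \<Gamma> k"
  by (cases k) (auto simp: lvec_def switch_def)

lemma switch_mem [simp]: "c \<in> switch c \<Gamma> \<longleftrightarrow> c \<notin> \<Gamma>" "c' \<noteq> c \<Longrightarrow> c' \<in> switch c \<Gamma> \<longleftrightarrow> c' \<in> \<Gamma>"
  by (auto simp: switch_def)

lemma switch_switch [simp]: "switch c (switch c \<Gamma>) = \<Gamma>"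
  by (auto simp: switch_def)

lemma switch_commute: "switch c (switch c' \<Gamma>) = switch c' (switch c \<Gamma>)"
  by (auto simp: switch_def)

lemma switch_subset: "c \<in> crossings L \<Longrightarrow> \<Gamma> \<subseteq> crossings L \<Longrightarrow> switch c \<Gamma> \<subseteq> crossings L"
  by (auto simp: switch_def)

lemma chi_mat_koszul:
  assumes "c \<in> crossings L"
  shows "mat_prod (Inl c) (chi_mat \<Gamma> c) (koszul (lvec \<Gamma> (Inl c))) =
    mat_prod (Inl c) (koszul (lvec (switch c \<Gamma>) (Inl c))) (chi_mat \<Gamma> c)"
proof -
  have s: "subst (end_var L c) p = loc (Inl c) p" for p
    unfolding loc_def by (rule arg_cong[where f = "\<lambda>f. subst f p"]) (auto simp: end_var_def)
  define x where "x = (\<lambda>e. Var (ends L c e) :: 'm mpoly)"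
  define u1 u2 a1 where "u1 = loc (Inl c) (u1_poly n)" and "u2 = loc (Inl c) (u2_poly n)" and "a1 = loc (Inl c) (a1_poly n)"
  have x: "loc (Inl c) (gvar e) = x e" "end_var L c e = x e" "Var (ends L c e) = x e" for e
    by (simp_all add: x_def end_var_def)
  have sd: "loc (Inl c) sum_diff = x 1 + x 2 - x 3 - x 4" "loc (Inl c) prod_diff = x 1 * x 2 - x 3 * x 4"
    by (simp_all only: sum_diff_def prod_diff_def loc_simps x)
  have p24: "loc (Inl c) (pi_at n (gvar 2) (gvar 4)) = u1 + x 3 * u2 - a1 * (x 1 - x 3)"
    by (simp only: pi_relations(1) loc_simps x u1_def u2_def a1_def)
  have p13: "loc (Inl c) (pi_at n (gvar 1) (gvar 3)) =
      u1 + x 3 * u2 - a1 * (x 1 - x 3) - u2 * (x 3 - x 2) + a1 * (x 1 + x 2 - x 3 - x 4)"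
    by (simp only: pi_relations(2) loc_simps x u2_def[symmetric] a1_def[symmetric] p24 sd)
  show ?thesis
  proof (intro ext)
    fix g e :: local_gen
    show "mat_prod (Inl c) (chi_mat \<Gamma> c) (koszul (lvec \<Gamma> (Inl c))) g e =
      mat_prod (Inl c) (koszul (lvec (switch c \<Gamma>) (Inl c))) (chi_mat \<Gamma> c) g e"
      by (cases "c \<in> \<Gamma>"; cases g; cases e; cases "fst g"; cases "snd g"; cases "fst e"; cases "snd e")
         (simp_all add: mat_prod_def sum_local_gens_Inl chi_mat_def chi0_local_def chi1_local_def koszul_def
           odd_map_def even_map_def entry_def lvec_def s loc_simps x sd[unfolded One_nat_def]
           p24[unfolded One_nat_def] p13[unfolded One_nat_def]
           u1_def[symmetric] u2_def[symmetric] a1_def[symmetric] algebra_simps del: local_gens.simps)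
  qed
qed

lemma chi_dd:
  assumes c: "c \<in> crossings L"
  shows "even_op (Inl c) (chi_mat \<Gamma> c) (dd \<Gamma> v) = dd (switch c \<Gamma>) (even_op (Inl c) (chi_mat \<Gamma> c) v)"
proof -
  have k: "Inl c \<in> factors L" using c by simp
  have "even_op (Inl c) (chi_mat \<Gamma> c) (cl k (lvec \<Gamma> k) v) =
      cl k (lvec (switch c \<Gamma>) k) (even_op (Inl c) (chi_mat \<Gamma> c) v)" if "k \<in> factors L" for k
  proof (cases "k = Inl c")
    case True
    show ?thesis
      unfolding cl_def True even_odd_same[OF k] odd_even_same[OF k] chi_mat_koszul[OF c] ..
  next
    case False
    then show ?thesis
      unfolding cl_def lvec_switch_other[OF False] using that k by (intro even_odd_other) auto
  qed
  then show ?thesis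
    unfolding dd_def rlin_sum[OF rlin_even_op] by (intro sum.cong) auto
qed

definition gap :: "'c \<Rightarrow> 'm mpoly" where "gap c = Var (ends L c 3) - Var (ends L c 2)"

lemma chi_chi:
  assumes c: "c \<in> crossings L" and v: "v \<in> supported"
  shows "even_op (Inl c) (chi_mat (switch c \<Gamma>) c) (even_op (Inl c) (chi_mat \<Gamma> c) v) = smul (gap c) v"
proof -
  have k: "Inl c \<in> factors L" using c by simp
  show ?thesis
    unfolding even_even_same[OF k]
  proof (rule even_op_scalar[OF k v])
    fix g e :: local_gen
    show "mat_prod (Inl c) (chi_mat (switch c \<Gamma>) c) (chi_mat \<Gamma> c) g e = (if e = g then gap c else 0)"
      by (cases "c \<in> \<Gamma>"; cases g; cases e; cases "fst g"; cases "snd g"; cases "fst e"; cases "snd e")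
         (simp_all add: mat_prod_def sum_local_gens_Inl chi_mat_def chi0_local_def chi1_local_def
           even_map_def entry_def end_var_def gap_def algebra_simps del: local_gens.simps)
  qed
qed

text \<open>Switching \<open>c\<close> does not affect the crossings below \<open>c\<close>, so the
  same sign serves for both directions along an edge of the cube.\<close>

definition edge_sign :: "'c set \<Rightarrow> 'c \<Rightarrow> 'm mpoly" where
  "edge_sign \<Gamma> c = (- 1) ^ card {c'\<in>\<Gamma>. c' < c}"

text \<open>The map into \<Gamma>, defined for both directions along an edge of the cube; one
  direction belongs to the differential and the other to the contraction.\<close>

definition edge :: "'c \<Rightarrow> 'c set \<Rightarrow> ('c, 'm) chain \<Rightarrow> ('c, 'm) chain" where
  "edge c \<Gamma> v = smul (edge_sign \<Gamma> c) (even_op (Inl c) (chi_mat (switch c \<Gamma>) c) v)"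

lemma rlin_edge [simp]: "rlin (edge c \<Gamma>)"
  using rlin_smul[OF rlin_even_op] unfolding edge_def[abs_def] .

lemma edge_dd: "c \<in> crossings L \<Longrightarrow> edge c \<Gamma> (dd (switch c \<Gamma>) v) = dd \<Gamma> (edge c \<Gamma> v)"
  unfolding edge_def chi_dd dd_simps by simp

lemma edge_sign_switch:
  assumes "finite \<Gamma>"
  shows "edge_sign (switch c \<Gamma>) c' = (if c < c' then - edge_sign \<Gamma> c' else edge_sign \<Gamma> c')"
proof (cases "c < c'")
  case False
  then have "{x \<in> switch c \<Gamma>. x < c'} = {x \<in> \<Gamma>. x < c'}" by (auto simp: switch_def)
  with False show ?thesis by (simp add: edge_sign_def)
next
  case True
  show ?thesis
  proof (cases "c \<in> \<Gamma>")
    case c: True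
    then have "{x \<in> \<Gamma>. x < c'} = insert c {x \<in> switch c \<Gamma>. x < c'}" "c \<notin> {x \<in> switch c \<Gamma>. x < c'}"
      using True by (auto simp: switch_def)
    moreover have "finite {x \<in> switch c \<Gamma>. x < c'}" using assms by (simp add: switch_def)
    ultimately have "card {x \<in> \<Gamma>. x < c'} = Suc (card {x \<in> switch c \<Gamma>. x < c'})" by simp
    with True show ?thesis by (simp add: edge_sign_def)
  next
    case c: False
    then have "{x \<in> switch c \<Gamma>. x < c'} = insert c {x \<in> \<Gamma>. x < c'}" "c \<notin> {x \<in> \<Gamma>. x < c'}"
      using True by (auto simp: switch_def)
    then have "card {x \<in> switch c \<Gamma>. x < c'} = Suc (card {x \<in> \<Gamma>. x < c'})" using assms by simp
    with True show ?thesis by (simp add: edge_sign_def)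
  qed
qed

lemma edge_sign_square: "edge_sign \<Gamma> c * edge_sign \<Gamma> c = 1"
  by (simp add: edge_sign_def flip: power_add mult_2)

lemma edge_edge:
  assumes "c \<in> crossings L" "finite \<Gamma>" "v \<in> supported"
  shows "edge c \<Gamma> (edge c (switch c \<Gamma>) v) = smul (gap c) v"
proof -
  have s: "edge_sign (switch c \<Gamma>) c = edge_sign \<Gamma> c" by (simp add: edge_sign_switch[OF assms(2)])
  have "edge c \<Gamma> (edge c (switch c \<Gamma>) v) =
      smul (edge_sign \<Gamma> c * edge_sign \<Gamma> c) (even_op (Inl c) (chi_mat (switch c \<Gamma>) c) (even_op (Inl c) (chi_mat \<Gamma> c) v))"
    unfolding edge_def s switch_switch rlinD(2)[OF rlin_even_op] smul_simps(3) ..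
  then show ?thesis unfolding edge_sign_square smul_simps(4) chi_chi[OF assms(1,3)] .
qed

text \<open>The maps act on different tensor factors and commute; switching the smaller crossing
  flips the sign at the larger one, but not conversely.\<close>

lemma edge_anticommute:
  assumes "c \<in> crossings L" "c' \<in> crossings L" "c \<noteq> c'" "finite \<Gamma>"
  shows "edge c \<Gamma> (edge c' (switch c \<Gamma>) v) = - edge c' \<Gamma> (edge c (switch c' \<Gamma>) v)"
proof -
  have cm: "chi_mat (switch a (switch b \<Gamma>)) a = chi_mat (switch a \<Gamma>) a" if "a \<noteq> b" for a b
    using that by (simp add: chi_mat_def)
  let ?E = "\<lambda>a. even_op (Inl a) (chi_mat (switch a \<Gamma>) a)"
  have 1: "edge a \<Gamma> (edge b (switch a \<Gamma>) v) = smul (edge_sign \<Gamma> a * edge_sign (switch a \<Gamma>) b) (?E a (?E b v))"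
    if "a \<noteq> b" for a b
    unfolding edge_def cm[OF that[symmetric]] rlinD(2)[OF rlin_even_op] smul_simps(3) ..
  have "?E c (?E c' v) = ?E c' (?E c v)"
    by (rule even_even_other) (use assms in auto)
  moreover have "edge_sign \<Gamma> c * edge_sign (switch c \<Gamma>) c' = - (edge_sign \<Gamma> c' * edge_sign (switch c' \<Gamma>) c)"
    using assms(3) by (auto simp: edge_sign_switch[OF assms(4)] neq_iff)
  ultimately show ?thesis
    unfolding 1[OF assms(3)] 1[OF assms(3)[symmetric]] by (simp only: smul_simps)
qed

subsection \<open>Cocycles of the resolutions\<close>

definition par0 :: bool where "par0 = circle_parity L"

definition Zr :: "'c set \<Rightarrow> ('c, 'm) chain set" where
  "Zr \<Gamma> = {z \<in> homogeneous par0. dd \<Gamma> z = 0}"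

definition Br :: "'c set \<Rightarrow> ('c, 'm) chain set" where
  "Br \<Gamma> = dd \<Gamma> ` homogeneous (\<not> par0)"

lemma dd_homogeneous: "v \<in> homogeneous p \<Longrightarrow> dd \<Gamma> v \<in> homogeneous (\<not> p)"
  unfolding dd_def cl_def by (intro homogeneous_sum homogeneous_odd_op) auto

lemma Zr_intros:
  "0 \<in> Zr \<Gamma>" "v \<in> Zr \<Gamma> \<Longrightarrow> w \<in> Zr \<Gamma> \<Longrightarrow> v + w \<in> Zr \<Gamma>" "v \<in> Zr \<Gamma> \<Longrightarrow> smul p v \<in> Zr \<Gamma>"
  "v \<in> Zr \<Gamma> \<Longrightarrow> w \<in> Zr \<Gamma> \<Longrightarrow> v - w \<in> Zr \<Gamma>" "v \<in> Zr \<Gamma> \<Longrightarrow> - v \<in> Zr \<Gamma>"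
  unfolding Zr_def by (auto simp: dd_simps smul_simps)

lemma Br_intros:
  "0 \<in> Br \<Gamma>" "v \<in> Br \<Gamma> \<Longrightarrow> w \<in> Br \<Gamma> \<Longrightarrow> v + w \<in> Br \<Gamma>" "v \<in> Br \<Gamma> \<Longrightarrow> smul p v \<in> Br \<Gamma>"
  "v \<in> Br \<Gamma> \<Longrightarrow> w \<in> Br \<Gamma> \<Longrightarrow> v - w \<in> Br \<Gamma>" "v \<in> Br \<Gamma> \<Longrightarrow> - v \<in> Br \<Gamma>"
proof -
  show "0 \<in> Br \<Gamma>" unfolding Br_def by (rule image_eqI[of _ _ 0]) (simp_all only: dd_simps homogeneous_intros)
  assume "v \<in> Br \<Gamma>"
  then obtain y where y: "v = dd \<Gamma> y" "y \<in> homogeneous (\<not> par0)" by (auto simp: Br_def)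
  show "smul p v \<in> Br \<Gamma>" unfolding Br_def
    by (rule image_eqI[of _ _ "smul p y"]) (use y in \<open>simp_all only: dd_simps homogeneous_intros\<close>)
  show "- v \<in> Br \<Gamma>" unfolding Br_def
    by (rule image_eqI[of _ _ "- y"]) (use y in \<open>simp_all only: dd_simps homogeneous_intros\<close>)
  assume "w \<in> Br \<Gamma>"
  then obtain x where x: "w = dd \<Gamma> x" "x \<in> homogeneous (\<not> par0)" by (auto simp: Br_def)
  show "v + w \<in> Br \<Gamma>" unfolding Br_def
    by (rule image_eqI[of _ _ "y + x"]) (use x y in \<open>simp_all only: dd_simps homogeneous_intros\<close>)
  show "v - w \<in> Br \<Gamma>" unfolding Br_def
    by (rule image_eqI[of _ _ "y - x"]) (use x y in \<open>simp_all only: dd_simps homogeneous_intros\<close>)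
qed

lemma Zr_sum: "(\<And>a. a \<in> A \<Longrightarrow> f a \<in> Zr \<Gamma>) \<Longrightarrow> sum f A \<in> Zr \<Gamma>"
  by (induction A rule: infinite_finite_induct) (auto intro: Zr_intros)

lemma Br_sum: "(\<And>a. a \<in> A \<Longrightarrow> f a \<in> Br \<Gamma>) \<Longrightarrow> sum f A \<in> Br \<Gamma>"
  by (induction A rule: infinite_finite_induct) (auto intro: Br_intros)

lemma Zr_supported: "v \<in> Zr \<Gamma> \<Longrightarrow> v \<in> supported" "v \<in> Zr \<Gamma> \<Longrightarrow> dd \<Gamma> v = 0"
  by (auto simp: Zr_def homogeneous_supported)

lemma Br_Zr: "Br \<Gamma> \<subseteq> Zr \<Gamma>"
  unfolding Br_def Zr_def using dd_homogeneous[of _ "\<not> par0"] by (auto simp: dd_dd homogeneous_supported)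

definition part :: "bool \<Rightarrow> ('c, 'm) chain \<Rightarrow> ('c, 'm) chain" where
  "part p v = (\<lambda>G. if odd_gen L G = p then v G else 0)"

lemma part_homogeneous: "v \<in> supported \<Longrightarrow> part p v \<in> homogeneous p"
  by (auto simp: part_def homogeneous_def supported_def)

lemma part_sum: "v = part p v + part (\<not> p) v"
  by (auto simp: part_def fun_eq_iff)

lemma dd_part:
  assumes "v \<in> supported"
  shows "dd \<Gamma> (part p v) = part (\<not> p) (dd \<Gamma> v)"
proof -
  have 1: "dd \<Gamma> (part p v) \<in> homogeneous (\<not> p)" "dd \<Gamma> (part (\<not> p) v) \<in> homogeneous p"
    using dd_homogeneous[OF part_homogeneous[OF assms], of \<Gamma> p] dd_homogeneous[OF part_homogeneous[OF assms], of \<Gamma> "\<not> p"]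
    by simp_all
  have "dd \<Gamma> v = dd \<Gamma> (part p v) + dd \<Gamma> (part (\<not> p) v)"
    by (subst part_sum[of v p]) (rule dd_simps)
  moreover have "part (\<not> p) (u + w) = u" if "u \<in> homogeneous (\<not> p)" "w \<in> homogeneous p" for u w
    using that by (auto simp: part_def homogeneous_def fun_eq_iff)
  ultimately show ?thesis using 1 by simp
qed

text \<open>The differential exchanges the two parities, so of any primitive of a homogeneous chain
  only the part of the other parity matters.\<close>

lemma Br_iff: "v \<in> Br \<Gamma> \<longleftrightarrow> v \<in> homogeneous par0 \<and> (\<exists>y\<in>supported. v = dd \<Gamma> y)"
proof
  assume "v \<in> Br \<Gamma>"
  then obtain y where y: "v = dd \<Gamma> y" "y \<in> homogeneous (\<not> par0)" by (auto simp: Br_def)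
  then show "v \<in> homogeneous par0 \<and> (\<exists>y\<in>supported. v = dd \<Gamma> y)"
    using dd_homogeneous[OF y(2), of \<Gamma>] homogeneous_supported by auto
next
  assume "v \<in> homogeneous par0 \<and> (\<exists>y\<in>supported. v = dd \<Gamma> y)"
  then obtain y where y: "v \<in> homogeneous par0" "y \<in> supported" "v = dd \<Gamma> y" by auto
  have "v = part par0 v" using y(1) by (auto simp: part_def homogeneous_def fun_eq_iff)
  also have "\<dots> = dd \<Gamma> (part (\<not> par0) y)" using dd_part[OF y(2), of \<Gamma> "\<not> par0"] y(3) by simp
  finally show "v \<in> Br \<Gamma>" unfolding Br_def using part_homogeneous[OF y(2)] by blast
qed

lemma null_Zr:
  assumes "null \<Gamma> p" "v \<in> Zr \<Gamma>"
  shows "smul p v \<in> Br \<Gamma>"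
proof -
  from assms(1) obtain s where s: "rlin s" "\<And>v. v \<in> supported \<Longrightarrow> dd \<Gamma> (s v) + s (dd \<Gamma> v) = smul p v"
    unfolding null_def by auto
  have "smul p v = dd \<Gamma> (s v)"
    using s(2)[of v] Zr_supported[OF assms(2)] rlinD(4)[OF s(1)] by (metis add.right_neutral)
  moreover have "smul p v \<in> homogeneous par0" using assms(2) unfolding Zr_def by auto
  ultimately show ?thesis unfolding Br_iff using rlinD(3)[OF s(1)] by blast
qed

lemma edge_Zr:
  assumes "c \<in> crossings L" "v \<in> Zr (switch c \<Gamma>)" shows "edge c \<Gamma> v \<in> Zr \<Gamma>"
proof -
  have "edge c \<Gamma> v \<in> homogeneous par0"
    unfolding edge_def using assms by (intro homogeneous_intros homogeneous_even_op) (auto simp: Zr_def)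
  moreover have "dd \<Gamma> (edge c \<Gamma> v) = 0"
    using edge_dd[OF assms(1), of \<Gamma> v] Zr_supported[OF assms(2)] rlinD(4)[OF rlin_edge] by metis
  ultimately show ?thesis by (simp add: Zr_def)
qed

lemma edge_Br:
  assumes "c \<in> crossings L" "v \<in> Br (switch c \<Gamma>)" shows "edge c \<Gamma> v \<in> Br \<Gamma>"
proof -
  obtain y where y: "v = dd (switch c \<Gamma>) y" "y \<in> homogeneous (\<not> par0)" using assms(2) by (auto simp: Br_def)
  have "edge c \<Gamma> y \<in> homogeneous (\<not> par0)"
    unfolding edge_def using assms y(2) by (intro homogeneous_intros homogeneous_even_op) auto
  then show ?thesis unfolding Br_def y(1) edge_dd[OF assms(1)] by (rule imageI)
qed

subsection \<open>States constant along the link\<close>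

definition thick :: "('m \<Rightarrow> complex) \<Rightarrow> 'c set" where
  "thick \<phi> = {c\<in>crossings L. \<phi> (ends L c 1) \<noteq> \<phi> (ends L c 2)}"

definition link_states :: "('m \<Rightarrow> complex) set" where
  "link_states = {\<phi>\<in>states. resolved (thick \<phi>) \<phi>}"

lemma link_states_iff: "\<phi> \<in> link_states \<longleftrightarrow> \<phi> \<in> states \<and> (\<forall>a\<in>arcs L. \<phi> (fst a) = \<phi> (snd a)) \<and>
     (\<forall>c\<in>crossings L. \<phi> (ends L c 1) = \<phi> (ends L c 4) \<and> \<phi> (ends L c 2) = \<phi> (ends L c 3))"
  by (auto simp: link_states_def resolved_def thick_def)

lemma link_states_subset: "link_states \<subseteq> states" by (auto simp: link_states_def)

lemma finite_link_states [simp]: "finite link_states"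
  using link_states_subset finite_states by (rule finite_subset)

text \<open>At a surviving thick edge the outgoing values are the distinct incoming ones in some
  order, and agreement at the ends 2 and 3 selects the order that follows the link. At a thin
  crossing the same agreement makes all four values equal.\<close>

lemma null_unresolved:
  assumes "\<phi> \<in> states" "\<And>c. c \<in> crossings L \<Longrightarrow> \<phi> (ends L c 2) = \<phi> (ends L c 3)"
    "\<Gamma> \<subseteq> crossings L" "\<not> (\<phi> \<in> link_states \<and> \<Gamma> = thick \<phi>)"
  shows "null \<Gamma> (idem \<phi>)"
proof (rule ccontr)
  assume nn: "\<not> null \<Gamma> (idem \<phi>)"
  have c: "\<phi> (ends L c 1) = \<phi> (ends L c 4) \<and> \<phi> (ends L c 2) = \<phi> (ends L c 3) \<and> (c \<in> \<Gamma> \<longleftrightarrow> \<phi> (ends L c 1) \<noteq> \<phi> (ends L c 2))"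
    if "c \<in> crossings L" for c
  proof (cases "c \<in> \<Gamma>")
    case True
    with not_null_thick[OF assms(1) nn that] assms(2)[OF that] show ?thesis by auto
  next
    case False
    with not_null_thin[OF assms(1) nn that] assms(2)[OF that] show ?thesis by auto
  qed
  have "\<phi> \<in> link_states"
    unfolding link_states_iff using assms(1) not_null_arc[OF assms(1) nn] c by blast
  moreover have "\<Gamma> = thick \<phi>" using c assms(3) by (auto simp: thick_def)
  ultimately show False using assms(4) by blast
qed

lemma cyc_empty: "\<phi> \<in> states \<Longrightarrow> cyc \<Gamma> \<phi> {} = {v\<in>supported. dd \<Gamma> v = 0}"
  by (simp add: cyc_def rv_simps)

lemma bnd_empty: "\<phi> \<in> states \<Longrightarrow> bnd \<Gamma> \<phi> {} = {v\<in>supported. \<exists>y\<in>supported. v = dd \<Gamma> y}"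
  by (simp add: bnd_def rv_simps)

text \<open>A class surviving in the total of both parities survives in one of them; its value at
  the state is nonzero, so \<open>cocycle_odd_gen\<close> identifies that parity as the required
  one.\<close>

lemma ex_canonical:
  assumes \<phi>: "\<phi> \<in> link_states"
  shows "\<exists>w\<in>Zr (thick \<phi>). smul (idem \<phi>) w \<notin> Br (thick \<phi>)"
proof -
  let ?\<Gamma> = "thick \<phi>"
  have st: "\<phi> \<in> states" and res: "resolved ?\<Gamma> \<phi>" using \<phi> by (auto simp: link_states_def)
  have sub: "?\<Gamma> \<subseteq> crossings L" by (auto simp: thick_def)
  obtain v where v: "v \<in> cyc ?\<Gamma> \<phi> {}" "smul (idem \<phi>) v \<notin> bnd ?\<Gamma> \<phi> {}"
    using ex_nonvanishing[OF st resolved_adm[OF res]] by blast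
  have vs: "v \<in> supported" "dd ?\<Gamma> v = 0" using v(1) by (auto simp: cyc_empty[OF st])
  have pc: "part p v \<in> cyc ?\<Gamma> \<phi> {}" for p
  proof -
    have "dd ?\<Gamma> (part p v) = 0" unfolding dd_part[OF vs(1)] vs(2) by (simp add: part_def fun_eq_iff)
    then show ?thesis unfolding cyc_empty[OF st] using homogeneous_supported[OF part_homogeneous[OF vs(1)]] by blast
  qed
  have "smul (idem \<phi>) v = smul (idem \<phi>) (part par0 v) + smul (idem \<phi>) (part (\<not> par0) v)"
    by (subst part_sum[of v par0]) (rule smul_simps)
  then obtain p where p: "smul (idem \<phi>) (part p v) \<notin> bnd ?\<Gamma> \<phi> {}"
    using bnd_intros(1)[OF st] v(2) by metis
  from cyc_ev_nonzero[OF st resolved_adm[OF res] pc p] obtain G where G: "ev \<phi> (part p v G) \<noteq> 0" by auto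
  have "part p v \<in> supported" "dd ?\<Gamma> (part p v) = 0" using pc[of p] by (auto simp: cyc_empty[OF st])
  from cocycle_odd_gen[OF res sub this G] have "odd_gen L G = par0" by (simp add: par0_def)
  moreover have "odd_gen L G = p" using G by (auto simp: part_def split: if_splits)
  ultimately have "p = par0" by simp
  then have "part p v \<in> Zr ?\<Gamma>"
    using part_homogeneous[OF vs(1), of p] pc[of p] by (auto simp: Zr_def cyc_empty[OF st])
  moreover have "smul (idem \<phi>) (part p v) \<notin> Br ?\<Gamma>"
    using p unfolding Br_iff bnd_empty[OF st] by (auto dest: homogeneous_supported)
  ultimately show ?thesis by blast
qed

text \<open>Multiplication by the idempotent puts the representative into the summand of \<phi>, so
  that it can be killed in other resolutions by a homotopy for \<open>idem \<phi>\<close>.\<close>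

definition canonical :: "('m \<Rightarrow> complex) \<Rightarrow> ('c, 'm) chain" where
  "canonical \<phi> = smul (idem \<phi>) (SOME w. w \<in> Zr (thick \<phi>) \<and> smul (idem \<phi>) w \<notin> Br (thick \<phi>))"

lemma null_idem_idem: "\<phi> \<in> states \<Longrightarrow> null \<Gamma> ((idem \<phi> - 1) * idem \<phi>)"
  using null_idem[of \<phi> \<Gamma> "idem \<phi>"] by (simp add: ev_idem)

lemma idem_idem_Br:
  assumes "\<phi> \<in> states" "v \<in> Zr \<Gamma>"
  shows "smul (idem \<phi>) (smul (idem \<phi>) v) \<in> Br \<Gamma> \<longleftrightarrow> smul (idem \<phi>) v \<in> Br \<Gamma>"
proof -
  have d: "smul (idem \<phi>) (smul (idem \<phi>) v) - smul (idem \<phi>) v \<in> Br \<Gamma>"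
    using null_Zr[OF null_idem_idem[OF assms(1)] assms(2)]
    by (simp only: left_diff_distrib mult_1 smul_simps)
  show ?thesis
  proof
    assume "smul (idem \<phi>) (smul (idem \<phi>) v) \<in> Br \<Gamma>"
    from Br_intros(4)[OF this d] show "smul (idem \<phi>) v \<in> Br \<Gamma>" by simp
  qed (rule Br_intros)
qed

lemma idem_orthogonal_Br:
  assumes "\<phi> \<in> states" "\<psi> \<in> states" "\<phi> \<noteq> \<psi>" "v \<in> Zr \<Gamma>"
  shows "smul (idem \<psi>) (smul (idem \<phi>) v) \<in> Br \<Gamma>"
proof -
  have "null \<Gamma> (idem \<psi> * idem \<phi>)"
    using null_idem[OF assms(1), of \<Gamma> "idem \<psi>"] ev_idem[OF assms(2,1)] assms(3) by simp
  from null_Zr[OF this assms(4)] show ?thesis by (simp only: smul_simps)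
qed

lemma canonical:
  assumes "\<phi> \<in> link_states"
  shows "canonical \<phi> \<in> Zr (thick \<phi>)" "smul (idem \<phi>) (canonical \<phi>) \<notin> Br (thick \<phi>)" "\<exists>w\<in>Zr (thick \<phi>). canonical \<phi> = smul (idem \<phi>) w"
proof -
  define w where "w = (SOME w. w \<in> Zr (thick \<phi>) \<and> smul (idem \<phi>) w \<notin> Br (thick \<phi>))"
  have "\<exists>w. w \<in> Zr (thick \<phi>) \<and> smul (idem \<phi>) w \<notin> Br (thick \<phi>)" using ex_canonical[OF assms] by blast
  from someI_ex[OF this] have w: "w \<in> Zr (thick \<phi>)" "smul (idem \<phi>) w \<notin> Br (thick \<phi>)" unfolding w_def by auto
  have c: "canonical \<phi> = smul (idem \<phi>) w" by (simp add: canonical_def w_def)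
  have st: "\<phi> \<in> states" using assms link_states_subset by auto
  show "canonical \<phi> \<in> Zr (thick \<phi>)" "smul (idem \<phi>) (canonical \<phi>) \<notin> Br (thick \<phi>)" "\<exists>w\<in>Zr (thick \<phi>). canonical \<phi> = smul (idem \<phi>) w"
    unfolding c using w idem_idem_Br[OF st w(1)] by (auto intro: Zr_intros)
qed

text \<open>By \<open>cyc_dependent\<close> there is a relation between \<open>v\<close> and the
  canonical cocycle; the coefficient of \<open>v\<close> is nonzero because the canonical class
  is.\<close>

lemma canonical_generates:
  assumes "\<phi> \<in> link_states" "v \<in> Zr (thick \<phi>)"
  shows "\<exists>a. smul (idem \<phi>) v - smul (Const a) (canonical \<phi>) \<in> Br (thick \<phi>)"
proof -
  let ?\<Gamma> = "thick \<phi>" and ?e = "idem \<phi>"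
  have st: "\<phi> \<in> states" and res: "resolved ?\<Gamma> \<phi>" using assms(1) by (auto simp: link_states_def)
  note can = canonical[OF assms(1)]
  have "v \<in> cyc ?\<Gamma> \<phi> {}" "canonical \<phi> \<in> cyc ?\<Gamma> \<phi> {}"
    using assms(2) can(1) Zr_supported by (auto simp: cyc_empty[OF st])
  from cyc_dependent[OF st resolved_adm[OF res] this]
  obtain a b where ab: "a \<noteq> 0 \<or> b \<noteq> 0" "smul ?e (smul (Const a) v + smul (Const b) (canonical \<phi>)) \<in> bnd ?\<Gamma> \<phi> {}" by blast
  have "smul ?e (smul (Const a) v + smul (Const b) (canonical \<phi>)) \<in> Zr ?\<Gamma>"
    using assms(2) can(1) by (intro Zr_intros)
  then have B: "smul ?e (smul (Const a) v + smul (Const b) (canonical \<phi>)) \<in> Br ?\<Gamma>"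
    using ab(2) unfolding Br_iff bnd_empty[OF st] Zr_def by blast
  have "a \<noteq> 0"
  proof
    assume "a = 0"
    then have "b \<noteq> 0" using ab by simp
    have "smul (Const (1 / b)) (smul ?e (smul (Const a) v + smul (Const b) (canonical \<phi>))) \<in> Br ?\<Gamma>"
      using B by (rule Br_intros)
    also have "smul (Const (1 / b)) (smul ?e (smul (Const a) v + smul (Const b) (canonical \<phi>))) = smul ?e (canonical \<phi>)"
    proof
      fix G
      have 1: "Const (1 / b) * (Const b * x) = x" for x :: "'m mpoly"
        using \<open>b \<noteq> 0\<close> by (simp flip: mult.assoc Const_mult)
      have "Const (1 / b) * (?e * (Const a * v G + Const b * canonical \<phi> G)) = Const (1 / b) * (Const b * (?e * canonical \<phi> G))"
        by (simp add: \<open>a = 0\<close> mult.left_commute)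
      then show "smul (Const (1 / b)) (smul ?e (smul (Const a) v + smul (Const b) (canonical \<phi>))) G = smul ?e (canonical \<phi>) G"
        unfolding 1 by (simp add: smul_def)
    qed
    finally show False using can(2) by simp
  qed
  obtain w where w: "w \<in> Zr ?\<Gamma>" "canonical \<phi> = smul ?e w" using can(3) by blast
  have d: "smul ?e (canonical \<phi>) - canonical \<phi> \<in> Br ?\<Gamma>"
    using null_Zr[OF null_idem_idem[OF st] w(1)] unfolding w(2) by (simp only: left_diff_distrib mult_1 smul_simps)
  have "smul (Const (1 / a)) (smul ?e (smul (Const a) v + smul (Const b) (canonical \<phi>))) - smul (Const (b / a)) (smul ?e (canonical \<phi>) - canonical \<phi>) \<in> Br ?\<Gamma>"
    by (rule Br_intros(4)[OF Br_intros(3)[OF B] Br_intros(3)[OF d]])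
  also have "smul (Const (1 / a)) (smul ?e (smul (Const a) v + smul (Const b) (canonical \<phi>))) - smul (Const (b / a)) (smul ?e (canonical \<phi>) - canonical \<phi>)
     = smul ?e v - smul (Const (- b / a)) (canonical \<phi>)"
  proof
    fix G
    have 1: "Const (1 / a) * (Const a * x) = x" "Const (1 / a) * (Const b * x) = Const (b / a) * x" for x :: "'m mpoly"
      using \<open>a \<noteq> 0\<close> by (simp_all flip: mult.assoc Const_mult)
    have 2: "Const (- b / a) * x = - (Const (b / a) * x)" for x :: "'m mpoly"
      by (simp add: Const_minus)
    have "(smul (Const (1 / a)) (smul ?e (smul (Const a) v + smul (Const b) (canonical \<phi>))) - smul (Const (b / a)) (smul ?e (canonical \<phi>) - canonical \<phi>)) G
      = Const (1 / a) * (Const a * (?e * v G)) + Const (1 / a) * (Const b * (?e * canonical \<phi> G)) - Const (b / a) * (?e * canonical \<phi> G) + Const (b / a) * canonical \<phi> G"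
      by (simp add: smul_def algebra_simps)
    also have "\<dots> = (smul ?e v - smul (Const (- b / a)) (canonical \<phi>)) G"
      unfolding 1 by (simp add: smul_def 2[simplified])
    finally show "(smul (Const (1 / a)) (smul ?e (smul (Const a) v + smul (Const b) (canonical \<phi>))) - smul (Const (b / a)) (smul ?e (canonical \<phi>) - canonical \<phi>)) G =
      (smul ?e v - smul (Const (- b / a)) (canonical \<phi>)) G" .
  qed
  finally show ?thesis by blast
qed

end

context gornik
begin

subsection \<open>The total complex on the chain level\<close>

text \<open>Here an element of the total complex is represented by a cocycle for every resolution.\<close>

definition valid :: "'c \<Rightarrow> 'c set \<Rightarrow> bool" where
  "valid c \<Gamma> \<longleftrightarrow> (c \<in> \<Gamma> \<longleftrightarrow> positive L c)"

lemma valid_switch [simp]: "valid c (switch c \<Gamma>) \<longleftrightarrow> \<not> valid c \<Gamma>" "c' \<noteq> c \<Longrightarrow> valid c' (switch c \<Gamma>) \<longleftrightarrow> valid c' \<Gamma>"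
  by (auto simp: valid_def)

definition del :: "('c set \<Rightarrow> ('c, 'm) chain) \<Rightarrow> 'c set \<Rightarrow> ('c, 'm) chain" where
  "del z \<Gamma> = (\<Sum>c\<in>{c\<in>crossings L. valid c \<Gamma>}. edge c \<Gamma> (z (switch c \<Gamma>)))"

definition contr :: "'c \<Rightarrow> ('c set \<Rightarrow> ('c, 'm) chain) \<Rightarrow> 'c set \<Rightarrow> ('c, 'm) chain" where
  "contr c z \<Gamma> = (if valid c \<Gamma> then 0 else edge c \<Gamma> (z (switch c \<Gamma>)))"

definition ZZ :: "('c set \<Rightarrow> ('c, 'm) chain) set" where
  "ZZ = {z. \<forall>\<Gamma>\<subseteq>crossings L. z \<Gamma> \<in> Zr \<Gamma>}"

definition BB :: "('c set \<Rightarrow> ('c, 'm) chain) set" where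
  "BB = {z. \<forall>\<Gamma>\<subseteq>crossings L. z \<Gamma> \<in> Br \<Gamma>}"

text \<open>The vertices of the cube are cohomology groups, so on representatives the cocycle
  equation is imposed only modulo the coboundaries of each resolution.\<close>

definition CZ :: "('c set \<Rightarrow> ('c, 'm) chain) set" where
  "CZ = {z\<in>ZZ. del z \<in> BB}"

definition CB :: "('c set \<Rightarrow> ('c, 'm) chain) set" where
  "CB = {z. \<exists>y\<in>ZZ. \<forall>\<Gamma>\<subseteq>crossings L. z \<Gamma> - del y \<Gamma> \<in> Br \<Gamma>}"

lemma edge_simps: "edge c \<Gamma> (v + w) = edge c \<Gamma> v + edge c \<Gamma> w" "edge c \<Gamma> (smul p v) = smul p (edge c \<Gamma> v)"
  "edge c \<Gamma> 0 = 0" "edge c \<Gamma> (- v) = - edge c \<Gamma> v" "edge c \<Gamma> (v - w) = edge c \<Gamma> v - edge c \<Gamma> w"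
  "edge c \<Gamma> (sum f A) = (\<Sum>a\<in>A. edge c \<Gamma> (f a))"
  by (rule rlinD[OF rlin_edge] rlin_sum[OF rlin_edge])+

lemma del_add: "del (\<lambda>\<Gamma>. y \<Gamma> + w \<Gamma>) \<Gamma> = del y \<Gamma> + del w \<Gamma>"
  unfolding del_def edge_simps by (rule sum.distrib)

lemma del_smul: "del (\<lambda>\<Gamma>. smul p (y \<Gamma>)) \<Gamma> = smul p (del y \<Gamma>)"
  unfolding del_def edge_simps smul_sum ..

lemma del_ZZ: "y \<in> ZZ \<Longrightarrow> del y \<in> ZZ"
  unfolding ZZ_def del_def using switch_subset by (auto intro!: Zr_sum edge_Zr)

lemma del_BB: "y \<in> BB \<Longrightarrow> del y \<in> BB"
  unfolding BB_def del_def using switch_subset by (auto intro!: Br_sum edge_Br)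

lemma contr_ZZ: "y \<in> ZZ \<Longrightarrow> c \<in> crossings L \<Longrightarrow> contr c y \<in> ZZ"
  unfolding ZZ_def contr_def using switch_subset by (auto intro!: Zr_intros(1) edge_Zr)

lemma contr_BB: "y \<in> BB \<Longrightarrow> c \<in> crossings L \<Longrightarrow> contr c y \<in> BB"
  unfolding BB_def contr_def using switch_subset by (auto intro!: Br_intros(1) edge_Br)

lemma ZZ_supported: "y \<in> ZZ \<Longrightarrow> \<Gamma> \<subseteq> crossings L \<Longrightarrow> y \<Gamma> \<in> supported"
  unfolding ZZ_def using Zr_supported by blast

lemma double_zero:
  fixes v :: "('c, 'm) chain"
  assumes "v = - v" shows "v = 0"
proof
  fix G
  have "v G = - v G" using fun_cong[OF assms, of G] by simp
  then have "2 * v G = 0" by (metis add.right_inverse mult_2)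
  then show "v G = 0 G" by simp
qed

text \<open>Exchanging the two crossings in the double sum shows that it equals its own
  negative.\<close>

lemma del_del:
  assumes "y \<in> ZZ" "\<Gamma> \<subseteq> crossings L"
  shows "del (del y) \<Gamma> = 0"
proof -
  let ?A = "{c\<in>crossings L. valid c \<Gamma>}"
  let ?F = "\<lambda>c c'. edge c \<Gamma> (edge c' (switch c \<Gamma>) (y (switch c' (switch c \<Gamma>))))"
  have fin: "finite \<Gamma>" "finite ?A" using assms(2) finite_crossings by (auto intro: finite_subset)
  have A: "{c'\<in>crossings L. valid c' (switch c \<Gamma>)} = ?A - {c}" if "c \<in> ?A" for c
    using that by (auto simp: valid_def switch_def)
  have "del (del y) \<Gamma> = (\<Sum>c\<in>?A. \<Sum>c'\<in>?A - {c}. ?F c c')"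
    unfolding del_def[of "del y"] by (rule sum.cong[OF refl]) (simp only: del_def A edge_simps)
  also have "\<dots> = (\<Sum>p\<in>(SIGMA c:?A. ?A - {c}). ?F (fst p) (snd p))"
    using fin by (subst sum.Sigma) (simp_all add: case_prod_unfold)
  finally have S: "del (del y) \<Gamma> = (\<Sum>p\<in>(SIGMA c:?A. ?A - {c}). ?F (fst p) (snd p))" .
  also have "\<dots> = (\<Sum>p\<in>(SIGMA c:?A. ?A - {c}). ?F (snd p) (fst p))"
    by (rule sum.reindex_bij_witness[where i = prod.swap and j = prod.swap]) auto
  also have "\<dots> = (\<Sum>p\<in>(SIGMA c:?A. ?A - {c}). - ?F (fst p) (snd p))"
  proof (rule sum.cong[OF refl])
    fix p assume "p \<in> (SIGMA c:?A. ?A - {c})"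
    then have p: "snd p \<in> crossings L" "fst p \<in> crossings L" "snd p \<noteq> fst p" by auto
    show "?F (snd p) (fst p) = - ?F (fst p) (snd p)"
      unfolding edge_anticommute[OF p fin(1)] switch_commute[of "fst p" "snd p"] ..
  qed
  also have "\<dots> = - del (del y) \<Gamma>" unfolding sum_negf S ..
  finally show ?thesis by (rule double_zero)
qed

lemma minus_add_swap: "- s + (a + s) = (a :: 'g::ab_group_add)" by (simp add: algebra_simps)

text \<open>At each vertex of the cube exactly one of the two composites goes back and forth along
  the edge at \<open>c\<close>, which gives \<open>gap c\<close>. The terms involving another
  crossing cancel by anticommutativity.\<close>

lemma del_contr:
  assumes c: "c \<in> crossings L" and y: "y \<in> ZZ" and \<Gamma>: "\<Gamma> \<subseteq> crossings L"
  shows "del (contr c y) \<Gamma> + contr c (del y) \<Gamma> = smul (gap c) (y \<Gamma>)"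
proof -
  have fin: "finite \<Gamma>" "finite (crossings L)" using \<Gamma> finite_crossings by (auto intro: finite_subset)
  let ?A = "{c'\<in>crossings L. valid c' \<Gamma>}"
  have sq: "edge c \<Gamma> (edge c (switch c \<Gamma>) (y \<Gamma>)) = smul (gap c) (y \<Gamma>)"
    by (rule edge_edge[OF c fin(1) ZZ_supported[OF y \<Gamma>]])
  show ?thesis
  proof (cases "valid c \<Gamma>")
    case True
    then have A: "?A = insert c (?A - {c})" "c \<notin> ?A - {c}" "finite (?A - {c})" using c fin by auto
    have "del (contr c y) \<Gamma> = edge c \<Gamma> (contr c y (switch c \<Gamma>)) + (\<Sum>c'\<in>?A - {c}. edge c' \<Gamma> (contr c y (switch c' \<Gamma>)))"
      unfolding del_def by (subst A(1)) (rule sum.insert[OF A(3,2)])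
    also have "(\<Sum>c'\<in>?A - {c}. edge c' \<Gamma> (contr c y (switch c' \<Gamma>))) = 0"
      by (rule sum.neutral) (use True in \<open>auto simp: contr_def edge_simps\<close>)
    also have "contr c y (switch c \<Gamma>) = edge c (switch c \<Gamma>) (y \<Gamma>)"
      using True by (simp add: contr_def)
    finally have "del (contr c y) \<Gamma> = smul (gap c) (y \<Gamma>)" unfolding sq by (simp only: add.right_neutral)
    moreover have "contr c (del y) \<Gamma> = 0" using True by (simp add: contr_def)
    ultimately show ?thesis by (simp only: add.right_neutral)
  next
    case False
    have A: "{c'\<in>crossings L. valid c' (switch c \<Gamma>)} = insert c ?A" "c \<notin> ?A" "finite ?A"
      using False c fin by (auto simp: valid_def switch_def)
    have "contr c (del y) \<Gamma> = edge c \<Gamma> (del y (switch c \<Gamma>))" using False by (simp add: contr_def)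
    also have "del y (switch c \<Gamma>) = edge c (switch c \<Gamma>) (y \<Gamma>) + (\<Sum>c'\<in>?A. edge c' (switch c \<Gamma>) (y (switch c' (switch c \<Gamma>))))"
      unfolding del_def A(1) sum.insert[OF A(3,2)] switch_switch ..
    finally have 1: "contr c (del y) \<Gamma> = smul (gap c) (y \<Gamma>) + (\<Sum>c'\<in>?A. edge c \<Gamma> (edge c' (switch c \<Gamma>) (y (switch c' (switch c \<Gamma>)))))"
      unfolding edge_simps sq .
    have "del (contr c y) \<Gamma> = (\<Sum>c'\<in>?A. - edge c \<Gamma> (edge c' (switch c \<Gamma>) (y (switch c' (switch c \<Gamma>)))))"
      unfolding del_def
    proof (rule sum.cong[OF refl])
      fix c' assume c': "c' \<in> ?A"
      then have ne: "c' \<noteq> c" "c' \<in> crossings L" using A(2) by auto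
      have "contr c y (switch c' \<Gamma>) = edge c (switch c' \<Gamma>) (y (switch c (switch c' \<Gamma>)))"
        using False ne by (simp add: contr_def)
      then show "edge c' \<Gamma> (contr c y (switch c' \<Gamma>)) = - edge c \<Gamma> (edge c' (switch c \<Gamma>) (y (switch c' (switch c \<Gamma>))))"
        using edge_anticommute[OF ne(2) c ne(1) fin(1)] switch_commute[of c c' \<Gamma>] by simp
    qed
    then show ?thesis unfolding 1 sum_negf by (simp only: minus_add_swap)
  qed
qed

lemma CB_add: "z \<in> CB \<Longrightarrow> w \<in> CB \<Longrightarrow> (\<lambda>\<Gamma>. z \<Gamma> + w \<Gamma>) \<in> CB"
proof -
  assume "z \<in> CB" "w \<in> CB"
  then obtain y x where y: "y \<in> ZZ" "x \<in> ZZ" "\<And>\<Gamma>. \<Gamma> \<subseteq> crossings L \<Longrightarrow> z \<Gamma> - del y \<Gamma> \<in> Br \<Gamma>"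
    "\<And>\<Gamma>. \<Gamma> \<subseteq> crossings L \<Longrightarrow> w \<Gamma> - del x \<Gamma> \<in> Br \<Gamma>" unfolding CB_def by blast
  have "(\<lambda>\<Gamma>. y \<Gamma> + x \<Gamma>) \<in> ZZ" using y(1,2) unfolding ZZ_def by (auto intro: Zr_intros)
  moreover have "z \<Gamma> + w \<Gamma> - del (\<lambda>\<Gamma>. y \<Gamma> + x \<Gamma>) \<Gamma> \<in> Br \<Gamma>" if "\<Gamma> \<subseteq> crossings L" for \<Gamma>
    using Br_intros(2)[OF y(3,4)[OF that]] unfolding del_add by (simp only: add_diff_add)
  ultimately show ?thesis unfolding CB_def by blast
qed

lemma CB_smul: "z \<in> CB \<Longrightarrow> (\<lambda>\<Gamma>. smul p (z \<Gamma>)) \<in> CB"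
proof -
  assume "z \<in> CB"
  then obtain y where y: "y \<in> ZZ" "\<And>\<Gamma>. \<Gamma> \<subseteq> crossings L \<Longrightarrow> z \<Gamma> - del y \<Gamma> \<in> Br \<Gamma>"
    unfolding CB_def by blast
  have "(\<lambda>\<Gamma>. smul p (y \<Gamma>)) \<in> ZZ" using y(1) unfolding ZZ_def by (auto intro: Zr_intros)
  moreover have "smul p (z \<Gamma>) - del (\<lambda>\<Gamma>. smul p (y \<Gamma>)) \<Gamma> \<in> Br \<Gamma>" if "\<Gamma> \<subseteq> crossings L" for \<Gamma>
    using Br_intros(3)[OF y(2)[OF that], of p] unfolding del_smul by (simp only: smul_simps)
  ultimately show ?thesis unfolding CB_def by blast
qed

lemma zero_ZZ: "(\<lambda>\<Gamma>. 0) \<in> ZZ" unfolding ZZ_def by (simp add: Zr_intros)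

lemma del_zero: "del (\<lambda>\<Gamma>. 0) \<Gamma> = 0"
  unfolding del_def edge_simps by (rule sum.neutral) simp

lemma BB_CB: "z \<in> BB \<Longrightarrow> z \<in> CB"
  unfolding CB_def BB_def using zero_ZZ by (auto simp: del_zero intro!: bexI[of _ "\<lambda>\<Gamma>. 0"])

lemma CB_sum: "finite A \<Longrightarrow> (\<And>a. a \<in> A \<Longrightarrow> f a \<in> CB) \<Longrightarrow> (\<lambda>\<Gamma>. \<Sum>a\<in>A. f a \<Gamma>) \<in> CB"
proof (induction A rule: finite_induct)
  case empty
  have "(\<lambda>\<Gamma>. 0) \<in> BB" by (simp add: BB_def Br_intros)
  then show ?case unfolding sum.empty by (rule BB_CB)
next
  case (insert a A)
  then have "(\<lambda>\<Gamma>. f a \<Gamma> + (\<Sum>a\<in>A. f a \<Gamma>)) \<in> CB" by (intro CB_add) auto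
  then show ?case unfolding sum.insert[OF insert.hyps] .
qed

text \<open>
  Where the values of a state at the ends 2 and 3 of a crossing differ, the maps in the two directions
  at that crossing are mutually inverse up to a scalar, so that the complex is contractible.
\<close>

lemma idem_contractible:
  assumes \<phi>: "\<phi> \<in> states" and c: "c \<in> crossings L" "\<phi> (ends L c 2) \<noteq> \<phi> (ends L c 3)" and z: "z \<in> CZ"
  shows "(\<lambda>\<Gamma>. smul (idem \<phi>) (z \<Gamma>)) \<in> CB"
proof -
  define \<kappa> where "\<kappa> = ev \<phi> (gap c)"
  have k: "\<kappa> \<noteq> 0" using c(2) by (simp add: \<kappa>_def gap_def ev_simps)
  define y where "y = (\<lambda>\<Gamma>. smul (idem \<phi>) (z \<Gamma>))"
  have zz: "z \<in> ZZ" "del z \<in> BB" using z by (auto simp: CZ_def)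
  have yz: "y \<in> ZZ" using zz(1) unfolding ZZ_def y_def by (auto intro: Zr_intros)
  have "del y \<in> BB" using zz(2) unfolding BB_def y_def del_smul by (auto intro: Br_intros)
  then have cb: "contr c (del y) \<in> BB" using c(1) by (rule contr_BB)
  have "(\<lambda>\<Gamma>. smul (Const \<kappa>) (y \<Gamma>)) \<in> CB"
    unfolding CB_def
  proof (intro CollectI bexI[of _ "contr c y"] allI impI contr_ZZ yz c)
    fix \<Gamma> assume \<Gamma>: "\<Gamma> \<subseteq> crossings L"
    have "smul (gap c) (y \<Gamma>) - smul (Const \<kappa>) (y \<Gamma>) = smul ((gap c - Const \<kappa>) * idem \<phi>) (z \<Gamma>)"
      unfolding y_def smul_simps(3) left_diff_distrib smul_simps(10) ..
    moreover have "smul ((gap c - Const \<kappa>) * idem \<phi>) (z \<Gamma>) \<in> Br \<Gamma>"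
      unfolding \<kappa>_def using zz(1) \<Gamma> by (intro null_Zr null_idem \<phi>) (auto simp: ZZ_def)
    moreover have "contr c (del y) \<Gamma> \<in> Br \<Gamma>" using cb \<Gamma> by (auto simp: BB_def)
    ultimately have "contr c (del y) \<Gamma> - (smul (gap c) (y \<Gamma>) - smul (Const \<kappa>) (y \<Gamma>)) \<in> Br \<Gamma>"
      by (simp only: Br_intros(4))
    also have "contr c (del y) \<Gamma> - (smul (gap c) (y \<Gamma>) - smul (Const \<kappa>) (y \<Gamma>)) = smul (Const \<kappa>) (y \<Gamma>) - del (contr c y) \<Gamma>"
      unfolding del_contr[OF c(1) yz \<Gamma>, symmetric] by (rule ext) simp
    finally show "smul (Const \<kappa>) (y \<Gamma>) - del (contr c y) \<Gamma> \<in> Br \<Gamma>" .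
  qed
  from CB_smul[OF this, of "Const (1 / \<kappa>)"]
  have "(\<lambda>\<Gamma>. smul (Const (1 / \<kappa>) * Const \<kappa>) (y \<Gamma>)) \<in> CB" unfolding smul_simps(3) .
  moreover have "Const (1 / \<kappa>) * Const \<kappa> = (1 :: 'm mpoly)" using k by (simp flip: Const_mult)
  ultimately show ?thesis by (simp only: smul_simps(4) y_def)
qed

definition gen_cube :: "('m \<Rightarrow> complex) \<Rightarrow> 'c set \<Rightarrow> ('c, 'm) chain" where
  "gen_cube \<phi> \<Gamma> = (if \<Gamma> = thick \<phi> then canonical \<phi> else 0)"

lemma link_state_ends: "\<phi> \<in> link_states \<Longrightarrow> c \<in> crossings L \<Longrightarrow> \<phi> (ends L c 2) = \<phi> (ends L c 3)"
  by (auto simp: link_states_iff)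

lemma null_link_state:
  assumes "\<phi> \<in> link_states" "\<Gamma> \<subseteq> crossings L" "\<Gamma> \<noteq> thick \<phi>"
  shows "null \<Gamma> (idem \<phi>)"
  by (rule null_unresolved) (use assms link_states_subset link_state_ends in auto)

lemma gen_cube_ZZ: "\<phi> \<in> link_states \<Longrightarrow> gen_cube \<phi> \<in> ZZ"
  unfolding ZZ_def gen_cube_def by (auto intro: canonical Zr_intros)

lemma thick_subset: "thick \<phi> \<subseteq> crossings L" by (auto simp: thick_def)

lemma switch_neq: "switch c \<Gamma> \<noteq> \<Gamma>" by (auto simp: switch_def)

text \<open>The maps of the cube commute with \<open>idem \<phi>\<close>, and this polynomial is
  null-homotopic at every resolution other than \<open>thick \<phi>\<close>.\<close>

lemma gen_cube_CZ:
  assumes "\<phi> \<in> link_states" shows "gen_cube \<phi> \<in> CZ"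
proof -
  have "edge c \<Gamma> (gen_cube \<phi> (switch c \<Gamma>)) \<in> Br \<Gamma>" if c: "c \<in> crossings L" and \<Gamma>: "\<Gamma> \<subseteq> crossings L" for c \<Gamma>
  proof (cases "switch c \<Gamma> = thick \<phi>")
    case True
    obtain w where w: "w \<in> Zr (thick \<phi>)" "canonical \<phi> = smul (idem \<phi>) w" using canonical(3)[OF assms] by blast
    have "\<Gamma> \<noteq> thick \<phi>" using True switch_neq by metis
    moreover have "edge c \<Gamma> w \<in> Zr \<Gamma>" using w(1) c by (intro edge_Zr) (simp_all add: True)
    ultimately have "smul (idem \<phi>) (edge c \<Gamma> w) \<in> Br \<Gamma>"
      by (intro null_Zr null_link_state assms \<Gamma>)
    then show ?thesis by (simp only: True gen_cube_def w(2) edge_simps refl if_True)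
  qed (simp add: gen_cube_def edge_simps Br_intros)
  then have "del (gen_cube \<phi>) \<in> BB" unfolding BB_def del_def by (auto intro!: Br_sum)
  then show ?thesis using gen_cube_ZZ[OF assms] by (simp add: CZ_def)
qed

text \<open>Either the values differ at the ends 2 and 3 of some crossing, and the component is
  contracted there, or each resolution can be treated by itself and at most one of them
  contributes.\<close>

lemma state_component:
  assumes \<phi>: "\<phi> \<in> states" and z: "z \<in> CZ"
  shows "\<exists>a. (\<lambda>\<Gamma>. smul (idem \<phi>) (z \<Gamma>) - (if \<phi> \<in> link_states then smul (Const a) (gen_cube \<phi> \<Gamma>) else 0)) \<in> CB"
proof (cases "\<exists>c\<in>crossings L. \<phi> (ends L c 2) \<noteq> \<phi> (ends L c 3)")
  case True
  then have "\<phi> \<notin> link_states" using link_state_ends by blast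
  then show ?thesis using True idem_contractible[OF \<phi> _ _ z] by auto
next
  case False
  have zz: "z \<Gamma> \<in> Zr \<Gamma>" if "\<Gamma> \<subseteq> crossings L" for \<Gamma> using z that by (auto simp: CZ_def ZZ_def)
  have other: "smul (idem \<phi>) (z \<Gamma>) \<in> Br \<Gamma>" if "\<Gamma> \<subseteq> crossings L" "\<not> (\<phi> \<in> link_states \<and> \<Gamma> = thick \<phi>)" for \<Gamma>
    by (rule null_Zr[OF null_unresolved zz]) (use that False \<phi> in auto)
  show ?thesis
  proof (cases "\<phi> \<in> link_states")
    case True
    then obtain a where a: "smul (idem \<phi>) (z (thick \<phi>)) - smul (Const a) (canonical \<phi>) \<in> Br (thick \<phi>)"
      using canonical_generates zz[OF thick_subset] by blast
    have "(\<lambda>\<Gamma>. smul (idem \<phi>) (z \<Gamma>) - smul (Const a) (gen_cube \<phi> \<Gamma>)) \<in> BB"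
      unfolding BB_def
    proof (intro CollectI allI impI)
      fix \<Gamma> assume "\<Gamma> \<subseteq> crossings L"
      then show "smul (idem \<phi>) (z \<Gamma>) - smul (Const a) (gen_cube \<phi> \<Gamma>) \<in> Br \<Gamma>"
        using a other[of \<Gamma>] by (cases "\<Gamma> = thick \<phi>") (simp_all only: gen_cube_def if_True if_False smul_simps diff_0_right not_False_eq_True simp_thms)
    qed
    then show ?thesis using True BB_CB by (intro exI[of _ a]) simp
  next
    case False
    have "(\<lambda>\<Gamma>. smul (idem \<phi>) (z \<Gamma>)) \<in> BB" unfolding BB_def using other False by auto
    then show ?thesis using False BB_CB by simp
  qed
qed

lemma cube_generated:
  assumes z: "z \<in> CZ"
  shows "\<exists>a. (\<lambda>\<Gamma>. z \<Gamma> - (\<Sum>\<phi>\<in>link_states. smul (Const (a \<phi>)) (gen_cube \<phi> \<Gamma>))) \<in> CB"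
proof -
  have "\<forall>\<phi>\<in>states. \<exists>a. (\<lambda>\<Gamma>. smul (idem \<phi>) (z \<Gamma>) - (if \<phi> \<in> link_states then smul (Const a) (gen_cube \<phi> \<Gamma>) else 0)) \<in> CB"
    using state_component[OF _ z] by blast
  from bchoice[OF this] obtain a where
    a: "\<forall>\<phi>\<in>states. (\<lambda>\<Gamma>. smul (idem \<phi>) (z \<Gamma>) - (if \<phi> \<in> link_states then smul (Const (a \<phi>)) (gen_cube \<phi> \<Gamma>) else 0)) \<in> CB"
    by blast
  have "(\<lambda>\<Gamma>. \<Sum>\<phi>\<in>states. smul (idem \<phi>) (z \<Gamma>) - (if \<phi> \<in> link_states then smul (Const (a \<phi>)) (gen_cube \<phi> \<Gamma>) else 0)) \<in> CB"
    by (rule CB_sum[OF _ a[rule_format]]) simp_all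
  moreover have "(\<Sum>\<phi>\<in>states. smul (idem \<phi>) (z \<Gamma>) - (if \<phi> \<in> link_states then smul (Const (a \<phi>)) (gen_cube \<phi> \<Gamma>) else 0)) =
      z \<Gamma> - (\<Sum>\<phi>\<in>link_states. smul (Const (a \<phi>)) (gen_cube \<phi> \<Gamma>))" for \<Gamma>
  proof -
    have "(\<Sum>\<phi>\<in>states. if \<phi> \<in> link_states then smul (Const (a \<phi>)) (gen_cube \<phi> \<Gamma>) else 0) =
        (\<Sum>\<phi>\<in>link_states. smul (Const (a \<phi>)) (gen_cube \<phi> \<Gamma>))"
      by (rule sum.mono_neutral_cong_right) (use link_states_subset in auto)
    then show ?thesis
      unfolding sum_subtractf smul_sum_left[symmetric] sum_idem smul_simps(4) by simp
  qed
  ultimately show ?thesis by (intro exI[of _ a]) (simp only:)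
qed

text \<open>Multiply by \<open>idem \<phi>\<close> and look at the resolution
  \<open>thick \<phi>\<close>. The other generators die by orthogonality of the idempotents, and the
  image of \<open>del\<close> dies because it arrives from resolutions where
  \<open>idem \<phi>\<close> is null.\<close>

lemma cube_independent:
  assumes CB: "(\<lambda>\<Gamma>. \<Sum>\<psi>\<in>link_states. smul (Const (a \<psi>)) (gen_cube \<psi> \<Gamma>)) \<in> CB" and \<phi>: "\<phi> \<in> link_states"
  shows "a \<phi> = 0"
proof (rule ccontr)
  assume "a \<phi> \<noteq> 0"
  let ?\<Gamma> = "thick \<phi>" and ?e = "idem \<phi>"
  have st: "\<phi> \<in> states" using \<phi> link_states_subset by auto
  from CB obtain y where y: "y \<in> ZZ"
    "(\<Sum>\<psi>\<in>link_states. smul (Const (a \<psi>)) (gen_cube \<psi> ?\<Gamma>)) - del y ?\<Gamma> \<in> Br ?\<Gamma>"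
    unfolding CB_def using thick_subset by blast
  let ?S = "\<Sum>\<psi>\<in>link_states - {\<phi>}. smul (Const (a \<psi>)) (smul ?e (gen_cube \<psi> ?\<Gamma>))"
  have 1: "?S \<in> Br ?\<Gamma>"
  proof (rule Br_sum, rule Br_intros(3))
    fix \<psi> assume p: "\<psi> \<in> link_states - {\<phi>}"
    show "smul ?e (gen_cube \<psi> ?\<Gamma>) \<in> Br ?\<Gamma>"
    proof (cases "thick \<psi> = ?\<Gamma>")
      case True
      obtain w where "w \<in> Zr (thick \<psi>)" "canonical \<psi> = smul (idem \<psi>) w" using canonical(3) p by blast
      then show ?thesis
        using idem_orthogonal_Br[of \<psi> \<phi> w ?\<Gamma>] p st link_states_subset True by (auto simp: gen_cube_def)
    qed (simp add: gen_cube_def smul_simps Br_intros)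
  qed
  have 2: "smul ?e (del y ?\<Gamma>) \<in> Br ?\<Gamma>"
    unfolding del_def smul_sum
  proof (rule Br_sum)
    fix c assume "c \<in> {c \<in> crossings L. valid c ?\<Gamma>}"
    then have c: "c \<in> crossings L" by simp
    have sub: "switch c ?\<Gamma> \<subseteq> crossings L" using switch_subset[OF c thick_subset] .
    have "smul ?e (y (switch c ?\<Gamma>)) \<in> Br (switch c ?\<Gamma>)"
      using y(1) sub by (intro null_Zr null_link_state \<phi> sub switch_neq) (auto simp: ZZ_def)
    from edge_Br[OF c this] show "smul ?e (edge c ?\<Gamma> (y (switch c ?\<Gamma>))) \<in> Br ?\<Gamma>"
      unfolding edge_simps .
  qed
  have "smul ?e ((\<Sum>\<psi>\<in>link_states. smul (Const (a \<psi>)) (gen_cube \<psi> ?\<Gamma>)) - del y ?\<Gamma>) \<in> Br ?\<Gamma>"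
    using y(2) by (rule Br_intros)
  also have "(\<Sum>\<psi>\<in>link_states. smul (Const (a \<psi>)) (gen_cube \<psi> ?\<Gamma>)) =
      smul (Const (a \<phi>)) (canonical \<phi>) + (\<Sum>\<psi>\<in>link_states - {\<phi>}. smul (Const (a \<psi>)) (gen_cube \<psi> ?\<Gamma>))"
    unfolding sum.remove[OF finite_link_states \<phi>] by (simp add: gen_cube_def)
  also have "smul ?e (smul (Const (a \<phi>)) (canonical \<phi>) + (\<Sum>\<psi>\<in>link_states - {\<phi>}. smul (Const (a \<psi>)) (gen_cube \<psi> ?\<Gamma>)) - del y ?\<Gamma>)
      = smul (Const (a \<phi>)) (smul ?e (canonical \<phi>)) + ?S - smul ?e (del y ?\<Gamma>)"
    unfolding smul_simps(1,9) smul_sum smul_simps(3) by (simp only: mult.commute)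
  finally have 3: "smul (Const (a \<phi>)) (smul ?e (canonical \<phi>)) + ?S - smul ?e (del y ?\<Gamma>) \<in> Br ?\<Gamma>" .
  from Br_intros(4)[OF Br_intros(2)[OF this 2] 1]
  have "smul (Const (a \<phi>)) (smul ?e (canonical \<phi>)) \<in> Br ?\<Gamma>" by (simp only: diff_add_cancel add_diff_cancel_right')
  from Br_intros(3)[OF this, of "Const (1 / a \<phi>)"]
  have "smul (Const (1 / a \<phi>) * Const (a \<phi>)) (smul ?e (canonical \<phi>)) \<in> Br ?\<Gamma>" by (simp only: smul_simps(3) mult.assoc)
  moreover have "Const (1 / a \<phi>) * Const (a \<phi>) = (1 :: 'm mpoly)" using \<open>a \<phi> \<noteq> 0\<close> by (simp flip: Const_mult)
  ultimately show False using canonical(2)[OF \<phi>] by (simp only: smul_simps(4))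
qed

end

section \<open>Vector spaces presented by representatives\<close>

text \<open>\<open>q\<close> is a linear surjection from concrete representatives; the vector space
  axioms of \<open>V\<close> are carried over along it. The pattern serves for chains, cohomology of
  resolutions, the direct sum over the cube and the total cohomology.\<close>

locale linear_presentation =
  fixes sc :: "complex \<Rightarrow> 'v::ab_group_add \<Rightarrow> 'v" and S :: "'v set"
    and q :: "'v \<Rightarrow> 'w" and V :: "(complex, 'w) module" (structure)
  assumes sc: "sc a (x + y) = sc a x + sc a y" "sc (a + b) x = sc a x + sc b x"
      "sc (a * b) x = sc a (sc b x)" "sc 1 x = x"
    and S: "0 \<in> S" "x \<in> S \<Longrightarrow> y \<in> S \<Longrightarrow> x + y \<in> S" "x \<in> S \<Longrightarrow> sc a x \<in> S"
    and carrier_q: "carrier V = q ` S"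
    and add_q: "x \<in> S \<Longrightarrow> y \<in> S \<Longrightarrow> q x \<oplus> q y = q (x + y)"
    and smult_q: "x \<in> S \<Longrightarrow> a \<odot>\<^bsub>V\<^esub> q x = q (sc a x)"
    and zero_q: "\<zero> = q 0"
begin

lemma sc_zero: "sc 0 x = 0" "sc a 0 = 0"
  using sc(2)[of 0 0 x] sc(1)[of a 0 0] by simp_all

lemma sc_uminus: "sc (- 1) x = - x"
  using sc(2)[of 1 "- 1" x] by (simp add: sc(4) sc_zero eq_neg_iff_add_eq_0 add.commute)

lemma S_uminus: "x \<in> S \<Longrightarrow> - x \<in> S" using S(3)[of x "- 1"] by (simp add: sc_uminus)

lemma S_sum: "(\<And>i. i \<in> I \<Longrightarrow> f i \<in> S) \<Longrightarrow> sum f I \<in> S"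
  by (induction I rule: infinite_finite_induct) (auto intro: S)

lemma vectorspace: "vectorspace class_ring V"
proof -
  have neg: "\<exists>y\<in>S. q x \<oplus> q y = q 0" if "x \<in> S" for x
    using that S_uminus by (intro bexI[of _ "- x"]) (simp_all add: add_q)
  have "module (class_ring :: complex ring) V"
    by (rule module_criteria)
      (use neg in \<open>auto simp: carrier_q add_q smult_q zero_q S sc ac_simps class_cring.is_cring
        intro: class_cring.cring_axioms\<close>)
  then show ?thesis unfolding vectorspace_def using class_field by blast
qed

sublocale vectorspace class_ring V by (rule vectorspace)

lemma finsum_q: "finite I \<Longrightarrow> (\<And>i. i \<in> I \<Longrightarrow> f i \<in> S) \<Longrightarrow> (\<Oplus>i\<in>I. q (f i)) = q (sum f I)"
proof (induction I rule: finite_induct)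
  case (insert i I)
  then have "(\<lambda>i. q (f i)) \<in> I \<rightarrow> carrier V" "q (f i) \<in> carrier V" by (auto simp: carrier_q)
  with insert show ?case by (simp add: add_q S_sum)
qed (simp add: zero_q)

context
  fixes T M :: "'v set"
  assumes T: "T \<subseteq> S" "0 \<in> T" "\<And>x y. x \<in> T \<Longrightarrow> y \<in> T \<Longrightarrow> x + y \<in> T" "\<And>x a. x \<in> T \<Longrightarrow> sc a x \<in> T"
    and M: "M \<subseteq> T" "0 \<in> M" "\<And>x y. x \<in> M \<Longrightarrow> y \<in> M \<Longrightarrow> x + y \<in> M" "\<And>x a. x \<in> M \<Longrightarrow> sc a x \<in> M"
begin

lemma coset_q:
  assumes x: "x \<in> T" shows "q ` M +>\<^bsub>V\<lparr>carrier := C\<rparr>\<^esub> q x = (\<lambda>m. q (m + x)) ` M"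
proof -
  have "q m \<oplus> q x = q (m + x)" if "m \<in> M" for m using that x T(1) M(1) by (intro add_q) auto
  then show ?thesis by (auto simp: a_r_coset_def')
qed

text \<open>\<open>T\<close> and \<open>M\<close> stand for representatives of cocycles and
  coboundaries. The result is again a presentation by the same representatives, so cohomology can be
  taken twice without handling cosets of cosets.\<close>

lemma quotient:
  "linear_presentation sc T (\<lambda>x. q ` M +>\<^bsub>V\<^esub> q x) (quotient_space (V\<lparr>carrier := q ` T\<rparr>) (q ` M))"
    (is "linear_presentation _ _ _ ?X")
proof -
  let ?Q = "\<lambda>x. (\<lambda>m. q (m + x)) ` M"
  have carrier: "carrier ?X = ?Q ` T"
    by (force simp: quotient_space_def A_RCOSETS_def' coset_q)
  have add: "?Q x \<oplus>\<^bsub>?X\<^esub> ?Q y = ?Q (x + y)" if "x \<in> T" "y \<in> T" for x y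
  proof -
    have eq: "q (m + x) \<oplus> q (m' + y) = q ((m + m') + (x + y))" if "m \<in> M" "m' \<in> M" for m m'
      using that \<open>x \<in> T\<close> \<open>y \<in> T\<close> T(1) M(1) by (simp add: add_q S subset_iff ac_simps)
    have "?Q x \<oplus>\<^bsub>?X\<^esub> ?Q y = (\<Union>m\<in>M. \<Union>m'\<in>M. {q (m + x) \<oplus> q (m' + y)})"
      by (simp add: quotient_space_def set_add_def set_mult_def)
    also have "\<dots> = (\<Union>m\<in>M. \<Union>m'\<in>M. {q ((m + m') + (x + y))})" by (simp add: eq)
    also have "\<dots> = ?Q (x + y)"
    proof
      show "?Q (x + y) \<subseteq> (\<Union>m\<in>M. \<Union>m'\<in>M. {q ((m + m') + (x + y))})"
        using M(2) by (force intro: bexI[of _ 0])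
    qed (use M(3) in blast)
    finally show ?thesis .
  qed
  have smult: "a \<odot>\<^bsub>?X\<^esub> ?Q x = ?Q (sc a x)" if x: "x \<in> T" for a x
  proof -
    have m: "a \<odot>\<^bsub>V\<^esub> q (m + x) = q (sc a m + sc a x)" "sc a m + sc a x \<in> T" if "m \<in> M" for m
      using that x T M(1) by (auto simp: smult_q S sc subset_iff)
    have "a \<odot>\<^bsub>?X\<^esub> ?Q x = (\<Union>m\<in>M. (\<lambda>m'. q (m' + (sc a m + sc a x))) ` M)"
      unfolding quotient_space_def by (simp add: m coset_q)
    also have "\<dots> = ?Q (sc a x)"
    proof
      show "(\<Union>m\<in>M. (\<lambda>m'. q (m' + (sc a m + sc a x))) ` M) \<subseteq> ?Q (sc a x)"
        using M(3,4) by (auto simp flip: add.assoc)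
      show "?Q (sc a x) \<subseteq> (\<Union>m\<in>M. (\<lambda>m'. q (m' + (sc a m + sc a x))) ` M)"
        using UN_upper[OF M(2), of "\<lambda>m. (\<lambda>m'. q (m' + (sc a m + sc a x))) ` M"] by (simp add: sc_zero)
    qed
    finally show ?thesis .
  qed
  have zero: "\<zero>\<^bsub>?X\<^esub> = ?Q 0" by (simp add: quotient_space_def)
  have "linear_presentation sc T ?Q ?X"
    by unfold_locales (simp_all only: sc T carrier add smult zero)
  moreover have "q ` M +>\<^bsub>V\<^esub> q x = ?Q x" if "x \<in> T" for x
    using coset_q[OF that, of "carrier V"] by simp
  ultimately show ?thesis
    using T(2-4) unfolding linear_presentation_def by (simp cong: image_cong)
qed

text \<open>\<open>q\<close> may already identify representatives, and equality of cosets can be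
  tested in \<open>T\<close> once \<open>M\<close> absorbs these identifications.\<close>

lemma quotient_eq_iff:
  assumes ker: "\<And>x y. x \<in> T \<Longrightarrow> y \<in> T \<Longrightarrow> q x = q y \<Longrightarrow> x - y \<in> M"
    and x: "x \<in> T" and y: "y \<in> T"
  shows "q ` M +>\<^bsub>V\<^esub> q x = q ` M +>\<^bsub>V\<^esub> q y \<longleftrightarrow> x - y \<in> M"
proof -
  have coset: "q ` M +>\<^bsub>V\<^esub> q x = (\<lambda>m. q (m + x)) ` M" if "x \<in> T" for x
    using coset_q[OF that, of "carrier V"] by simp
  have neg: "- m \<in> M" if "m \<in> M" for m using M(4)[OF that, of "- 1"] by (simp add: sc_uminus)
  show ?thesis unfolding coset[OF x] coset[OF y]
  proof
    assume "(\<lambda>m. q (m + x)) ` M = (\<lambda>m. q (m + y)) ` M"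
    then have "q (0 + x) \<in> (\<lambda>m. q (m + y)) ` M" using M(2) by blast
    then obtain m where m: "m \<in> M" "q x = q (m + y)" by auto
    have "x - (m + y) \<in> M" using m M(1) T(3) x y by (intro ker) auto
    from M(3)[OF this m(1)] show "x - y \<in> M" by simp
  next
    assume xy: "x - y \<in> M"
    have "q (m + x) \<in> (\<lambda>m. q (m + y)) ` M" if "m \<in> M" for m
      by (rule image_eqI[of _ _ "m + (x - y)"]) (use that xy M(3) in auto)
    moreover have "q (m + y) \<in> (\<lambda>m. q (m + x)) ` M" if "m \<in> M" for m
      by (rule image_eqI[of _ _ "m + - (x - y)"]) (use that M(3) neg[OF xy] in auto)
    ultimately show "(\<lambda>m. q (m + x)) ` M = (\<lambda>m. q (m + y)) ` M" by blast
  qed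
qed

end

lemma basis_image:
  assumes J: "finite J" and f: "\<And>j. j \<in> J \<Longrightarrow> f j \<in> S"
    and gen: "\<And>x. x \<in> S \<Longrightarrow> \<exists>a. q x = q (\<Sum>j\<in>J. sc (a j) (f j))"
    and indep: "\<And>a j. q (\<Sum>j\<in>J. sc (a j) (f j)) = q 0 \<Longrightarrow> j \<in> J \<Longrightarrow> a j = 0"
  shows "inj_on (\<lambda>j. q (f j)) J" "basis ((\<lambda>j. q (f j)) ` J)"
proof -
  let ?g = "\<lambda>j. q (f j)"
  show inj: "inj_on ?g J"
  proof (rule inj_onI, rule ccontr)
    fix i j assume ij: "i \<in> J" "j \<in> J" "?g i = ?g j" "i \<noteq> j"
    \<comment> \<open>Two equal images would give the nontrivial relation with coefficients 1 and
      -1.\<close>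
    let ?a = "\<lambda>k. if k = i then 1 else if k = j then - 1 else (0::complex)"
    have "(\<Sum>k\<in>J. sc (?a k) (f k)) = (\<Sum>k\<in>{i, j}. sc (?a k) (f k))"
      using ij J by (intro sum.mono_neutral_right) (auto simp: sc_zero)
    also have "\<dots> = f i + - f j" using ij(4) by (simp add: sc sc_uminus)
    also have "q \<dots> = ?g j \<oplus> q (- f j)" using ij f by (simp add: add_q S_uminus flip: ij(3))
    also have "\<dots> = q 0" using ij f by (simp add: add_q S_uminus)
    finally show False using indep[of ?a i] ij by simp
  qed
  have car: "?g ` J \<subseteq> carrier V" using f by (auto simp: carrier_q)
  have lin: "lincomb a (?g ` J) = q (\<Sum>j\<in>J. sc (a (?g j)) (f j))" for a
  proof -
    have "lincomb a (?g ` J) = (\<Oplus>j\<in>J. a (?g j) \<odot>\<^bsub>V\<^esub> ?g j)"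
      unfolding lincomb_def using f by (subst finsum_reindex[OF _ inj]) (auto simp: carrier_q smult_q S)
    also have "\<dots> = (\<Oplus>j\<in>J. q (sc (a (?g j)) (f j)))"
      using f by (intro finsum_cong') (auto simp: carrier_q smult_q S)
    finally show ?thesis using J f by (simp add: finsum_q S)
  qed
  have "lin_indpt (?g ` J)"
    by (rule finite_lin_indpt2) (use J car lin indep zero_q in \<open>auto\<close>)
  moreover have "carrier V \<subseteq> span (?g ` J)"
  proof
    fix v assume "v \<in> carrier V"
    then obtain x a where x: "x \<in> S" "v = q x" "q x = q (\<Sum>j\<in>J. sc (a j) (f j))"
      using gen carrier_q by blast
    have "v = lincomb (\<lambda>w. a (inv_into J ?g w)) (?g ` J)"
      unfolding lin x(2,3) using inv_into_f_f[OF inj] by (intro arg_cong[of _ _ q] sum.cong) auto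
    then show "v \<in> span (?g ` J)" unfolding finite_span[OF finite_imageI[OF J] car] by auto
  qed
  moreover have "span (?g ` J) \<subseteq> carrier V" using span_is_subset2[OF car] .
  ultimately show "basis (?g ` J)" unfolding basis_def using car by auto
qed

end

lemma linear_presentation_direct_sum:
  assumes I: "finite I" and P: "\<And>i. i \<in> I \<Longrightarrow> linear_presentation sc (S i) (q i) (V i)"
    and sc: "\<And>a x y. sc a (x + y) = sc a x + sc a y" "\<And>a b x. sc (a + b) x = sc a x + sc b x"
      "\<And>a b x. sc (a * b) x = sc a (sc b x)" "\<And>x. sc 1 x = x"
  shows "linear_presentation (\<lambda>a z i. sc a (z i)) {z. \<forall>i\<in>I. z i \<in> S i} (\<lambda>z. \<lambda>i\<in>I. q i (z i)) (direct_sum I V)"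
proof
  show "carrier (direct_sum I V) = (\<lambda>z. \<lambda>i\<in>I. q i (z i)) ` {z. \<forall>i\<in>I. z i \<in> S i}"
  proof (intro subset_antisym subsetI)
    fix f assume f: "f \<in> carrier (direct_sum I V)"
    then have "\<forall>i\<in>I. \<exists>x. x \<in> S i \<and> f i = q i x"
      using linear_presentation.carrier_q[OF P] by (fastforce simp: direct_sum_def)
    from bchoice[OF this] obtain z where "\<forall>i\<in>I. z i \<in> S i \<and> f i = q i (z i)" ..
    moreover have "f \<in> extensional I" using f by (simp add: direct_sum_def PiE_def)
    ultimately show "f \<in> (\<lambda>z. \<lambda>i\<in>I. q i (z i)) ` {z. \<forall>i\<in>I. z i \<in> S i}"
      by (intro image_eqI[of _ _ z]) (auto intro: extensionalityI)
  qed (use I linear_presentation.carrier_q[OF P] in \<open>auto simp: direct_sum_def\<close>)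
qed (use sc linear_presentation.S[OF P] linear_presentation.add_q[OF P]
    linear_presentation.smult_q[OF P] linear_presentation.zero_q[OF P] in
    \<open>auto simp: direct_sum_def fun_eq_iff\<close>)

section \<open>The cohomology of the link\<close>

context gornik
begin

abbreviation scale :: "complex \<Rightarrow> ('c, 'm) chain \<Rightarrow> ('c, 'm) chain" where
  "scale a \<equiv> smul (Const a)"

abbreviation cls :: "'c set \<Rightarrow> ('c, 'm) chain \<Rightarrow> ('c, 'm) chain set" where
  "cls \<equiv> res_class n \<beta> L"

lemma carrier_chains: "carrier (chains L p) = homogeneous p"
  by (simp add: chains_def homogeneous_def)

lemma res_cocycles_eq: "res_cocycles n \<beta> L \<Gamma> = Zr \<Gamma>"
  by (simp add: res_cocycles_def carrier_chains res_diff_eq Zr_def par0_def zero_fun_def)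

lemma res_coboundaries_eq: "res_coboundaries n \<beta> L \<Gamma> = Br \<Gamma>"
  by (simp add: res_coboundaries_def carrier_chains res_diff_eq Br_def par0_def)

lemma scale_simps: "scale a (x + y) = scale a x + scale a y" "scale (a + b) x = scale a x + scale b x"
  "scale (a * b) x = scale a (scale b x)" "scale 1 x = x"
  by (simp_all only: Const_add Const_mult Const_1 smul_simps)

lemma chains_presentation: "linear_presentation scale (homogeneous p) (\<lambda>z. z) (chains L p)"
proof
  show "\<zero>\<^bsub>chains L p\<^esub> = 0" by (simp add: chains_def zero_fun_def)
qed (simp_all only: scale_simps homogeneous_intros carrier_chains image_ident,
  simp_all add: chains_def plus_fun_def smul_def)

lemma cohomology_presentation: "linear_presentation scale (Zr \<Gamma>) (cls \<Gamma>) (res_cohomology n \<beta> L \<Gamma>)"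
  and cls_eq_iff: "z \<in> Zr \<Gamma> \<Longrightarrow> w \<in> Zr \<Gamma> \<Longrightarrow> cls \<Gamma> z = cls \<Gamma> w \<longleftrightarrow> z - w \<in> Br \<Gamma>"
proof -
  interpret linear_presentation scale "homogeneous par0" "\<lambda>z. z" "chains L par0" by (rule chains_presentation)
  have sub: "Zr \<Gamma> \<subseteq> homogeneous par0" by (auto simp: Zr_def)
  note closed = sub Zr_intros(1-3) Br_Zr Br_intros(1-3)
  show "linear_presentation scale (Zr \<Gamma>) (cls \<Gamma>) (res_cohomology n \<beta> L \<Gamma>)"
    using quotient[OF closed]
    by (simp add: res_cohomology_def res_class_def[abs_def] res_cocycles_eq res_coboundaries_eq flip: par0_def)
  show "cls \<Gamma> z = cls \<Gamma> w \<longleftrightarrow> z - w \<in> Br \<Gamma>" if "z \<in> Zr \<Gamma>" "w \<in> Zr \<Gamma>"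
    using quotient_eq_iff[OF closed _ that] Br_intros(1) by (simp add: res_class_def res_coboundaries_eq flip: par0_def)
qed

text \<open>\<open>chi\<close> takes a union over all representatives of a class. The map sends
  coboundaries to coboundaries, so every representative contributes the same coset and the union is
  that coset.\<close>

lemma chi_cls:
  assumes c: "c \<in> crossings L" and z: "z \<in> Zr (switch c \<Gamma>)"
  shows "(- 1) ^ card {c'\<in>\<Gamma>. c' < c} \<odot>\<^bsub>res_cohomology n \<beta> L \<Gamma>\<^esub> chi n \<beta> L (switch c \<Gamma>) c (cls (switch c \<Gamma>) z) =
    cls \<Gamma> (edge c \<Gamma> z)"
proof -
  interpret linear_presentation scale "Zr \<Gamma>" "cls \<Gamma>" "res_cohomology n \<beta> L \<Gamma>"
    by (rule cohomology_presentation)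
  define E where "E = chi_chain n L (switch c \<Gamma>) c"
  have E: "E v = smul (edge_sign \<Gamma> c) (edge c \<Gamma> v)" for v
    unfolding E_def chi_chain_eq edge_def smul_simps(3) edge_sign_square smul_simps(4) ..
  have EZ: "E v \<in> Zr \<Gamma>" if "v \<in> Zr (switch c \<Gamma>)" for v
    unfolding E using edge_Zr[OF c that] by (rule Zr_intros)
  have EB: "E v \<in> Br \<Gamma>" if "v \<in> Br (switch c \<Gamma>)" for v
    unfolding E using edge_Br[OF c that] by (rule Br_intros)
  have "cls \<Gamma> (E (m + z)) = cls \<Gamma> (E z)" if m: "m \<in> Br (switch c \<Gamma>)" for m
  proof -
    have "E (m + z) - E z = E m" unfolding E edge_simps smul_simps(1) by (rule add_diff_cancel_right')
    moreover have "m + z \<in> Zr (switch c \<Gamma>)" using m Br_Zr z by (blast intro: Zr_intros)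
    ultimately show ?thesis using EZ z EB[OF m] by (simp only: cls_eq_iff)
  qed
  moreover have "cls (switch c \<Gamma>) z = (\<lambda>m. m + z) ` Br (switch c \<Gamma>)"
    by (auto simp: res_class_def a_r_coset_def' chains_def res_coboundaries_eq plus_fun_def)
  moreover have "Br (switch c \<Gamma>) \<noteq> {}" using Br_intros(1) by blast
  ultimately have "chi n \<beta> L (switch c \<Gamma>) c (cls (switch c \<Gamma>) z) = cls \<Gamma> (E z)"
    unfolding chi_def switch_switch E_def[symmetric] by auto
  then have "(- 1) ^ card {c'\<in>\<Gamma>. c' < c} \<odot>\<^bsub>res_cohomology n \<beta> L \<Gamma>\<^esub> chi n \<beta> L (switch c \<Gamma>) c (cls (switch c \<Gamma>) z) =
      cls \<Gamma> (scale ((- 1) ^ card {c'\<in>\<Gamma>. c' < c}) (E z))" using EZ[OF z] by (simp only: smult_q)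
  also have "scale ((- 1) ^ card {c'\<in>\<Gamma>. c' < c}) (E z) = edge c \<Gamma> z"
    unfolding Const_power Const_minus Const_1 edge_sign_def[symmetric] E smul_simps(3) edge_sign_square smul_simps(4) ..
  finally show ?thesis .
qed

abbreviation scale_cube :: "complex \<Rightarrow> ('c set \<Rightarrow> ('c, 'm) chain) \<Rightarrow> 'c set \<Rightarrow> ('c, 'm) chain" where
  "scale_cube a z \<equiv> \<lambda>\<Gamma>. scale a (z \<Gamma>)"

definition tot :: "('c set \<Rightarrow> ('c, 'm) chain) \<Rightarrow> 'c set \<Rightarrow> ('c, 'm) chain set" where
  "tot z = (\<lambda>\<Gamma>\<in>Pow (crossings L). cls \<Gamma> (z \<Gamma>))"

lemma total_presentation:
  "linear_presentation scale_cube ZZ tot (total_space (link_complex n \<beta> L))"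
proof -
  have "ZZ = {z. \<forall>\<Gamma>\<in>Pow (crossings L). z \<Gamma> \<in> Zr \<Gamma>}" by (auto simp: ZZ_def)
  then show ?thesis
    using linear_presentation_direct_sum[OF _ cohomology_presentation scale_simps, of "Pow (crossings L)"] finite_crossings
    by (simp add: link_complex_def Let_def tot_def[abs_def])
qed

lemma tot_eq_iff:
  assumes "z \<in> ZZ" "w \<in> ZZ"
  shows "tot z = tot w \<longleftrightarrow> (\<lambda>\<Gamma>. z \<Gamma> - w \<Gamma>) \<in> BB"
proof -
  have "tot z = tot w \<longleftrightarrow> (\<forall>\<Gamma>\<subseteq>crossings L. cls \<Gamma> (z \<Gamma>) = cls \<Gamma> (w \<Gamma>))"
    by (auto simp: tot_def fun_eq_iff restrict_def)
  also have "\<dots> \<longleftrightarrow> (\<lambda>\<Gamma>. z \<Gamma> - w \<Gamma>) \<in> BB"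
    using assms by (auto simp: cls_eq_iff ZZ_def BB_def)
  finally show ?thesis .
qed

lemma total_diff_tot:
  assumes z: "z \<in> ZZ"
  shows "total_diff (link_complex n \<beta> L) (tot z) = tot (del z)"
proof -
  have "(\<Oplus>\<^bsub>res_cohomology n \<beta> L \<Gamma>\<^esub> c\<in>{c \<in> crossings L. c \<in> \<Gamma> \<longleftrightarrow> positive L c}.
          (- 1) ^ card {c' \<in> \<Gamma>. c' < c} \<odot>\<^bsub>res_cohomology n \<beta> L \<Gamma>\<^esub>
            chi n \<beta> L (switch c \<Gamma>) c (tot z (switch c \<Gamma>))) = cls \<Gamma> (del z \<Gamma>)" (is "?l = _")
    if \<Gamma>: "\<Gamma> \<subseteq> crossings L" for \<Gamma>
  proof -
    interpret linear_presentation scale "Zr \<Gamma>" "cls \<Gamma>" "res_cohomology n \<beta> L \<Gamma>"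
      by (rule cohomology_presentation)
    have zs: "z (switch c \<Gamma>) \<in> Zr (switch c \<Gamma>)" if "c \<in> crossings L" for c
      using z switch_subset[OF that \<Gamma>] by (auto simp: ZZ_def)
    have e: "edge c \<Gamma> (z (switch c \<Gamma>)) \<in> Zr \<Gamma>" if "c \<in> crossings L" for c
      using edge_Zr[OF that zs[OF that]] .
    have "?l = (\<Oplus>\<^bsub>res_cohomology n \<beta> L \<Gamma>\<^esub> c\<in>{c \<in> crossings L. valid c \<Gamma>}. cls \<Gamma> (edge c \<Gamma> (z (switch c \<Gamma>))))"
      using e zs switch_subset[OF _ \<Gamma>] 
      by (intro finsum_cong') (auto simp: valid_def chi_cls carrier_q tot_def)
    also have "\<dots> = cls \<Gamma> (del z \<Gamma>)" unfolding del_def using e finite_crossings by (intro finsum_q) auto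
    finally show ?thesis .
  qed
  then show ?thesis by (simp add: link_complex_def Let_def tot_def[of "del z"] cong: restrict_cong)
qed

lemma CB_ZZ: "CB \<subseteq> CZ"
proof
  fix z assume "z \<in> CB"
  then obtain y where y: "y \<in> ZZ" "\<And>\<Gamma>. \<Gamma> \<subseteq> crossings L \<Longrightarrow> z \<Gamma> - del y \<Gamma> \<in> Br \<Gamma>" by (auto simp: CB_def)
  define b where "b = (\<lambda>\<Gamma>. z \<Gamma> - del y \<Gamma>)"
  have b: "b \<in> BB" using y(2) by (auto simp: b_def BB_def)
  have zb: "z = (\<lambda>\<Gamma>. b \<Gamma> + del y \<Gamma>)" unfolding b_def by (simp only: diff_add_cancel)
  have "b \<in> ZZ" using b Br_Zr by (auto simp: BB_def ZZ_def)
  then have "z \<in> ZZ" unfolding zb using del_ZZ[OF y(1)] by (auto simp: ZZ_def intro: Zr_intros)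
  moreover have "del z \<Gamma> \<in> Br \<Gamma>" if "\<Gamma> \<subseteq> crossings L" for \<Gamma>
    unfolding zb del_add del_del[OF y(1) that] add.right_neutral using del_BB[OF b] that by (auto simp: BB_def)
  ultimately show "z \<in> CZ" by (auto simp: CZ_def BB_def)
qed

lemma cocycles_eq: "cocycles (link_complex n \<beta> L) = tot ` CZ"
proof -
  interpret linear_presentation scale_cube ZZ tot "total_space (link_complex n \<beta> L)"
    by (rule total_presentation)
  have "total_diff (link_complex n \<beta> L) (tot z) = \<zero>\<^bsub>total_space (link_complex n \<beta> L)\<^esub> \<longleftrightarrow> z \<in> CZ" if "z \<in> ZZ" for z
    using tot_eq_iff[OF del_ZZ[OF that] S(1)] that
    unfolding total_diff_tot[OF that] zero_q by (simp add: CZ_def zero_fun_def[where 'b = "('c, 'm) chain"])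
  then show ?thesis unfolding cocycles_def carrier_q by (auto simp: CZ_def)
qed

lemma coboundaries_eq: "coboundaries (link_complex n \<beta> L) = tot ` CB"
proof -
  interpret linear_presentation scale_cube ZZ tot "total_space (link_complex n \<beta> L)"
    by (rule total_presentation)
  have "tot z \<in> (\<lambda>y. tot (del y)) ` ZZ" if "z \<in> CB" for z
  proof -
    have "\<exists>y\<in>ZZ. (\<lambda>\<Gamma>. z \<Gamma> - del y \<Gamma>) \<in> BB" using that by (simp only: CB_def BB_def mem_Collect_eq)
    then obtain y where y: "y \<in> ZZ" "(\<lambda>\<Gamma>. z \<Gamma> - del y \<Gamma>) \<in> BB" by blast
    have "z \<in> ZZ" using that CB_ZZ by (auto simp: CZ_def)
    from tot_eq_iff[OF this del_ZZ[OF y(1)]] y show ?thesis by (intro image_eqI[of _ _ y]) simp_all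
  qed
  moreover have "del y \<in> CB" if "y \<in> ZZ" for y
    unfolding CB_def using that by (intro CollectI bexI[of _ y]) (simp_all only: diff_self Br_intros simp_thms)
  ultimately show ?thesis
    unfolding coboundaries_def carrier_q image_image by (auto simp: total_diff_tot)
qed

definition total_class :: "('c set \<Rightarrow> ('c, 'm) chain) \<Rightarrow> ('c set \<Rightarrow> ('c, 'm) chain set) set" where
  "total_class z = coboundaries (link_complex n \<beta> L) +>\<^bsub>total_space (link_complex n \<beta> L)\<^esub> tot z"

lemma total_cohomology_presentation:
  "linear_presentation scale_cube CZ total_class (cohomology (link_complex n \<beta> L))"
  and total_class_eq_iff: "z \<in> CZ \<Longrightarrow> w \<in> CZ \<Longrightarrow> total_class z = total_class w \<longleftrightarrow> z - w \<in> CB"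
proof -
  interpret linear_presentation scale_cube ZZ tot "total_space (link_complex n \<beta> L)"
    by (rule total_presentation)
  have sub: "CZ \<subseteq> ZZ" by (auto simp: CZ_def)
  have Z: "z + w \<in> CZ" if z: "z \<in> CZ" and w: "w \<in> CZ" for z w
  proof -
    have "z \<Gamma> + w \<Gamma> \<in> Zr \<Gamma>" "del (\<lambda>\<Gamma>. z \<Gamma> + w \<Gamma>) \<Gamma> \<in> Br \<Gamma>" if "\<Gamma> \<subseteq> crossings L" for \<Gamma>
      unfolding del_add using z w that by (auto simp: CZ_def ZZ_def BB_def intro: Zr_intros(2) Br_intros(2) simp del: plus_fun_apply)
    then show ?thesis unfolding plus_fun_def[of z w] CZ_def ZZ_def BB_def by blast
  qed
  have sZ: "scale_cube a z \<in> CZ" if z: "z \<in> CZ" for z a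
  proof -
    have "scale a (z \<Gamma>) \<in> Zr \<Gamma>" "del (scale_cube a z) \<Gamma> \<in> Br \<Gamma>" if "\<Gamma> \<subseteq> crossings L" for \<Gamma>
      unfolding del_smul using z that by (auto simp: CZ_def ZZ_def BB_def intro: Zr_intros(3) Br_intros(3))
    then show ?thesis unfolding CZ_def ZZ_def BB_def by blast
  qed
  have B: "z + w \<in> CB" if "z \<in> CB" "w \<in> CB" for z w
    using CB_add[OF that] unfolding plus_fun_def[of z w] .
  have 0: "0 \<in> CB" using BB_CB[of 0] Br_intros(1) by (simp add: BB_def)
  note closed = sub subsetD[OF CB_ZZ 0] Z sZ CB_ZZ 0 B CB_smul
  show "linear_presentation scale_cube CZ total_class (cohomology (link_complex n \<beta> L))"
    using quotient[OF closed] unfolding cohomology_def total_class_def[abs_def] cocycles_eq coboundaries_eq .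
  have "z - w \<in> CB" if "z \<in> CZ" "w \<in> CZ" "tot z = tot w" for z w
    using that tot_eq_iff[of z w] BB_CB[of "\<lambda>\<Gamma>. z \<Gamma> - w \<Gamma>"] unfolding fun_diff_def[of z w] by (auto simp: CZ_def)
  then show "total_class z = total_class w \<longleftrightarrow> z - w \<in> CB" if "z \<in> CZ" "w \<in> CZ"
    using quotient_eq_iff[OF closed, of z w] that unfolding total_class_def coboundaries_eq by blast
qed

section \<open>Colourings of the components and linking numbers\<close>

definition strand :: "'m \<Rightarrow> 'm \<Rightarrow> bool" where
  "strand x y \<longleftrightarrow> (x, y) \<in> arcs L \<or>
     (\<exists>c\<in>crossings L. (x, y) \<in> {(ends L c 1, ends L c 4), (ends L c 2, ends L c 3)})"

definition component :: "'m \<Rightarrow> 'm set" where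
  "component x = Collect (equivclp strand x)"

lemma link_components_eq: "link_components L = range component"
  unfolding link_components_def equiv_classes_range component_def[abs_def] strand_def[abs_def] ..

lemma component_iff: "K \<in> link_components L \<Longrightarrow> x \<in> K \<longleftrightarrow> component x = K"
proof -
  assume "K \<in> link_components L"
  then obtain y where "K = component y" by (auto simp: link_components_eq)
  then show "x \<in> K \<longleftrightarrow> component x = K"
    using equivclp_sym[of strand] by (simp only: component_def class_eq_iff mem_Collect_eq) blast
qed

lemma finite_link_components: "finite (link_components L)"
  by (simp add: link_components_eq)

lemma strand_component: "strand x y \<Longrightarrow> component x = component y"
  unfolding component_def class_eq_iff by (rule r_into_equivclp)

abbreviation colourings :: "('m set \<Rightarrow> complex) set" where
  "colourings \<equiv> link_components L \<rightarrow>\<^sub>E roots_of_unity n"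

text \<open>The factor \<beta> carries the roots of unity to the roots of
  \<open>x ^ n = \<beta> ^ n\<close>.\<close>

definition state_of :: "('m set \<Rightarrow> complex) \<Rightarrow> 'm \<Rightarrow> complex" where
  "state_of \<psi> x = \<beta> * \<psi> (component x)"

lemma rts_eq: "\<beta> * \<epsilon> \<in> rts \<longleftrightarrow> \<epsilon> \<in> roots_of_unity n"
  using \<beta> by (simp add: rts_def roots_of_unity_def power_mult_distrib)

lemma card_roots_of_unity: "card (roots_of_unity n) = n"
proof -
  have "bij_betw ((*) \<beta>) (roots_of_unity n) rts"
    by (rule bij_betw_byWitness[where f' = "\<lambda>\<epsilon>. \<epsilon> / \<beta>"]) (use \<beta> rts_eq in \<open>auto simp flip: rts_eq\<close>)
  then show ?thesis using bij_betw_same_card card_rts by metis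
qed

lemma finite_colourings: "finite colourings" and card_colourings: "card colourings = n ^ card (link_components L)"
proof -
  have "finite (roots_of_unity n)" using card_roots_of_unity n by (intro card_ge_0_finite) simp
  then show "finite colourings" by (intro finite_PiE) (simp_all add: finite_link_components)
  show "card colourings = n ^ card (link_components L)"
    by (simp add: card_PiE finite_link_components card_roots_of_unity)
qed

lemma bij_state_of: "bij_betw state_of colourings link_states"
proof (rule bij_betwI')
  fix \<psi> assume \<psi>: "\<psi> \<in> colourings"
  have "state_of \<psi> x \<in> rts" for x
    using \<psi> unfolding state_of_def rts_eq by (auto simp: link_components_eq)
  moreover have "state_of \<psi> x = state_of \<psi> y" if "strand x y" for x y
    unfolding state_of_def strand_component[OF that] ..
  ultimately show "state_of \<psi> \<in> link_states"
    unfolding link_states_iff states_iff by (auto simp: strand_def)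
next
  fix \<psi> \<psi>' assume \<psi>: "\<psi> \<in> colourings" "\<psi>' \<in> colourings"
  show "state_of \<psi> = state_of \<psi>' \<longleftrightarrow> \<psi> = \<psi>'"
  proof
    assume eq: "state_of \<psi> = state_of \<psi>'"
    show "\<psi> = \<psi>'"
    proof (rule PiE_ext[OF \<psi>])
      fix K assume "K \<in> link_components L"
      then obtain x where "K = component x" by (auto simp: link_components_eq)
      then show "\<psi> K = \<psi>' K" using fun_cong[OF eq, of x] \<beta> by (simp add: state_of_def)
    qed
  qed simp
next
  fix \<phi> assume \<phi>: "\<phi> \<in> link_states"
  have const: "\<phi> x = \<phi> y" if "equivclp strand x y" for x y
    using that by (induction rule: equivclp_induct) (use \<phi> in \<open>fastforce simp: strand_def link_states_iff\<close>)+
  define \<psi> where "\<psi> = (\<lambda>K\<in>link_components L. \<phi> (SOME x. component x = K) / \<beta>)"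
  have \<psi>: "\<psi> (component x) = \<phi> x / \<beta>" for x
  proof -
    have "component (SOME y. component y = component x) = component x" by (rule someI) (rule refl)
    then have "\<phi> (SOME y. component y = component x) = \<phi> x" by (intro const) (simp add: component_def class_eq_iff)
    then show ?thesis by (simp add: \<psi>_def link_components_eq)
  qed
  have "\<phi> = state_of \<psi>" using \<beta> by (simp add: fun_eq_iff state_of_def \<psi>)
  moreover have "\<psi> \<in> colourings"
  proof (rule PiE_I)
    fix K assume "K \<in> link_components L"
    then obtain x where "K = component x" by (auto simp: link_components_eq)
    moreover have "\<phi> x \<in> rts" using \<phi> by (auto simp: link_states_iff states_iff)
    ultimately show "\<psi> K \<in> roots_of_unity n" using \<beta> by (simp add: \<psi> flip: rts_eq)
  qed (simp add: \<psi>_def)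
  ultimately show "\<exists>\<psi>\<in>colourings. \<phi> = state_of \<psi>" ..
qed

text \<open>Sum over ordered pairs of components of different colour and exchange with the sum over
  crossings: a crossing of two such components occurs for both orders, which compensates the factor
  one half of the linking number. These crossings are the thick ones.\<close>

lemma degree_thick:
  assumes \<psi>: "\<psi> \<in> colourings"
  shows "of_int (res_degree L (thick (state_of \<psi>))) =
    (\<Sum>(\<epsilon>1, \<epsilon>2)\<in>{(\<epsilon>1, \<epsilon>2) \<in> roots_of_unity n \<times> roots_of_unity n. \<epsilon>1 \<noteq> \<epsilon>2}.
       lk L {K \<in> link_components L. \<psi> K = \<epsilon>1} {K \<in> link_components L. \<psi> K = \<epsilon>2})"
proof -
  let ?R = "{(\<epsilon>1, \<epsilon>2) \<in> roots_of_unity n \<times> roots_of_unity n. \<epsilon>1 \<noteq> \<epsilon>2}"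
  let ?A = "\<lambda>\<epsilon>. {K \<in> link_components L. \<psi> K = \<epsilon>}"
  let ?D = "{(K, K') \<in> link_components L \<times> link_components L. \<psi> K \<noteq> \<psi> K'}"
  let ?s = "\<lambda>c. of_int (crossing_sign L c) :: rat"
  let ?p = "\<lambda>c. (component (ends L c 1), component (ends L c 2))"
  have fin: "finite ?D" "finite ?R"
    using finite_link_components card_ge_0_finite[of "roots_of_unity n"] card_roots_of_unity n
    by (auto intro: finite_subset[of _ "link_components L \<times> link_components L"]
      finite_subset[of _ "roots_of_unity n \<times> roots_of_unity n"])
  have link: "linking_number L K K' = (\<Sum>c\<in>crossings L.
      ?s c * ((if ?p c = (K, K') then 1 else 0) + (if ?p c = (K', K) then 1 else 0))) / 2"
    if "(K, K') \<in> ?D" for K K'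
  proof -
    have K: "K \<in> link_components L" "K' \<in> link_components L" "K \<noteq> K'" using that by auto
    have "(\<Sum>c\<in>{c \<in> crossings L. component (ends L c 1) = K \<and> component (ends L c 2) = K' \<or>
          component (ends L c 1) = K' \<and> component (ends L c 2) = K}. ?s c) =
        (\<Sum>c\<in>crossings L. ?s c * ((if ?p c = (K, K') then 1 else 0) + (if ?p c = (K', K) then 1 else 0)))"
      unfolding sum.inter_filter[OF finite_crossings] using K(3) by (intro sum.cong) auto
    then show ?thesis
      unfolding linking_number_def of_int_sum component_iff[OF K(1)] component_iff[OF K(2)] by (rule arg_cong)
  qed
  have "(\<Sum>(\<epsilon>1, \<epsilon>2)\<in>?R. lk L (?A \<epsilon>1) (?A \<epsilon>2)) =
      (\<Sum>r\<in>?R. \<Sum>(K, K')\<in>{x \<in> ?D. map_prod \<psi> \<psi> x = r}. linking_number L K K')"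
  proof (rule sum.cong[OF refl])
    fix r assume r: "r \<in> ?R"
    have "{x \<in> ?D. map_prod \<psi> \<psi> x = r} = ?A (fst r) \<times> ?A (snd r)" using r by auto
    then show "(case r of (\<epsilon>1, \<epsilon>2) \<Rightarrow> lk L (?A \<epsilon>1) (?A \<epsilon>2)) = (\<Sum>(K, K')\<in>{x \<in> ?D. map_prod \<psi> \<psi> x = r}. linking_number L K K')"
      by (simp only: lk_def sum.cartesian_product split_beta)
  qed
  also have "\<dots> = (\<Sum>(K, K')\<in>?D. linking_number L K K')"
    using \<psi> fin by (intro sum.group) auto
  also have "\<dots> = (\<Sum>(K, K')\<in>?D. \<Sum>c\<in>crossings L. ?s c / 2 * ((if ?p c = (K, K') then 1 else 0) + (if ?p c = (K', K) then 1 else 0)))"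
  proof (rule sum.cong[OF refl])
    fix x assume x: "x \<in> ?D"
    obtain K K' where K: "x = (K, K')" by (cases x)
    show "(case x of (K, K') \<Rightarrow> linking_number L K K') = (case x of (K, K') \<Rightarrow>
        \<Sum>c\<in>crossings L. ?s c / 2 * ((if ?p c = (K, K') then 1 else 0) + (if ?p c = (K', K) then 1 else 0)))"
      using link[OF x[unfolded K]] unfolding K prod.case by (simp only: sum_divide_distrib times_divide_eq_left)
  qed
  also have "\<dots> = (\<Sum>c\<in>crossings L. \<Sum>(K, K')\<in>?D. ?s c / 2 * ((if ?p c = (K, K') then 1 else 0) + (if ?p c = (K', K) then 1 else 0)))"
    unfolding split_beta by (rule sum.swap)
  also have "\<dots> = (\<Sum>c\<in>crossings L. if c \<in> thick (state_of \<psi>) then ?s c else 0)"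
  proof (rule sum.cong[OF refl])
    fix c assume c: "c \<in> crossings L"
    have split: "(\<Sum>(K, K')\<in>?D. ?s c / 2 * ((if ?p c = (K, K') then 1 else 0) + (if ?p c = (K', K) then 1 else 0))) =
        ?s c / 2 * ((\<Sum>(K, K')\<in>?D. if ?p c = (K, K') then 1 else 0) + (\<Sum>(K, K')\<in>?D. if ?p c = (K', K) then 1 else 0))"
      by (simp only: case_prod_unfold flip: sum.distrib sum_distrib_left)
    have "(\<Sum>(K, K')\<in>?D. if ?p c = (K', K) then 1 else 0 :: rat) = (\<Sum>x\<in>?D. if ?p c = x then 1 else 0)"
      by (rule sum.reindex_bij_witness[where i = prod.swap and j = prod.swap]) (auto simp del: prod.inject)
    moreover have "(\<Sum>(K, K')\<in>?D. if ?p c = (K, K') then 1 else 0 :: rat) = (\<Sum>x\<in>?D. if ?p c = x then 1 else 0)"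
      by (simp only: case_prod_unfold prod.collapse)
    moreover have "(\<Sum>x\<in>?D. if ?p c = x then 1 else 0 :: rat) = (if ?p c \<in> ?D then 1 else 0)"
      by (rule sum.delta'[OF fin(1)])
    moreover have "?p c \<in> ?D \<longleftrightarrow> c \<in> thick (state_of \<psi>)"
      using c \<beta> by (simp add: thick_def state_of_def link_components_eq)
    ultimately show "(\<Sum>(K, K')\<in>?D. ?s c / 2 * ((if ?p c = (K, K') then 1 else 0) + (if ?p c = (K', K) then 1 else 0))) =
        (if c \<in> thick (state_of \<psi>) then ?s c else 0)"
      unfolding split by (simp only: if_True if_False split: if_split) simp
  qed
  also have "\<dots> = of_int (res_degree L (thick (state_of \<psi>)))"
    using finite_crossings thick_subset[of "state_of \<psi>"]
    by (simp add: res_degree_def sum.If_cases Int_absorb1)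
  finally show ?thesis ..
qed

definition generator :: "('m set \<Rightarrow> complex) \<Rightarrow> ('c set \<Rightarrow> ('c, 'm) chain set) set" where
  "generator \<psi> = total_class (gen_cube (state_of \<psi>))"

lemma state_of_link_states: "\<psi> \<in> colourings \<Longrightarrow> state_of \<psi> \<in> link_states"
  using bij_state_of by (auto simp: bij_betw_def)

text \<open>The representative is zero outside the single resolution
  \<open>thick (state_of \<psi>)\<close>.\<close>

lemma generator_degree:
  assumes \<psi>: "\<psi> \<in> colourings"
  shows "generator \<psi> \<in> cohomology_part (link_complex n \<beta> L) (res_degree L (thick (state_of \<psi>)))"
proof -
  let ?C = "link_complex n \<beta> L" and ?g = "gen_cube (state_of \<psi>)"
  interpret linear_presentation scale_cube ZZ tot "total_space ?C" by (rule total_presentation)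
  have g: "?g \<in> CZ" by (rule gen_cube_CZ[OF state_of_link_states[OF \<psi>]])
  then have car: "tot ?g \<in> carrier (total_space ?C)" unfolding carrier_q by (auto simp: CZ_def)
  have "tot ?g \<Gamma> = \<zero>\<^bsub>res_cohomology n \<beta> L \<Gamma>\<^esub>"
    if "\<Gamma> \<in> Pow (crossings L)" "res_degree L \<Gamma> \<noteq> res_degree L (thick (state_of \<psi>))" for \<Gamma>
    using that linear_presentation.zero_q[OF cohomology_presentation]
    by (auto simp: tot_def gen_cube_def)
  then have "tot ?g \<in> degree_part ?C (res_degree L (thick (state_of \<psi>)))"
    using car by (simp add: link_complex_def Let_def)
  then show ?thesis
    unfolding generator_def total_class_def cohomology_part_def cocycles_eq using g by blast
qed

theorem cohomology_link_complex:
  defines "C \<equiv> link_complex n \<beta> L" and "F \<equiv> (class_ring :: complex ring)"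
  shows "vectorspace F (cohomology C)" "vectorspace.fin_dim F (cohomology C)"
    "vectorspace.dim F (cohomology C) = n ^ card (link_components L)"
    "\<psi> \<in> colourings \<Longrightarrow> generator \<psi> \<in> carrier (cohomology C)"
    "LinearCombinations.module.span F (cohomology C) (generator ` colourings) = carrier (cohomology C)"
proof -
  interpret linear_presentation scale_cube CZ total_class "cohomology C"
    unfolding C_def by (rule total_cohomology_presentation)
  let ?f = "\<lambda>\<psi>. gen_cube (state_of \<psi>)"
  have f: "?f \<psi> \<in> CZ" if "\<psi> \<in> colourings" for \<psi> using gen_cube_CZ state_of_link_states[OF that] .
  have comb: "(\<Sum>\<psi>\<in>colourings. scale_cube (a (state_of \<psi>)) (?f \<psi>)) =
      (\<lambda>\<Gamma>. \<Sum>\<phi>\<in>link_states. scale (a \<phi>) (gen_cube \<phi> \<Gamma>))" for a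
  proof
    fix \<Gamma>
    show "(\<Sum>\<psi>\<in>colourings. scale_cube (a (state_of \<psi>)) (?f \<psi>)) \<Gamma> = (\<Sum>\<phi>\<in>link_states. scale (a \<phi>) (gen_cube \<phi> \<Gamma>))"
      by (rule trans[OF sum_fun_apply]) (rule sum.reindex_bij_betw[OF bij_state_of])
  qed
  have gen: "\<exists>a. total_class x = total_class (\<Sum>\<psi>\<in>colourings. scale_cube (a \<psi>) (?f \<psi>))" if x: "x \<in> CZ" for x
  proof -
    obtain a where a: "(\<lambda>\<Gamma>. x \<Gamma> - (\<Sum>\<phi>\<in>link_states. scale (a \<phi>) (gen_cube \<phi> \<Gamma>))) \<in> CB"
      using cube_generated[OF x] by blast
    have "(\<Sum>\<psi>\<in>colourings. scale_cube (a (state_of \<psi>)) (?f \<psi>)) \<in> CZ" by (intro S_sum S(3) f)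
    then have "total_class x = total_class (\<Sum>\<psi>\<in>colourings. scale_cube (a (state_of \<psi>)) (?f \<psi>))"
      using a x by (simp only: total_class_eq_iff comb fun_diff_def)
    then show ?thesis by (rule exI[of _ "\<lambda>\<psi>. a (state_of \<psi>)"])
  qed
  have indep: "a \<psi> = 0" if eq: "total_class (\<Sum>\<psi>\<in>colourings. scale_cube (a \<psi>) (?f \<psi>)) = total_class 0" and \<psi>: "\<psi> \<in> colourings" for a \<psi>
  proof -
    define b where "b = a \<circ> inv_into colourings state_of"
    have b: "b (state_of \<psi>) = a \<psi>" if "\<psi> \<in> colourings" for \<psi>
      using that bij_state_of by (simp add: b_def bij_betw_inv_into_left)
    have "(\<Sum>\<psi>\<in>colourings. scale_cube (a \<psi>) (?f \<psi>)) = (\<Sum>\<psi>\<in>colourings. scale_cube (b (state_of \<psi>)) (?f \<psi>))"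
      by (rule sum.cong) (simp_all only: b)
    also note comb
    finally have *: "(\<Sum>\<psi>\<in>colourings. scale_cube (a \<psi>) (?f \<psi>)) = (\<lambda>\<Gamma>. \<Sum>\<phi>\<in>link_states. scale (b \<phi>) (gen_cube \<phi> \<Gamma>))" .
    have "(\<Sum>\<psi>\<in>colourings. scale_cube (a \<psi>) (?f \<psi>)) \<in> CZ" by (intro S_sum S(3) f)
    then have "(\<lambda>\<Gamma>. \<Sum>\<phi>\<in>link_states. scale (b \<phi>) (gen_cube \<phi> \<Gamma>)) \<in> CB"
      using eq S(1) by (simp only: total_class_eq_iff diff_0_right flip: *)
    from cube_independent[OF this state_of_link_states[OF \<psi>]] show ?thesis using b \<psi> by simp
  qed
  have inj: "inj_on generator colourings"
    unfolding generator_def[abs_def]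
    by (rule basis_image(1)[of colourings ?f]) (rule finite_colourings, erule f, erule gen, erule (1) indep)
  have basis: "basis (generator ` colourings)"
    unfolding generator_def[abs_def]
    by (rule basis_image(2)[of colourings ?f]) (rule finite_colourings, erule f, erule gen, erule (1) indep)
  show "vectorspace F (cohomology C)" unfolding F_def by (rule vectorspace)
  show "generator \<psi> \<in> carrier (cohomology C)" if "\<psi> \<in> colourings"
    using f[OF that] by (simp add: generator_def carrier_q)
  show span: "LinearCombinations.module.span F (cohomology C) (generator ` colourings) = carrier (cohomology C)"
    using basis unfolding basis_def F_def by blast
  show "vectorspace.fin_dim F (cohomology C)"
    unfolding F_def fin_dim_def
    using finite_imageI[OF finite_colourings] basis unfolding basis_def by (intro exI[of _ "generator ` colourings"]) simp
  show "vectorspace.dim F (cohomology C) = n ^ card (link_components L)"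
    unfolding F_def using dim_basis[OF _ basis] finite_colourings inj by (simp add: card_image card_colourings)
qed

end

theorem theorem2:
  fixes n :: nat and \<beta> :: complex
    and L :: "('c::linorder, 'm::{finite, linorder}) diagram"
  assumes "n \<ge> 2" and "\<beta> \<noteq> 0" and "link_diagram L"
  shows "let C = link_complex n \<beta> L; H = cohomology C; F = (class_ring :: complex ring) in
    vectorspace F H \<and> vectorspace.fin_dim F H \<and>
    vectorspace.dim F H = n ^ card (link_components L) \<and>
    (\<exists>a :: ('m set \<Rightarrow> complex) \<Rightarrow> ('c set \<Rightarrow> ('c, 'm) chain set) set.
      (\<forall>\<psi> \<in> link_components L \<rightarrow>\<^sub>E roots_of_unity n.
        a \<psi> \<in> carrier H \<and>
        (\<exists>j. of_int j = (\<Sum>(\<epsilon>1, \<epsilon>2)\<in>{(\<epsilon>1, \<epsilon>2) \<in> roots_of_unity n \<times> roots_of_unity n. \<epsilon>1 \<noteq> \<epsilon>2}.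
                lk L {K \<in> link_components L. \<psi> K = \<epsilon>1} {K \<in> link_components L. \<psi> K = \<epsilon>2}) \<and>
             a \<psi> \<in> cohomology_part C j)) \<and>
      LinearCombinations.module.span F H (a ` (link_components L \<rightarrow>\<^sub>E roots_of_unity n)) =
        carrier H)"
proof -
  interpret gornik L n \<beta> using assms by unfold_locales
  show ?thesis
    unfolding Let_def
    using cohomology_link_complex degree_thick generator_degree by (intro conjI exI[of _ generator] ballI) blast+
qed

end
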